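(* Let $W$ be a finite Weyl group, $\mathrm{NH}_W$ its nilHecke algebra, $\mathrm{Pol}_{\mathfrak h}=S(\mathfrak h)$ its polynomial representation and $\Lambda_{\mathfrak h}=S(\mathfrak h)^W$. Then there are isomorphisms of graded algebras $$\mathrm{NH}_{W,\mathbb{Q}}\xrightarrow{\ \cong\ }\mathrm{End}_{\Lambda_{\mathfrak h,\mathbb{Q}}}(\mathrm{Pol}_{\mathfrak h,\mathbb{Q}})\cong\mathrm{Mat}_{\mathrm{rk}_qW}(\Lambda_{\mathfrak h,\mathbb{Q}}),$$ where the first map is induced by the action of $\mathrm{NH}_W$ on $\mathrm{Pol}_{\mathfrak h}$.
   Context: $W$ is a finite Weyl group generated by simple reflections $s_i$ ($i\in I$), $\mathfrak h$ is the reflection representation of $W$ over $\mathbb{Z}$, with simple coroots $\alpha_i^\vee\in\mathfrak h$ and simple roots $\alpha_i\in\mathfrak h^*$, so that $x^{s_i}:=s_i(x)=x-\langle x,\alpha_i\rangle\alpha_i^\vee$ for $x\in\mathfrak h$. A subscript $\mathbb{Q}$ denotes base change from $\mathbb{Z}$ to $\mathbb{Q}$. The nilCoxeter algebra $\mathrm{NC}_W$ is the $\mathbb{Z}$-algebra generated by $\partial_i$ ($i\in I$) subject to $\partial_i^2=0$ and the braid relations of $W$. The nilHecke algebra $\mathrm{NH}_W$ is the $\mathbb{Z}$-algebra which is $\mathrm{NC}_W\otimes S(\mathfrak h)$ as a $\mathbb{Z}$-module, contains $\mathrm{NC}_W$ and the symmetric algebra $S(\mathfrak h)$ as subalgebras,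 and satisfies $x\,\partial_i-\partial_i\,x^{s_i}=\langle x,\alpha_i\rangle$ for $x\in\mathfrak h$, $i\in I$. It is $\mathbb{Z}$-graded with $|\partial_i|=-2$ and $|h|=2$ for $0\neq h\in\mathfrak h$. $\mathrm{NH}_W$ acts on $\mathrm{Pol}_{\mathfrak h}=S(\mathfrak h)$: $h\in\mathfrak h$ acts by multiplication and $\partial_i$ by the Demazure operator $f\mapsto (f-s_i(f))/\alpha_i^\vee$. $\Lambda_{\mathfrak h}=\bigcap_{i\in I}\ker(\partial_i)=S(\mathfrak h)^W$; the action of $\mathrm{NH}_W$ is $\Lambda_{\mathfrak h}$-linear. $\mathrm{rk}_qW=\sum_{w\in W}q^{2\ell(w)}$ is the Poincaré polynomial of $W$. For $f(q)=\sum_{i=1}^N q^{d_i}$, $\mathrm{Mat}_{f(q)}(R)$ denotes the algebra of $N\times N$ matrices over the graded ring $R$, graded as the endomorphism algebra of a free graded $R$-module with basis in degrees $d_1,\dots,d_N$. *)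

theory Defs
  imports
    "Jordan_Normal_Form.Matrix"
    "HOL-Algebra.Free_Abelian_Groups"
    "HOL-Algebra.Multiplicative_Group"
    "HOL-Algebra.QuotRing"
    "HOL-Algebra.Algebraic_Closure_Type"
    "HOL-Library.Poly_Mapping"
    "HOL-Computational_Algebra.Polynomial"
begin

section \<open>General algebra\<close>

text \<open>The integral monoid ring of a monoid \<open>G\<close>, on finitely supported functions \<open>G \<rightarrow> \<int>\<close>;
  \<^const>\<open>Poly_Mapping.single\<close>, abbreviated \<open>frag_of\<close>, gives the basis elements.\<close>

definition monoid_ring :: "('g, 'm) monoid_scheme \<Rightarrow> ('g \<Rightarrow>\<^sub>0 int) ring" where
  "monoid_ring G =
    \<lparr>carrier = {c. Poly_Mapping.keys c \<subseteq> carrier G},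
     mult = (\<lambda>c d. \<Sum>g\<in>Poly_Mapping.keys c. \<Sum>h\<in>Poly_Mapping.keys d.
       Poly_Mapping.single (g \<otimes>\<^bsub>G\<^esub> h) (Poly_Mapping.lookup c g * Poly_Mapping.lookup d h)),
     one = frag_of \<one>\<^bsub>G\<^esub>,
     ring.zero = 0,
     add = (+)\<rparr>"

definition free_algebra :: "'i set \<Rightarrow> ('i list \<Rightarrow>\<^sub>0 int) ring" where
  "free_algebra I = monoid_ring \<lparr>carrier = lists I, mult = (@), one = []\<rparr>"

text \<open>The tensor product \<open>A \<otimes>\<^sub>\<int> B\<close> of two rings: the free abelian group on \<open>A \<times> B\<close>,
  multiplied by \<open>(a, b) (a', b') = (a a', b b')\<close>, modulo the subgroup generated by the
  biadditivity relations. That subgroup is a two-sided ideal because the relations are stable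
  under multiplication by basis elements. The underlying additive group is the tensor product
  of the \<open>\<int>\<close>-modules.\<close>

definition biadditive_relators ::
  "('a, 'm) ring_scheme \<Rightarrow> ('b, 'n) ring_scheme \<Rightarrow> ('a \<times> 'b \<Rightarrow>\<^sub>0 int) set" where
  "biadditive_relators A B =
     {frag_of (a \<oplus>\<^bsub>A\<^esub> a', b) - frag_of (a, b) - frag_of (a', b) | a a' b.
        a \<in> carrier A \<and> a' \<in> carrier A \<and> b \<in> carrier B} \<union>
     {frag_of (a, b \<oplus>\<^bsub>B\<^esub> b') - frag_of (a, b) - frag_of (a, b') | a b b'.
        a \<in> carrier A \<and> b \<in> carrier B \<and> b' \<in> carrier B}"

definition biadditive_kernel ::
  "('a, 'm) ring_scheme \<Rightarrow> ('b, 'n) ring_scheme \<Rightarrow> ('a \<times> 'b \<Rightarrow>\<^sub>0 int) set" where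
  "biadditive_kernel A B =
     generate (add_monoid (monoid_ring (A \<times>\<times> B))) (biadditive_relators A B)"

definition tensor_ring ::
  "('a, 'm) ring_scheme \<Rightarrow> ('b, 'n) ring_scheme \<Rightarrow> ('a \<times> 'b \<Rightarrow>\<^sub>0 int) set ring" where
  "tensor_ring A B = monoid_ring (A \<times>\<times> B) Quot biadditive_kernel A B"

definition pure_tensor ::
  "('a, 'm) ring_scheme \<Rightarrow> ('b, 'n) ring_scheme \<Rightarrow> 'a \<Rightarrow> 'b \<Rightarrow> ('a \<times> 'b \<Rightarrow>\<^sub>0 int) set" where
  "pure_tensor A B a b = biadditive_kernel A B +>\<^bsub>monoid_ring (A \<times>\<times> B)\<^esub> frag_of (a, b)"

text \<open>Endomorphisms of the additive group of \<open>P\<close> commuting with multiplication by all elements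
  of \<open>L\<close>. Maps are made extensional outside the carrier of \<open>P\<close>.\<close>

definition lin_end :: "('p, 'm) ring_scheme \<Rightarrow> 'p set \<Rightarrow> ('p \<Rightarrow> 'p) ring" where
  "lin_end P L =
    \<lparr>carrier = {F \<in> carrier P \<rightarrow>\<^sub>E carrier P.
       (\<forall>f\<in>carrier P. \<forall>g\<in>carrier P. F (f \<oplus>\<^bsub>P\<^esub> g) = F f \<oplus>\<^bsub>P\<^esub> F g) \<and>
       (\<forall>l\<in>L. \<forall>f\<in>carrier P. F (l \<otimes>\<^bsub>P\<^esub> f) = l \<otimes>\<^bsub>P\<^esub> F f)},
     mult = (\<lambda>F G. compose (carrier P) F G),
     one = (\<lambda>f\<in>carrier P. f),
     ring.zero = (\<lambda>f\<in>carrier P. \<zero>\<^bsub>P\<^esub>),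
     add = (\<lambda>F G. \<lambda>f\<in>carrier P. F f \<oplus>\<^bsub>P\<^esub> G f)\<rparr>"

definition is_grading :: "('a, 'm) ring_scheme \<Rightarrow> (int \<Rightarrow> 'a set) \<Rightarrow> bool" where
  "is_grading R G \<longleftrightarrow>
     (\<forall>k. subgroup (G k) (add_monoid R)) \<and>
     \<one>\<^bsub>R\<^esub> \<in> G 0 \<and>
     (\<forall>k l. \<forall>a\<in>G k. \<forall>b\<in>G l. a \<otimes>\<^bsub>R\<^esub> b \<in> G (k + l)) \<and>
     (\<forall>a\<in>carrier R. \<exists>!c. (\<forall>k. c k \<in> G k) \<and> finite {k. c k \<noteq> \<zero>\<^bsub>R\<^esub>} \<and>
        a = (\<Oplus>\<^bsub>R\<^esub>k\<in>{k. c k \<noteq> \<zero>\<^bsub>R\<^esub>}. c k))"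

definition graded_ring_iso ::
  "('a, 'm) ring_scheme \<Rightarrow> (int \<Rightarrow> 'a set) \<Rightarrow> ('b, 'n) ring_scheme \<Rightarrow> (int \<Rightarrow> 'b set) \<Rightarrow>
   ('a \<Rightarrow> 'b) \<Rightarrow> bool" where
  "graded_ring_iso R G S H \<phi> \<longleftrightarrow>
     ring R \<and> ring S \<and> is_grading R G \<and> is_grading S H \<and>
     \<phi> \<in> ring_iso R S \<and> (\<forall>k. \<phi> ` G k = H k)"


section \<open>Finite Weyl groups and their reflection representations\<close>

text \<open>The lattice \<open>\<hh> = \<int>\<^sup>n\<close> consists of the integer vectors of dimension \<open>n\<close>, its dual is
  identified with \<open>\<int>\<^sup>n\<close> by the dual basis, and the pairing is the scalar product.\<close>

record 'i refl_datum =
  rnk :: nat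
  nodes :: "'i set"
  simple_coroot :: "'i \<Rightarrow> int vec"
  simple_root :: "'i \<Rightarrow> int vec"

abbreviation colattice :: "('i, 'z) refl_datum_scheme \<Rightarrow> int vec set" where
  "colattice D \<equiv> carrier_vec (rnk D)"

text \<open>The matrix of \<open>x \<mapsto> x - \<langle>x, \<alpha>\<^sub>i\<rangle> \<alpha>\<^sub>i\<^sup>\<or>\<close>.\<close>

definition simple_refl :: "('i, 'z) refl_datum_scheme \<Rightarrow> 'i \<Rightarrow> int mat" where
  "simple_refl D i = mat (rnk D) (rnk D)
     (\<lambda>(k, l). (if k = l then 1 else 0) - simple_coroot D i $ k * simple_root D i $ l)"

definition GL :: "nat \<Rightarrow> int mat monoid" where
  "GL n = units_of (ring_mat TYPE(int) n ())"

definition weyl_group :: "('i, 'z) refl_datum_scheme \<Rightarrow> int mat set" where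
  "weyl_group D = generate (GL (rnk D)) (simple_refl D ` nodes D)"

text \<open>The simple coroots and simple roots realise a generalised Cartan matrix, the simple coroots
  are linearly independent, and the Weyl group is finite; so the Cartan matrix is of finite type.
  The lattice may be strictly larger than the span of the simple coroots.\<close>

definition finite_weyl_datum :: "('i, 'z) refl_datum_scheme \<Rightarrow> bool" where
  "finite_weyl_datum D \<longleftrightarrow>
     finite (nodes D) \<and>
     (\<forall>i\<in>nodes D. simple_coroot D i \<in> colattice D \<and> simple_root D i \<in> carrier_vec (rnk D)) \<and>
     (\<forall>i\<in>nodes D. simple_coroot D i \<bullet> simple_root D i = 2) \<and>
     (\<forall>i\<in>nodes D. \<forall>j\<in>nodes D. i \<noteq> j \<longrightarrow> simple_coroot D i \<bullet> simple_root D j \<le> 0) \<and>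
     (\<forall>i\<in>nodes D. \<forall>j\<in>nodes D. simple_coroot D i \<bullet> simple_root D j = 0 \<longleftrightarrow> simple_coroot D j \<bullet> simple_root D i = 0) \<and>
     (\<forall>c :: 'i \<Rightarrow> int. (\<forall>k<rnk D. (\<Sum>i\<in>nodes D. c i * simple_coroot D i $ k) = 0) \<longrightarrow>
        (\<forall>i\<in>nodes D. c i = 0)) \<and>
     finite (weyl_group D)"

definition weyl_length :: "('i, 'z) refl_datum_scheme \<Rightarrow> int mat \<Rightarrow> nat" where
  "weyl_length D w = (LEAST l. \<exists>u\<in>lists (nodes D). length u = l \<and>
     foldr (\<lambda>i A. simple_refl D i * A) u (1\<^sub>m (rnk D)) = w)"

definition poincare_poly :: "('i, 'z) refl_datum_scheme \<Rightarrow> int poly" where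
  "poincare_poly D = (\<Sum>w\<in>weyl_group D. Polynomial.monom 1 (2 * weyl_length D w))"


section \<open>The symmetric algebra\<close>

text \<open>The symmetric algebra of \<open>\<hh>\<close> over \<open>'k\<close> is the polynomial ring in the variables
  with indices \<open>0, \<dots>, n - 1\<close>; over the rationals it is the base change of \<open>S(\<hh>)\<close>.\<close>

type_synonym 'k pol = "(nat \<Rightarrow>\<^sub>0 nat) \<Rightarrow>\<^sub>0 'k"

definition Pol :: "('i, 'z) refl_datum_scheme \<Rightarrow> 'k::comm_ring_1 pol ring" where
  "Pol D = ring_of_type_algebra
     \<lparr>carrier := {f. \<forall>m\<in>Poly_Mapping.keys f. Poly_Mapping.keys m \<subseteq> {..<rnk D}}\<rparr>"

definition lin :: "int vec \<Rightarrow> 'k::comm_ring_1 pol" where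
  "lin x = (\<Sum>k<dim_vec x. Poly_Mapping.single (Poly_Mapping.single k 1) (of_int (x $ k)))"

text \<open>The action of a matrix on polynomials by algebra endomorphisms extending its action
  on \<open>\<hh>\<close>, i.e. substitution of the image of the \<open>k\<close>-th basis vector for the \<open>k\<close>-th variable.\<close>

definition pol_act :: "int mat \<Rightarrow> 'k::comm_ring_1 pol \<Rightarrow> 'k pol" where
  "pol_act w f = (\<Sum>m\<in>Poly_Mapping.keys f. Poly_Mapping.single 0 (Poly_Mapping.lookup f m) *
     (\<Prod>k\<in>Poly_Mapping.keys m. lin (col w k) ^ Poly_Mapping.lookup m k))"

definition demazure :: "('i, 'z) refl_datum_scheme \<Rightarrow> 'i \<Rightarrow> 'k::comm_ring_1 pol \<Rightarrow> 'k pol" where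
  "demazure D i f = (THE g. g \<in> carrier (Pol D) \<and>
     lin (simple_coroot D i) * g = f - pol_act (simple_refl D i) f)"

text \<open>Linear forms have degree 2.\<close>

definition Pol_grade :: "('i, 'z) refl_datum_scheme \<Rightarrow> int \<Rightarrow> 'k::comm_ring_1 pol set" where
  "Pol_grade D k = {f \<in> carrier (Pol D). \<forall>m\<in>Poly_Mapping.keys f.
     k = 2 * int (\<Sum>j\<in>Poly_Mapping.keys m. Poly_Mapping.lookup m j)}"

definition Invar :: "('i, 'z) refl_datum_scheme \<Rightarrow> int pol set" where
  "Invar D = {f \<in> carrier (Pol D). \<forall>w\<in>weyl_group D. pol_act w f = f}"

abbreviation to_rat :: "int pol \<Rightarrow> rat pol" where
  "to_rat f \<equiv> Poly_Mapping.map rat_of_int f"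

text \<open>The base change of the invariants, inside the rational polynomials: since every finite set
  of rationals has a common denominator, the rational multiples of integral invariants
  already form a subspace.\<close>

definition InvarQ :: "('i, 'z) refl_datum_scheme \<Rightarrow> rat pol set" where
  "InvarQ D = {Poly_Mapping.single 0 q * to_rat f | q f. f \<in> Invar D}"


section \<open>The nilCoxeter and nilHecke algebras\<close>

text \<open>\<open>alt_word m i j\<close> is \<open>i j i \<dots>\<close> with \<open>m\<close> letters.\<close>

fun alt_word :: "nat \<Rightarrow> 'i \<Rightarrow> 'i \<Rightarrow> 'i list" where
  "alt_word 0 i j = []"
| "alt_word (Suc m) i j = i # alt_word m j i"

definition cox :: "('i, 'z) refl_datum_scheme \<Rightarrow> 'i \<Rightarrow> 'i \<Rightarrow> nat" where
  "cox D i j = group.ord (GL (rnk D)) (simple_refl D i * simple_refl D j)"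

definition nilCoxeter_ideal :: "('i, 'z) refl_datum_scheme \<Rightarrow> ('i list \<Rightarrow>\<^sub>0 int) set" where
  "nilCoxeter_ideal D = genideal (free_algebra (nodes D))
     ({frag_of [i, i] | i. i \<in> nodes D} \<union>
      {frag_of (alt_word (cox D i j) i j) - frag_of (alt_word (cox D i j) j i) | i j.
         i \<in> nodes D \<and> j \<in> nodes D \<and> i \<noteq> j})"

definition nilCoxeter :: "('i, 'z) refl_datum_scheme \<Rightarrow> ('i list \<Rightarrow>\<^sub>0 int) set ring" where
  "nilCoxeter D = free_algebra (nodes D) Quot nilCoxeter_ideal D"

definition nc_del :: "('i, 'z) refl_datum_scheme \<Rightarrow> 'i \<Rightarrow> ('i list \<Rightarrow>\<^sub>0 int) set" where
  "nc_del D i = nilCoxeter_ideal D +>\<^bsub>free_algebra (nodes D)\<^esub> frag_of [i]"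

text \<open>\<open>NH\<close> is a nilHecke algebra containing the nilCoxeter algebra via \<open>\<iota>\<close> and the symmetric
  algebra via \<open>\<kappa>\<close>: multiplication identifies its additive group with their tensor product,
  and the cross relation holds. These properties determine \<open>(NH, \<iota>, \<kappa>)\<close> up to unique
  isomorphism.\<close>

definition nilHecke :: "('i, 'z) refl_datum_scheme \<Rightarrow> ('a, 'm) ring_scheme \<Rightarrow>
    (('i list \<Rightarrow>\<^sub>0 int) set \<Rightarrow> 'a) \<Rightarrow> (int pol \<Rightarrow> 'a) \<Rightarrow> bool" where
  "nilHecke D NH \<iota> \<kappa> \<longleftrightarrow>
     ring NH \<and>
     \<iota> \<in> ring_hom (nilCoxeter D) NH \<and> inj_on \<iota> (carrier (nilCoxeter D)) \<and>
     \<kappa> \<in> ring_hom (Pol D) NH \<and> inj_on \<kappa> (carrier (Pol D)) \<and>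
     (\<exists>\<theta> \<in> iso (add_monoid (tensor_ring (nilCoxeter D) (Pol D :: int pol ring))) (add_monoid NH).
        \<forall>a\<in>carrier (nilCoxeter D). \<forall>f\<in>carrier (Pol D).
          \<theta> (pure_tensor (nilCoxeter D) (Pol D) a f) = \<iota> a \<otimes>\<^bsub>NH\<^esub> \<kappa> f) \<and>
     (\<forall>x\<in>colattice D. \<forall>i\<in>nodes D.
        \<kappa> (lin x) \<otimes>\<^bsub>NH\<^esub> \<iota> (nc_del D i) \<ominus>\<^bsub>NH\<^esub>
          \<iota> (nc_del D i) \<otimes>\<^bsub>NH\<^esub> \<kappa> (lin (simple_refl D i *\<^sub>v x))
        = [(x \<bullet> simple_root D i)] \<cdot>\<^bsub>NH\<^esub> \<one>\<^bsub>NH\<^esub>)"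

text \<open>Products of the generators together with their total degrees.\<close>

inductive_set nh_monomials :: "('i, 'z) refl_datum_scheme \<Rightarrow> ('a, 'm) ring_scheme \<Rightarrow>
    (('i list \<Rightarrow>\<^sub>0 int) set \<Rightarrow> 'a) \<Rightarrow> (int pol \<Rightarrow> 'a) \<Rightarrow> ('a \<times> int) set"
  for D NH \<iota> \<kappa> where
  one: "(\<one>\<^bsub>NH\<^esub>, 0) \<in> nh_monomials D NH \<iota> \<kappa>"
| del: "\<lbrakk>i \<in> nodes D; (a, k) \<in> nh_monomials D NH \<iota> \<kappa>\<rbrakk> \<Longrightarrow>
    (\<iota> (nc_del D i) \<otimes>\<^bsub>NH\<^esub> a, k - 2) \<in> nh_monomials D NH \<iota> \<kappa>"
| lin: "\<lbrakk>x \<in> colattice D; (a, k) \<in> nh_monomials D NH \<iota> \<kappa>\<rbrakk> \<Longrightarrow>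
    (\<kappa> (lin x) \<otimes>\<^bsub>NH\<^esub> a, k + 2) \<in> nh_monomials D NH \<iota> \<kappa>"

definition NH_grade :: "('i, 'z) refl_datum_scheme \<Rightarrow> ('a, 'm) ring_scheme \<Rightarrow>
    (('i list \<Rightarrow>\<^sub>0 int) set \<Rightarrow> 'a) \<Rightarrow> (int pol \<Rightarrow> 'a) \<Rightarrow> int \<Rightarrow> 'a set" where
  "NH_grade D NH \<iota> \<kappa> k = generate (add_monoid NH) {a. (a, k) \<in> nh_monomials D NH \<iota> \<kappa>}"

abbreviation Q_ring :: "rat ring" where
  "Q_ring \<equiv> ring_of_type_algebra"

definition base_change_grade ::
  "('a, 'm) ring_scheme \<Rightarrow> (int \<Rightarrow> 'a set) \<Rightarrow> int \<Rightarrow> (rat \<times> 'a \<Rightarrow>\<^sub>0 int) set set" where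
  "base_change_grade A G k = generate (add_monoid (tensor_ring Q_ring A))
     {pure_tensor Q_ring A q a | q a. a \<in> G k}"

text \<open>The action on \<open>S(\<hh>)\<close> over the integers; since \<open>NH\<close> is generated by the \<open>\<partial>\<^sub>i\<close>
  and \<open>\<hh>\<close>, it is determined on the carrier by these conditions.\<close>

definition polynomial_rep :: "('i, 'z) refl_datum_scheme \<Rightarrow> ('a, 'm) ring_scheme \<Rightarrow>
    (('i list \<Rightarrow>\<^sub>0 int) set \<Rightarrow> 'a) \<Rightarrow> (int pol \<Rightarrow> 'a) \<Rightarrow> ('a \<Rightarrow> int pol \<Rightarrow> int pol) \<Rightarrow> bool" where
  "polynomial_rep D NH \<iota> \<kappa> \<rho> \<longleftrightarrow>
     \<rho> \<in> ring_hom NH (lin_end (Pol D) (Invar D)) \<and>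
     (\<forall>i\<in>nodes D. \<forall>f\<in>carrier (Pol D). \<rho> (\<iota> (nc_del D i)) f = demazure D i f) \<and>
     (\<forall>x\<in>colattice D. \<forall>f\<in>carrier (Pol D). \<rho> (\<kappa> (lin x)) f = lin x * f)"


section \<open>Graded endomorphism and matrix algebras over the rational invariants\<close>

abbreviation EndQ :: "('i, 'z) refl_datum_scheme \<Rightarrow> (rat pol \<Rightarrow> rat pol) ring" where
  "EndQ D \<equiv> lin_end (Pol D) (InvarQ D)"

definition EndQ_grade :: "('i, 'z) refl_datum_scheme \<Rightarrow> int \<Rightarrow> (rat pol \<Rightarrow> rat pol) set" where
  "EndQ_grade D k = {F \<in> carrier (EndQ D). \<forall>j. F ` Pol_grade D j \<subseteq> Pol_grade D (j + k)}"

text \<open>The list \<open>ds\<close> gives the degrees \<open>d\<^sub>1, \<dots>, d\<^sub>N\<close> of the basis. The matrix \<open>A\<close> sends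
  the \<open>b\<close>-th basis vector to the sum of the \<open>A\<^sub>a\<^sub>b\<close>-multiples of the \<open>a\<close>-th ones, so it is
  homogeneous of degree \<open>k\<close> if and only if \<open>A\<^sub>a\<^sub>b\<close> has degree \<open>k + d\<^sub>b - d\<^sub>a\<close>.\<close>

definition MatQ :: "('i, 'z) refl_datum_scheme \<Rightarrow> nat list \<Rightarrow> rat pol mat ring" where
  "MatQ D ds = ring_mat TYPE(rat pol) (length ds) ()
     \<lparr>carrier := {A \<in> carrier_mat (length ds) (length ds).
        \<forall>a<length ds. \<forall>b<length ds. A $$ (a, b) \<in> InvarQ D}\<rparr>"

definition MatQ_grade :: "('i, 'z) refl_datum_scheme \<Rightarrow> nat list \<Rightarrow> int \<Rightarrow> rat pol mat set" where
  "MatQ_grade D ds k = {A \<in> carrier (MatQ D ds).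
     \<forall>a<length ds. \<forall>b<length ds. A $$ (a, b) \<in> Pol_grade D (k + int (ds ! b) - int (ds ! a))}"

end

theory Submission
  imports Defs
begin

text \<open>
  Write \<open>\<partial>\<^sub>w\<close> for the product of Demazure operators along a reduced word of \<open>w\<close>. Both isomorphisms
  come from one unitriangular system: over \<open>\<rat>\<close> there are polynomials \<open>b\<^sub>w\<close>, homogeneous of degree
  \<open>2 l(w)\<close>, such that \<open>\<partial>\<^sub>v b\<^sub>w\<close> is \<open>1\<close> for \<open>v = w\<close> and \<open>0\<close> for all other \<open>v\<close> with \<open>l(v) \<ge> l(w)\<close>.

  Existence of the \<open>b\<^sub>w\<close>. An element \<open>w\<close> sends a simple coroot to a nonnegative combination of simple
  coroots unless the corresponding reflection shortens it (\<open>coroot_pos\<close>). The proof is an induction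
  on the length which reduces to subgroups generated by two reflections, where the possible Cartan
  integers are listed (\<open>rank2\<close>). It yields Matsumoto's theorem: a function on words that is invariant
  under braid moves depends only on the group element on reduced words (\<open>matsumoto\<close>), and it takes
  its value on words containing a square on all nonreduced words (\<open>nonreduced_zero\<close>). Demazure
  operators obey a twisted Leibniz rule (\<open>dword_leibniz\<close>), from which the braid relations follow
  (\<open>dword_braid\<close>), so \<open>\<partial>\<^sub>w\<close> is well defined, and \<open>\<partial>\<^sub>v \<partial>\<^sub>w\<close> is \<open>\<partial>\<^sub>v\<^sub>w\<close> if lengths add and \<open>0\<close>
  otherwise (\<open>dred_mult\<close>). The same rule shows that the operator of the longest element \<open>w\<^sub>0\<close> maps
  \<open>x\<close> to the power \<open>l(w\<^sub>0)\<close>, for regular dominant \<open>x\<close>, to a positive integer (\<open>dword_power_pos\<close>).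
  A rational multiple \<open>p\<close> of that power is mapped to \<open>1\<close>, and \<open>b\<^sub>w = \<partial>\<^sub>u p\<close> with \<open>u = w\<^sup>-\<^sup>1 w\<^sub>0\<close> is as
  required (\<open>bas_triangular\<close>).

  Consequences. The nilHecke algebra acts on polynomials (\<open>rep_exists\<close>). Moving polynomials to the
  left, each of its elements is a combination \<open>\<Sum>\<^sub>w g\<^sub>w \<partial>\<^sub>w\<close> with polynomial coefficients (\<open>NH_span\<close>),
  and by triangularity such a combination vanishes as an operator only if all \<open>g\<^sub>w\<close> do
  (\<open>dred_independent\<close>): the action is faithful. Solving the triangular system from the longest
  element downwards (\<open>elimination\<close>) writes every polynomial as \<open>f = \<Sum>\<^sub>w b\<^sub>w E\<^sub>w(f)\<close> with invariant
  coefficients, where the maps \<open>E\<^sub>w\<close> are built from Demazure operators and multiplications. Hence the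
  polynomials are free over the invariants with basis \<open>b\<^sub>w\<close>, and every linear endomorphism
  \<open>F = \<Sum>\<^sub>w F(b\<^sub>w) E\<^sub>w\<close> comes from the rational nilHecke algebra (\<open>EQ_generated\<close>). This gives the first
  isomorphism (\<open>phi_exists\<close>); taking matrices in the basis \<open>b\<^sub>w\<close> gives the second (\<open>to_mat_iso\<close>), the
  Poincare polynomial recording the degrees \<open>2 l(w)\<close>. That the isomorphisms respect the gradings
  costs little: it suffices that homogeneous elements generate the source, that their images are
  homogeneous, and that components in the target are unique (\<open>graded_iso_criterion\<close>).
\<close>

(* The infix dollar is freed for the entries of vectors. *)
no_notation fps_nth (infixl \<open>$\<close> 75)

section \<open>Words and lengths in a finite Weyl group\<close>

locale weyl_datum =
  fixes D :: "('i, 'z) refl_datum_scheme"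
  assumes weyl: "finite_weyl_datum D"
begin

abbreviation "n \<equiv> rnk D"
abbreviation "I \<equiv> nodes D"
abbreviation "s \<equiv> simple_refl D"
abbreviation "cr \<equiv> simple_coroot D"
abbreviation "rt \<equiv> simple_root D"
abbreviation "W \<equiv> weyl_group D"
abbreviation "len \<equiv> weyl_length D"

definition wmat :: "'i list \<Rightarrow> int mat" where
  "wmat u = foldr (\<lambda>i A. s i * A) u (1\<^sub>m n)"

lemma finite_I: "finite I"
  and cr_carrier [simp]: "i \<in> I \<Longrightarrow> cr i \<in> carrier_vec n"
  and rt_carrier [simp]: "i \<in> I \<Longrightarrow> rt i \<in> carrier_vec n"
  and cr_rt_2: "i \<in> I \<Longrightarrow> cr i \<bullet> rt i = 2"
  and cr_rt_le: "i \<in> I \<Longrightarrow> j \<in> I \<Longrightarrow> i \<noteq> j \<Longrightarrow> cr i \<bullet> rt j \<le> 0"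
  and cr_rt_0: "i \<in> I \<Longrightarrow> j \<in> I \<Longrightarrow> cr i \<bullet> rt j = 0 \<longleftrightarrow> cr j \<bullet> rt i = 0"
  and cr_indep: "(\<And>k. k < n \<Longrightarrow> (\<Sum>i\<in>I. c i * cr i $ k) = 0) \<Longrightarrow> i \<in> I \<Longrightarrow> c i = 0"
  and finite_W: "finite W"
  using weyl unfolding finite_weyl_datum_def by auto

lemma cr_dim [simp]: "i \<in> I \<Longrightarrow> dim_vec (cr i) = n"
  and rt_dim [simp]: "i \<in> I \<Longrightarrow> dim_vec (rt i) = n"
  using cr_carrier[of i] rt_carrier[of i] unfolding carrier_vec_def by simp_all

lemma sq_mult_carrier [simp]: "A \<in> carrier_mat n n \<Longrightarrow> B \<in> carrier_mat n n \<Longrightarrow> A * B \<in> carrier_mat n n"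
  for A B :: "int mat" by simp

lemma sq_assoc: "A \<in> carrier_mat n n \<Longrightarrow> B \<in> carrier_mat n n \<Longrightarrow> C \<in> carrier_mat n n \<Longrightarrow> A * B * C = A * (B * C)"
  for A B C :: "int mat" by simp

lemma sq_act: "A \<in> carrier_mat n n \<Longrightarrow> B \<in> carrier_mat n n \<Longrightarrow> x \<in> carrier_vec n \<Longrightarrow> A * B *\<^sub>v x = A *\<^sub>v (B *\<^sub>v x)"
  for A B :: "int mat" by simp

lemma act_smult: "A \<in> carrier_mat n n \<Longrightarrow> x \<in> carrier_vec n \<Longrightarrow> A *\<^sub>v (a \<cdot>\<^sub>v x) = a \<cdot>\<^sub>v (A *\<^sub>v x)"
  for A :: "int mat"
  by (rule eq_vecI) (auto simp: scalar_prod_smult_distrib[of _ n])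

lemma s_carrier [simp]: "s i \<in> carrier_mat n n"
  by (simp add: simple_refl_def)

lemma s_dim [simp]: "dim_row (s i) = n" "dim_col (s i) = n"
  by (auto simp: simple_refl_def)

lemma s_nth: "x \<in> carrier_vec n \<Longrightarrow> k < n \<Longrightarrow> i \<in> I \<Longrightarrow> (s i *\<^sub>v x) $ k = x $ k - (x \<bullet> rt i) * cr i $ k"
proof -
  assume x: "x \<in> carrier_vec n" and k: "k < n" and i: "i \<in> I"
  have r: "rt i \<in> carrier_vec n" using i by simp
  have "(s i *\<^sub>v x) $ k = (\<Sum>l\<in>{0..<n}. ((if k = l then 1 else 0) - cr i $ k * rt i $ l) * x $ l)"
    using x k by (simp add: simple_refl_def scalar_prod_def)
  also have "\<dots> = (\<Sum>l\<in>{0..<n}. (if k = l then x $ l else 0) - cr i $ k * (x $ l * rt i $ l))"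
    by (rule sum.cong) (auto simp: algebra_simps)
  also have "\<dots> = x $ k - cr i $ k * (\<Sum>l\<in>{0..<n}. x $ l * rt i $ l)"
    using k by (simp add: sum_subtractf sum_distrib_left)
  finally show ?thesis using r by (simp add: scalar_prod_def algebra_simps)
qed

lemma s_vec [simp]: "x \<in> carrier_vec n \<Longrightarrow> s i *\<^sub>v x \<in> carrier_vec n"
  using mult_mat_vec_carrier s_carrier by blast

lemma mat_eqI_act:
  fixes A B :: "int mat"
  assumes A: "A \<in> carrier_mat n n" "B \<in> carrier_mat n n" and e: "\<And>x. x \<in> carrier_vec n \<Longrightarrow> A *\<^sub>v x = B *\<^sub>v x"
  shows "A = B"
proof (rule eq_matI)
  fix i j assume ij: "i < dim_row B" "j < dim_col B"
  then have "j < n" "i < n" using A by auto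
  have "A $$ (i,j) = (A *\<^sub>v unit_vec n j) $ i" using A ij by auto
  also have "\<dots> = (B *\<^sub>v unit_vec n j) $ i" using e by simp
  also have "\<dots> = B $$ (i,j)" using A ij by auto
  finally show "A $$ (i,j) = B $$ (i,j)" .
qed (use A in auto)

lemma s_cr: "i \<in> I \<Longrightarrow> s i *\<^sub>v cr i = - cr i"
  by (rule eq_vecI) (auto simp: s_nth cr_rt_2 carrier_vecD simp del: index_mult_mat_vec)

lemma s_s: assumes i: "i \<in> I" shows "s i * s i = 1\<^sub>m n"
proof (rule mat_eqI_act)
  fix x :: "int vec" assume x: "x \<in> carrier_vec n"
  have "(s i *\<^sub>v x) \<bullet> rt i = (\<Sum>k\<in>{0..<n}. (x $ k - (x \<bullet> rt i) * cr i $ k) * rt i $ k)"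
    unfolding scalar_prod_def[of "s i *\<^sub>v x"] using i x by (intro sum.cong) (auto simp: s_nth carrier_vecD simp del: index_mult_mat_vec)
  also have "\<dots> = x \<bullet> rt i - (x \<bullet> rt i) * (cr i \<bullet> rt i)"
    using i by (simp add: scalar_prod_def sum_subtractf sum_distrib_left algebra_simps carrier_vecD)
  finally have *: "(s i *\<^sub>v x) \<bullet> rt i = - (x \<bullet> rt i)" using i cr_rt_2 by simp
  have "s i *\<^sub>v (s i *\<^sub>v x) = x"
    by (rule eq_vecI) (use i x * in \<open>auto simp: s_nth algebra_simps carrier_vecD simp del: index_mult_mat_vec\<close>)
  then show "(s i * s i) *\<^sub>v x = 1\<^sub>m n *\<^sub>v x"
    using x by (subst assoc_mult_mat_vec[OF s_carrier s_carrier x]) auto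
qed auto

lemma wmat_Nil [simp]: "wmat [] = 1\<^sub>m n"
  and wmat_Cons: "wmat (i # u) = s i * wmat u"
  by (auto simp: wmat_def)

lemma wmat_carrier [simp]: "wmat u \<in> carrier_mat n n"
  by (induction u) (auto simp: wmat_Cons)

lemma wmat_dim [simp]: "dim_row (wmat u) = n" "dim_col (wmat u) = n"
  using wmat_carrier[of u] unfolding carrier_mat_def by simp_all

lemma wmat_append: "wmat (u @ v) = wmat u * wmat v"
  by (induction u) (auto simp: wmat_Cons sq_assoc left_mult_one_mat)

lemma wmat_single [simp]: "wmat [i] = s i"
  by (simp add: wmat_Cons)

lemma wmat_snoc: "wmat (u @ [i]) = wmat u * s i"
  by (simp add: wmat_append)

lemma wmat_rev_inv: "u \<in> lists I \<Longrightarrow> wmat (rev u) * wmat u = 1\<^sub>m n"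
proof (induction u)
  case (Cons i u)
  have "wmat (rev (i # u)) * wmat (i # u) = wmat (rev u) * ((s i * s i) * wmat u)"
    by (simp add: wmat_Cons wmat_append sq_assoc)
  then show ?case using Cons by (simp add: s_s)
qed simp

lemma wmat_rev_inv': "u \<in> lists I \<Longrightarrow> wmat u * wmat (rev u) = 1\<^sub>m n"
  using wmat_rev_inv[of "rev u"] by (simp add: lists_eq_set)

lemma wmat_vec [simp]: "x \<in> carrier_vec n \<Longrightarrow> wmat u *\<^sub>v x \<in> carrier_vec n"
  using mult_mat_vec_carrier wmat_carrier by blast

lemma wmat_act_Cons: "x \<in> carrier_vec n \<Longrightarrow> wmat (i # u) *\<^sub>v x = s i *\<^sub>v (wmat u *\<^sub>v x)"
  by (simp add: wmat_Cons sq_act)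

lemma GL_group: "group (GL n)"
proof -
  interpret ring "ring_mat TYPE(int) n ()" by (rule ring_mat)
  show ?thesis unfolding GL_def by (rule units_group)
qed

lemma GL_simps: "mult (GL n) = (*)" "one (GL n) = 1\<^sub>m n"
  by (auto simp: GL_def units_of_def ring_mat_def)

lemma GL_carrierI: "A \<in> carrier_mat n n \<Longrightarrow> B \<in> carrier_mat n n \<Longrightarrow> A * B = 1\<^sub>m n \<Longrightarrow> B * A = 1\<^sub>m n \<Longrightarrow> A \<in> carrier (GL n)"
  by (auto simp: GL_def units_of_def ring_mat_def Units_def)

lemma wmat_GL: "u \<in> lists I \<Longrightarrow> wmat u \<in> carrier (GL n)"
  by (rule GL_carrierI[of _ "wmat (rev u)"]) (auto simp: wmat_rev_inv wmat_rev_inv')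

lemma inv_GL_wmat: "u \<in> lists I \<Longrightarrow> inv\<^bsub>GL n\<^esub> (wmat u) = wmat (rev u)"
proof -
  assume u: "u \<in> lists I"
  interpret group "GL n" by (rule GL_group)
  have "rev u \<in> lists I" using u by (auto simp: lists_eq_set)
  then show ?thesis using u by (intro inv_equality) (auto simp: GL_simps wmat_rev_inv wmat_GL)
qed

text \<open>The generators are involutions, so inverses bring nothing new: the generated group consists of
  the products of words.\<close>

lemma W_eq: "W = wmat ` lists I"
proof (intro equalityI subsetI)
  fix w assume "w \<in> W"
  then show "w \<in> wmat ` lists I" unfolding weyl_group_def
  proof induction
    case one
    have "wmat [] \<in> wmat ` lists I" by blast
    then show ?case by (simp add: GL_simps)
  next
    case (incl h)
    then obtain i where "i \<in> I" "h = s i" by auto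
    then have "h = wmat [i]" "[i] \<in> lists I" by auto
    then show ?case by blast
  next
    case (inv h)
    then obtain i where "i \<in> I" "h = s i" by auto
    then have "inv\<^bsub>GL n\<^esub> h = wmat [i]" "[i] \<in> lists I" using inv_GL_wmat[of "[i]"] by auto
    then show ?case by blast
  next
    case (eng h1 h2)
    then obtain u v where "h1 = wmat u" "h2 = wmat v" "u \<in> lists I" "v \<in> lists I" by auto
    then have "h1 \<otimes>\<^bsub>GL n\<^esub> h2 = wmat (u @ v)" "u @ v \<in> lists I" by (auto simp: wmat_append GL_simps)
    then show ?case by blast
  qed
next
  fix w assume "w \<in> wmat ` lists I"
  then obtain u where u: "u \<in> lists I" "w = wmat u" by auto
  have "wmat u \<in> generate (GL n) (s ` I)" using u(1)
  proof (induction u)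
    case Nil
    have "\<one>\<^bsub>GL n\<^esub> \<in> generate (GL n) (s ` I)" by (rule generate.one)
    then show ?case by (simp add: GL_simps)
  next
    case (Cons i u)
    then have "s i \<otimes>\<^bsub>GL n\<^esub> wmat u \<in> generate (GL n) (s ` I)"
      by (intro generate.eng) (auto intro: generate.incl)
    then show ?case by (simp add: GL_simps wmat_Cons)
  qed
  then show "w \<in> W" using u by (simp add: weyl_group_def)
qed

lemma wmat_in_W: "u \<in> lists I \<Longrightarrow> wmat u \<in> W"
  by (simp add: W_eq)

lemma W_carrier: "w \<in> W \<Longrightarrow> w \<in> carrier_mat n n"
  by (auto simp: W_eq)

lemma W_mult: "v \<in> W \<Longrightarrow> w \<in> W \<Longrightarrow> v * w \<in> W"
proof -
  assume "v \<in> W" "w \<in> W"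
  then obtain a b where "a \<in> lists I" "b \<in> lists I" "v = wmat a" "w = wmat b" by (auto simp: W_eq)
  then have "v * w = wmat (a @ b)" "a @ b \<in> lists I" by (auto simp: wmat_append)
  then show ?thesis using wmat_in_W by metis
qed

lemma W_s: "i \<in> I \<Longrightarrow> s i \<in> W"
  using wmat_in_W[of "[i]"] by simp

lemma len_alt: "len w = (LEAST l. \<exists>u\<in>lists I. length u = l \<and> wmat u = w)"
  by (simp add: weyl_length_def wmat_def)

lemma len_le: "u \<in> lists I \<Longrightarrow> len (wmat u) \<le> length u"
  unfolding len_alt by (rule Least_le) auto

lemma reduced_word_exists: assumes "w \<in> W" obtains u where "u \<in> lists I" "wmat u = w" "length u = len w"
proof -
  obtain v where "v \<in> lists I" "wmat v = w" using assms by (auto simp: W_eq)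
  then have "\<exists>u\<in>lists I. length u = len w \<and> wmat u = w"
    unfolding len_alt by (intro LeastI[of "\<lambda>l. \<exists>u\<in>lists I. length u = l \<and> wmat u = w" "length v"]) auto
  then show ?thesis using that by auto
qed

lemma len_mult: assumes "v \<in> W" "w \<in> W" shows "len (v * w) \<le> len v + len w"
proof -
  obtain a b where "a \<in> lists I" "wmat a = v" "length a = len v" "b \<in> lists I" "wmat b = w" "length b = len w"
    using assms reduced_word_exists by metis
  then show ?thesis using len_le[of "a @ b"] by (auto simp: wmat_append)
qed

lemma len_one [simp]: "len (1\<^sub>m n) = 0"
  using len_le[of "[]"] by simp

lemma len_0: "w \<in> W \<Longrightarrow> len w = 0 \<Longrightarrow> w = 1\<^sub>m n"
  by (metis length_0_conv reduced_word_exists wmat_Nil)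

lemma len_s: "i \<in> I \<Longrightarrow> len (s i) \<le> 1"
  using len_le[of "[i]"] by simp

lemma mult_s_s: "w \<in> W \<Longrightarrow> i \<in> I \<Longrightarrow> w * s i * s i = w"
  using W_carrier[of w] by (simp add: sq_assoc s_s)

lemma len_mult_s_le: "w \<in> W \<Longrightarrow> i \<in> I \<Longrightarrow> len (w * s i) \<le> len w + 1"
  using len_mult[of w "s i"] len_s[of i] W_s[of i] by linarith

lemma len_mult_s_ge: "w \<in> W \<Longrightarrow> i \<in> I \<Longrightarrow> len w \<le> len (w * s i) + 1"
  using len_mult_s_le[of "w * s i" i] W_mult[of w "s i"] W_s mult_s_s by auto

lemma len_rev_le: "u \<in> lists I \<Longrightarrow> len (wmat (rev u)) \<le> len (wmat u)"
proof -
  assume u: "u \<in> lists I"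
  obtain v where v: "v \<in> lists I" "wmat v = wmat u" "length v = len (wmat u)" using reduced_word_exists[OF wmat_in_W[OF u]] by metis
  have "wmat (rev v) = wmat (rev u)" using v u inv_GL_wmat by metis
  then show ?thesis using len_le[of "rev v"] v by (auto simp: lists_eq_set)
qed

lemma len_rev: "u \<in> lists I \<Longrightarrow> len (wmat (rev u)) = len (wmat u)"
  using len_rev_le[of u] len_rev_le[of "rev u"] by (auto simp: lists_eq_set)

section \<open>The invariant form\<close>

text \<open>Summing over the finite group makes every element of \<open>W\<close> an isometry. This is how finiteness of
  \<open>W\<close> comes to bound the Cartan integers.\<close>

definition bform :: "int vec \<Rightarrow> int vec \<Rightarrow> int" where
  "bform x y = (\<Sum>w\<in>W. (w *\<^sub>v x) \<bullet> (w *\<^sub>v y))"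

lemma bform_comm: "x \<in> carrier_vec n \<Longrightarrow> y \<in> carrier_vec n \<Longrightarrow> bform x y = bform y x"
  unfolding bform_def by (intro sum.cong refl comm_scalar_prod[of _ n]) (auto simp: W_eq)

lemma bform_add_left: "x \<in> carrier_vec n \<Longrightarrow> y \<in> carrier_vec n \<Longrightarrow> z \<in> carrier_vec n \<Longrightarrow> bform (x + y) z = bform x z + bform y z"
  unfolding bform_def sum.distrib[symmetric]
proof (intro sum.cong refl)
  fix w assume x: "x \<in> carrier_vec n" "y \<in> carrier_vec n" "z \<in> carrier_vec n" and "w \<in> W"
  then have w: "w \<in> carrier_mat n n" by (simp add: W_carrier)
  show "(w *\<^sub>v (x + y)) \<bullet> (w *\<^sub>v z) = (w *\<^sub>v x) \<bullet> (w *\<^sub>v z) + (w *\<^sub>v y) \<bullet> (w *\<^sub>v z)"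
    using mult_add_distrib_mat_vec[OF w x(1,2)] add_scalar_prod_distrib[of "w *\<^sub>v x" n "w *\<^sub>v y" "w *\<^sub>v z"] x w by auto
qed

lemma bform_smult_left: "x \<in> carrier_vec n \<Longrightarrow> y \<in> carrier_vec n \<Longrightarrow> bform (a \<cdot>\<^sub>v x) y = a * bform x y"
  unfolding bform_def sum_distrib_left
proof (intro sum.cong refl)
  fix w assume x: "x \<in> carrier_vec n" "y \<in> carrier_vec n" and "w \<in> W"
  then have w: "w \<in> carrier_mat n n" by (simp add: W_carrier)
  show "(w *\<^sub>v (a \<cdot>\<^sub>v x)) \<bullet> (w *\<^sub>v y) = a * ((w *\<^sub>v x) \<bullet> (w *\<^sub>v y))"
    using act_smult[OF w x(1)] smult_scalar_prod_distrib[of "w *\<^sub>v x" n "w *\<^sub>v y"] x w by auto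
qed

lemma bform_add_right: "x \<in> carrier_vec n \<Longrightarrow> y \<in> carrier_vec n \<Longrightarrow> z \<in> carrier_vec n \<Longrightarrow> bform z (x + y) = bform z x + bform z y"
  by (metis add_carrier_vec bform_add_left bform_comm)

lemma bform_smult_right: "x \<in> carrier_vec n \<Longrightarrow> y \<in> carrier_vec n \<Longrightarrow> bform y (a \<cdot>\<^sub>v x) = a * bform y x"
  by (metis smult_carrier_vec bform_smult_left bform_comm)

lemma bform_sum_right:
  assumes "finite J" "\<And>i. i \<in> J \<Longrightarrow> y i \<in> carrier_vec n" "x \<in> carrier_vec n"
    "z \<in> carrier_vec n" "\<And>k. k < n \<Longrightarrow> z $ k = (\<Sum>i\<in>J. c i * y i $ k)"
  shows "bform x z = (\<Sum>i\<in>J. c i * bform x (y i))"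
  using assms(1,2,4,5)
proof (induction J arbitrary: z)
  case empty
  have "z = 0 \<cdot>\<^sub>v x" using empty assms(3) by (intro eq_vecI) auto
  then show ?case using bform_smult_right[of x x 0] assms(3) by simp
next
  case (insert j J)
  define z' where "z' = vec n (\<lambda>k. \<Sum>i\<in>J. c i * y i $ k)"
  have z': "z' \<in> carrier_vec n" by (simp add: z'_def)
  have "z = c j \<cdot>\<^sub>v y j + z'" using insert.hyps insert.prems(2,3) carrier_vecD[OF insert.prems(1)[of j]] by (intro eq_vecI) (auto simp: z'_def)
  moreover have "bform x z' = (\<Sum>i\<in>J. c i * bform x (y i))"
    by (rule insert.IH) (use insert in \<open>auto simp: z'_def\<close>)
  ultimately show ?case using insert z' assms(3) by (simp add: bform_add_right bform_smult_right)
qed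

lemma bform_W: assumes w: "w \<in> W" and x: "x \<in> carrier_vec n" "y \<in> carrier_vec n"
  shows "bform (w *\<^sub>v x) (w *\<^sub>v y) = bform x y"
proof -
  obtain u where u: "u \<in> lists I" "w = wmat u" using w by (auto simp: W_eq)
  have r: "wmat (rev u) \<in> W" using u by (intro wmat_in_W) (auto simp: lists_eq_set)
  have bij: "bij_betw (\<lambda>v. v * w) W W"
  proof (rule bij_betwI[where g = "\<lambda>v. v * wmat (rev u)"])
    show "(\<lambda>v. v * w) \<in> W \<rightarrow> W" using w W_mult by auto
    show "(\<lambda>v. v * wmat (rev u)) \<in> W \<rightarrow> W" using r W_mult by auto
    fix v assume "v \<in> W" then have v: "v \<in> carrier_mat n n" by (rule W_carrier)
    show "v * w * wmat (rev u) = v" using v u by (simp add: sq_assoc wmat_rev_inv')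
    show "v * wmat (rev u) * w = v" using v u by (simp add: sq_assoc wmat_rev_inv)
  qed
  have "bform x y = (\<Sum>v\<in>W. ((v * w) *\<^sub>v x) \<bullet> ((v * w) *\<^sub>v y))"
    unfolding bform_def by (rule sum.reindex_bij_betw[OF bij, symmetric])
  also have "\<dots> = bform (w *\<^sub>v x) (w *\<^sub>v y)"
    unfolding bform_def
  proof (intro sum.cong refl)
    fix v assume "v \<in> W"
    then have "v \<in> carrier_mat n n" "w \<in> carrier_mat n n" using w by (auto simp: W_carrier)
    then show "((v * w) *\<^sub>v x) \<bullet> ((v * w) *\<^sub>v y) = (v *\<^sub>v (w *\<^sub>v x)) \<bullet> (v *\<^sub>v (w *\<^sub>v y))"
      using x by simp
  qed
  finally show ?thesis by simp
qed

lemma scalar_prod_self_ge: "(x :: int vec) \<bullet> x \<ge> 0"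
  by (auto simp: scalar_prod_def intro: sum_nonneg)

lemma bform_pos: assumes x: "x \<in> carrier_vec n" "x \<noteq> 0\<^sub>v n" shows "bform x x > 0"
proof -
  have one: "1\<^sub>m n \<in> W" using wmat_in_W[of "[]"] by simp
  obtain k where k: "k < n" "x $ k \<noteq> 0" using x by (metis carrier_vecD eq_vecI index_zero_vec)
  have "x \<bullet> x > 0" unfolding scalar_prod_def
    by (rule sum_pos2[of _ k]) (use k x in \<open>auto simp: zero_less_mult_iff\<close>)
  also have "x \<bullet> x \<le> bform x x"
    unfolding bform_def using x one finite_W sum_nonneg_leq_bound
    member_le_sum[of "1\<^sub>m n" W "\<lambda>w. (w *\<^sub>v x) \<bullet> (w *\<^sub>v x)"] scalar_prod_self_ge by auto
  finally show ?thesis .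
qed

lemma cr_nonzero: "i \<in> I \<Longrightarrow> cr i \<noteq> 0\<^sub>v n"
  using cr_rt_2[of i] by auto

lemma s_eq_add: "i \<in> I \<Longrightarrow> x \<in> carrier_vec n \<Longrightarrow> s i *\<^sub>v x = x + (- (x \<bullet> rt i)) \<cdot>\<^sub>v cr i"
  by (rule eq_vecI) (auto simp: s_nth carrier_vecD simp del: index_mult_mat_vec)

text \<open>The reflection \<open>s i\<close> is an isometry that negates \<open>cr i\<close>. Comparing the form of \<open>x\<close> and \<open>cr i\<close>
  with that of their images expresses the root by the form.\<close>

lemma rt_bform: assumes i: "i \<in> I" and x: "x \<in> carrier_vec n"
  shows "(x \<bullet> rt i) * bform (cr i) (cr i) = 2 * bform x (cr i)"
proof -
  have m: "- cr i = (-1) \<cdot>\<^sub>v cr i" by (rule eq_vecI) auto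
  have "bform x (cr i) = bform (s i *\<^sub>v x) (s i *\<^sub>v cr i)" using bform_W[OF W_s[OF i] x, of "cr i"] i by simp
  also have "\<dots> = bform (x + (- (x \<bullet> rt i)) \<cdot>\<^sub>v cr i) ((-1) \<cdot>\<^sub>v cr i)" using i x by (simp only: s_cr m s_eq_add)
  also have "\<dots> = - (bform x (cr i) - (x \<bullet> rt i) * bform (cr i) (cr i))"
    using i x by (simp add: bform_smult_right bform_smult_left bform_add_left algebra_simps)
  finally show ?thesis by simp
qed

lemma rt_pos_iff: assumes i: "i \<in> I" and x: "x \<in> carrier_vec n"
  shows "x \<bullet> rt i > 0 \<longleftrightarrow> bform x (cr i) > 0"
proof -
  have "bform (cr i) (cr i) > 0" using i cr_nonzero by (intro bform_pos) auto
  then show ?thesis using rt_bform[OF i x] zero_less_mult_pos2 zero_less_mult_iff[of "x \<bullet> rt i" "bform (cr i) (cr i)"] by auto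
qed

lemma indep2: assumes ij: "i \<in> I" "j \<in> I" "i \<noteq> j" and e: "\<And>k. k < n \<Longrightarrow> p * cr i $ k + q * cr j $ k = 0"
  shows "p = 0 \<and> q = 0"
proof -
  define c where "c = (\<lambda>l. if l = i then p else if l = j then q else 0)"
  have "(\<Sum>l\<in>I. c l * cr l $ k) = 0" if "k < n" for k
  proof -
    have "(\<Sum>l\<in>I. c l * cr l $ k) = (\<Sum>l\<in>{i,j}. c l * cr l $ k)"
      by (rule sum.mono_neutral_right) (use ij finite_I in \<open>auto simp: c_def\<close>)
    also have "\<dots> = 0" using ij e[OF that] by (simp add: c_def)
    finally show ?thesis .
  qed
  then have "c i = 0" "c j = 0" using cr_indep ij by blast+
  then show ?thesis using ij by (simp add: c_def)
qed

text \<open>Up to the factor 4 the product of the two Cartan integers is the squared cosine of the angle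
  between the coroots, so this is strict Cauchy-Schwarz for two independent vectors.\<close>

lemma cartan_lt_4: assumes ij: "i \<in> I" "j \<in> I" "i \<noteq> j"
  shows "(cr i \<bullet> rt j) * (cr j \<bullet> rt i) < 4"
proof -
  define a b where "a = cr i \<bullet> rt j" and "b = cr j \<bullet> rt i"
  define A B C where "A = bform (cr i) (cr i)" and "B = bform (cr i) (cr j)" and "C = bform (cr j) (cr j)"
  have A: "A > 0" "C > 0" unfolding A_def C_def using ij cr_nonzero bform_pos by auto
  have 1: "a * C = 2 * B" "b * A = 2 * B"
    using rt_bform[of j "cr i"] rt_bform[of i "cr j"] bform_comm[of "cr i" "cr j"] ij unfolding a_def b_def A_def B_def C_def by auto
  \<comment> \<open>Up to the factor \<open>C\<close> this is the component of \<open>cr i\<close> orthogonal to \<open>cr j\<close>.\<close>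
  define x where "x = C \<cdot>\<^sub>v cr i + (- B) \<cdot>\<^sub>v cr j"
  have x: "x \<in> carrier_vec n" using ij by (simp add: x_def)
  have "x \<noteq> 0\<^sub>v n"
  proof
    assume x0: "x = 0\<^sub>v n"
    have "C * cr i $ k + (- B) * cr j $ k = 0" if k: "k < n" for k
      using arg_cong[OF x0, of "\<lambda>x. x $ k"] ij k by (auto simp: x_def carrier_vecD)
    then have "C = 0" using indep2[OF ij] by blast
    then show False using A by simp
  qed
  then have "bform x x > 0" using bform_pos x by blast
  also have "bform x x = C * (A * C - B * B)"
    unfolding x_def using ij bform_comm[of "cr i" "cr j"]
    by (simp add: bform_add_left bform_add_right bform_smult_left bform_smult_right A_def B_def C_def algebra_simps)
  finally have "B * B < A * C" using A by (simp add: zero_less_mult_iff)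
  moreover have "a * b * (A * C) = 4 * (B * B)"
  proof -
    have "a * b * (A * C) = (a * C) * (b * A)" by simp
    also have "\<dots> = 4 * (B * B)" unfolding 1 by simp
    finally show ?thesis .
  qed
  ultimately have "a * b * (A * C) < 4 * (A * C)" by simp
  moreover have "A * C > 0" using A by simp
  ultimately show ?thesis unfolding a_def b_def using mult_less_cancel_right_pos by blast
qed

section \<open>Dihedral subgroups\<close>

text \<open>Words in \<open>s i\<close> and \<open>s j\<close> act on these vectors by integral affine maps of \<open>(p, q)\<close>, which turns
  identities between such words into computations that rewriting can do.\<close>

definition lc :: "'i \<Rightarrow> 'i \<Rightarrow> int vec \<Rightarrow> int \<Rightarrow> int \<Rightarrow> int vec" where
  "lc i j y p q = vec n (\<lambda>k. y $ k + p * cr i $ k + q * cr j $ k)"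

lemma lc_carrier [simp]: "lc i j y p q \<in> carrier_vec n"
  by (simp add: lc_def)

lemma lc_dim [simp]: "dim_vec (lc i j y p q) = n"
  by (simp add: lc_def)

lemma lc_0_0: "y \<in> carrier_vec n \<Longrightarrow> lc i j y 0 0 = y"
  by (rule eq_vecI) (auto simp: lc_def)

lemma lc_cr: "i \<in> I \<Longrightarrow> lc i j (0\<^sub>v n) 1 0 = cr i"
  by (rule eq_vecI) (auto simp: lc_def)

lemma lc_rt: "i \<in> I \<Longrightarrow> j \<in> I \<Longrightarrow> l \<in> I \<Longrightarrow> y \<in> carrier_vec n \<Longrightarrow>
    lc i j y p q \<bullet> rt l = y \<bullet> rt l + p * (cr i \<bullet> rt l) + q * (cr j \<bullet> rt l)"
  by (simp add: scalar_prod_def lc_def sum_distrib_left algebra_simps flip: sum.distrib)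

lemma s_lc_i: "i \<in> I \<Longrightarrow> j \<in> I \<Longrightarrow> y \<in> carrier_vec n \<Longrightarrow>
    s i *\<^sub>v lc i j y p q = lc i j y (- p - y \<bullet> rt i - q * (cr j \<bullet> rt i)) q"
  by (rule eq_vecI) (simp_all add: s_nth lc_rt cr_rt_2 del: index_mult_mat_vec, simp_all add: lc_def algebra_simps)

lemma s_lc_j: "i \<in> I \<Longrightarrow> j \<in> I \<Longrightarrow> y \<in> carrier_vec n \<Longrightarrow>
    s j *\<^sub>v lc i j y p q = lc i j y p (- q - y \<bullet> rt j - p * (cr i \<bullet> rt j))"
  by (rule eq_vecI) (simp_all add: s_nth lc_rt cr_rt_2 del: index_mult_mat_vec, simp_all add: lc_def algebra_simps)

lemma lc_inject: assumes ij: "i \<in> I" "j \<in> I" "i \<noteq> j" shows "lc i j y p q = lc i j y p' q' \<longleftrightarrow> p = p' \<and> q = q'"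
proof
  assume e: "lc i j y p q = lc i j y p' q'"
  have "(p - p') * cr i $ k + (q - q') * cr j $ k = 0" if "k < n" for k
    using arg_cong[OF e, of "\<lambda>x. x $ k"] that by (simp add: lc_def algebra_simps)
  then show "p = p' \<and> q = q'" using indep2[OF ij, of "p - p'" "q - q'"] by simp
qed auto

lemma cox_dvd_iff: assumes ij: "i \<in> I" "j \<in> I"
  shows "cox D i j dvd k \<longleftrightarrow> wmat (alt_word (2 * k) i j) = 1\<^sub>m n"
proof -
  interpret group "GL n" by (rule GL_group)
  have g: "s i * s j \<in> carrier (GL n)" using wmat_GL[of "[i,j]"] ij by (simp add: wmat_Cons)
  have "(s i * s j) [^]\<^bsub>GL n\<^esub> k = wmat (alt_word (2 * k) i j)"
  proof (induction k)
    case (Suc k)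
    have "(s i * s j) [^]\<^bsub>GL n\<^esub> Suc k = (s i * s j) * ((s i * s j) [^]\<^bsub>GL n\<^esub> k)"
      using nat_pow_Suc2[OF g, of k] by (simp add: GL_simps)
    then show ?case using Suc by (simp add: wmat_Cons sq_assoc)
  qed (simp add: GL_simps)
  then show ?thesis unfolding cox_def using pow_eq_id[OF g, of k] by (simp add: GL_simps)
qed

lemma cartan_cases: assumes ij: "i \<in> I" "j \<in> I" "i \<noteq> j"
  defines "a \<equiv> cr i \<bullet> rt j" and "b \<equiv> cr j \<bullet> rt i"
  shows "(a = 0 \<and> b = 0) \<or> (a = -1 \<and> b = -1) \<or> (a = -1 \<and> b = -2) \<or> (a = -2 \<and> b = -1) \<or> (a = -1 \<and> b = -3) \<or> (a = -3 \<and> b = -1)"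
proof -
  have ab: "a * b < 4" "a \<le> 0" "b \<le> 0" "a = 0 \<longleftrightarrow> b = 0"
    using cartan_lt_4[OF ij] cr_rt_le cr_rt_0 ij unfolding a_def b_def by auto
  show ?thesis
  proof (cases "a = 0")
    case False
    then have n: "a \<le> -1" "b \<le> -1" using ab by auto
    have "(- a) * 1 \<le> (- a) * (- b)" using n by (intro mult_left_mono) auto
    then have a: "a \<ge> -3" using ab by simp
    have "1 * (- b) \<le> (- a) * (- b)" using n by (intro mult_right_mono) auto
    then have b: "b \<ge> -3" using ab by simp
    have "a = -1 \<or> a = -2 \<or> a = -3" "b = -1 \<or> b = -2 \<or> b = -3" using a b n by auto
    then show ?thesis using ab by auto
  qed (use ab in auto)
qed

lemma wmat_eq_lc: assumes "i \<in> I" "j \<in> I"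
   "\<And>y. y \<in> carrier_vec n \<Longrightarrow> wmat u *\<^sub>v lc i j y 0 0 = wmat v *\<^sub>v lc i j y 0 0" shows "wmat u = wmat v"
  by (rule mat_eqI_act) (use assms in \<open>simp_all add: lc_0_0\<close>)

lemma wmat_1_lc: assumes "i \<in> I" "j \<in> I"
   "\<And>y. y \<in> carrier_vec n \<Longrightarrow> wmat u *\<^sub>v lc i j y 0 0 = lc i j y 0 0" shows "wmat u = 1\<^sub>m n"
  using wmat_eq_lc[of i j u "[]"] assms by simp

lemma wmat_not_1_lc: assumes "wmat u *\<^sub>v lc i j (0\<^sub>v n) 1 0 \<noteq> lc i j (0\<^sub>v n) 1 0" shows "wmat u \<noteq> 1\<^sub>m n"
  using assms by auto

text \<open>The three clauses are what the general theory needs from a pair of simple reflections: the first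
  is the braid relation, the second enters the sign lemma \<open>coroot_pos\<close>, and the third compares the
  two outer terms of the Leibniz rule for an alternating word (\<open>dword_braid\<close>).\<close>

definition rank2_facts :: "'i \<Rightarrow> 'i \<Rightarrow> nat \<Rightarrow> bool" where
  "rank2_facts i j m \<longleftrightarrow> wmat (alt_word m i j) = wmat (alt_word m j i) \<and>
     (\<forall>k<m. \<exists>p q. p \<ge> 0 \<and> q \<ge> 0 \<and> wmat (rev (alt_word k j i)) *\<^sub>v cr i = lc i j (0\<^sub>v n) p q) \<and>
     (\<forall>x\<in>carrier_vec n. (wmat (alt_word (m - 1) j i) *\<^sub>v x) \<bullet> rt i = x \<bullet> rt (if even m then i else j))"

lemma rank2_factsI:
  assumes ij: "i \<in> I" "j \<in> I"
   and 1: "\<And>y. y \<in> carrier_vec n \<Longrightarrow> wmat (alt_word m i j) *\<^sub>v lc i j y 0 0 = wmat (alt_word m j i) *\<^sub>v lc i j y 0 0"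
   and 2: "\<And>k. k < m \<Longrightarrow> \<exists>p q. p \<ge> 0 \<and> q \<ge> 0 \<and> wmat (rev (alt_word k j i)) *\<^sub>v lc i j (0\<^sub>v n) 1 0 = lc i j (0\<^sub>v n) p q"
   and 3: "\<And>y. y \<in> carrier_vec n \<Longrightarrow> (wmat (alt_word (m - 1) j i) *\<^sub>v lc i j y 0 0) \<bullet> rt i = y \<bullet> rt (if even m then i else j)"
 shows "rank2_facts i j m"
  unfolding rank2_facts_def using 1 2 3 wmat_eq_lc[OF ij, of "alt_word m i j" "alt_word m j i"] ij
  by (auto simp: lc_cr lc_0_0)

lemma Suc_bounds: "(k::nat) < 2 \<Longrightarrow> k \<in> {0,1}" "k < 3 \<Longrightarrow> k \<in> {0,1,2}" "k < 4 \<Longrightarrow> k \<in> {0,1,2,3}" "k < 6 \<Longrightarrow> k \<in> {0,1,2,3,4,5}"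
  by auto

lemma dvd_numerals: "(c::nat) dvd 2 \<Longrightarrow> \<not> c dvd 1 \<Longrightarrow> c = 2" "c dvd 3 \<Longrightarrow> \<not> c dvd 1 \<Longrightarrow> c = 3"
  "c dvd 4 \<Longrightarrow> \<not> c dvd 2 \<Longrightarrow> c = 4" "c dvd 6 \<Longrightarrow> \<not> c dvd 2 \<Longrightarrow> \<not> c dvd 3 \<Longrightarrow> c = 6"
proof -
  have "c = 0 \<or> c = 1 \<or> c = 2" if "c dvd 2" using dvd_imp_le[OF that] by arith
  then show "c dvd 2 \<Longrightarrow> \<not> c dvd 1 \<Longrightarrow> c = 2" by (metis dvd_0_left_iff one_dvd zero_neq_numeral)
  have "c = 0 \<or> c = 1 \<or> c = 2 \<or> c = 3" if "c dvd 3" using dvd_imp_le[OF that] by arith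
  moreover have "\<not> (2::nat) dvd 3" by simp
  ultimately show "c dvd 3 \<Longrightarrow> \<not> c dvd 1 \<Longrightarrow> c = 3" by (metis dvd_0_left_iff one_dvd zero_neq_numeral)
  have "c = 0 \<or> c = 1 \<or> c = 2 \<or> c = 3 \<or> c = 4" if "c dvd 4" using dvd_imp_le[OF that] by arith
  moreover have "\<not> (3::nat) dvd 4" by simp
  ultimately show "c dvd 4 \<Longrightarrow> \<not> c dvd 2 \<Longrightarrow> c = 4" by (metis dvd_0_left_iff one_dvd zero_neq_numeral dvd_refl)
  have "c = 0 \<or> c = 1 \<or> c = 2 \<or> c = 3 \<or> c = 4 \<or> c = 5 \<or> c = 6" if "c dvd 6" using dvd_imp_le[OF that] by arith
  moreover have "\<not> (4::nat) dvd 6" "\<not> (5::nat) dvd 6" by simp_all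
  ultimately show "c dvd 6 \<Longrightarrow> \<not> c dvd 2 \<Longrightarrow> \<not> c dvd 3 \<Longrightarrow> c = 6"
    by (metis dvd_0_left_iff one_dvd zero_neq_numeral dvd_refl)
qed

lemma alt_word_numeral: "alt_word (numeral v) i j = i # alt_word (pred_numeral v) j i"
  by (simp add: numeral_eq_Suc)

text \<open>The Cartan integers leave six cases. In each one the order of \<open>s i * s j\<close> is found by checking
  that the claimed power acts as the identity and that the powers for its maximal proper divisors
  move \<open>cr i\<close>; everything else is evaluation of short words.\<close>

lemma rank2: assumes ij: "i \<in> I" "j \<in> I" "i \<noteq> j"
  shows "rank2_facts i j (cox D i j) \<and> cox D i j \<ge> 2"
proof -
  note S = wmat_act_Cons s_lc_i s_lc_j alt_word_numeral lc_inject algebra_simps lc_rt cr_rt_2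
  have *: "rank2_facts i j m \<and> cox D i j = m \<and> m \<ge> 2 \<Longrightarrow> ?thesis" for m by auto
  consider "cr i \<bullet> rt j = 0" "cr j \<bullet> rt i = 0" | "cr i \<bullet> rt j = -1" "cr j \<bullet> rt i = -1"
    | "cr i \<bullet> rt j = -1" "cr j \<bullet> rt i = -2" | "cr i \<bullet> rt j = -2" "cr j \<bullet> rt i = -1"
    | "cr i \<bullet> rt j = -1" "cr j \<bullet> rt i = -3" | "cr i \<bullet> rt j = -3" "cr j \<bullet> rt i = -1"
    using cartan_cases[OF ij] by argo
  then show ?thesis
  proof cases
    case 1
    show ?thesis
    proof (rule *[of 2], intro conjI)
      show "rank2_facts i j 2"
        by (rule rank2_factsI) (use ij 1 in \<open>auto simp: S dest!: Suc_bounds\<close>)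
      show "cox D i j = 2"
      proof (rule dvd_numerals)
        show "cox D i j dvd 2" unfolding cox_dvd_iff[OF ij(1,2)] using ij 1 by (intro wmat_1_lc[of i j]) (auto simp: S)
        show "\<not> cox D i j dvd 1" unfolding cox_dvd_iff[OF ij(1,2)] using ij 1
          by (intro wmat_not_1_lc[of _ i j]) (auto simp: S)
      qed
    qed simp
  next
    case 2
    show ?thesis
    proof (rule *[of 3], intro conjI)
      show "rank2_facts i j 3"
        by (rule rank2_factsI) (use ij 2 in \<open>auto simp: S dest!: Suc_bounds\<close>)
      show "cox D i j = 3"
      proof (rule dvd_numerals)
        show "cox D i j dvd 3" unfolding cox_dvd_iff[OF ij(1,2)] using ij 2 by (intro wmat_1_lc[of i j]) (auto simp: S)
        show "\<not> cox D i j dvd 1" unfolding cox_dvd_iff[OF ij(1,2)] using ij 2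
          by (intro wmat_not_1_lc[of _ i j]) (auto simp: S)
      qed
    qed simp
  next
    case 3
    show ?thesis
    proof (rule *[of 4], intro conjI)
      show "rank2_facts i j 4"
        by (rule rank2_factsI) (use ij 3 in \<open>auto simp: S dest!: Suc_bounds\<close>)
      show "cox D i j = 4" using ij 3
        by (intro dvd_numerals) (auto simp: cox_dvd_iff S intro!: wmat_1_lc[of i j] wmat_not_1_lc[of _ i j])
    qed simp
  next
    case 4
    show ?thesis
    proof (rule *[of 4], intro conjI)
      show "rank2_facts i j 4"
        by (rule rank2_factsI) (use ij 4 in \<open>auto simp: S dest!: Suc_bounds\<close>)
      show "cox D i j = 4" using ij 4
        by (intro dvd_numerals) (auto simp: cox_dvd_iff S intro!: wmat_1_lc[of i j] wmat_not_1_lc[of _ i j])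
    qed simp
  next
    case 5
    show ?thesis
    proof (rule *[of 6], intro conjI)
      show "rank2_facts i j 6"
        by (rule rank2_factsI) (use ij 5 in \<open>auto simp: S dest!: Suc_bounds\<close>)
      show "cox D i j = 6" using ij 5
        by (intro dvd_numerals) (auto simp: cox_dvd_iff S intro!: wmat_1_lc[of i j] wmat_not_1_lc[of _ i j])
    qed simp
  next
    case 6
    show ?thesis
    proof (rule *[of 6], intro conjI)
      show "rank2_facts i j 6"
        by (rule rank2_factsI) (use ij 6 in \<open>auto simp: S dest!: Suc_bounds\<close>)
      show "cox D i j = 6" using ij 6
        by (intro dvd_numerals) (auto simp: cox_dvd_iff S intro!: wmat_1_lc[of i j] wmat_not_1_lc[of _ i j])
    qed simp
  qed
qed

section \<open>Positive coroots and lengths\<close>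

definition cone :: "int vec set" where
  "cone = {x \<in> carrier_vec n. \<exists>c. (\<forall>i\<in>I. 0 \<le> c i) \<and> (\<forall>k<n. x $ k = (\<Sum>i\<in>I. c i * cr i $ k))}"

lemma cone_carrier: "x \<in> cone \<Longrightarrow> x \<in> carrier_vec n"
  by (simp add: cone_def)

lemma coneI: "x \<in> carrier_vec n \<Longrightarrow> (\<And>i. i \<in> I \<Longrightarrow> 0 \<le> c i) \<Longrightarrow> (\<And>k. k < n \<Longrightarrow> x $ k = (\<Sum>i\<in>I. c i * cr i $ k)) \<Longrightarrow> x \<in> cone"
  unfolding cone_def mem_Collect_eq by (intro conjI exI[of _ c]) simp_all

lemma cone_sum:
  assumes J: "finite J" "\<And>j. j \<in> J \<Longrightarrow> f j \<in> cone" "\<And>j. j \<in> J \<Longrightarrow> (0::int) \<le> c j"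
    and z: "z \<in> carrier_vec n" "\<And>k. k < n \<Longrightarrow> z $ k = (\<Sum>j\<in>J. c j * f j $ k)"
  shows "z \<in> cone"
proof -
  have "\<forall>j\<in>J. \<exists>d. (\<forall>i\<in>I. 0 \<le> d i) \<and> (\<forall>k<n. f j $ k = (\<Sum>i\<in>I. d i * cr i $ k))"
    using J by (simp add: cone_def)
  then obtain d where d: "\<And>j. j \<in> J \<Longrightarrow> (\<forall>i\<in>I. 0 \<le> d j i) \<and> (\<forall>k<n. f j $ k = (\<Sum>i\<in>I. d j i * cr i $ k))"
    by metis
  have "z $ k = (\<Sum>i\<in>I. (\<Sum>j\<in>J. c j * d j i) * cr i $ k)" if "k < n" for k
  proof -
    have "z $ k = (\<Sum>j\<in>J. \<Sum>i\<in>I. c j * d j i * cr i $ k)"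
      using z(2)[OF that] d that by (simp add: sum_distrib_left mult.assoc)
    also have "\<dots> = (\<Sum>i\<in>I. \<Sum>j\<in>J. c j * d j i * cr i $ k)" by (rule sum.swap)
    finally show ?thesis by (simp add: sum_distrib_right)
  qed
  moreover have "0 \<le> (\<Sum>j\<in>J. c j * d j i)" if "i \<in> I" for i using d J that by (intro sum_nonneg mult_nonneg_nonneg) auto
  ultimately show ?thesis by (intro coneI z(1))
qed

lemma cone_cr: assumes "i \<in> I" shows "cr i \<in> cone"
proof -
  have "cr i $ k = (\<Sum>j\<in>I. (if j = i then 1 else 0) * cr j $ k)" for k
    using assms finite_I by (simp add: if_distrib[of "\<lambda>a. a * _"] cong: if_cong)
  then show ?thesis using assms by (intro coneI[of _ "\<lambda>j. if j = i then 1 else 0"]) simp_all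
qed

lemma cone_comb: assumes "x \<in> cone" "y \<in> cone" "0 \<le> p" "0 \<le> q" shows "p \<cdot>\<^sub>v x + q \<cdot>\<^sub>v y \<in> cone"
proof (rule cone_sum[of "UNIV :: bool set" "\<lambda>b. if b then x else y" "\<lambda>b. if b then p else q"])
  show "p \<cdot>\<^sub>v x + q \<cdot>\<^sub>v y \<in> carrier_vec n" using assms cone_carrier by auto
qed (use assms cone_carrier[of x] cone_carrier[of y] in \<open>auto simp: UNIV_bool\<close>)

lemma cone_pointed: assumes "x \<in> cone" "- x \<in> cone" shows "x = 0\<^sub>v n"
proof -
  obtain c where c: "\<forall>i\<in>I. 0 \<le> c i" "\<forall>k<n. x $ k = (\<Sum>i\<in>I. c i * cr i $ k)" using assms by (auto simp: cone_def)
  obtain d where d: "\<forall>i\<in>I. 0 \<le> d i" "\<forall>k<n. (-x) $ k = (\<Sum>i\<in>I. d i * cr i $ k)" using assms by (auto simp: cone_def)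
  have x: "x \<in> carrier_vec n" using assms cone_carrier by auto
  have "(\<Sum>i\<in>I. (c i + d i) * cr i $ k) = 0" if "k < n" for k
  proof -
    have "(\<Sum>i\<in>I. (c i + d i) * cr i $ k) = x $ k + (-x) $ k" using c d that by (simp add: algebra_simps sum.distrib)
    then show ?thesis using x that by simp
  qed
  then have cd: "c i + d i = 0" if "i \<in> I" for i using cr_indep[of "\<lambda>i. c i + d i"] that by blast
  have "c i = 0" if "i \<in> I" for i using cd[OF that] c(1) d(1) that by (smt (verit))
  then show ?thesis using x c(2) by (intro eq_vecI) auto
qed

lemma lc_0_comb: "i \<in> I \<Longrightarrow> j \<in> I \<Longrightarrow> lc i j (0\<^sub>v n) p q = p \<cdot>\<^sub>v cr i + q \<cdot>\<^sub>v cr j"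
  by (rule eq_vecI) (auto simp: lc_def)

lemma W_inj_vec: assumes w: "w \<in> W" and x: "x \<in> carrier_vec n" "w *\<^sub>v x = 0\<^sub>v n" shows "x = 0\<^sub>v n"
proof -
  obtain u where u: "u \<in> lists I" "w = wmat u" using w by (auto simp: W_eq)
  have "x = wmat (rev u) *\<^sub>v (w *\<^sub>v x)" using u x(1) by (simp add: sq_act[symmetric] wmat_rev_inv)
  also have "\<dots> = wmat (rev u) *\<^sub>v (0 \<cdot>\<^sub>v x)"
    using x by (intro arg_cong2[of _ _ _ _ "(*\<^sub>v)"] refl eq_vecI) auto
  also have "\<dots> = 0\<^sub>v n" using x by (subst act_smult) auto
  finally show ?thesis .
qed

lemma act_minus: "A \<in> carrier_mat n n \<Longrightarrow> x \<in> carrier_vec n \<Longrightarrow> A *\<^sub>v (- x) = - (A *\<^sub>v x)" for A :: "int mat"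
proof -
  assume A: "A \<in> carrier_mat n n" "x \<in> carrier_vec n"
  have "- x = (-1) \<cdot>\<^sub>v x" "- (A *\<^sub>v x) = (-1) \<cdot>\<^sub>v (A *\<^sub>v x)" by (auto intro: eq_vecI)
  then show ?thesis using act_smult[OF A] by simp
qed

lemma alt_word_lists [simp]: "i \<in> I \<Longrightarrow> j \<in> I \<Longrightarrow> alt_word k i j \<in> lists I"
  by (induction k arbitrary: i j) auto

lemma rev_lists [simp]: "rev u \<in> lists I \<longleftrightarrow> u \<in> lists I"
  by (auto simp: lists_eq_set)

lemma length_alt_word [simp]: "length (alt_word k i j) = k"
  by (induction k arbitrary: i j) auto

lemma alt_word_add: "alt_word (a + b) i j = alt_word a i j @ (if even a then alt_word b i j else alt_word b j i)"
  by (induction a arbitrary: i j) auto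

lemma alt_word_Suc_right: "alt_word (Suc a) i j = alt_word a i j @ [if even a then i else j]"
  using alt_word_add[of a 1 i j] by auto

lemma rev_alt_word: "rev (alt_word a i j) = (if even a then alt_word a j i else alt_word a i j)"
proof (induction a arbitrary: i j)
  case (Suc a)
  have "rev (alt_word (Suc a) i j) = rev (alt_word a j i) @ [i]" by simp
  then show ?case using Suc[of j i] alt_word_Suc_right[of a i j] alt_word_Suc_right[of a j i]
    by (auto simp del: alt_word.simps(2))
qed simp

lemma s_involution_word: assumes u: "u \<in> lists I" "v \<in> lists I" "wmat u = wmat v" shows "wmat (rev u) = wmat (rev v)"
  using inv_GL_wmat[OF u(1)] inv_GL_wmat[OF u(2)] u(3) by simp

text \<open>Split off from \<open>w\<close> a suffix in the two letters that is as long as possible. By maximality neither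
  letter shortens what remains, which is thus minimal in its coset of the dihedral subgroup.\<close>

lemma alt_suffix:
  assumes w: "w \<in> W" and ij: "i \<in> I" "j \<in> I" "i \<noteq> j" and d: "len (w * s j) < len w"
  obtains k v where "v \<in> W" "w = v * wmat (rev (alt_word k j i))" "len v + k = len w" "k \<ge> 1"
    "len v \<le> len (v * s i)" "len v \<le> len (v * s j)"
proof -
  define K where "K = (\<lambda>k. \<exists>v\<in>W. w = v * wmat (rev (alt_word k j i)) \<and> len v + k = len w)"
  have K1: "K 1" unfolding K_def
  proof (intro bexI conjI)
    show ws: "w * s j \<in> W" using w ij W_mult W_s by auto
    show "w = (w * s j) * wmat (rev (alt_word 1 j i))" using w ij mult_s_s by simp
    show "len (w * s j) + 1 = len w" using d len_mult_s_ge[OF w ij(2)] by linarith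
  qed
  have bd: "\<forall>k. K k \<longrightarrow> k \<le> len w" unfolding K_def by auto
  define k where "k = (GREATEST k. K k)"
  have k: "K k" and kmax: "\<And>l. K l \<Longrightarrow> l \<le> k"
    unfolding k_def using GreatestI_nat[of K, OF K1] Greatest_le_nat[of K] bd by blast+
  obtain v where v: "v \<in> W" "w = v * wmat (rev (alt_word k j i))" "len v + k = len w" using k by (auto simp: K_def)
  have k1: "k \<ge> 1" using kmax[OF K1] .
  \<comment> \<open>The letter \<open>f\<close> begins the suffix, as a word read from left to right, and \<open>e\<close> is the one that could extend it.\<close>
  define e where "e = (if even k then j else i)"
  define f where "f = (if even k then i else j)"
  have ef: "e \<in> I" "f \<in> I" "{e, f} = {i, j}" using ij by (auto simp: e_def f_def)
  have e: "len v \<le> len (v * s e)"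
  proof (rule ccontr)
    assume "\<not> ?thesis"
    then have l: "len (v * s e) + 1 = len v" using len_mult_s_ge[OF v(1) ef(1)] by linarith
    have "K (Suc k)" unfolding K_def
    proof (intro bexI conjI)
      show "v * s e \<in> W" using v ef W_mult W_s by auto
      have "(v * s e) * wmat (rev (alt_word (Suc k) j i)) = (v * s e * s e) * wmat (rev (alt_word k j i))"
        using W_carrier[OF v(1)] unfolding alt_word_Suc_right e_def by (simp add: wmat_Cons sq_assoc)
      then show "w = (v * s e) * wmat (rev (alt_word (Suc k) j i))" using v ef mult_s_s by simp
      show "len (v * s e) + Suc k = len w" using l v by simp
    qed
    then show False using kmax by fastforce
  qed
  have f: "len v \<le> len (v * s f)"
  proof (rule ccontr)
    assume l: "\<not> ?thesis"
    obtain k' where k': "k = Suc k'" using k1 by (cases k) auto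
    have "f = (if even k' then j else i)" by (simp add: f_def k')
    then have "w = (v * s f) * wmat (rev (alt_word k' j i))"
      using v(2) W_carrier[OF v(1)] unfolding k' alt_word_Suc_right by (simp add: wmat_Cons sq_assoc)
    moreover have "len (wmat (rev (alt_word k' j i))) \<le> k'" using len_le[of "rev (alt_word k' j i)"] ij by simp
    ultimately have "len w \<le> len (v * s f) + k'"
      using len_mult[of "v * s f" "wmat (rev (alt_word k' j i))"] v ef W_mult W_s wmat_in_W[of "rev (alt_word k' j i)"] ij by force
    then show False using l v(3) k' by simp
  qed
  have "len v \<le> len (v * s i)" "len v \<le> len (v * s j)" using e f ef(3) by (metis doubleton_eq_iff)+
  then show ?thesis using that v k1 by blast
qed

text \<open>The dihedral part sends \<open>cr i\<close> to a nonnegative combination of \<open>cr i\<close> and \<open>cr j\<close>, and \<open>v\<close> keeps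
  both of them in the cone.\<close>

lemma rank2_cone:
  assumes v: "v \<in> W" and ij: "i \<in> I" "j \<in> I" "i \<noteq> j" and k: "k < cox D i j"
   and c: "v *\<^sub>v cr i \<in> cone" "v *\<^sub>v cr j \<in> cone"
  shows "(v * wmat (rev (alt_word k j i))) *\<^sub>v cr i \<in> cone"
proof -
  obtain p q where pq: "p \<ge> 0" "q \<ge> 0" "wmat (rev (alt_word k j i)) *\<^sub>v cr i = lc i j (0\<^sub>v n) p q"
    using rank2[OF ij] k unfolding rank2_facts_def by blast
  have "(v * wmat (rev (alt_word k j i))) *\<^sub>v cr i = v *\<^sub>v (p \<cdot>\<^sub>v cr i + q \<cdot>\<^sub>v cr j)"
    using W_carrier[OF v] ij pq by (simp add: sq_act lc_0_comb)
  also have "\<dots> = p \<cdot>\<^sub>v (v *\<^sub>v cr i) + q \<cdot>\<^sub>v (v *\<^sub>v cr j)"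
    using W_carrier[OF v] ij by (subst mult_add_distrib_mat_vec[of _ n n]) (auto simp: act_smult)
  also have "\<dots> \<in> cone" using cone_comb c pq by blast
  finally show ?thesis .
qed

text \<open>The point is that the length stays additive: the last \<open>m\<close> letters of a longer dihedral suffix form
  an alternating word of length exactly \<open>m\<close>, to which a braid relation applies.\<close>

lemma rank2_absorb:
  assumes v: "v \<in> W" and ij: "i \<in> I" "j \<in> I" and k: "k \<ge> m"
    and l: "len (v * wmat (rev (alt_word k j i))) = len v + k"
  obtains v' where "v' \<in> W" "v * wmat (rev (alt_word k j i)) = v' * wmat (rev (alt_word m j i))"
    "len v' + m = len (v * wmat (rev (alt_word k j i)))"
proof -
  obtain b where b: "k = m + b" using k le_Suc_ex by blast
  define r where "r = rev (if even m then alt_word b j i else alt_word b i j)"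
  have r: "r \<in> lists I" "length r = b" using ij by (auto simp: r_def)
  have e: "v * wmat (rev (alt_word k j i)) = (v * wmat r) * wmat (rev (alt_word m j i))"
    using W_carrier[OF v] by (simp add: b alt_word_add r_def wmat_append sq_assoc)
  have vr: "v * wmat r \<in> W" using v r wmat_in_W W_mult by blast
  have "len (v * wmat r) \<le> len v + b" using len_mult[OF v wmat_in_W[OF r(1)]] len_le[OF r(1)] r(2) by linarith
  moreover have "len ((v * wmat r) * wmat (rev (alt_word m j i))) \<le> len (v * wmat r) + m"
    using len_mult[OF vr wmat_in_W[of "rev (alt_word m j i)"]] len_le[of "rev (alt_word m j i)"] ij by simp
  ultimately have "len (v * wmat r) + m = len (v * wmat (rev (alt_word k j i)))" using l b e by simp
  then show ?thesis using that vr e by blast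
qed

lemma wmat_rev_alt: "i \<in> I \<Longrightarrow> j \<in> I \<Longrightarrow> i \<noteq> j \<Longrightarrow>
    wmat (rev (alt_word (cox D i j) j i)) = wmat (rev (alt_word (cox D i j) i j))"
  using rank2[of i j] by (intro s_involution_word) (auto simp: rank2_facts_def)

text \<open>The sign lemma. A nontrivial \<open>w\<close> is shortened by some letter \<open>j\<close>, different from \<open>i\<close>. Split off a
  maximal suffix in \<open>i\<close> and \<open>j\<close>; the remaining factor \<open>v\<close> is shorter and is shortened by neither
  letter, so the induction hypothesis applies to it for both coroots. The suffix is too short to
  contain a full alternating word: that word could be rewritten to end in \<open>i\<close>, and then \<open>i\<close>
  would shorten \<open>w\<close>. What is left is the computation in the dihedral subgroup.\<close>

lemma coroot_pos:
  assumes "w \<in> W" "i \<in> I" "len w \<le> len (w * s i)"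
  shows "w *\<^sub>v cr i \<in> cone"
  using assms
proof (induction "len w" arbitrary: w i rule: less_induct)
  case less
  note w = less.prems(1) and i = less.prems(2)
  show ?case
  proof (cases "len w = 0")
    case True
    then show ?thesis using len_0[OF w] i cone_cr by simp
  next
    case False
    obtain u where u: "u \<in> lists I" "wmat u = w" "length u = len w" using reduced_word_exists[OF w] by metis
    then obtain u' j where uj: "u = u' @ [j]" using False by (metis length_0_conv rev_exhaust)
    have j: "j \<in> I" "u' \<in> lists I" using u uj by auto
    have "w * s j = wmat u'" using u(2) uj mult_s_s[OF wmat_in_W[OF j(2)] j(1)] by (simp add: wmat_snoc)
    then have d: "len (w * s j) < len w" using len_le[OF j(2)] u(3) uj by simp
    then have ne: "i \<noteq> j" using less.prems(3) by auto
    obtain k v where v: "v \<in> W" "w = v * wmat (rev (alt_word k j i))" "len v + k = len w" "k \<ge> 1"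
      "len v \<le> len (v * s i)" "len v \<le> len (v * s j)" using alt_suffix[OF w i j(1) ne d] by metis
    have "k < cox D i j"
    proof (rule ccontr)
      define m where "m = cox D i j"
      have m2: "m \<ge> 2" using rank2[OF i j(1) ne] by (simp add: m_def)
      assume "\<not> k < cox D i j"
      then obtain v' where v': "v' \<in> W" "w = v' * wmat (rev (alt_word m j i))" "len v' + m = len w"
        using rank2_absorb[OF v(1) i j(1), of m k] v by (auto simp: m_def)
      obtain m' where m': "m = Suc m'" using m2 by (cases m) auto
      have "w = v' * wmat (rev (alt_word m i j))" using v'(2) wmat_rev_alt[OF i j(1) ne] by (simp add: m_def)
      then have "w = (v' * wmat (rev (alt_word m' j i))) * s i"
        using W_carrier[OF v'(1)] by (simp add: m' wmat_append sq_assoc)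
      \<comment> \<open>After the braid relation the suffix ends in \<open>i\<close>, so that \<open>i\<close> shortens \<open>w\<close>.\<close>
      then have "w * s i = v' * wmat (rev (alt_word m' j i))"
        using mult_s_s[of "v' * wmat (rev (alt_word m' j i))" i] W_mult[OF v'(1) wmat_in_W] i j by simp
      moreover have "len (v' * wmat (rev (alt_word m' j i))) \<le> len v' + m'"
        using len_mult[OF v'(1) wmat_in_W[of "rev (alt_word m' j i)"]] len_le[of "rev (alt_word m' j i)"] i j by simp
      ultimately show False using less.prems(3) v'(3) m' by simp
    qed
    moreover have "v *\<^sub>v cr i \<in> cone" "v *\<^sub>v cr j \<in> cone"
      using less.hyps[of v i] less.hyps[of v j] v i j by auto
    ultimately show ?thesis using rank2_cone[OF v(1) i j(1) ne] v(2) by simp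
  qed
qed

lemma act_s_cr: "w \<in> W \<Longrightarrow> i \<in> I \<Longrightarrow> (w * s i) *\<^sub>v cr i = - (w *\<^sub>v cr i)"
  using W_carrier[of w] by (simp add: sq_act s_cr act_minus)

lemma coroot_neg:
  assumes w: "w \<in> W" and i: "i \<in> I" "len (w * s i) \<le> len w"
  shows "- (w *\<^sub>v cr i) \<in> cone"
  using coroot_pos[of "w * s i" i] mult_s_s[OF w i(1)] W_mult[OF w W_s[OF i(1)]] i act_s_cr[OF w i(1)] by simp

lemma coroot_not_both: "w \<in> W \<Longrightarrow> i \<in> I \<Longrightarrow> w *\<^sub>v cr i \<in> cone \<Longrightarrow> - (w *\<^sub>v cr i) \<in> cone \<Longrightarrow> False"
  using cone_pointed[of "w *\<^sub>v cr i"] W_inj_vec[of w "cr i"] cr_nonzero[of i] cr_carrier[of i] by blast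

lemma len_mult_s_cases: "w \<in> W \<Longrightarrow> i \<in> I \<Longrightarrow> len (w * s i) = len w + 1 \<or> len (w * s i) + 1 = len w"
  using coroot_pos[of w i] coroot_neg[of w i] coroot_not_both[of w i] len_mult_s_le[of w i] len_mult_s_ge[of w i]
  by (cases "len w = len (w * s i)") auto

lemma coroot_pos_iff: assumes "w \<in> W" "i \<in> I" shows "w *\<^sub>v cr i \<in> cone \<longleftrightarrow> len (w * s i) = len w + 1"
proof
  assume "w *\<^sub>v cr i \<in> cone"
  then have "\<not> len (w * s i) \<le> len w" using coroot_neg coroot_not_both assms by blast
  then show "len (w * s i) = len w + 1" using len_mult_s_cases[OF assms] by linarith
qed (use coroot_pos[OF assms] in simp)

lemma coroot_neg_iff: assumes "w \<in> W" "i \<in> I" shows "- (w *\<^sub>v cr i) \<in> cone \<longleftrightarrow> len (w * s i) + 1 = len w"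
proof
  assume "- (w *\<^sub>v cr i) \<in> cone"
  then have "\<not> len w \<le> len (w * s i)" using coroot_pos coroot_not_both assms by blast
  then show "len (w * s i) + 1 = len w" using len_mult_s_cases[OF assms] by linarith
qed (use coroot_neg[OF assms] in simp)

section \<open>Reduced words\<close>

definition reduced :: "'i list \<Rightarrow> bool" where
  "reduced u \<longleftrightarrow> u \<in> lists I \<and> len (wmat u) = length u"

lemma reduced_appendD: assumes "reduced (u @ v)" shows "reduced u" "reduced v"
proof -
  have uv: "u \<in> lists I" "v \<in> lists I" using assms by (auto simp: reduced_def)
  have "length u + length v \<le> len (wmat u) + len (wmat v)"
    using assms len_mult[OF wmat_in_W[OF uv(1)] wmat_in_W[OF uv(2)]] by (simp add: reduced_def wmat_append)
  then show "reduced u" "reduced v" using uv len_le[OF uv(1)] len_le[OF uv(2)] by (auto simp: reduced_def)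
qed

lemma wmat_snoc_cancel: "u \<in> lists I \<Longrightarrow> v \<in> lists I \<Longrightarrow> i \<in> I \<Longrightarrow> wmat (u @ [i]) = wmat (v @ [i]) \<Longrightarrow> wmat u = wmat v"
  by (metis mult_s_s wmat_in_W wmat_snoc)

text \<open>Let \<open>u\<close> and \<open>v\<close> end in different letters \<open>i\<close> and \<open>j\<close>. Both letters shorten the group element, so
  by the sign lemma it has reduced words ending in the two full alternating words in \<open>i\<close> and \<open>j\<close>.
  One of these shares its last letter with \<open>u\<close>, the other with \<open>v\<close>, and one braid move connects
  them. The fixed tail \<open>b\<close> is there for the induction, which moves shared last letters into it.\<close>

lemma matsumoto:
  assumes braid: "\<And>a b i j. a \<in> lists I \<Longrightarrow> b \<in> lists I \<Longrightarrow> i \<in> I \<Longrightarrow> j \<in> I \<Longrightarrow> i \<noteq> j \<Longrightarrow>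
     P (a @ alt_word (cox D i j) i j @ b) = P (a @ alt_word (cox D i j) j i @ b)"
   and "reduced u" "reduced v" "wmat u = wmat v" "b \<in> lists I"
  shows "P (u @ b) = P (v @ b)"
  using assms(2-)
proof (induction "length u" arbitrary: u v b rule: less_induct)
  case less
  have lv: "length v = length u" using less.prems by (simp add: reduced_def)
  show ?case
  proof (cases u rule: rev_cases)
    case Nil
    then show ?thesis using lv by simp
  next
    case (snoc u' i)
    then obtain v' j where vj: "v = v' @ [j]" using lv by (metis length_0_conv rev_exhaust snoc_eq_iff_butlast)
    have red: "reduced u'" "reduced v'" using less.prems(1,2) snoc vj reduced_appendD by blast+
    have I: "u' \<in> lists I" "v' \<in> lists I" "i \<in> I" "j \<in> I" using less.prems(1,2) snoc vj by (auto simp: reduced_def)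
    define w where "w = wmat u"
    have w: "w \<in> W" using less.prems(1) by (simp add: w_def wmat_in_W reduced_def)
    have lw: "len w = length u" using less.prems(1) by (simp add: w_def reduced_def)
    have IH: "P (x @ [l] @ b) = P (y @ [l] @ b)"
      if "x \<in> lists I" "y \<in> lists I" "l \<in> I" "wmat (x @ [l]) = wmat (y @ [l])" "reduced x" "reduced y" "length x < length u" for x y l
      using less.hyps[of x y "[l] @ b"] that less.prems(4) wmat_snoc_cancel[OF that(1-4)] by simp
    show ?thesis
    proof (cases "i = j")
      case True
      then show ?thesis using IH[of u' v' i] I red less.prems(3) snoc vj by simp
    next
      case False
      have "w * s i = wmat u'" using mult_s_s[OF wmat_in_W[OF I(1)] I(3)] by (simp add: w_def snoc wmat_snoc)
      then have di: "len (w * s i) + 1 = len w" using red lw snoc by (simp add: reduced_def)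
      have "w * s j = wmat v'" using mult_s_s[OF wmat_in_W[OF I(2)] I(4)] less.prems(3) by (simp add: w_def vj wmat_snoc)
      then have dj: "len (w * s j) + 1 = len w" using red lw lv vj by (simp add: reduced_def)
      define m where "m = cox D i j"
      have m2: "m \<ge> 2" using rank2[OF I(3,4) False] by (simp add: m_def)
      then obtain m' where m': "m = Suc m'" by (cases m) auto
      obtain k x where x: "x \<in> W" "w = x * wmat (rev (alt_word k j i))" "len x + k = len w" "k \<ge> 1"
        "len x \<le> len (x * s i)" "len x \<le> len (x * s j)"
      proof (rule alt_suffix[OF w I(3,4) False])
        show "len (w * s j) < len w" using dj by simp
      qed
      have "\<not> k < m"
      proof
        assume "k < m"
        then have "w *\<^sub>v cr i \<in> cone" unfolding x(2) m_def using x I coroot_pos by (intro rank2_cone False) auto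
        then show False using coroot_pos_iff[OF w I(3)] di by simp
      qed
      then obtain y where y: "y \<in> W" "w = y * wmat (rev (alt_word m j i))" "len y + m = len w"
        using rank2_absorb[OF x(1) I(3,4), of m k] x by auto
      obtain r where r: "r \<in> lists I" "wmat r = y" "length r = len y" using reduced_word_exists[OF y(1)] by metis
      have e: "wmat (r @ rev (alt_word m j i)) = w" "wmat (r @ rev (alt_word m i j)) = w"
        using y r wmat_rev_alt[OF I(3,4) False] by (auto simp: wmat_append m_def)
      have rr: "reduced (r @ rev (alt_word m j i))" "reduced (r @ rev (alt_word m i j))"
        unfolding reduced_def e using r y I by auto
      have "P (u' @ [i] @ b) = P ((r @ rev (alt_word m' j i)) @ [i] @ b)"
      proof (rule IH)
        show "reduced (r @ rev (alt_word m' j i))" using rr(2) reduced_appendD(1)[of "r @ rev (alt_word m' j i)" "[i]"] by (simp add: m')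
        show "wmat (u' @ [i]) = wmat ((r @ rev (alt_word m' j i)) @ [i])" using e(2) snoc w_def by (simp add: m')
      qed (use I r red snoc in auto)
      then have 1: "P (u @ b) = P (r @ rev (alt_word m i j) @ b)" by (simp add: snoc m')
      have "P (v' @ [j] @ b) = P ((r @ rev (alt_word m' i j)) @ [j] @ b)"
      proof (rule IH)
        show "reduced (r @ rev (alt_word m' i j))" using rr(1) reduced_appendD(1)[of "r @ rev (alt_word m' i j)" "[j]"] by (simp add: m')
        show "wmat (v' @ [j]) = wmat ((r @ rev (alt_word m' i j)) @ [j])" using e(1) less.prems(3) vj w_def by (simp add: m')
      qed (use I r red vj lv in auto)
      then have 2: "P (v @ b) = P (r @ rev (alt_word m j i) @ b)" by (simp add: vj m')
      have "P (r @ alt_word m i j @ b) = P (r @ alt_word m j i @ b)"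
        unfolding m_def using braid r less.prems(4) I False by blast
      then have "P (r @ rev (alt_word m i j) @ b) = P (r @ rev (alt_word m j i) @ b)"
        by (simp add: rev_alt_word)
      then show ?thesis using 1 2 by simp
    qed
  qed
qed

text \<open>If \<open>u\<close> is reduced and \<open>u @ [i]\<close> is not, then \<open>i\<close> shortens \<open>wmat u\<close>, which therefore has a reduced
  word ending in \<open>i\<close>. Replacing \<open>u\<close> by it produces the square \<open>i i\<close>.\<close>

lemma nonreduced_zero:
  assumes braid: "\<And>a b i j. a \<in> lists I \<Longrightarrow> b \<in> lists I \<Longrightarrow> i \<in> I \<Longrightarrow> j \<in> I \<Longrightarrow> i \<noteq> j \<Longrightarrow>
     P (a @ alt_word (cox D i j) i j @ b) = P (a @ alt_word (cox D i j) j i @ b)"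
   and sq: "\<And>a b i. a \<in> lists I \<Longrightarrow> b \<in> lists I \<Longrightarrow> i \<in> I \<Longrightarrow> P (a @ [i, i] @ b) = z"
   and "u \<in> lists I" "\<not> reduced u" "b \<in> lists I"
  shows "P (u @ b) = z"
  using assms(3-)
proof (induction u arbitrary: b rule: rev_induct)
  case Nil
  then show ?case by (simp add: reduced_def)
next
  case (snoc i u)
  have I: "u \<in> lists I" "i \<in> I" using snoc.prems by auto
  show ?case
  proof (cases "reduced u")
    case False
    then show ?thesis using snoc.IH[of "i # b"] I snoc.prems(3) by simp
  next
    case True
    define w where "w = wmat u"
    have w: "w \<in> W" using I by (simp add: w_def wmat_in_W)
    have "len (w * s i) \<noteq> len w + 1" using snoc.prems(2) True I by (auto simp: reduced_def w_def wmat_snoc)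
    then have l: "len (w * s i) + 1 = len w" using len_mult_s_cases[OF w I(2)] by simp
    obtain r where r: "r \<in> lists I" "wmat r = w * s i" "length r = len (w * s i)"
      using reduced_word_exists[OF W_mult[OF w W_s[OF I(2)]]] by metis
    have e: "wmat (r @ [i]) = w" using r mult_s_s[OF w I(2)] by (simp add: wmat_snoc)
    then have "reduced (r @ [i])" using r l I by (auto simp: reduced_def)
    then have "P (u @ i # b) = P ((r @ [i]) @ i # b)"
      using matsumoto[of P, OF braid True, of "r @ [i]" "i # b"] e snoc.prems(3) I by (simp add: w_def)
    also have "\<dots> = z" using sq[of r b i] r snoc.prems(3) I by simp
    finally show ?thesis by simp
  qed
qed

section \<open>The longest element\<close>

lemma cone_map_neg:
  assumes A: "A \<in> carrier_mat n n" and x: "x \<in> cone" and c: "\<And>j. j \<in> I \<Longrightarrow> - (A *\<^sub>v cr j) \<in> cone"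
  shows "- (A *\<^sub>v x) \<in> cone"
proof -
  obtain d where d: "\<And>i. i \<in> I \<Longrightarrow> 0 \<le> d i" "\<And>k. k < n \<Longrightarrow> x $ k = (\<Sum>i\<in>I. d i * cr i $ k)" using x by (auto simp: cone_def)
  show ?thesis
  proof (rule cone_sum[OF finite_I c d(1)])
    fix k assume k: "k < n"
    have "(A *\<^sub>v x) $ k = (\<Sum>l\<in>{0..<n}. A $$ (k, l) * x $ l)" using A k cone_carrier[OF x] by (simp add: scalar_prod_def)
    also have "\<dots> = (\<Sum>l\<in>{0..<n}. \<Sum>i\<in>I. A $$ (k, l) * (d i * cr i $ l))" using d(2) by (simp add: sum_distrib_left)
    also have "\<dots> = (\<Sum>i\<in>I. \<Sum>l\<in>{0..<n}. A $$ (k, l) * (d i * cr i $ l))" by (rule sum.swap)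
    also have "\<dots> = (\<Sum>i\<in>I. d i * (A *\<^sub>v cr i) $ k)"
      using A k by (intro sum.cong refl) (simp add: scalar_prod_def sum_distrib_left algebra_simps)
    finally show "(- (A *\<^sub>v x)) $ k = (\<Sum>i\<in>I. d i * (- (A *\<^sub>v cr i)) $ k)"
      using A k by (simp add: sum_negf del: index_mult_mat_vec)
  qed (use A cone_carrier[OF x] in auto)
qed

definition w0 :: "int mat" where
  "w0 = (SOME w. w \<in> W \<and> (\<forall>v\<in>W. len v \<le> len w))"

lemma one_W: "1\<^sub>m n \<in> W"
  using wmat_in_W[of "[]"] by simp

lemma w0: "w0 \<in> W" and len_le_w0: "v \<in> W \<Longrightarrow> len v \<le> len w0"
proof -
  have "finite (len ` W)" "len ` W \<noteq> {}" using finite_W one_W by auto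
  then have "Max (len ` W) \<in> len ` W" by (rule Max_in)
  then obtain w where "w \<in> W" "len w = Max (len ` W)" by auto
  then have "w \<in> W \<and> (\<forall>v\<in>W. len v \<le> len w)" using finite_W by simp
  then have "w0 \<in> W \<and> (\<forall>v\<in>W. len v \<le> len w0)" unfolding w0_def by (rule someI)
  then show "w0 \<in> W" "v \<in> W \<Longrightarrow> len v \<le> len w0" by auto
qed

text \<open>The longest element makes every simple coroot negative. A letter \<open>j\<close> that lengthens \<open>v'\<close> has
  \<open>v' *\<^sub>v cr j\<close> in the cone, so \<open>w0 * v'\<close> sends \<open>cr j\<close> to the negative cone and is shortened by \<open>j\<close>.\<close>

lemma len_w0_mult: assumes "v \<in> W" shows "len (w0 * v) + len v = len w0"
  using assms
proof (induction "len v" arbitrary: v)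
  case 0
  then show ?case using len_0[of v] W_carrier[OF w0] by auto
next
  case (Suc l)
  obtain u where u: "u \<in> lists I" "wmat u = v" "length u = len v" using reduced_word_exists[OF Suc.prems] by metis
  then obtain u' j where uj: "u = u' @ [j]" using Suc.hyps(2) by (metis length_0_conv rev_exhaust nat.distinct(1))
  define v' where "v' = wmat u'"
  have j: "j \<in> I" "u' \<in> lists I" using u uj by auto
  have v': "v' \<in> W" "v = v' * s j" using u uj j by (auto simp: v'_def wmat_in_W wmat_snoc)
  have "len v' \<le> l" using len_le[OF j(2)] u Suc.hyps(2) uj by (simp add: v'_def)
  then have lv: "len v' = l" "len (v' * s j) = len v' + 1" using len_mult_s_le[OF v'(1) j(1)] Suc.hyps(2) v'(2) by auto
  then have IH: "len (w0 * v') + len v' = len w0" using Suc.hyps(1)[of v'] v' by simp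
  have "v' *\<^sub>v cr j \<in> cone" using coroot_pos_iff[OF v'(1) j(1)] lv by simp
  moreover have "- (w0 *\<^sub>v cr i) \<in> cone" if "i \<in> I" for i
    using coroot_neg[OF w0 that] len_le_w0[OF W_mult[OF w0 W_s[OF that]]] by simp
  ultimately have "- (w0 *\<^sub>v (v' *\<^sub>v cr j)) \<in> cone" using cone_map_neg[OF W_carrier[OF w0]] by blast
  then have "- ((w0 * v') *\<^sub>v cr j) \<in> cone" using W_carrier[OF w0] W_carrier[OF v'(1)] j by (simp add: sq_act)
  then have "len ((w0 * v') * s j) + 1 = len (w0 * v')" using coroot_neg_iff[OF W_mult[OF w0 v'(1)] j(1)] by simp
  moreover have "(w0 * v') * s j = w0 * v" using v' W_carrier[OF w0] W_carrier[OF v'(1)] by (simp add: sq_assoc)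
  ultimately show ?case using IH lv v' by simp
qed

lemma w0_w0: "w0 * w0 = 1\<^sub>m n"
  using len_w0_mult[OF w0] len_0[OF W_mult[OF w0 w0]] by simp

lemma w0_unique: assumes v: "v \<in> W" "len v = len w0" shows "v = w0"
proof -
  have "w0 * v = 1\<^sub>m n" using len_w0_mult[OF v(1)] v len_0[OF W_mult[OF w0 v(1)]] by simp
  then have "w0 * (w0 * v) = w0" using W_carrier[OF w0] by simp
  moreover have "w0 * (w0 * v) = v" using W_carrier[OF w0] W_carrier[OF v(1)] w0_w0 by (simp flip: sq_assoc)
  ultimately show ?thesis by simp
qed

lemma complement_exists: assumes w: "w \<in> W" obtains u where "u \<in> W" "w * u = w0" "len w + len u = len w0"
proof -
  obtain a b where a: "a \<in> lists I" "wmat a = w" and b: "b \<in> lists I" "wmat b = w0" using reduced_word_exists[OF w] reduced_word_exists[OF w0] by metis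
  define u where "u = wmat (rev a @ b)"
  have ab: "rev a @ b \<in> lists I" using a b by simp
  have "w * u = (wmat a * wmat (rev a)) * w0" using a(2) b(2) W_carrier[OF w0] W_carrier[OF w] by (simp add: u_def wmat_append sq_assoc)
  then have 1: "w * u = w0" using wmat_rev_inv'[OF a(1)] a(2) W_carrier[OF w0] by simp
  have "wmat (rev b) = wmat (rev b) * (w0 * w0)" using w0_w0 by simp
  also have "\<dots> = (wmat (rev b) * wmat b) * w0" using b W_carrier[OF w0] by (simp add: sq_assoc)
  also have "\<dots> = w0" using wmat_rev_inv[OF b(1)] b(2) W_carrier[OF w0] by simp
  finally have rb: "wmat (rev b) = w0" .
  have "len u = len (wmat (rev (rev a @ b)))" using len_rev[OF ab] by (simp add: u_def)
  also have "\<dots> = len (w0 * w)" using a rb by (simp add: wmat_append)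
  finally have "len w + len u = len w0" using len_w0_mult[OF w] by simp
  then show ?thesis using that 1 wmat_in_W[OF ab] u_def by blast
qed

section \<open>A regular dominant vector\<close>

lemma s_act_rt: "i \<in> I \<Longrightarrow> x \<in> carrier_vec n \<Longrightarrow> (s i *\<^sub>v x) \<bullet> rt i = - (x \<bullet> rt i)"
  by (simp add: s_eq_add add_scalar_prod_distrib[of _ n] cr_rt_2)

lemma W_s_left: "i \<in> I \<Longrightarrow> w \<in> W \<Longrightarrow> s i * (s i * w) = w"
  using W_carrier[of w] by (simp add: s_s flip: sq_assoc)

text \<open>The sum of all positive coroots is regular and dominant. A coroot is represented by the pairs
  \<open>(w, j)\<close> with value \<open>w *\<^sub>v cr j\<close>, so it may be counted several times, which does not affect
  positivity. Pairs that stay positive under \<open>s i\<close> cancel against each other in the pairing with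
  \<open>rt i\<close>; the coroot of any other pair is a positive multiple of \<open>cr i\<close>.\<close>

lemma regular_exists: "\<exists>x\<in>carrier_vec n. \<forall>i\<in>I. x \<bullet> rt i > 0"
proof -
  define T where "T = {(w, j). w \<in> W \<and> j \<in> I \<and> w *\<^sub>v cr j \<in> cone}"
  define f where "f = (\<lambda>(w, j). w *\<^sub>v cr j)"
  have fT: "f t \<in> cone" if "t \<in> T" for t using that by (auto simp: T_def f_def)
  have finT: "finite T" by (rule finite_subset[of _ "W \<times> I"]) (use finite_W finite_I in \<open>auto simp: T_def\<close>)
  define x where "x = vec n (\<lambda>k. \<Sum>t\<in>T. f t $ k)"
  have x: "x \<in> carrier_vec n" by (simp add: x_def)
  have "x \<bullet> rt i > 0" if i: "i \<in> I" for i
  proof -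
    define g where "g = (\<lambda>t. f t \<bullet> rt i)"
    have "x \<bullet> rt i = (\<Sum>k\<in>{0..<n}. \<Sum>t\<in>T. f t $ k * rt i $ k)"
      using i by (simp add: scalar_prod_def x_def sum_distrib_right)
    also have "\<dots> = (\<Sum>t\<in>T. g t)"
      using i by (subst sum.swap) (simp add: g_def scalar_prod_def)
    finally have xg: "x \<bullet> rt i = sum g T" .
    define \<sigma> where "\<sigma> = (\<lambda>(w, j :: 'i). (s i * w, j))"
    have inW: "fst t \<in> W" "snd t \<in> I" if "t \<in> T" for t using that by (auto simp: T_def)
    have ff: "f t \<in> carrier_vec n" if "t \<in> T" for t using fT[OF that] cone_carrier by blast
    have f\<sigma>: "f (\<sigma> t) = s i *\<^sub>v f t" if "t \<in> T" for t
      using that W_carrier by (auto simp: T_def f_def \<sigma>_def sq_act)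
    have \<sigma>\<sigma>: "\<sigma> (\<sigma> t) = t" if "t \<in> T" for t using that i by (auto simp: T_def \<sigma>_def W_s_left)
    \<comment> \<open>\<open>\<sigma>\<close> is the action of \<open>s i\<close>; on \<open>T0\<close> it is an involution that changes the sign of \<open>g\<close>.\<close>
    define T0 where "T0 = {t \<in> T. \<sigma> t \<in> T}"
    have "sum g T0 = sum (g \<circ> \<sigma>) T0"
      by (rule sum.reindex_bij_witness[of _ \<sigma> \<sigma>]) (use \<sigma>\<sigma> in \<open>auto simp: T0_def\<close>)
    also have "\<dots> = (\<Sum>t\<in>T0. - g t)"
      by (rule sum.cong) (use f\<sigma> ff i in \<open>auto simp: T0_def g_def s_act_rt\<close>)
    finally have z: "sum g T0 = 0" by (simp add: sum_negf)
    have gp: "g t > 0" if t: "t \<in> T - T0" for t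
    proof -
      obtain w j where wj: "t = (w, j)" "w \<in> W" "j \<in> I" using t by (auto simp: T_def)
      have "s i *\<^sub>v f t \<notin> cone" using t wj i W_mult[OF W_s[OF i] wj(2)] f\<sigma>[of t] by (auto simp: T0_def T_def \<sigma>_def f_def)
      then have "(s i * w) *\<^sub>v cr j \<notin> cone" using wj W_carrier[OF wj(2)] by (simp add: f_def sq_act)
      then have "- ((s i * w) *\<^sub>v cr j) \<in> cone"
        using coroot_pos coroot_neg W_mult[OF W_s[OF i] wj(2)] wj(3) nat_le_linear by blast
      then have neg: "- (s i *\<^sub>v f t) \<in> cone" using wj W_carrier[OF wj(2)] by (simp add: f_def sq_act)
      obtain c where c: "\<And>l. l \<in> I \<Longrightarrow> 0 \<le> c l" "\<And>k. k < n \<Longrightarrow> f t $ k = (\<Sum>l\<in>I. c l * cr l $ k)"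
        using fT[of t] t by (auto simp: cone_def)
      obtain d where d: "\<And>l. l \<in> I \<Longrightarrow> 0 \<le> d l" "\<And>k. k < n \<Longrightarrow> (- (s i *\<^sub>v f t)) $ k = (\<Sum>l\<in>I. d l * cr l $ k)"
        using neg by (auto simp: cone_def)
      have ft: "f t \<in> carrier_vec n" using ff t by auto
      \<comment> \<open>Since \<open>f t - s\<^sub>i (f t) = g t cr\<^sub>i\<close>, the coefficients satisfy \<open>c + d = g t \<delta>\<^sub>i\<close>, all being nonnegative.\<close>
      define e where "e = (\<lambda>l. c l + d l - (if l = i then g t else 0))"
      have "(\<Sum>l\<in>I. e l * cr l $ k) = 0" if k: "k < n" for k
      proof -
        have "(\<Sum>l\<in>I. e l * cr l $ k) = (\<Sum>l\<in>I. c l * cr l $ k) + (\<Sum>l\<in>I. d l * cr l $ k) - (\<Sum>l\<in>I. (if l = i then g t else 0) * cr l $ k)"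
          by (simp add: e_def algebra_simps sum.distrib sum_subtractf)
        also have "(\<Sum>l\<in>I. (if l = i then g t else 0) * cr l $ k) = g t * cr i $ k"
          using finite_I i by (simp add: if_distrib[of "\<lambda>a. a * _"] cong: if_cong)
        finally show ?thesis using c(2)[OF k] d(2)[OF k] ft i k by (simp add: s_nth g_def del: index_mult_mat_vec)
      qed
      then have e0: "e l = 0" if "l \<in> I" for l using cr_indep[of e l] that by blast
      have cl: "c l = 0" if "l \<in> I" "l \<noteq> i" for l using e0[OF that(1)] c(1)[OF that(1)] d(1)[OF that(1)] that by (simp add: e_def)
      have "g t = c i + d i" using e0[OF i] by (simp add: e_def)
      moreover have "c i \<noteq> 0"
      proof
        assume "c i = 0"
        then have "c l = 0" if "l \<in> I" for l using cl that by (cases "l = i") auto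
        then have "f t = 0\<^sub>v n" using c(2) ft by (intro eq_vecI) auto
        then show False using W_inj_vec[of w "cr j"] wj cr_nonzero[of j] by (auto simp: f_def)
      qed
      ultimately show ?thesis using c(1)[OF i] d(1)[OF i] by simp
    qed
    have "(1\<^sub>m n, i) \<in> T - T0"
    proof -
      have "(1\<^sub>m n, i) \<in> T" using i one_W cone_cr by (auto simp: T_def)
      moreover have "- cr i \<notin> cone" using cone_pointed[OF cone_cr[OF i]] cr_nonzero[OF i] by auto
      then have "\<sigma> (1\<^sub>m n, i) \<notin> T" using i by (auto simp: \<sigma>_def T_def s_cr)
      ultimately show ?thesis by (simp add: T0_def)
    qed
    then have "sum g (T - T0) > 0" using finT gp by (intro sum_pos) auto
    moreover have "sum g T = sum g (T - T0) + sum g T0" using finT by (intro sum.subset_diff) (auto simp: T0_def)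
    ultimately show ?thesis using xg z by simp
  qed
  then show ?thesis using x by blast
qed

text \<open>Reducedness of \<open>i # u\<close> makes the coroot \<open>z\<close> with \<open>wmat u *\<^sub>v z = cr i\<close> positive, and the sign of the
  left-hand side is that of the invariant form of \<open>x\<close> and \<open>z\<close>.\<close>

lemma regular_pos:
  assumes x: "x \<in> carrier_vec n" "\<And>i. i \<in> I \<Longrightarrow> x \<bullet> rt i > 0" and r: "reduced (i # u)"
  shows "(wmat u *\<^sub>v x) \<bullet> rt i > 0"
proof -
  have iu: "i \<in> I" "u \<in> lists I" using r by (auto simp: reduced_def)
  have ru: "len (wmat u) = length u" using r reduced_appendD(2)[of "[i]" u] by (simp add: reduced_def)
  define z where "z = wmat (rev u) *\<^sub>v cr i"
  have rw: "wmat (rev u) \<in> W" using iu by (intro wmat_in_W) simp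
  have "len (wmat (rev u) * s i) = len (wmat (rev (i # u)))" by (simp add: wmat_append)
  also have "\<dots> = length u + 1" using r len_rev[of "i # u"] by (simp add: reduced_def)
  finally have "z \<in> cone" unfolding z_def using len_rev[OF iu(2)] ru by (intro coroot_pos rw iu) simp
  then obtain c where c: "\<And>l. l \<in> I \<Longrightarrow> 0 \<le> c l" "\<And>k. k < n \<Longrightarrow> z $ k = (\<Sum>l\<in>I. c l * cr l $ k)" and zc: "z \<in> carrier_vec n"
    by (auto simp: cone_def)
  have "wmat u *\<^sub>v z = cr i" using iu by (simp add: z_def wmat_rev_inv' flip: sq_act)
  then have "bform (wmat u *\<^sub>v x) (cr i) = bform x z" using bform_W[OF wmat_in_W[OF iu(2)] x(1) zc] by simp
  also have "\<dots> = (\<Sum>l\<in>I. c l * bform x (cr l))" using c(2) by (intro bform_sum_right finite_I x zc) auto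
  also have "\<dots> > 0"
  proof -
    have bp: "bform x (cr l) > 0" if "l \<in> I" for l using x that rt_pos_iff by blast
    have "\<exists>l\<in>I. c l \<noteq> 0"
    proof (rule ccontr)
      assume "\<not> ?thesis"
      then have "z = 0\<^sub>v n" using c(2) zc by (intro eq_vecI) (auto intro!: sum.neutral)
      then show False using W_inj_vec[OF rw, of "cr i"] iu cr_nonzero[of i] by (simp add: z_def)
    qed
    then obtain l where l: "l \<in> I" "c l > 0" using c(1) by (metis order_le_imp_less_or_eq)
    show ?thesis by (rule sum_pos2[OF finite_I l(1)]) (use l bp c(1) in \<open>auto intro!: mult_nonneg_nonneg less_imp_le[OF bp]\<close>)
  qed
  finally show ?thesis using rt_pos_iff[OF iu(1)] x(1) by simp
qed

end

section \<open>Polynomials\<close>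

abbreviation Const :: "'k::comm_ring_1 \<Rightarrow> 'k pol" where
  "Const c \<equiv> Poly_Mapping.single 0 c"

definition var :: "nat \<Rightarrow> 'k::comm_ring_1 pol" where
  "var k = Poly_Mapping.single (Poly_Mapping.single k 1) 1"

lemma pm_sum: "f = (\<Sum>m\<in>Poly_Mapping.keys f. Poly_Mapping.single m (Poly_Mapping.lookup f m))"
  by (rule poly_mapping_eqI) (auto simp: lookup_sum lookup_single when_def in_keys_iff)

lemma pm_induct [case_names single zero add]:
  fixes f :: "'a \<Rightarrow>\<^sub>0 'b::comm_monoid_add"
  assumes s: "\<And>m c. m \<in> Poly_Mapping.keys f \<Longrightarrow> P (Poly_Mapping.single m c)" and z: "P 0" and a: "\<And>g h. P g \<Longrightarrow> P h \<Longrightarrow> P (g + h)"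
  shows "P f"
proof -
  have "P (\<Sum>m\<in>A. Poly_Mapping.single m (Poly_Mapping.lookup f m))" if "finite A" "A \<subseteq> Poly_Mapping.keys f" for A
    using that by (induction A) (auto intro: s z a)
  from this[of "Poly_Mapping.keys f"] show ?thesis using pm_sum[of f] by simp
qed

lemma exp_induct [case_names zero step]:
  fixes m :: "nat \<Rightarrow>\<^sub>0 nat"
  assumes z: "P 0" and s: "\<And>m k. P m \<Longrightarrow> P (Poly_Mapping.single k 1 + m)"
  shows "P m"
proof (induction "\<Sum>k\<in>Poly_Mapping.keys m. Poly_Mapping.lookup m k" arbitrary: m)
  case 0
  then have "m = 0" by (intro poly_mapping_eqI) (auto simp: in_keys_iff)
  then show ?case using z by simp
next
  case (Suc d)
  then obtain k where k: "k \<in> Poly_Mapping.keys m" by fastforce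
  define m' where "m' = m - Poly_Mapping.single k 1"
  have m: "m = Poly_Mapping.single k 1 + m'"
    by (rule poly_mapping_eqI) (use k in \<open>auto simp: m'_def lookup_add lookup_minus lookup_single when_def in_keys_iff\<close>)
  have km: "Poly_Mapping.keys m' \<subseteq> Poly_Mapping.keys m" using m by (auto simp: in_keys_iff lookup_add)
  have "(\<Sum>l\<in>Poly_Mapping.keys m. Poly_Mapping.lookup m l) = (\<Sum>l\<in>Poly_Mapping.keys m. (if l = k then 1 else 0) + Poly_Mapping.lookup m' l)"
    by (subst m) (auto simp: lookup_add lookup_single when_def intro!: sum.cong)
  also have "\<dots> = 1 + (\<Sum>l\<in>Poly_Mapping.keys m. Poly_Mapping.lookup m' l)" using k by (simp add: sum.distrib)
  also have "(\<Sum>l\<in>Poly_Mapping.keys m. Poly_Mapping.lookup m' l) = (\<Sum>l\<in>Poly_Mapping.keys m'. Poly_Mapping.lookup m' l)"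
    by (rule sum.mono_neutral_right) (use km in \<open>auto simp: in_keys_iff\<close>)
  finally have "P m'" using Suc by auto
  then show ?case using s m by metis
qed

lemma single_var_mult: "Poly_Mapping.single (Poly_Mapping.single k 1 + m) c = var k * Poly_Mapping.single m (c::'k::comm_ring_1)"
  by (simp add: mult_single var_def)

lemma lin_add: "dim_vec x = dim_vec y \<Longrightarrow> lin (x + y) = (lin x + lin y :: 'k::comm_ring_1 pol)"
  by (simp add: lin_def single_add sum.distrib)

lemma of_int_Const: "(of_int a :: 'k::comm_ring_1 pol) = Const (of_int a)"
  by simp

lemma lin_smult: "lin (a \<cdot>\<^sub>v x) = (of_int a * lin x :: 'k::comm_ring_1 pol)"
  unfolding lin_def of_int_Const by (simp add: sum_distrib_left mult_single del: single_of_int)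

lemma lin_uminus: "lin (- x) = - (lin x :: 'k::comm_ring_1 pol)"
  by (simp add: lin_def sum_negf single_uminus)

lemma lin_unit: "k < n \<Longrightarrow> lin (unit_vec n k) = (var k :: 'k::comm_ring_1 pol)"
proof -
  assume k: "k < n"
  have "lin (unit_vec n k) = (\<Sum>l<n. if l = k then var k else (0 :: 'k pol))"
    unfolding lin_def by (rule sum.cong) (auto simp: unit_vec_def var_def)
  then show ?thesis using k by simp
qed

lemma lin_alt: "dim_vec x = n \<Longrightarrow> lin x = (\<Sum>k<n. of_int (x $ k) * var k :: 'k::comm_ring_1 pol)"
  unfolding lin_def of_int_Const by (simp add: mult_single var_def del: single_of_int)

lemma lookup_lin: "k < dim_vec x \<Longrightarrow> Poly_Mapping.lookup (lin x :: 'k::comm_ring_1 pol) (Poly_Mapping.single k 1) = of_int (x $ k)"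
proof -
  assume k: "k < dim_vec x"
  have inj: "Poly_Mapping.single l (Suc 0) = Poly_Mapping.single k (Suc 0) \<longleftrightarrow> l = k" for l :: nat
    by (metis lookup_single_eq lookup_single_not_eq nat.distinct(1))
  show ?thesis using k unfolding lin_def by (simp add: lookup_sum lookup_single when_def inj)
qed

subsection \<open>Substitution\<close>

definition mono_act :: "int mat \<Rightarrow> (nat \<Rightarrow>\<^sub>0 nat) \<Rightarrow> 'k::comm_ring_1 pol" where
  "mono_act w m = (\<Prod>k\<in>Poly_Mapping.keys m. lin (col w k) ^ Poly_Mapping.lookup m k)"

lemma mono_act_super: "finite A \<Longrightarrow> Poly_Mapping.keys m \<subseteq> A \<Longrightarrow> mono_act w m = (\<Prod>k\<in>A. lin (col w k) ^ Poly_Mapping.lookup m k)"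
  unfolding mono_act_def by (rule prod.mono_neutral_left) (auto simp: in_keys_iff)

lemma mono_act_add: "mono_act w (a + b) = (mono_act w a * mono_act w b :: 'k::comm_ring_1 pol)"
proof -
  define A where "A = Poly_Mapping.keys a \<union> Poly_Mapping.keys b"
  have "finite A" "Poly_Mapping.keys (a + b) \<subseteq> A" "Poly_Mapping.keys a \<subseteq> A" "Poly_Mapping.keys b \<subseteq> A"
    using keys_add[of a b] by (auto simp: A_def)
  then show ?thesis by (simp add: mono_act_super[of A] lookup_add power_add prod.distrib)
qed

lemma mono_act_0 [simp]: "mono_act w 0 = 1"
  by (simp add: mono_act_def)

lemma pol_act_super: "finite A \<Longrightarrow> Poly_Mapping.keys f \<subseteq> A \<Longrightarrow> pol_act w f = (\<Sum>m\<in>A. Const (Poly_Mapping.lookup f m) * mono_act w m)"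
  unfolding pol_act_def mono_act_def[symmetric] by (rule sum.mono_neutral_left) (auto simp: in_keys_iff)

lemma pol_act_0 [simp]: "pol_act w 0 = 0"
  by (simp add: pol_act_def)

lemma pol_act_add: "pol_act w (f + g) = (pol_act w f + pol_act w g :: 'k::comm_ring_1 pol)"
proof -
  define A where "A = Poly_Mapping.keys f \<union> Poly_Mapping.keys g"
  have "finite A" "Poly_Mapping.keys (f + g) \<subseteq> A" "Poly_Mapping.keys f \<subseteq> A" "Poly_Mapping.keys g \<subseteq> A"
    using keys_add[of f g] by (auto simp: A_def)
  then show ?thesis by (simp add: pol_act_super[of A] lookup_add single_add distrib_right sum.distrib)
qed

lemma pol_act_single: "pol_act w (Poly_Mapping.single m c) = Const c * (mono_act w m :: 'k::comm_ring_1 pol)"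
  by (subst pol_act_super[of "{m}"]) (auto simp: keys_single)

lemma pol_act_Const [simp]: "pol_act w (Const c) = (Const c :: 'k::comm_ring_1 pol)"
  by (simp add: pol_act_single)

lemma pol_act_mult: "pol_act w (f * g) = (pol_act w f * pol_act w g :: 'k::comm_ring_1 pol)"
proof (induction f rule: pm_induct)
  case (single m c)
  show ?case
  proof (induction g rule: pm_induct)
    case (single l d)
    have "Const (c * d) = (Const c * Const d :: 'k pol)" by (simp add: mult_single)
    moreover have "pol_act w (Poly_Mapping.single m c * Poly_Mapping.single l d) = Const (c * d) * (mono_act w m * mono_act w l)"
      by (simp only: mult_single pol_act_single mono_act_add)
    ultimately show ?case by (simp only: pol_act_single mult_ac)
  qed (auto simp: distrib_left pol_act_add)
qed (auto simp: distrib_right pol_act_add)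

lemma pol_act_of_int [simp]: "pol_act w (of_int a) = (of_int a :: 'k::comm_ring_1 pol)"
  unfolding of_int_Const by (rule pol_act_Const)

lemma pol_act_uminus: "pol_act w (- f) = - (pol_act w f :: 'k::comm_ring_1 pol)"
  using pol_act_add[of w "- f" f] by (simp add: eq_neg_iff_add_eq_0)

lemma pol_act_diff: "pol_act w (f - g) = (pol_act w f - pol_act w g :: 'k::comm_ring_1 pol)"
  using pol_act_add[of w f "- g"] by (simp add: pol_act_uminus)

lemma pol_act_sum: "pol_act w (sum f A) = (\<Sum>a\<in>A. pol_act w (f a) :: 'k::comm_ring_1 pol)"
  by (induction A rule: infinite_finite_induct) (auto simp: pol_act_add)

lemma pol_act_var: "pol_act w (var k) = (lin (col w k) :: 'k::comm_ring_1 pol)"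
  by (simp add: pol_act_single mono_act_def var_def)

lemma pol_act_lin:
  assumes w: "w \<in> carrier_mat n n" and x: "x \<in> carrier_vec n"
  shows "pol_act w (lin x) = (lin (w *\<^sub>v x) :: 'k::comm_ring_1 pol)"
proof -
  have "pol_act w (lin x) = (\<Sum>k<n. of_int (x $ k) * lin (col w k) :: 'k pol)"
    using x by (simp add: lin_alt[of x n] pol_act_sum pol_act_mult pol_act_var)
  also have "\<dots> = (\<Sum>k<n. \<Sum>l<n. of_int (x $ k) * (of_int (w $$ (l, k)) * var l))"
    using w by (intro sum.cong refl) (auto simp: lin_alt[of _ n] sum_distrib_left)
  also have "\<dots> = (\<Sum>l<n. \<Sum>k<n. of_int (x $ k) * (of_int (w $$ (l, k)) * var l))" by (rule sum.swap)
  also have "\<dots> = (\<Sum>l<n. of_int ((w *\<^sub>v x) $ l) * var l)"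
    using w x by (intro sum.cong refl)
      (simp add: scalar_prod_def sum_distrib_left sum_distrib_right mult_ac lessThan_atLeast0)
  also have "\<dots> = lin (w *\<^sub>v x)" using w by (simp add: lin_alt[of _ n])
  finally show ?thesis .
qed

subsection \<open>Base change of coefficients\<close>

text \<open>Stated for every coefficient ring: the target is \<open>\<int>\<close> for the polynomial representation itself and
  \<open>\<rat>\<close> for its base change, and the two cases are treated together below.\<close>

definition base :: "int pol \<Rightarrow> 'k::comm_ring_1 pol" where
  "base f = Poly_Mapping.map of_int f"

lemma lookup_base: "Poly_Mapping.lookup (base f) m = of_int (Poly_Mapping.lookup f m)"
  by (simp add: base_def map.rep_eq when_def)

lemma base_int [simp]: "base (f :: int pol) = f"
  by (rule poly_mapping_eqI) (simp add: lookup_base)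

lemma base_0 [simp]: "base 0 = 0"
  by (rule poly_mapping_eqI) (simp add: lookup_base)

lemma base_add: "base (f + g) = base f + base g"
  by (rule poly_mapping_eqI) (simp add: lookup_base lookup_add)

lemma base_uminus: "base (- f) = - base f"
  by (rule poly_mapping_eqI) (simp add: lookup_base)

lemma base_diff: "base (f - g) = base f - base g"
  by (rule poly_mapping_eqI) (simp add: lookup_base lookup_minus)

lemma base_single [simp]: "base (Poly_Mapping.single m c) = Poly_Mapping.single m (of_int c)"
  by (rule poly_mapping_eqI) (simp add: lookup_base lookup_single when_def)

lemma base_1 [simp]: "base 1 = 1"
  using base_single[of 0 1] by simp

lemma base_mult: "base (f * g) = (base f * base g :: 'k::comm_ring_1 pol)"
proof (induction f rule: pm_induct)
  case (single m c)
  show ?case by (induction g rule: pm_induct) (auto simp: mult_single distrib_left base_add)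
qed (auto simp: distrib_right base_add)

lemma base_sum: "base (sum f A) = (\<Sum>a\<in>A. base (f a))"
  by (induction A rule: infinite_finite_induct) (auto simp: base_add)

lemma base_prod: "base (prod f A) = (\<Prod>a\<in>A. base (f a) :: 'k::comm_ring_1 pol)"
  by (induction A rule: infinite_finite_induct) (auto simp: base_mult)

lemma base_power: "base (f ^ k) = (base f ^ k :: 'k::comm_ring_1 pol)"
  by (induction k) (auto simp: base_mult)

lemma base_lin [simp]: "base (lin x) = lin x"
  by (simp add: lin_def base_sum)

lemma base_pol_act: "base (pol_act w f) = (pol_act w (base f) :: 'k::comm_ring_1 pol)"
proof (induction f rule: pm_induct)
  case (single m c)
  then show ?case by (simp add: pol_act_single base_mult mono_act_def base_prod base_power)
qed (auto simp: pol_act_add base_add)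

lemma base_inject [simp]: "(base f :: 'k::{comm_ring_1, ring_char_0} pol) = base g \<longleftrightarrow> f = g"
  by (metis lookup_base of_int_eq_iff poly_mapping_eqI)

lemma base_of_int [simp]: "base (of_int a) = of_int a"
  unfolding of_int_Const by (simp only: base_single) (simp del: single_of_int)

lemma rat_pol_denominator: "\<exists>d f. d > 0 \<and> of_int d * (g :: rat pol) = base f \<and> Poly_Mapping.keys f = Poly_Mapping.keys g"
proof -
  have "\<exists>d f. d > 0 \<and> of_int d * (g :: rat pol) = base f"
  proof (induction g rule: pm_induct)
    case (single m c)
    obtain a b where ab: "quotient_of c = (a, b)" by fastforce
    then have b: "b > 0" "c = of_int a / of_int b" using quotient_of_denom_pos quotient_of_div by auto
    then have "of_int b * c = of_int a" by simp
    then have "of_int b * Poly_Mapping.single m c = (base (Poly_Mapping.single m a) :: rat pol)"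
      unfolding of_int_Const by (simp add: mult_single del: single_of_int)
    then show ?case using b by blast
  next
    case zero
    show ?case by (intro exI[of _ 1] exI[of _ 0]) simp
  next
    case (add g h)
    then obtain d f d' f' where d: "d > 0" "of_int d * g = base f" "d' > 0" "of_int d' * h = base f'" by auto
    have "of_int (d * d') * (g + h) = of_int d' * (of_int d * g) + of_int d * (of_int d' * h)" by (simp add: algebra_simps)
    also have "\<dots> = base (of_int d' * f + of_int d * f')"
      by (simp add: d base_add base_mult)
    finally show ?case using d by (intro exI[of _ "d * d'"] exI[of _ "of_int d' * f + of_int d * f'"]) simp
  qed
  then obtain d f where d: "d > 0" "of_int d * g = base f" by blast
  have "of_int (Poly_Mapping.lookup f m) = of_int d * Poly_Mapping.lookup g m" for m
  proof -
    have "Poly_Mapping.lookup (of_int d * g) m = of_int d * Poly_Mapping.lookup g m"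
      unfolding of_int_Const mult_map_scale_conv_mult[symmetric] by (simp add: map.rep_eq when_def)
    then show ?thesis using d(2) lookup_base[of f m] by metis
  qed
  then have "Poly_Mapping.keys f = Poly_Mapping.keys g" using d(1)
    by (auto simp: in_keys_iff) (metis mult_eq_0_iff of_int_eq_0_iff less_irrefl)+
  then show ?thesis using d by blast
qed

context weyl_datum
begin

section \<open>The polynomial ring\<close>

definition PC :: "'k::comm_ring_1 pol set" where
  "PC = {f. \<forall>m\<in>Poly_Mapping.keys f. Poly_Mapping.keys m \<subseteq> {..<n}}"

lemma Pol_simps [simp]: "carrier (Pol D) = PC" "monoid.mult (Pol D) = (*)" "monoid.one (Pol D) = 1" "ring.zero (Pol D) = 0" "ring.add (Pol D) = (+)"
  by (auto simp: Pol_def PC_def ring_of_type_algebra_def)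

lemma PC_0 [simp]: "0 \<in> PC" by (simp add: PC_def)
lemma PC_Const [simp]: "Const c \<in> PC" by (auto simp: PC_def)
lemma PC_1 [simp]: "1 \<in> PC" by (simp add: PC_def)
lemma PC_of_int [simp]: "of_int a \<in> PC" unfolding of_int_Const by (rule PC_Const)
lemma PC_add [simp]: "f \<in> PC \<Longrightarrow> g \<in> PC \<Longrightarrow> f + g \<in> PC"
  using keys_add[of f g] by (auto simp: PC_def)
lemma PC_uminus [simp]: "f \<in> PC \<Longrightarrow> - f \<in> PC"
  by (auto simp: PC_def in_keys_iff)
lemma PC_diff [simp]: "f \<in> PC \<Longrightarrow> g \<in> PC \<Longrightarrow> f - g \<in> PC"
  using PC_add[of f "- g"] by simp
lemma PC_mult [simp]: assumes "f \<in> PC" "g \<in> PC" shows "f * g \<in> PC"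
  unfolding PC_def mem_Collect_eq
proof
  fix m assume "m \<in> Poly_Mapping.keys (f * g)"
  then obtain a b where "m = a + b" "a \<in> Poly_Mapping.keys f" "b \<in> Poly_Mapping.keys g" using keys_mult[of f g] by auto
  then show "Poly_Mapping.keys m \<subseteq> {..<n}" using assms keys_add[of a b] by (fastforce simp: PC_def)
qed
lemma PC_sum [simp]: "(\<And>a. a \<in> A \<Longrightarrow> f a \<in> PC) \<Longrightarrow> sum f A \<in> PC"
  by (induction A rule: infinite_finite_induct) auto
lemma PC_power [simp]: "f \<in> PC \<Longrightarrow> f ^ k \<in> PC"
  by (induction k) auto
lemma PC_var [simp]: "k < n \<Longrightarrow> var k \<in> PC"
  by (auto simp: PC_def var_def)
lemma PC_lin [simp]: "x \<in> carrier_vec n \<Longrightarrow> lin x \<in> PC"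
  by (subst lin_alt[of x n], simp, intro PC_sum PC_mult PC_of_int PC_var) simp
lemma PC_single: "Poly_Mapping.keys m \<subseteq> {..<n} \<Longrightarrow> Poly_Mapping.single m c \<in> PC"
  by (auto simp: PC_def)
lemma PC_base [simp]: "f \<in> PC \<Longrightarrow> base f \<in> PC"
  by (auto simp: PC_def in_keys_iff lookup_base)

lemma exp_n_induct [consumes 1, case_names zero step]:
  fixes m :: "nat \<Rightarrow>\<^sub>0 nat"
  assumes "Poly_Mapping.keys m \<subseteq> {..<n}" and z: "P 0"
    and s: "\<And>m k. Poly_Mapping.keys m \<subseteq> {..<n} \<Longrightarrow> k < n \<Longrightarrow> P m \<Longrightarrow> P (Poly_Mapping.single k 1 + m)"
  shows "P m"
  using assms(1)
proof (induction m rule: exp_induct)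
  case (step m k)
  have "Poly_Mapping.keys (Poly_Mapping.single k 1 + m) = insert k (Poly_Mapping.keys m)"
    by (auto simp: in_keys_iff lookup_add lookup_single when_def split: if_splits)
  then show ?case using step s by auto
qed (rule z)

lemma PC_induct [consumes 1, case_names Const add var]:
  fixes f :: "'k::comm_ring_1 pol"
  assumes "f \<in> PC" and c: "\<And>c. P (Const c)" and a: "\<And>f g. f \<in> PC \<Longrightarrow> g \<in> PC \<Longrightarrow> P f \<Longrightarrow> P g \<Longrightarrow> P (f + g)"
    and v: "\<And>k f. k < n \<Longrightarrow> f \<in> PC \<Longrightarrow> P f \<Longrightarrow> P (lin (unit_vec n k) * f)"
  shows "P f"
proof -
  have s: "P (Poly_Mapping.single m c)" if "Poly_Mapping.keys m \<subseteq> {..<n}" for m c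
    using that
  proof (induction m rule: exp_n_induct)
    case (step m k)
    then show ?case using v[of k "Poly_Mapping.single m c"] PC_single[of m c]
      by (simp add: single_var_mult[simplified] lin_unit)
  qed (rule c)
  have "f \<in> PC \<and> P f"
  proof (induction f rule: pm_induct)
    case (single m c)
    then have "Poly_Mapping.keys m \<subseteq> {..<n}" using assms(1) by (auto simp: PC_def)
    then show ?case using s PC_single by blast
  next
    case zero
    show ?case using c[of 0] by simp
  next
    case (add g h)
    then show ?case using a assms(1) by auto
  qed
  then show ?thesis by blast
qed

lemma pol_act_PC [simp]: assumes w: "w \<in> carrier_mat n n" and f: "f \<in> PC" shows "pol_act w f \<in> PC"
  using f
proof (induction f rule: PC_induct)
  case (var k f)
  have "w *\<^sub>v unit_vec n k \<in> carrier_vec n" using w by auto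
  then show ?case using var w by (simp add: pol_act_mult pol_act_lin[of w n])
qed (auto simp: pol_act_add)

lemma pol_act_comp: assumes v: "v \<in> carrier_mat n n" and w: "w \<in> carrier_mat n n" and f: "f \<in> PC"
  shows "pol_act v (pol_act w f) = pol_act (v * w) f"
  using f
proof (induction f rule: PC_induct)
  case (var k f)
  have "w *\<^sub>v unit_vec n k \<in> carrier_vec n" using w by auto
  then show ?case using var v w by (simp add: pol_act_mult pol_act_lin[of _ n])
qed (auto simp: pol_act_add)

lemma pol_act_one: "f \<in> PC \<Longrightarrow> pol_act (1\<^sub>m n) f = f"
proof (induction f rule: PC_induct)
  case (var k f)
  then show ?case by (simp add: pol_act_mult pol_act_lin[of _ n])
qed (auto simp: pol_act_add)

section \<open>Demazure operators\<close>

lemma lin_nonzero: "x \<in> carrier_vec n \<Longrightarrow> x \<noteq> 0\<^sub>v n \<Longrightarrow> (lin x :: 'k::{comm_ring_1, ring_char_0} pol) \<noteq> 0"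
proof
  assume x: "x \<in> carrier_vec n" "x \<noteq> 0\<^sub>v n" and l: "(lin x :: 'k pol) = 0"
  have "x $ k = 0" if "k < n" for k using lookup_lin[of k x, where 'k = 'k] l x that by simp
  then have "x = 0\<^sub>v n" using x by (intro eq_vecI) auto
  then show False using x by simp
qed

lemma lin_cr_nonzero: "i \<in> I \<Longrightarrow> (lin (cr i) :: 'k::{comm_ring_1, ring_char_0} pol) \<noteq> 0"
  by (rule lin_nonzero) (simp_all add: cr_nonzero)

lemma lin_s: fixes x :: "int vec" assumes "i \<in> I" "x \<in> carrier_vec n"
  shows "lin (s i *\<^sub>v x) = (lin x - of_int (x \<bullet> rt i) * lin (cr i) :: 'k::comm_ring_1 pol)"
  using assms by (simp add: s_eq_add lin_add lin_smult)

text \<open>The quotient exists over any coefficients, without dividing: the Leibniz rule reduces the claim to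
  a variable \<open>x\<close>, and \<open>x - s\<^sub>i(x)\<close> is an integral multiple of the coroot.\<close>

lemma dem_exists:
  fixes f :: "'k::comm_ring_1 pol"
  assumes i: "i \<in> I" and f: "f \<in> PC"
  shows "\<exists>g\<in>PC. lin (cr i) * g = f - pol_act (s i) f"
  using f
proof (induction f rule: PC_induct)
  case (Const c)
  show ?case by (intro bexI[of _ 0]) auto
next
  case (add f g)
  then obtain f' g' where "f' \<in> PC" "lin (cr i) * f' = f - pol_act (s i) f" "g' \<in> PC" "lin (cr i) * g' = g - pol_act (s i) g" by auto
  then show ?case by (intro bexI[of _ "f' + g'"]) (auto simp: distrib_left pol_act_add)
next
  case (var k f)
  define x :: "int vec" where "x = unit_vec n k"
  have x: "x \<in> carrier_vec n" by (simp add: x_def)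
  obtain g where g: "g \<in> PC" "lin (cr i) * g = f - pol_act (s i) f" using var by auto
  have "lin (cr i) * (lin x * g + of_int (x \<bullet> rt i) * pol_act (s i) f) = lin x * (lin (cr i) * g) + (lin x - lin (s i *\<^sub>v x)) * pol_act (s i) f"
    using i x by (simp add: lin_s algebra_simps)
  also have "\<dots> = lin x * f - pol_act (s i) (lin x * f)"
    using x by (subst g(2)) (simp add: pol_act_mult pol_act_lin[of _ n] algebra_simps)
  finally show ?case using g x var i by (intro bexI[of _ "lin x * g + of_int (x \<bullet> rt i) * pol_act (s i) f"]) (auto simp: x_def)
qed

abbreviation "dem \<equiv> demazure D"

lemma dem_unique:
  fixes f :: "'k::{idom, ring_char_0} pol"
  assumes i: "i \<in> I" and g: "g \<in> PC" "lin (cr i) * g = f - pol_act (s i) f"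
  shows "dem i f = g"
  unfolding demazure_def Pol_simps
proof (rule the_equality)
  fix h assume "h \<in> PC \<and> lin (cr i) * h = f - pol_act (s i) f"
  then have "lin (cr i) * h = lin (cr i) * g" using g by simp
  then show "h = g" using lin_cr_nonzero[OF i, where 'k = 'k] by simp
qed (use g in auto)

lemma dem_PC [simp]: "i \<in> I \<Longrightarrow> f \<in> PC \<Longrightarrow> dem i (f :: 'k::{idom, ring_char_0} pol) \<in> PC"
  and dem_eq: "i \<in> I \<Longrightarrow> f \<in> PC \<Longrightarrow> lin (cr i) * dem i (f :: 'k::{idom, ring_char_0} pol) = f - pol_act (s i) f"
  using dem_exists[of i f] dem_unique[of i _ f] by auto

lemma dem_Const [simp]: "i \<in> I \<Longrightarrow> dem i (Const c :: 'k::{idom, ring_char_0} pol) = 0"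
  by (rule dem_unique) auto

lemma dem_0 [simp]: "i \<in> I \<Longrightarrow> dem i (0 :: 'k::{idom, ring_char_0} pol) = 0"
  by (rule dem_unique) auto

lemma dem_add: "i \<in> I \<Longrightarrow> f \<in> PC \<Longrightarrow> g \<in> PC \<Longrightarrow> dem i (f + g) = dem i f + dem i (g :: 'k::{idom, ring_char_0} pol)"
  by (rule dem_unique) (auto simp: dem_eq distrib_left pol_act_add)

lemma dem_mult: "i \<in> I \<Longrightarrow> f \<in> PC \<Longrightarrow> g \<in> PC \<Longrightarrow> dem i (f * g) = dem i f * g + pol_act (s i) f * dem i (g :: 'k::{idom, ring_char_0} pol)"
proof (rule dem_unique)
  assume a: "i \<in> I" "f \<in> PC" "g \<in> PC"
  have "lin (cr i) * (dem i f * g + pol_act (s i) f * dem i g) = (lin (cr i) * dem i f) * g + pol_act (s i) f * (lin (cr i) * dem i g)"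
    by (simp add: algebra_simps)
  also have "\<dots> = f * g - pol_act (s i) (f * g)" using a by (simp add: dem_eq pol_act_mult) (simp add: algebra_simps)
  finally show "lin (cr i) * (dem i f * g + pol_act (s i) f * dem i g) = f * g - pol_act (s i) (f * g)" .
qed auto

lemma dem_of_int_mult: "i \<in> I \<Longrightarrow> f \<in> PC \<Longrightarrow> dem i (of_int a * f) = of_int a * dem i (f :: 'k::{idom, ring_char_0} pol)"
  unfolding of_int_Const by (subst dem_mult) (auto simp del: single_of_int)

lemma dem_sum: "i \<in> I \<Longrightarrow> (\<And>a. a \<in> A \<Longrightarrow> f a \<in> PC) \<Longrightarrow> dem i (sum f A) = (\<Sum>a\<in>A. dem i (f a :: 'k::{idom, ring_char_0} pol))"
  by (induction A rule: infinite_finite_induct) (auto simp: dem_add)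

lemma dem_lin: "i \<in> I \<Longrightarrow> x \<in> carrier_vec n \<Longrightarrow> dem i (lin x) = (of_int (x \<bullet> rt i) :: 'k::{idom, ring_char_0} pol)"
  by (rule dem_unique) (auto simp: pol_act_lin[of _ n] lin_s)

lemma dem_lin_mult: "i \<in> I \<Longrightarrow> x \<in> carrier_vec n \<Longrightarrow> f \<in> PC \<Longrightarrow>
   dem i (lin x * f) = of_int (x \<bullet> rt i) * f + lin (s i *\<^sub>v x) * dem i (f :: 'k::{idom, ring_char_0} pol)"
  by (simp add: dem_mult dem_lin pol_act_lin[of _ n])

lemma dem_eq_0_iff: "i \<in> I \<Longrightarrow> f \<in> PC \<Longrightarrow> dem i (f :: 'k::{idom, ring_char_0} pol) = 0 \<longleftrightarrow> pol_act (s i) f = f"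
  using dem_eq[of i f] lin_cr_nonzero[of i, where 'k = 'k] by auto

text \<open>Both \<open>lin (cr i)\<close> and \<open>f - s\<^sub>i(f)\<close> change sign under \<open>s i\<close>, so their quotient is invariant.\<close>

lemma dem_dem: assumes i: "i \<in> I" and f: "f \<in> PC" shows "dem i (dem i (f :: 'k::{idom, ring_char_0} pol)) = 0"
proof -
  have "- (lin (cr i) * pol_act (s i) (dem i f)) = pol_act (s i) (lin (cr i) * dem i f)"
    using i by (simp add: pol_act_mult pol_act_lin[of _ n] s_cr lin_uminus)
  also have "\<dots> = - (lin (cr i) * dem i f)"
    using i f by (simp add: dem_eq pol_act_diff pol_act_comp s_s pol_act_one)
  finally have "pol_act (s i) (dem i f) = dem i f" using lin_cr_nonzero[OF i, where 'k = 'k] by simp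
  then show ?thesis using dem_eq_0_iff[OF i dem_PC[OF i f]] by simp
qed

lemma base_dem: "i \<in> I \<Longrightarrow> f \<in> PC \<Longrightarrow> base (dem i f) = dem i (base f :: 'k::{idom, ring_char_0} pol)"
proof (rule dem_unique[symmetric])
  assume i: "i \<in> I" and f: "f \<in> PC"
  have "lin (cr i) * base (dem i f) = (base (lin (cr i) * dem i f) :: 'k pol)" by (simp add: base_mult)
  then show "lin (cr i) * base (dem i f) = base f - pol_act (s i) (base f :: 'k pol)"
    using i f by (simp add: dem_eq base_diff base_pol_act)
qed auto

subsection \<open>Words of Demazure operators\<close>

definition dword :: "'i list \<Rightarrow> 'k::comm_ring_1 pol \<Rightarrow> 'k pol" where
  "dword u f = foldr dem u f"

lemma dword_Nil [simp]: "dword [] f = f"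
  and dword_Cons: "dword (i # u) f = dem i (dword u f)"
  and dword_append: "dword (u @ v) f = dword u (dword v f)"
  by (auto simp: dword_def)

lemma dword_PC [simp]: "u \<in> lists I \<Longrightarrow> f \<in> PC \<Longrightarrow> dword u (f :: 'k::{idom, ring_char_0} pol) \<in> PC"
  by (induction u) (auto simp: dword_Cons)

lemma dword_add: "u \<in> lists I \<Longrightarrow> f \<in> PC \<Longrightarrow> g \<in> PC \<Longrightarrow> dword u (f + g) = dword u f + dword u (g :: 'k::{idom, ring_char_0} pol)"
  by (induction u) (auto simp: dword_Cons dem_add)

lemma dword_0 [simp]: "u \<in> lists I \<Longrightarrow> dword u (0 :: 'k::{idom, ring_char_0} pol) = 0"
  by (induction u) (auto simp: dword_Cons)

lemma base_dword: "u \<in> lists I \<Longrightarrow> f \<in> PC \<Longrightarrow> base (dword u f) = dword u (base f :: 'k::{idom, ring_char_0} pol)"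
  by (induction u) (auto simp: dword_Cons base_dem)

text \<open>A linear form passes through each letter of the word, up to a correction in which it is consumed by
  that letter; the sum collects the corrections, one for every omitted letter.\<close>

lemma dword_leibniz:
  assumes u: "u \<in> lists I" and x: "x \<in> carrier_vec n" and f: "f \<in> PC"
  shows "dword u (lin x * f) = lin (wmat u *\<^sub>v x) * dword u f +
     (\<Sum>k<length u. of_int ((wmat (drop (Suc k) u) *\<^sub>v x) \<bullet> rt (u ! k)) * dword (take k u @ drop (Suc k) u) (f :: 'k::{idom, ring_char_0} pol))"
  using u
proof (induction u)
  case (Cons i u)
  then have iu: "i \<in> I" "u \<in> lists I" by simp_all
  have td: "take k u @ drop (Suc k) u \<in> lists I" for k
    using iu(2) by (auto dest: in_set_takeD in_set_dropD)
  have "dword (i # u) (lin x * f) = dem i (lin (wmat u *\<^sub>v x) * dword u f) +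
     (\<Sum>k<length u. of_int ((wmat (drop (Suc k) u) *\<^sub>v x) \<bullet> rt (u ! k)) * dem i (dword (take k u @ drop (Suc k) u) f))"
    using Cons.IH iu f x td by (simp add: dword_Cons dem_add dem_sum dem_of_int_mult)
  also have "dem i (lin (wmat u *\<^sub>v x) * dword u f) =
     of_int ((wmat u *\<^sub>v x) \<bullet> rt i) * dword u f + lin (wmat (i # u) *\<^sub>v x) * dword (i # u) f"
    using iu f x by (simp add: dem_lin_mult dword_Cons wmat_act_Cons)
  also have "\<dots> + (\<Sum>k<length u. of_int ((wmat (drop (Suc k) u) *\<^sub>v x) \<bullet> rt (u ! k)) * dem i (dword (take k u @ drop (Suc k) u) f)) =
     lin (wmat (i # u) *\<^sub>v x) * dword (i # u) f + (\<Sum>k<length (i # u). of_int ((wmat (drop (Suc k) (i # u)) *\<^sub>v x) \<bullet> rt ((i # u) ! k)) * dword (take k (i # u) @ drop (Suc k) (i # u)) f)"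
    by (simp add: sum.lessThan_Suc_shift dword_Cons del: sum.lessThan_Suc)
  finally show ?case .
qed (use x in simp)

lemma cox_sym: assumes ij: "i \<in> I" "j \<in> I" shows "cox D i j = cox D j i"
proof -
  have *: "cox D j i dvd cox D i j" if "i \<in> I" "j \<in> I" for i j
  proof -
    let ?u = "alt_word (2 * cox D i j) i j"
    have "wmat ?u = wmat []" using cox_dvd_iff[OF that, of "cox D i j"] by simp
    then have "wmat (rev ?u) = wmat (rev [])" using that by (intro s_involution_word) auto
    then show ?thesis using that cox_dvd_iff[of j i "cox D i j"] by (simp add: rev_alt_word)
  qed
  show ?thesis by (rule dvd_antisym) (use * ij in auto)
qed

lemma alt_word_nth: "k < m \<Longrightarrow> alt_word m i j ! k = (if even k then i else j)"
  by (induction m arbitrary: k i j) (auto simp: nth_Cons split: nat.split)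

lemma dword_sq: "a \<in> lists I \<Longrightarrow> b \<in> lists I \<Longrightarrow> e \<in> I \<Longrightarrow> f \<in> PC \<Longrightarrow> dword (a @ [e, e] @ b) (f :: 'k::{idom, ring_char_0} pol) = 0"
  by (simp add: dword_append dword_Cons dem_dem)

text \<open>The neighbours of an inner letter of an alternating word are equal and become adjacent.\<close>

lemma alt_omit_middle:
  assumes ij: "i \<in> I" "j \<in> I" and k: "0 < k" "Suc k < m" and f: "f \<in> PC"
  shows "dword (take k (alt_word m i j) @ drop (Suc k) (alt_word m i j)) (f :: 'k::{idom, ring_char_0} pol) = 0"
proof -
  define u where "u = alt_word m i j"
  have lu: "length u = m" "u \<in> lists I" using ij by (auto simp: u_def)
  obtain l where l: "k = Suc l" using k by (cases k) auto
  have "take k u = take l u @ [u ! l]" using k lu by (simp add: l take_Suc_conv_app_nth)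
  moreover have "drop (Suc k) u = u ! (Suc k) # drop (Suc (Suc k)) u" using k lu by (simp add: Cons_nth_drop_Suc)
  moreover have "u ! Suc k = u ! l" using k by (simp add: u_def alt_word_nth l)
  ultimately have e: "take k u @ drop (Suc k) u = take l u @ [u ! l, u ! l] @ drop (Suc (Suc k)) u" by simp
  have "take l u \<in> lists I" "drop (Suc (Suc k)) u \<in> lists I" "u ! l \<in> I"
    using lu k l by (auto dest: in_set_takeD in_set_dropD)
  then show ?thesis using dword_sq f e by (metis u_def)
qed

lemma alt_leibniz:
  assumes ij: "i \<in> I" "j \<in> I" and m: "m \<ge> 2" and x: "x \<in> carrier_vec n" and f: "f \<in> PC"
  shows "dword (alt_word m i j) (lin x * f) = lin (wmat (alt_word m i j) *\<^sub>v x) * dword (alt_word m i j) f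
     + of_int ((wmat (alt_word (m - 1) j i) *\<^sub>v x) \<bullet> rt i) * dword (alt_word (m - 1) j i) f
     + of_int (x \<bullet> rt (if even m then j else i)) * dword (alt_word (m - 1) i j) (f :: 'k::{idom, ring_char_0} pol)"
proof -
  define u where "u = alt_word m i j"
  have lu: "length u = m" "u \<in> lists I" using ij by (auto simp: u_def)
  define t where "t = (\<lambda>k. of_int ((wmat (drop (Suc k) u) *\<^sub>v x) \<bullet> rt (u ! k)) * dword (take k u @ drop (Suc k) u) f)"
  obtain l where l: "m = Suc (Suc l)" using m by (metis Suc_le_D numeral_2_eq_2 Suc_le_mono)
  have "(\<Sum>k<m. t k) = (\<Sum>k\<in>{0, Suc l}. t k)"
  proof (rule sum.mono_neutral_right)
    show "\<forall>k\<in>{..<m} - {0, Suc l}. t k = 0"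
    proof
      fix k assume "k \<in> {..<m} - {0, Suc l}"
      then have "0 < k" "Suc k < m" using l by auto
      then show "t k = 0" using alt_omit_middle[OF ij _ _ f] by (simp add: t_def u_def)
    qed
  qed (use l in auto)
  then have "(\<Sum>k<m. t k) = t 0 + t (Suc l)" by simp
  moreover have "t 0 = of_int ((wmat (alt_word (m - 1) j i) *\<^sub>v x) \<bullet> rt i) * dword (alt_word (m - 1) j i) f"
    by (simp add: t_def u_def l)
  moreover have "t (Suc l) = of_int (x \<bullet> rt (if even m then j else i)) * dword (alt_word (m - 1) i j) f"
  proof -
    have "drop (Suc (Suc l)) u = []" using lu l by simp
    moreover have "take (Suc l) u = alt_word (m - 1) i j"
      using alt_word_Suc_right[of "Suc l" i j] by (simp add: u_def l del: alt_word.simps)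
    moreover have "u ! Suc l = (if even m then j else i)" by (simp add: u_def l alt_word_nth del: alt_word.simps)
    ultimately show ?thesis using x by (simp add: t_def)
  qed
  ultimately show ?thesis using dword_leibniz[OF lu(2) x f] lu(1) unfolding t_def[symmetric] by (simp add: u_def)
qed

text \<open>Both sides satisfy the same Leibniz rule for multiplication by a linear form: only the outer
  letters of an alternating word contribute, and the coefficients agree by \<open>rank2\<close>, the two terms
  changing places. Both sides vanish on constants, so they agree on all polynomials.\<close>

lemma dword_braid:
  assumes ij: "i \<in> I" "j \<in> I" "i \<noteq> j" and f: "f \<in> PC"
  shows "dword (alt_word (cox D i j) i j) f = dword (alt_word (cox D i j) j i) (f :: 'k::{idom, ring_char_0} pol)"
proof -
  define m where "m = cox D i j"
  have m: "m \<ge> 2" and r1: "rank2_facts i j m" using rank2[OF ij] by (auto simp: m_def)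
  have r2: "rank2_facts j i m" using rank2[OF ij(2,1)] ij cox_sym[of i j] by (auto simp: m_def)
  have I: "alt_word m i j \<in> lists I" "alt_word m j i \<in> lists I" using ij by auto
  show ?thesis unfolding m_def[symmetric] using f
  proof (induction f rule: PC_induct)
    case (Const c)
    obtain m' where "m = Suc m'" using m by (cases m) auto
    moreover have "dword u (Const c :: 'k pol) = 0" if "u \<in> lists I" "u \<noteq> []" for u
      using that by (cases u rule: rev_cases) (auto simp: dword_append dword_Cons)
    ultimately show ?case using I by (metis alt_word.simps(2) list.distinct(1))
  next
    case (add f g)
    then show ?case using I by (simp add: dword_add)
  next
    case (var k f)
    have x: "(unit_vec n k :: int vec) \<in> carrier_vec n" by simp
    have c1: "(wmat (alt_word (m - 1) j i) *\<^sub>v unit_vec n k) \<bullet> rt i = unit_vec n k \<bullet> rt (if even m then i else j)"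
      using r1 x by (auto simp: rank2_facts_def)
    have c2: "(wmat (alt_word (m - 1) i j) *\<^sub>v unit_vec n k) \<bullet> rt j = unit_vec n k \<bullet> rt (if even m then j else i)"
      using r2 x by (auto simp: rank2_facts_def)
    have w: "wmat (alt_word m i j) = wmat (alt_word m j i)" using r1 by (auto simp: rank2_facts_def)
    show ?case unfolding alt_leibniz[OF ij(1,2) m x var(2)] alt_leibniz[OF ij(2,1) m x var(2)] c1 c2 w var(3)
      by (simp add: add_ac)
  qed
qed

lemma dword_nonreduced:
  assumes "u \<in> lists I" "\<not> reduced u" "f \<in> PC" shows "dword u (f :: 'k::{idom, ring_char_0} pol) = 0"
proof -
  have "dword (u @ []) f = 0"
  proof (rule nonreduced_zero[of "\<lambda>u. dword u f"])
    fix a b i j assume "b \<in> lists I" "i \<in> I" "j \<in> I" "i \<noteq> j"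
    then show "dword (a @ alt_word (cox D i j) i j @ b) f = dword (a @ alt_word (cox D i j) j i @ b) f"
      using dword_braid[of i j "dword b f"] assms(3) by (simp add: dword_append)
  qed (use assms dword_sq in auto)
  then show ?thesis by simp
qed

subsection \<open>Degrees\<close>

abbreviation "G \<equiv> Pol_grade D"

definition edeg :: "(nat \<Rightarrow>\<^sub>0 nat) \<Rightarrow> int" where
  "edeg m = 2 * int (\<Sum>j\<in>Poly_Mapping.keys m. Poly_Mapping.lookup m j)"

lemma edeg_super: "finite A \<Longrightarrow> Poly_Mapping.keys m \<subseteq> A \<Longrightarrow> edeg m = 2 * int (\<Sum>j\<in>A. Poly_Mapping.lookup m j)"
  unfolding edeg_def by (subst sum.mono_neutral_left[of A]) (auto simp: in_keys_iff)

lemma edeg_add: "edeg (a + b) = edeg a + edeg b"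
proof -
  define A where "A = Poly_Mapping.keys a \<union> Poly_Mapping.keys b"
  have "finite A" "Poly_Mapping.keys (a + b) \<subseteq> A" "Poly_Mapping.keys a \<subseteq> A" "Poly_Mapping.keys b \<subseteq> A"
    using keys_add[of a b] by (auto simp: A_def)
  then show ?thesis by (simp add: edeg_super[of A] lookup_add sum.distrib)
qed

lemma edeg_0 [simp]: "edeg 0 = 0" and edeg_single [simp]: "edeg (Poly_Mapping.single k (Suc 0)) = 2"
  by (auto simp: edeg_def)

lemma edeg_ge_0: "edeg m \<ge> 0"
  by (simp add: edeg_def sum_nonneg)

lemma G_iff: "f \<in> G d \<longleftrightarrow> f \<in> PC \<and> (\<forall>m\<in>Poly_Mapping.keys f. edeg m = d)"
  unfolding Pol_grade_def edeg_def[symmetric] by auto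

lemma G_PC: "f \<in> G d \<Longrightarrow> f \<in> PC"
  by (simp add: G_iff)

lemma G_0 [simp]: "0 \<in> G d" by (simp add: G_iff)
lemma G_add: "f \<in> G d \<Longrightarrow> g \<in> G d \<Longrightarrow> f + g \<in> G d"
  using keys_add[of f g] by (auto simp: G_iff)
lemma G_uminus: "f \<in> G d \<Longrightarrow> - f \<in> G d"
  by (auto simp: G_iff in_keys_iff)
lemma G_sum: "(\<And>a. a \<in> A \<Longrightarrow> f a \<in> G d) \<Longrightarrow> sum f A \<in> G d"
  by (induction A rule: infinite_finite_induct) (auto intro: G_add)
lemma G_mult: assumes "f \<in> G d" "g \<in> G e" shows "f * g \<in> G (d + e)"
  unfolding G_iff
proof (intro conjI ballI)
  fix m assume "m \<in> Poly_Mapping.keys (f * g)"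
  then obtain a b where "m = a + b" "a \<in> Poly_Mapping.keys f" "b \<in> Poly_Mapping.keys g" using keys_mult[of f g] by auto
  then show "edeg m = d + e" using assms by (auto simp: G_iff edeg_add)
qed (use assms in \<open>auto simp: G_iff\<close>)
lemma G_Const [simp]: "Const c \<in> G 0" by (auto simp: G_iff keys_single)
lemma G_of_int [simp]: "of_int c \<in> G 0" unfolding of_int_Const by (rule G_Const)
lemma G_Const_mult: "f \<in> G d \<Longrightarrow> Const c * f \<in> G d"
  using G_mult[OF G_Const, of f d c] by simp
lemma G_of_int_mult: "f \<in> G d \<Longrightarrow> of_int c * f \<in> G d"
  using G_mult[OF G_of_int, of f d c] by simp
lemma G_var: "k < n \<Longrightarrow> var k \<in> G 2"
  unfolding G_iff using PC_var[of k] by (auto simp: var_def)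
lemma G_lin: "x \<in> carrier_vec n \<Longrightarrow> lin x \<in> G 2"
  by (subst lin_alt[of x n], simp, intro G_sum G_of_int_mult G_var) simp
lemma G_neg: "f \<in> G d \<Longrightarrow> d < 0 \<Longrightarrow> f = 0"
proof -
  assume "f \<in> G d" "d < 0"
  then have "m \<notin> Poly_Mapping.keys f" for m using edeg_ge_0[of m] by (auto simp: G_iff)
  then have "Poly_Mapping.keys f = {}" by blast
  then show ?thesis by (metis pm_sum sum.empty)
qed

lemma G_lookup: "f \<in> G d \<Longrightarrow> edeg m \<noteq> d \<Longrightarrow> Poly_Mapping.lookup f m = 0"
  by (auto simp: G_iff in_keys_iff)

lemma G_single: "Poly_Mapping.keys m \<subseteq> {..<n} \<Longrightarrow> edeg m = d \<Longrightarrow> Poly_Mapping.single m c \<in> G d"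
  by (auto simp: G_iff PC_single)

lemma G_induct [consumes 1, case_names zero Const add var]:
  fixes f :: "'k::comm_ring_1 pol"
  assumes "f \<in> G d" and z: "\<And>d. P d 0" and c: "\<And>c. P 0 (Const c)"
    and a: "\<And>f g d. f \<in> G d \<Longrightarrow> g \<in> G d \<Longrightarrow> P d f \<Longrightarrow> P d g \<Longrightarrow> P d (f + g)"
    and v: "\<And>k f d. k < n \<Longrightarrow> f \<in> G d \<Longrightarrow> P d f \<Longrightarrow> P (d + 2) (lin (unit_vec n k) * f)"
  shows "P d f"
proof -
  have s: "P (edeg m) (Poly_Mapping.single m c)" if "Poly_Mapping.keys m \<subseteq> {..<n}" for m c
    using that
  proof (induction m rule: exp_n_induct)
    case (step m k)
    have 1: "Poly_Mapping.single (Poly_Mapping.single k 1 + m) c = lin (unit_vec n k) * Poly_Mapping.single m c"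
      by (simp only: single_var_mult lin_unit[OF step(2)])
    have 2: "edeg (Poly_Mapping.single k 1 + m) = edeg m + 2" by (simp add: edeg_add)
    show ?case unfolding 1 2 using v step G_single[OF step(1) refl] by blast
  qed (use c in simp)
  have "f \<in> G d \<and> P d f"
  proof (induction f rule: pm_induct)
    case (single m c)
    then have "Poly_Mapping.keys m \<subseteq> {..<n}" "edeg m = d" using assms(1) by (auto simp: G_iff PC_def)
    then show ?case using s G_single by blast
  qed (use z a G_add in auto)
  then show ?thesis by blast
qed

lemma dem_G: assumes i: "i \<in> I" and f: "f \<in> G d" shows "dem i (f :: 'k::{idom, ring_char_0} pol) \<in> G (d - 2)"
  using f
proof (induction d f rule: G_induct)
  case (var k f d)
  have "lin (s i *\<^sub>v unit_vec n k) * dem i f \<in> G (2 + (d - 2))" using var by (intro G_mult G_lin) auto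
  then show ?case using var i G_PC[OF var(2)] by (auto simp: dem_lin_mult intro: G_add G_of_int_mult)
next
  case (add f g d)
  then show ?case using i G_PC[OF add(1)] G_PC[OF add(2)] by (simp add: dem_add G_add)
qed (use i in auto)

lemma dword_G: "u \<in> lists I \<Longrightarrow> f \<in> G d \<Longrightarrow> dword u (f :: 'k::{idom, ring_char_0} pol) \<in> G (d - 2 * int (length u))"
proof (induction u)
  case (Cons i u)
  then have "dem i (dword u f) \<in> G (d - 2 * int (length u) - 2)" by (intro dem_G) auto
  then show ?case by (simp add: dword_Cons algebra_simps)
qed simp

lemma lin_power_G: "x \<in> carrier_vec n \<Longrightarrow> lin x ^ l \<in> G (2 * int l)"
proof (induction l)
  case 0
  then show ?case using G_of_int[of 1] by simp
next
  case (Suc l)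
  then show ?case using G_mult[OF G_lin[of x] Suc.IH] by (simp add: algebra_simps)
qed

text \<open>Chevalley's formula. By degree, applying the Leibniz rule to a power of \<open>x\<close> leaves only terms with
  an omitted letter. Their coefficients are positive for regular dominant \<open>x\<close>, a term whose
  remaining word is not reduced vanishes, and omitting the first letter leaves a reduced word.\<close>

lemma dword_power_pos:
  assumes x: "x \<in> carrier_vec n" "\<And>i. i \<in> I \<Longrightarrow> x \<bullet> rt i > 0" and "reduced u"
  shows "\<exists>c>0. dword u (lin x ^ length u :: 'k::{idom, ring_char_0} pol) = of_int c"
  using assms(3)
proof (induction "length u" arbitrary: u)
  case 0
  then show ?case by (intro exI[of _ 1]) simp
next
  case (Suc l)
  have u: "u \<in> lists I" using Suc.prems by (simp add: reduced_def)
  have lu: "length u = Suc l" using Suc.hyps by simp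
  define om where "om = (\<lambda>k. take k u @ drop (Suc k) u)"
  define c where "c = (\<lambda>k. (wmat (drop (Suc k) u) *\<^sub>v x) \<bullet> rt (u ! k))"
  have omI: "om k \<in> lists I" "k < length u \<Longrightarrow> length (om k) = l" for k
    using u lu by (auto simp: om_def dest: in_set_takeD in_set_dropD)
  have cpos: "c k > 0" if "k < length u" for k
  proof -
    have "u = take k u @ (u ! k # drop (Suc k) u)" using that by (simp add: id_take_nth_drop[symmetric])
    then have "reduced (u ! k # drop (Suc k) u)" using Suc.prems reduced_appendD(2) by metis
    then show ?thesis unfolding c_def using regular_pos x by blast
  qed
  have "\<exists>e\<ge>0. dword (om k) (lin x ^ l :: 'k pol) = of_int e \<and> (reduced (om k) \<longrightarrow> e > 0)" if k: "k < length u" for k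
  proof (cases "reduced (om k)")
    case True
    then show ?thesis using Suc.hyps(1)[of "om k"] omI(2)[OF k] by (auto intro: less_imp_le)
  next
    case False
    then have "dword (om k) (lin x ^ l :: 'k pol) = 0" using x by (intro dword_nonreduced omI) auto
    then show ?thesis using False by (intro exI[of _ 0]) simp
  qed
  then obtain e where e: "\<And>k. k < length u \<Longrightarrow> e k \<ge> 0 \<and> dword (om k) (lin x ^ l :: 'k pol) = of_int (e k) \<and> (reduced (om k) \<longrightarrow> e k > 0)"
    by metis
  have "dword u (lin x ^ l :: 'k pol) \<in> G (2 * int l - 2 * int (length u))" by (intro dword_G lin_power_G u x)
  \<comment> \<open>The degree of \<open>x ^ l\<close> is too small for the whole word.\<close>
  then have z: "dword u (lin x ^ l :: 'k pol) = 0" using lu by (auto intro: G_neg)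
  have "dword u (lin x ^ length u :: 'k pol) = (\<Sum>k<length u. of_int (c k) * dword (om k) (lin x ^ l))"
    using dword_leibniz[OF u x(1), of "lin x ^ l :: 'k pol"] x z lu by (simp add: c_def om_def del: sum.lessThan_Suc)
  also have "\<dots> = of_int (\<Sum>k<length u. c k * e k)" using e by simp
  finally have 1: "dword u (lin x ^ length u :: 'k pol) = of_int (\<Sum>k<length u. c k * e k)" .
  have "om 0 = drop 1 u" "u = take 1 u @ drop 1 u" by (auto simp: om_def)
  then have "reduced (om 0)" using Suc.prems reduced_appendD(2) by metis
  then have "c 0 * e 0 > 0" using e[of 0] cpos[of 0] lu by simp
  then have "(\<Sum>k<length u. c k * e k) > 0"
    using e cpos lu by (intro sum_pos2[of _ 0]) (auto intro!: mult_nonneg_nonneg less_imp_le[OF cpos])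
  then show ?case using 1 by blast
qed

subsection \<open>Invariants\<close>

definition Inv :: "'k::comm_ring_1 pol set" where
  "Inv = {f \<in> PC. \<forall>w\<in>W. pol_act w f = f}"

lemma Inv_PC: "f \<in> Inv \<Longrightarrow> f \<in> PC"
  by (simp add: Inv_def)

lemma Inv_iff: "f \<in> Inv \<longleftrightarrow> f \<in> PC \<and> (\<forall>i\<in>I. dem i (f :: 'k::{idom, ring_char_0} pol) = 0)"
proof
  assume "f \<in> Inv"
  then show "f \<in> PC \<and> (\<forall>i\<in>I. dem i f = 0)" using W_s by (auto simp: Inv_def dem_eq_0_iff)
next
  assume f: "f \<in> PC \<and> (\<forall>i\<in>I. dem i f = 0)"
  have "pol_act (wmat u) f = f" if "u \<in> lists I" for u
    using that
  proof (induction u)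
    case Nil
    then show ?case using f by (simp add: pol_act_one)
  next
    case (Cons i u)
    have "pol_act (wmat (i # u)) f = pol_act (s i) (pol_act (wmat u) f)" using f by (simp add: wmat_Cons pol_act_comp)
    moreover have "pol_act (wmat u) f = f" "pol_act (s i) f = f" using Cons f dem_eq_0_iff[of i f] by auto
    ultimately show ?case by simp
  qed
  then show "f \<in> Inv" using f by (auto simp: Inv_def W_eq)
qed

lemma Inv_Invar: "Invar D = Inv"
  by (simp add: Invar_def Inv_def)

lemma Inv_0 [simp]: "0 \<in> Inv" by (simp add: Inv_def)
lemma Inv_Const [simp]: "Const c \<in> Inv" by (simp add: Inv_def)
lemma Inv_1 [simp]: "1 \<in> Inv" using Inv_Const[of 1] by simp
lemma Inv_add: "f \<in> Inv \<Longrightarrow> g \<in> Inv \<Longrightarrow> f + g \<in> Inv" by (simp add: Inv_def pol_act_add)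
lemma Inv_uminus: "f \<in> Inv \<Longrightarrow> - f \<in> Inv" by (simp add: Inv_def pol_act_uminus)
lemma dem_Inv: "i \<in> I \<Longrightarrow> l \<in> Inv \<Longrightarrow> f \<in> PC \<Longrightarrow> dem i (l * f) = l * dem i (f :: 'k::{idom, ring_char_0} pol)"
proof -
  assume i: "i \<in> I" and l: "l \<in> Inv" and f: "f \<in> PC"
  have "pol_act (s i) l = l" using l W_s[OF i] by (simp add: Inv_def)
  moreover have "dem i l = 0" using Inv_iff l i by blast
  ultimately show ?thesis using i f Inv_PC[OF l] by (simp add: dem_mult)
qed

lemma dword_Inv: "u \<in> lists I \<Longrightarrow> l \<in> Inv \<Longrightarrow> f \<in> PC \<Longrightarrow> dword u (l * f) = l * dword u (f :: 'k::{idom, ring_char_0} pol)"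
  by (induction u) (auto simp: dword_Cons dem_Inv Inv_PC)

text \<open>Clearing the denominators of an invariant leaves it invariant.\<close>

lemma InvarQ_eq: "InvarQ D = (Inv :: rat pol set)"
proof (intro equalityI subsetI)
  fix g assume "g \<in> InvarQ D"
  then obtain q f where "f \<in> Invar D" "g = Const q * base f" by (auto simp: InvarQ_def base_def)
  then show "g \<in> Inv" by (auto simp: Inv_Invar Inv_def pol_act_mult simp flip: base_pol_act)
next
  fix g :: "rat pol" assume g: "g \<in> Inv"
  obtain d f where d: "d > 0" "of_int d * g = base f" "Poly_Mapping.keys f = Poly_Mapping.keys g"
    using rat_pol_denominator[of g] by auto
  have "base (pol_act w f) = (base f :: rat pol)" if "w \<in> W" for w
    using g that by (auto simp: base_pol_act pol_act_mult Inv_def simp flip: d(2))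
  then have "f \<in> Invar D" using g d(3) by (auto simp: Inv_Invar Inv_def PC_def)
  moreover have "g = Const (1 / of_int d) * base f"
  proof -
    have "Const (1 / of_int d) * base f = (Const (1 / of_int d) * Const (of_int d)) * g"
      unfolding d(2)[symmetric] of_int_Const by (simp add: mult.assoc del: single_of_int)
    also have "\<dots> = g" using d(1) by (simp add: mult_single del: single_of_int)
    finally show ?thesis by simp
  qed
  ultimately show "g \<in> InvarQ D" unfolding InvarQ_def base_def by blast
qed

end

section \<open>Monoid rings, quotients and tensor products of rings\<close>

lemma frag_extend_fun_add: "frag_extend (\<lambda>x. f x + g x) c = frag_extend f c + frag_extend g c"
  by (simp add: frag_extend_def frag_cmul_distrib2 sum.distrib)

lemma frag_extend_fun_diff: "frag_extend (\<lambda>x. f x - g x) c = frag_extend f c - frag_extend g c"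
proof -
  have "frag_extend (\<lambda>x. f x - g x) c + frag_extend g c = frag_extend f c"
    by (simp flip: frag_extend_fun_add)
  then show ?thesis by (simp add: eq_diff_eq)
qed

lemma frag_extend_fun_0: "frag_extend (\<lambda>x. 0) c = 0"
  by (simp add: frag_extend_def)

lemma monoid_ring_simps:
  "carrier (monoid_ring G) = {c. Poly_Mapping.keys c \<subseteq> carrier G}"
  "ring.zero (monoid_ring G) = 0"
  "ring.add (monoid_ring G) = (+)"
  "monoid.one (monoid_ring G) = frag_of \<one>\<^bsub>G\<^esub>"
  by (auto simp: monoid_ring_def)

lemma frag_cmul_frag_of: "frag_cmul a (frag_of x) = Poly_Mapping.single x a"
  by (rule poly_mapping_eqI) (simp add: lookup_single when_def)

lemma frag_cmul_sum_right: "frag_cmul a (sum f A) = (\<Sum>x\<in>A. frag_cmul a (f x))"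
  by (induction A rule: infinite_finite_induct) (auto simp: frag_cmul_distrib2)

lemma monoid_ring_mult:
  "c \<otimes>\<^bsub>monoid_ring G\<^esub> d = frag_extend (\<lambda>g. frag_extend (\<lambda>h. frag_of (g \<otimes>\<^bsub>G\<^esub> h)) d) c"
  unfolding monoid_ring_def frag_extend_def frag_cmul_sum_right frag_cmul_cmul by (simp add: frag_cmul_frag_of)

lemma monoid_ring_frag_mult: "frag_of g \<otimes>\<^bsub>monoid_ring G\<^esub> frag_of h = frag_of (g \<otimes>\<^bsub>G\<^esub> h)"
  by (simp add: monoid_ring_mult)

lemma monoid_ring_mult_bilinear:
  "(a + b) \<otimes>\<^bsub>monoid_ring G\<^esub> c = a \<otimes>\<^bsub>monoid_ring G\<^esub> c + b \<otimes>\<^bsub>monoid_ring G\<^esub> c"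
  "c \<otimes>\<^bsub>monoid_ring G\<^esub> (a + b) = c \<otimes>\<^bsub>monoid_ring G\<^esub> a + c \<otimes>\<^bsub>monoid_ring G\<^esub> b"
  "(a - b) \<otimes>\<^bsub>monoid_ring G\<^esub> c = a \<otimes>\<^bsub>monoid_ring G\<^esub> c - b \<otimes>\<^bsub>monoid_ring G\<^esub> c"
  "c \<otimes>\<^bsub>monoid_ring G\<^esub> (a - b) = c \<otimes>\<^bsub>monoid_ring G\<^esub> a - c \<otimes>\<^bsub>monoid_ring G\<^esub> b"
  "0 \<otimes>\<^bsub>monoid_ring G\<^esub> c = 0" "c \<otimes>\<^bsub>monoid_ring G\<^esub> 0 = 0"
  by (auto simp: monoid_ring_mult frag_extend_add frag_extend_diff frag_extend_fun_add frag_extend_fun_diff frag_extend_fun_0)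

lemma keys_frag_diff: "Poly_Mapping.keys a \<subseteq> S \<Longrightarrow> Poly_Mapping.keys b \<subseteq> S \<Longrightarrow> Poly_Mapping.keys (a - b) \<subseteq> S"
  for a b :: "'a \<Rightarrow>\<^sub>0 int"
  using keys_diff[of a b] by blast

lemma monoid_ring_ring: assumes "monoid G" shows "ring (monoid_ring G)"
proof -
  interpret G: monoid G by fact
  let ?M = "monoid_ring G"
  have cl: "c \<otimes>\<^bsub>?M\<^esub> d \<in> carrier ?M" if "c \<in> carrier ?M" "d \<in> carrier ?M" for c d
  proof -
    have "Poly_Mapping.keys c \<subseteq> carrier G" "Poly_Mapping.keys d \<subseteq> carrier G" using that by (auto simp: monoid_ring_simps)
    then have "Poly_Mapping.keys (c \<otimes>\<^bsub>?M\<^esub> d) \<subseteq> carrier G"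
      unfolding monoid_ring_mult by (intro subset_trans[OF keys_frag_extend] UN_least) (auto simp: keys_single)
    then show ?thesis by (simp add: monoid_ring_simps)
  qed
  have assoc: "(a \<otimes>\<^bsub>?M\<^esub> b) \<otimes>\<^bsub>?M\<^esub> c = a \<otimes>\<^bsub>?M\<^esub> (b \<otimes>\<^bsub>?M\<^esub> c)"
    if "Poly_Mapping.keys a \<subseteq> carrier G" "Poly_Mapping.keys b \<subseteq> carrier G" "Poly_Mapping.keys c \<subseteq> carrier G" for a b c
    using that(1)
  proof (induction a rule: frag_induction)
    case (one x)
    show ?case using that(2)
    proof (induction b rule: frag_induction)
      case (one y)
      show ?case using that(3)
      proof (induction c rule: frag_induction)
        case (one z)
        then show ?case using \<open>x \<in> carrier G\<close> \<open>y \<in> carrier G\<close> by (simp add: monoid_ring_frag_mult G.m_assoc)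
      qed (simp_all add: monoid_ring_mult_bilinear)
    qed (simp_all add: monoid_ring_mult_bilinear)
  qed (simp_all add: monoid_ring_mult_bilinear)
  have one: "frag_of \<one>\<^bsub>G\<^esub> \<otimes>\<^bsub>?M\<^esub> a = a \<and> a \<otimes>\<^bsub>?M\<^esub> frag_of \<one>\<^bsub>G\<^esub> = a" if "Poly_Mapping.keys a \<subseteq> carrier G" for a
    using that by (induction a rule: frag_induction) (auto simp: monoid_ring_frag_mult monoid_ring_mult_bilinear)
  show ?thesis
  proof (rule ringI)
    show "abelian_group ?M"
    proof (rule abelian_groupI)
      fix x assume "x \<in> carrier ?M"
      then show "\<exists>y\<in>carrier ?M. y \<oplus>\<^bsub>?M\<^esub> x = \<zero>\<^bsub>?M\<^esub>"
        by (intro bexI[of _ "- x"]) (auto simp: monoid_ring_simps)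
    qed (use keys_add in \<open>auto simp: monoid_ring_simps add_ac dest!: subsetD[OF keys_add]\<close>)
    show "monoid ?M"
      by (rule monoidI) (use cl assoc one in \<open>auto simp: monoid_ring_simps\<close>)
  qed (auto simp: monoid_ring_simps monoid_ring_mult_bilinear)
qed

lemma add_monoid_monoid_ring: "add_monoid (monoid_ring G) = free_Abelian_group (carrier G)"
  by (simp add: monoid_ring_def free_Abelian_group_def)

lemma ring_add_comm_group: "ring R \<Longrightarrow> comm_group (add_monoid R)"
  using abelian_group.a_comm_group ring.is_abelian_group by blast

lemma ring_add_group: "ring R \<Longrightarrow> group (add_monoid R)"
  using ring_add_comm_group comm_group.axioms(2) by blast

lemma ring_homD_add: assumes "ring R" "ring S" "h \<in> ring_hom R S" shows "h \<in> hom (add_monoid R) (add_monoid S)"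
  using assms(3) by (auto simp: ring_hom_def hom_def)

lemma add_hom_inv:
  assumes "ring R" "group H" "h \<in> hom (add_monoid R) H" "x \<in> carrier R" shows "h (\<ominus>\<^bsub>R\<^esub> x) = inv\<^bsub>H\<^esub> (h x)"
proof -
  interpret group_hom "add_monoid R" H h
    using assms ring_add_group by (auto simp: group_hom_def group_hom_axioms_def)
  show ?thesis using hom_inv[of x] assms(4) by (simp add: a_inv_def)
qed

lemma generate_hom_into:
  assumes G: "group G" and H: "group H" and h: "h \<in> hom G H" and A: "A \<subseteq> carrier G"
    and K: "subgroup K H" and AK: "\<And>a. a \<in> A \<Longrightarrow> h a \<in> K" and x: "x \<in> generate G A"
  shows "h x \<in> K"
proof -
  interpret h: group_hom G H h using G H h by (simp add: group_hom_def group_hom_axioms_def)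
  have c: "y \<in> carrier G" if "y \<in> generate G A" for y using group.generate_in_carrier[OF G A that] .
  show ?thesis using x
  proof induction
    case one
    then show ?case using subgroup.one_closed[OF K] by simp
  next
    case (incl a)
    then show ?case using AK by simp
  next
    case (inv a)
    then show ?case using AK subgroup.m_inv_closed[OF K] A by auto
  next
    case (eng a b)
    then show ?case using subgroup.m_closed[OF K] c by simp
  qed
qed

lemma mult_generate:
  assumes R: "ring R" and A: "A \<subseteq> carrier R" and B: "B \<subseteq> carrier R" and C: "subgroup C (add_monoid R)"
    and m: "\<And>a b. a \<in> A \<Longrightarrow> b \<in> B \<Longrightarrow> a \<otimes>\<^bsub>R\<^esub> b \<in> C"
    and x: "x \<in> generate (add_monoid R) A" and y: "y \<in> generate (add_monoid R) B"
  shows "x \<otimes>\<^bsub>R\<^esub> y \<in> C"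
proof -
  interpret R: ring R by fact
  note g = ring_add_group[OF R]
  have yc: "y \<in> carrier R" using group.generate_in_carrier[OF g _ y] B by simp
  show ?thesis
  proof (rule generate_hom_into[OF g g _ _ C _ x, of "\<lambda>x. x \<otimes>\<^bsub>R\<^esub> y"])
    show "(\<lambda>x. x \<otimes>\<^bsub>R\<^esub> y) \<in> hom (add_monoid R) (add_monoid R)" using yc by (intro homI) (auto simp: R.l_distr)
    fix a assume a: "a \<in> A"
    show "a \<otimes>\<^bsub>R\<^esub> y \<in> C"
    proof (rule generate_hom_into[OF g g _ _ C _ y, of "\<lambda>y. a \<otimes>\<^bsub>R\<^esub> y"])
      show "(\<lambda>y. a \<otimes>\<^bsub>R\<^esub> y) \<in> hom (add_monoid R) (add_monoid R)" using a A by (intro homI) (auto simp: R.r_distr)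
    qed (use a m B in auto)
  qed (use A in auto)
qed

lemma monoid_ring_add_hom:
  assumes "comm_group H" "\<And>g. g \<in> carrier G \<Longrightarrow> \<phi> g \<in> carrier H"
  shows "\<exists>h\<in>hom (add_monoid (monoid_ring G)) H. \<forall>g\<in>carrier G. h (frag_of g) = \<phi> g"
proof -
  interpret comm_group H by fact
  show ?thesis using free_Abelian_group_universal[of \<phi> "carrier G"] assms(2)
    unfolding add_monoid_monoid_ring by (metis image_subset_iff)
qed

lemma add_monoid_inv_monoid_ring: "x \<in> carrier (monoid_ring G) \<Longrightarrow> inv\<^bsub>add_monoid (monoid_ring G)\<^esub> x = - x"
  unfolding add_monoid_monoid_ring by (rule inv_free_Abelian_group) (simp add: monoid_ring_simps)

lemma monoid_ring_induct [consumes 2, case_names one diff]: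
  assumes "c \<in> carrier (monoid_ring G)" "monoid G"
    and "\<And>g. g \<in> carrier G \<Longrightarrow> P (frag_of g)"
    and "\<And>a b. a \<in> carrier (monoid_ring G) \<Longrightarrow> b \<in> carrier (monoid_ring G) \<Longrightarrow> P a \<Longrightarrow> P b \<Longrightarrow> P (a - b)"
  shows "P c"
proof -
  interpret monoid G by fact
  have f: "frag_of g \<in> carrier (monoid_ring G)" if "g \<in> carrier G" for g using that by (simp add: monoid_ring_simps keys_single)
  have "P (frag_of \<one>\<^bsub>G\<^esub> - frag_of \<one>\<^bsub>G\<^esub>)" using f assms by blast
  then have P0: "P 0" by simp
  have "Poly_Mapping.keys c \<subseteq> carrier G" using assms(1) by (simp add: monoid_ring_simps)
  then have "c \<in> carrier (monoid_ring G) \<and> P c"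
  proof (induction c rule: frag_induction)
    case (diff a b)
    then show ?case using assms(4)[of a b] keys_frag_diff[of a "carrier G" b] by (simp add: monoid_ring_simps)
  qed (use P0 f assms(3) in \<open>auto simp: monoid_ring_simps\<close>)
  then show ?thesis by blast
qed

lemma hom_frag_diff_eq:
  assumes "group H" "h \<in> hom (add_monoid (monoid_ring G)) H" "monoid G"
   "a \<in> carrier (monoid_ring G)" "b \<in> carrier (monoid_ring G)"
  shows "h (a - b) = h a \<otimes>\<^bsub>H\<^esub> inv\<^bsub>H\<^esub> h b"
proof -
  interpret M: ring "monoid_ring G" using monoid_ring_ring assms by blast
  have "a - b = a \<oplus>\<^bsub>monoid_ring G\<^esub> (\<ominus>\<^bsub>monoid_ring G\<^esub> b)"
    using assms add_monoid_inv_monoid_ring[of b G] by (simp add: monoid_ring_simps a_inv_def)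
  then have "h (a - b) = h a \<otimes>\<^bsub>H\<^esub> h (\<ominus>\<^bsub>monoid_ring G\<^esub> b)"
    using assms hom_mult[OF assms(2), of a "\<ominus>\<^bsub>monoid_ring G\<^esub> b"] by simp
  then show ?thesis using add_hom_inv[OF M.ring_axioms assms(1,2,5)] by simp
qed

text \<open>The additive extension of \<open>\<phi>\<close> exists because the additive group is free, and its multiplicativity is
  biadditive, hence can be checked on basis elements.\<close>

lemma monoid_ring_hom:
  assumes G: "monoid G" and R: "ring R" and \<phi>: "\<phi> \<in> hom G R" "\<phi> \<one>\<^bsub>G\<^esub> = \<one>\<^bsub>R\<^esub>"
  shows "\<exists>h\<in>ring_hom (monoid_ring G) R. \<forall>g\<in>carrier G. h (frag_of g) = \<phi> g"
proof -
  interpret M: ring "monoid_ring G" using monoid_ring_ring G by blast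
  interpret G: monoid G by fact
  interpret R: ring R by fact
  have gR: "group (add_monoid R)" using ring_add_group R by blast
  obtain h where h: "h \<in> hom (add_monoid (monoid_ring G)) (add_monoid R)" "\<And>g. g \<in> carrier G \<Longrightarrow> h (frag_of g) = \<phi> g"
    using monoid_ring_add_hom[of "add_monoid R" G \<phi>] ring_add_comm_group[OF R] hom_in_carrier[OF \<phi>(1)] by auto
  have hc: "h a \<in> carrier R" if "a \<in> carrier (monoid_ring G)" for a using hom_in_carrier[OF h(1)] that by simp
  have hd: "h (a - b) = h a \<oplus>\<^bsub>R\<^esub> (\<ominus>\<^bsub>R\<^esub> h b)" if "a \<in> carrier (monoid_ring G)" "b \<in> carrier (monoid_ring G)" for a b
    using hom_frag_diff_eq[OF gR h(1) G that] by (simp add: a_inv_def)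
  have mult: "h (a \<otimes>\<^bsub>monoid_ring G\<^esub> b) = h a \<otimes>\<^bsub>R\<^esub> h b"
    if a: "a \<in> carrier (monoid_ring G)" and b: "b \<in> carrier (monoid_ring G)" for a b
    using a G
  proof (induction a rule: monoid_ring_induct)
    case (one g)
    show ?case using b G
    proof (induction b rule: monoid_ring_induct)
      case (one g')
      then show ?case using \<open>g \<in> carrier G\<close> h(2) hom_mult[OF \<phi>(1)] by (simp add: monoid_ring_frag_mult)
    next
      case (diff a b)
      have g: "frag_of g \<in> carrier (monoid_ring G)" using one by (simp add: monoid_ring_simps keys_single)
      show ?case using diff hd[of a b] hd[OF M.m_closed[OF g diff(1)] M.m_closed[OF g diff(2)]] hc g
        by (simp add: monoid_ring_mult_bilinear R.r_distr R.r_minus)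
    qed
  next
    case (diff a c)
    show ?case using diff hd[of a c] hd[OF M.m_closed[OF diff(1) b] M.m_closed[OF diff(2) b]] hc b
      by (simp add: monoid_ring_mult_bilinear R.l_distr R.l_minus)
  qed
  have "h \<in> ring_hom (monoid_ring G) R"
  proof (rule ring_hom_memI)
    show "h (x \<oplus>\<^bsub>monoid_ring G\<^esub> y) = h x \<oplus>\<^bsub>R\<^esub> h y" if "x \<in> carrier (monoid_ring G)" "y \<in> carrier (monoid_ring G)" for x y
      using hom_mult[OF h(1)] that by simp
    show "h \<one>\<^bsub>monoid_ring G\<^esub> = \<one>\<^bsub>R\<^esub>" using h(2) \<phi>(2) by (simp add: monoid_ring_simps)
  qed (use hc mult in auto)
  then show ?thesis using h(2) by blast
qed

lemma quot_carrier: "carrier (R Quot J) = {(a_r_coset R J x) | x. x \<in> carrier R}"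
  by (auto simp: FactRing_def A_RCOSETS_def' )

lemma quot_add_hom:
  assumes J: "ideal J R" and H: "group H" and h: "h \<in> hom (add_monoid R) H" and z: "\<And>x. x \<in> J \<Longrightarrow> h x = \<one>\<^bsub>H\<^esub>"
  shows "\<exists>k\<in>hom (add_monoid (R Quot J)) H. \<forall>x\<in>carrier R. k ((a_r_coset R J x)) = h x"
proof -
  interpret J: ideal J R by fact
  interpret H: group H by fact
  define k where "k = (\<lambda>U. h (SOME x. x \<in> U))"
  have k: "k ((a_r_coset R J x)) = h x" if x: "x \<in> carrier R" for x
  proof -
    have "x \<in> (a_r_coset R J x)" using J.a_rcos_self x by blast
    then have "(SOME y. y \<in> (a_r_coset R J x)) \<in> (a_r_coset R J x)" by (rule someI)
    then obtain j where j: "j \<in> J" "(SOME y. y \<in> (a_r_coset R J x)) = j \<oplus>\<^bsub>R\<^esub> x" by (auto simp: a_r_coset_def')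
    have "h (j \<oplus>\<^bsub>R\<^esub> x) = h j \<otimes>\<^bsub>H\<^esub> h x" using hom_mult[OF h, of j x] j x by simp
    then show ?thesis using z[OF j(1)] j hom_in_carrier[OF h, of x] x by (simp add: k_def)
  qed
  have "k \<in> hom (add_monoid (R Quot J)) H"
  proof (rule homI)
    fix U assume "U \<in> carrier (add_monoid (R Quot J))"
    then show "k U \<in> carrier H" using hom_in_carrier[OF h] k by (auto simp: quot_carrier)
  next
    fix U V assume "U \<in> carrier (add_monoid (R Quot J))" "V \<in> carrier (add_monoid (R Quot J))"
    then obtain x y where xy: "x \<in> carrier R" "y \<in> carrier R" "U = (a_r_coset R J x)" "V = (a_r_coset R J y)" by (auto simp: quot_carrier)
    have "U \<oplus>\<^bsub>R Quot J\<^esub> V = (a_r_coset R J (x \<oplus>\<^bsub>R\<^esub> y))" using ring_hom_add[OF J.rcos_ring_hom xy(1,2)] xy by simp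
    then show "k (U \<otimes>\<^bsub>add_monoid (R Quot J)\<^esub> V) = k U \<otimes>\<^bsub>H\<^esub> k V" using k xy hom_mult[OF h, of x y] by simp
  qed
  then show ?thesis using k by blast
qed

lemma quot_ring_hom:
  assumes J: "ideal J R" and S: "ring S" and h: "h \<in> ring_hom R S" and z: "\<And>x. x \<in> J \<Longrightarrow> h x = \<zero>\<^bsub>S\<^esub>"
  shows "\<exists>k\<in>ring_hom (R Quot J) S. \<forall>x\<in>carrier R. k ((a_r_coset R J x)) = h x"
proof -
  interpret J: ideal J R by fact
  interpret S: ring S by fact
  obtain k where k: "k \<in> hom (add_monoid (R Quot J)) (add_monoid S)" "\<And>x. x \<in> carrier R \<Longrightarrow> k ((a_r_coset R J x)) = h x"
    using quot_add_hom[OF J ring_add_group[OF S] ring_homD_add[OF J.ring_axioms S h]] z by auto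
  have "k \<in> ring_hom (R Quot J) S"
  proof (rule ring_hom_memI)
    fix U V assume "U \<in> carrier (R Quot J)" "V \<in> carrier (R Quot J)"
    then obtain x y where xy: "x \<in> carrier R" "y \<in> carrier R" "U = (a_r_coset R J x)" "V = (a_r_coset R J y)" by (auto simp: quot_carrier)
    show "k (U \<oplus>\<^bsub>R Quot J\<^esub> V) = k U \<oplus>\<^bsub>S\<^esub> k V"
      using hom_mult[OF k(1), of U V] xy by (auto simp: quot_carrier)
    have "U \<otimes>\<^bsub>R Quot J\<^esub> V = (a_r_coset R J (x \<otimes>\<^bsub>R\<^esub> y))" using ring_hom_mult[OF J.rcos_ring_hom xy(1,2)] xy by simp
    then show "k (U \<otimes>\<^bsub>R Quot J\<^esub> V) = k U \<otimes>\<^bsub>S\<^esub> k V" using k(2) xy ring_hom_mult[OF h xy(1,2)] by simp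
  next
    fix U assume "U \<in> carrier (R Quot J)"
    then show "k U \<in> carrier S" using hom_in_carrier[OF k(1)] by simp
  next
    show "k \<one>\<^bsub>R Quot J\<^esub> = \<one>\<^bsub>S\<^esub>" using k(2)[of "\<one>\<^bsub>R\<^esub>"] ring_hom_one[OF h] by (simp add: FactRing_def)
  qed
  then show ?thesis using k(2) by blast
qed

context
  fixes A :: "('a, 'm) ring_scheme" and B :: "('b, 'n) ring_scheme"
  assumes A: "ring A" and B: "ring B"
begin

interpretation A: ring A by (rule A)
interpretation B: ring B by (rule B)

private abbreviation "M \<equiv> monoid_ring (A \<times>\<times> B)"
private abbreviation "J \<equiv> biadditive_kernel A B"

lemma DirProd_AB_monoid: "monoid (A \<times>\<times> B)"
  by (rule DirProd_monoid) (rule A.monoid_axioms, rule B.monoid_axioms)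

interpretation M: ring M by (rule monoid_ring_ring[OF DirProd_AB_monoid])

lemma biadditive_relators_carrier: "biadditive_relators A B \<subseteq> carrier M"
  unfolding biadditive_relators_def by (auto simp: monoid_ring_simps dest!: subsetD[OF keys_diff])

lemma biadditive_relators_left: "a \<in> carrier A \<Longrightarrow> a' \<in> carrier A \<Longrightarrow> b \<in> carrier B \<Longrightarrow>
    frag_of (a \<oplus>\<^bsub>A\<^esub> a', b) - frag_of (a, b) - frag_of (a', b) \<in> biadditive_relators A B"
  unfolding biadditive_relators_def by (rule UnI1) blast

lemma biadditive_relators_right: "a \<in> carrier A \<Longrightarrow> b \<in> carrier B \<Longrightarrow> b' \<in> carrier B \<Longrightarrow>
    frag_of (a, b \<oplus>\<^bsub>B\<^esub> b') - frag_of (a, b) - frag_of (a, b') \<in> biadditive_relators A B"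
  unfolding biadditive_relators_def by (rule UnI2) blast

text \<open>A product of a basis element and a relator is again a relator. This is why the additive subgroup
  generated by the relators is already an ideal.\<close>

lemma biadditive_relators_mult:
  assumes p: "p \<in> carrier (A \<times>\<times> B)" and r: "r \<in> biadditive_relators A B"
  shows "frag_of p \<otimes>\<^bsub>M\<^esub> r \<in> biadditive_relators A B" "r \<otimes>\<^bsub>M\<^esub> frag_of p \<in> biadditive_relators A B"
proof -
  obtain x y where xy: "p = (x, y)" "x \<in> carrier A" "y \<in> carrier B" using p by auto
  from r consider a a' b where "a \<in> carrier A" "a' \<in> carrier A" "b \<in> carrier B" "r = frag_of (a \<oplus>\<^bsub>A\<^esub> a', b) - frag_of (a, b) - frag_of (a', b)"
    | a b b' where "a \<in> carrier A" "b \<in> carrier B" "b' \<in> carrier B" "r = frag_of (a, b \<oplus>\<^bsub>B\<^esub> b') - frag_of (a, b) - frag_of (a, b')"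
    by (auto simp: biadditive_relators_def)
  then have "frag_of p \<otimes>\<^bsub>M\<^esub> r \<in> biadditive_relators A B \<and> r \<otimes>\<^bsub>M\<^esub> frag_of p \<in> biadditive_relators A B"
  proof cases
    case 1
    have "frag_of p \<otimes>\<^bsub>M\<^esub> r = frag_of (x \<otimes>\<^bsub>A\<^esub> a \<oplus>\<^bsub>A\<^esub> x \<otimes>\<^bsub>A\<^esub> a', y \<otimes>\<^bsub>B\<^esub> b) - frag_of (x \<otimes>\<^bsub>A\<^esub> a, y \<otimes>\<^bsub>B\<^esub> b) - frag_of (x \<otimes>\<^bsub>A\<^esub> a', y \<otimes>\<^bsub>B\<^esub> b)"
      using 1 xy by (simp add: monoid_ring_mult_bilinear monoid_ring_frag_mult A.r_distr)
    moreover have "r \<otimes>\<^bsub>M\<^esub> frag_of p = frag_of (a \<otimes>\<^bsub>A\<^esub> x \<oplus>\<^bsub>A\<^esub> a' \<otimes>\<^bsub>A\<^esub> x, b \<otimes>\<^bsub>B\<^esub> y) - frag_of (a \<otimes>\<^bsub>A\<^esub> x, b \<otimes>\<^bsub>B\<^esub> y) - frag_of (a' \<otimes>\<^bsub>A\<^esub> x, b \<otimes>\<^bsub>B\<^esub> y)"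
      using 1 xy by (simp add: monoid_ring_mult_bilinear monoid_ring_frag_mult A.l_distr)
    ultimately show ?thesis using 1 xy
      by (auto intro!: biadditive_relators_left)
  next
    case 2
    have "frag_of p \<otimes>\<^bsub>M\<^esub> r = frag_of (x \<otimes>\<^bsub>A\<^esub> a, y \<otimes>\<^bsub>B\<^esub> b \<oplus>\<^bsub>B\<^esub> y \<otimes>\<^bsub>B\<^esub> b') - frag_of (x \<otimes>\<^bsub>A\<^esub> a, y \<otimes>\<^bsub>B\<^esub> b) - frag_of (x \<otimes>\<^bsub>A\<^esub> a, y \<otimes>\<^bsub>B\<^esub> b')"
      using 2 xy by (simp add: monoid_ring_mult_bilinear monoid_ring_frag_mult B.r_distr)
    moreover have "r \<otimes>\<^bsub>M\<^esub> frag_of p = frag_of (a \<otimes>\<^bsub>A\<^esub> x, b \<otimes>\<^bsub>B\<^esub> y \<oplus>\<^bsub>B\<^esub> b' \<otimes>\<^bsub>B\<^esub> y) - frag_of (a \<otimes>\<^bsub>A\<^esub> x, b \<otimes>\<^bsub>B\<^esub> y) - frag_of (a \<otimes>\<^bsub>A\<^esub> x, b' \<otimes>\<^bsub>B\<^esub> y)"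
      using 2 xy by (simp add: monoid_ring_mult_bilinear monoid_ring_frag_mult B.l_distr)
    ultimately show ?thesis using 2 xy
      by (auto intro!: biadditive_relators_right)
  qed
  then show "frag_of p \<otimes>\<^bsub>M\<^esub> r \<in> biadditive_relators A B" "r \<otimes>\<^bsub>M\<^esub> frag_of p \<in> biadditive_relators A B" by auto
qed

lemma biadditive_kernel_subgroup: "subgroup J (add_monoid M)"
  unfolding biadditive_kernel_def
  by (rule group.generate_is_subgroup) (use ring_add_group[OF M.ring_axioms] biadditive_relators_carrier in auto)

lemma J_carrier: "x \<in> J \<Longrightarrow> x \<in> carrier M"
  using subgroup.subset[OF biadditive_kernel_subgroup] by auto

lemma J_diff: "a \<in> J \<Longrightarrow> b \<in> J \<Longrightarrow> a - b \<in> J"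
  using subgroup.m_closed[OF biadditive_kernel_subgroup, of a "- b"] subgroup.m_inv_closed[OF biadditive_kernel_subgroup, of b]
    add_monoid_inv_monoid_ring[OF J_carrier, of b] by (simp add: monoid_ring_simps)

lemma J_frag_mult:
  assumes p: "p \<in> carrier (A \<times>\<times> B)" and "x \<in> J"
  shows "frag_of p \<otimes>\<^bsub>M\<^esub> x \<in> J \<and> x \<otimes>\<^bsub>M\<^esub> frag_of p \<in> J"
  using assms(2) unfolding biadditive_kernel_def
proof (induction x rule: generate.induct)
  case one
  have "0 \<in> J" using subgroup.one_closed[OF biadditive_kernel_subgroup] by (simp add: monoid_ring_simps)
  then show ?case by (simp add: monoid_ring_simps monoid_ring_mult_bilinear biadditive_kernel_def)
next
  case (incl r)
  then show ?case using biadditive_relators_mult[OF p] by (auto intro: generate.incl)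
next
  case (inv r)
  have i: "inv\<^bsub>add_monoid M\<^esub> r = 0 - r" using add_monoid_inv_monoid_ring[of r "A \<times>\<times> B"] subsetD[OF biadditive_relators_carrier inv] by simp
  have "0 \<in> J" using subgroup.one_closed[OF biadditive_kernel_subgroup] by (simp add: monoid_ring_simps)
  moreover have "frag_of p \<otimes>\<^bsub>M\<^esub> r \<in> J" "r \<otimes>\<^bsub>M\<^esub> frag_of p \<in> J"
    using biadditive_relators_mult[OF p inv] by (auto simp: biadditive_kernel_def intro: generate.incl)
  ultimately show ?case unfolding i monoid_ring_mult_bilinear biadditive_kernel_def[symmetric] using J_diff by blast
next
  case (eng a b)
  then show ?case by (auto simp: monoid_ring_simps monoid_ring_mult_bilinear intro: generate.eng[where G = "add_monoid M", simplified, unfolded monoid_ring_simps])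
qed

lemma biadditive_kernel_ideal: "ideal J M"
proof (rule idealI[OF M.ring_axioms biadditive_kernel_subgroup])
  have *: "x \<otimes>\<^bsub>M\<^esub> a \<in> J \<and> a \<otimes>\<^bsub>M\<^esub> x \<in> J" if a: "a \<in> J" and x: "x \<in> carrier M" for a x
    using x DirProd_AB_monoid
    by (induction x rule: monoid_ring_induct) (use J_frag_mult[OF _ a] J_diff in \<open>auto simp: monoid_ring_mult_bilinear\<close>)
  show "x \<otimes>\<^bsub>M\<^esub> a \<in> J" "a \<otimes>\<^bsub>M\<^esub> x \<in> J" if "a \<in> J" "x \<in> carrier M" for a x using *[OF that] by auto
qed

interpretation J: ideal J M by (rule biadditive_kernel_ideal)

lemma tensor_ring_ring: "ring (tensor_ring A B)"
  unfolding tensor_ring_def by (rule J.quotient_is_ring)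

lemma frag_carrier: "a \<in> carrier A \<Longrightarrow> b \<in> carrier B \<Longrightarrow> frag_of (a, b) \<in> carrier M"
  by (simp add: monoid_ring_simps keys_single)

lemma pure_tensor_closed: "a \<in> carrier A \<Longrightarrow> b \<in> carrier B \<Longrightarrow> pure_tensor A B a b \<in> carrier (tensor_ring A B)"
  unfolding pure_tensor_def tensor_ring_def quot_carrier using frag_carrier by blast

lemma pure_tensor_mult:
  "a \<in> carrier A \<Longrightarrow> b \<in> carrier B \<Longrightarrow> a' \<in> carrier A \<Longrightarrow> b' \<in> carrier B \<Longrightarrow>
   pure_tensor A B a b \<otimes>\<^bsub>tensor_ring A B\<^esub> pure_tensor A B a' b' = pure_tensor A B (a \<otimes>\<^bsub>A\<^esub> a') (b \<otimes>\<^bsub>B\<^esub> b')"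
  unfolding pure_tensor_def tensor_ring_def
  by (simp add: ring_hom_mult[OF J.rcos_ring_hom, symmetric] frag_carrier monoid_ring_frag_mult)

lemma pure_tensor_one: "\<one>\<^bsub>tensor_ring A B\<^esub> = pure_tensor A B \<one>\<^bsub>A\<^esub> \<one>\<^bsub>B\<^esub>"
  unfolding pure_tensor_def tensor_ring_def FactRing_def by (simp add: monoid_ring_simps)

lemma tensor_induct [consumes 1, case_names pure diff]:
  assumes t: "t \<in> carrier (tensor_ring A B)"
    and p: "\<And>a b. a \<in> carrier A \<Longrightarrow> b \<in> carrier B \<Longrightarrow> P (pure_tensor A B a b)"
    and d: "\<And>x y. x \<in> carrier (tensor_ring A B) \<Longrightarrow> y \<in> carrier (tensor_ring A B) \<Longrightarrow> P x \<Longrightarrow> P y \<Longrightarrow> P (x \<ominus>\<^bsub>tensor_ring A B\<^esub> y)"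
  shows "P t"
proof -
  obtain c where c: "c \<in> carrier M" "t = (a_r_coset M J c)" using t by (auto simp: tensor_ring_def quot_carrier)
  have Q: "(a_r_coset M J x) \<in> carrier (M Quot J)" if "x \<in> carrier M" for x using that by (auto simp: quot_carrier)
  interpret T: ring "M Quot J" by (rule J.quotient_is_ring)
  interpret h: ring_hom_ring M "M Quot J" "a_r_coset M J" by (rule J.rcos_ring_hom_ring)
  have "P ((a_r_coset M J c))" using c(1) DirProd_AB_monoid
  proof (induction c rule: monoid_ring_induct)
    case (one g)
    then show ?case using p unfolding pure_tensor_def by auto
  next
    case (diff a b)
    have "a - b = a \<oplus>\<^bsub>M\<^esub> (\<ominus>\<^bsub>M\<^esub> b)" using add_monoid_inv_monoid_ring[OF diff(2)] by (simp add: monoid_ring_simps a_inv_def)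
    then have "(a_r_coset M J (a - b)) = ((a_r_coset M J a)) \<ominus>\<^bsub>M Quot J\<^esub> ((a_r_coset M J b))" using diff by (simp add: a_minus_def)
    then show ?case using d[unfolded tensor_ring_def, OF Q[OF diff(1)] Q[OF diff(2)] diff(3,4)] by simp
  qed
  then show ?thesis using c by simp
qed

lemma tensor_universal:
  assumes H: "comm_group H" and \<beta>: "\<And>a b. a \<in> carrier A \<Longrightarrow> b \<in> carrier B \<Longrightarrow> \<beta> a b \<in> carrier H"
    and l: "\<And>a a' b. a \<in> carrier A \<Longrightarrow> a' \<in> carrier A \<Longrightarrow> b \<in> carrier B \<Longrightarrow> \<beta> (a \<oplus>\<^bsub>A\<^esub> a') b = \<beta> a b \<otimes>\<^bsub>H\<^esub> \<beta> a' b"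
    and r: "\<And>a b b'. a \<in> carrier A \<Longrightarrow> b \<in> carrier B \<Longrightarrow> b' \<in> carrier B \<Longrightarrow> \<beta> a (b \<oplus>\<^bsub>B\<^esub> b') = \<beta> a b \<otimes>\<^bsub>H\<^esub> \<beta> a b'"
  shows "\<exists>h\<in>hom (add_monoid (tensor_ring A B)) H. \<forall>a\<in>carrier A. \<forall>b\<in>carrier B. h (pure_tensor A B a b) = \<beta> a b"
proof -
  interpret H: comm_group H by fact
  obtain h where h: "h \<in> hom (add_monoid M) H" "\<And>g. g \<in> carrier (A \<times>\<times> B) \<Longrightarrow> h (frag_of g) = case_prod \<beta> g"
    using monoid_ring_add_hom[OF H, of "A \<times>\<times> B" "case_prod \<beta>"] \<beta> by auto
  have hd: "h (x - y) = h x \<otimes>\<^bsub>H\<^esub> inv\<^bsub>H\<^esub> h y" if "x \<in> carrier M" "y \<in> carrier M" for x y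
    by (rule hom_frag_diff_eq[OF H.group_axioms h(1) DirProd_AB_monoid that])
  have d: "x - y \<in> carrier M" if "x \<in> carrier M" "y \<in> carrier M" for x y using that keys_frag_diff[of x _ y] by (simp add: monoid_ring_simps)
  have rel: "h x = \<one>\<^bsub>H\<^esub>" if "x \<in> biadditive_relators A B" for x
    using that \<beta> unfolding biadditive_relators_def
    by (auto simp: hd d frag_carrier h(2) l r H.m_assoc H.inv_mult_group) (auto simp: H.m_comm H.m_assoc H.m_lcomm H.inv_mult_group[symmetric] simp flip: H.m_assoc)
  interpret gh: group_hom "add_monoid M" H h
    using h(1) ring_add_group[OF M.ring_axioms] by (auto simp: group_hom_def group_hom_axioms_def H.group_axioms)
  have "J \<subseteq> kernel (add_monoid M) H h"
    unfolding biadditive_kernel_def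
  proof (rule group.generate_subgroup_incl[OF ring_add_group[OF M.ring_axioms]])
    show "biadditive_relators A B \<subseteq> kernel (add_monoid M) H h"
      using rel biadditive_relators_carrier by (auto simp: kernel_def)
  qed (rule gh.subgroup_kernel)
  then have z: "h x = \<one>\<^bsub>H\<^esub>" if "x \<in> J" for x using that by (auto simp: kernel_def)
  obtain k where k: "k \<in> hom (add_monoid (M Quot J)) H" "\<And>x. x \<in> carrier M \<Longrightarrow> k (a_r_coset M J x) = h x"
    using quot_add_hom[OF biadditive_kernel_ideal H.group_axioms h(1) z] by blast
  have "k (pure_tensor A B a b) = \<beta> a b" if "a \<in> carrier A" "b \<in> carrier B" for a b
    unfolding pure_tensor_def using k(2)[OF frag_carrier[OF that]] h(2)[of "(a, b)"] that by simp
  then show ?thesis using k(1) unfolding tensor_ring_def by blast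
qed

lemma pure_tensor_eqI:
  assumes "x \<in> carrier M" "y \<in> carrier M" "x - y \<in> J"
  shows "(a_r_coset M J x) = (a_r_coset M J y)"
proof -
  have "x = (x - y) \<oplus>\<^bsub>M\<^esub> y" by (simp add: monoid_ring_simps)
  then have "x \<in> (a_r_coset M J y)" using assms(3) unfolding a_r_coset_def' by blast
  then show ?thesis using M.a_repr_independence[OF _ assms(2) biadditive_kernel_subgroup] by simp
qed

lemma pure_tensor_add_left:
  assumes "a \<in> carrier A" "a' \<in> carrier A" "b \<in> carrier B"
  shows "pure_tensor A B (a \<oplus>\<^bsub>A\<^esub> a') b = pure_tensor A B a b \<oplus>\<^bsub>tensor_ring A B\<^esub> pure_tensor A B a' b"
proof -
  have "pure_tensor A B a b \<oplus>\<^bsub>tensor_ring A B\<^esub> pure_tensor A B a' b = (a_r_coset M J (frag_of (a, b) \<oplus>\<^bsub>M\<^esub> frag_of (a', b)))"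
    using assms unfolding pure_tensor_def tensor_ring_def by (simp add: ring_hom_add[OF J.rcos_ring_hom] frag_carrier)
  also have "\<dots> = (a_r_coset M J (frag_of (a \<oplus>\<^bsub>A\<^esub> a', b)))"
  proof (rule pure_tensor_eqI[symmetric])
    have "frag_of (a \<oplus>\<^bsub>A\<^esub> a', b) - frag_of (a, b) - frag_of (a', b) \<in> J"
      unfolding biadditive_kernel_def by (rule generate.incl) (use assms in \<open>auto simp: biadditive_relators_def\<close>)
    then show "frag_of (a \<oplus>\<^bsub>A\<^esub> a', b) - (frag_of (a, b) \<oplus>\<^bsub>M\<^esub> frag_of (a', b)) \<in> J"
      by (simp add: monoid_ring_simps algebra_simps)
  qed (use assms frag_carrier in auto)
  finally show ?thesis by (simp add: pure_tensor_def)
qed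

lemma pure_tensor_add_right:
  assumes "a \<in> carrier A" "b \<in> carrier B" "b' \<in> carrier B"
  shows "pure_tensor A B a (b \<oplus>\<^bsub>B\<^esub> b') = pure_tensor A B a b \<oplus>\<^bsub>tensor_ring A B\<^esub> pure_tensor A B a b'"
proof -
  have "pure_tensor A B a b \<oplus>\<^bsub>tensor_ring A B\<^esub> pure_tensor A B a b' = (a_r_coset M J (frag_of (a, b) \<oplus>\<^bsub>M\<^esub> frag_of (a, b')))"
    using assms unfolding pure_tensor_def tensor_ring_def by (simp add: ring_hom_add[OF J.rcos_ring_hom] frag_carrier)
  also have "\<dots> = (a_r_coset M J (frag_of (a, b \<oplus>\<^bsub>B\<^esub> b')))"
  proof (rule pure_tensor_eqI[symmetric])
    have "frag_of (a, b \<oplus>\<^bsub>B\<^esub> b') - frag_of (a, b) - frag_of (a, b') \<in> J"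
      unfolding biadditive_kernel_def by (rule generate.incl) (use assms in \<open>auto simp: biadditive_relators_def\<close>)
    then show "frag_of (a, b \<oplus>\<^bsub>B\<^esub> b') - (frag_of (a, b) \<oplus>\<^bsub>M\<^esub> frag_of (a, b')) \<in> J"
      by (simp add: monoid_ring_simps algebra_simps)
  qed (use assms frag_carrier in auto)
  finally show ?thesis by (simp add: pure_tensor_def)
qed

end

section \<open>Graded isomorphisms\<close>

lemma (in abelian_monoid) finsum_support:
  assumes "finite A" "{k. c k \<noteq> \<zero>} \<subseteq> A" "\<And>k. k \<in> A \<Longrightarrow> c k \<in> carrier G"
  shows "finsum G c {k. c k \<noteq> \<zero>} = finsum G c A"
  by (rule add.finprod_mono_neutral_cong_left) (use assms in auto)

lemma ring_iso_hom: "\<phi> \<in> ring_iso R S \<Longrightarrow> \<phi> \<in> ring_hom R S" and ring_iso_bij: "\<phi> \<in> ring_iso R S \<Longrightarrow> bij_betw \<phi> (carrier R) (carrier S)"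
  by (auto simp: ring_iso_def)

lemma ring_iso_ring: assumes R: "ring R" and \<phi>: "\<phi> \<in> ring_iso R S" and z: "\<phi> \<zero>\<^bsub>R\<^esub> = \<zero>\<^bsub>S\<^esub>" shows "ring S"
proof -
  interpret R: ring R by fact
  have "ring (S \<lparr> carrier := \<phi> ` (carrier R), zero := \<phi> \<zero>\<^bsub>R\<^esub> \<rparr>)"
    by (rule R.ring_hom_imp_img_ring[OF ring_iso_hom[OF \<phi>]])
  moreover have "\<phi> ` carrier R = carrier S" using ring_iso_bij[OF \<phi>] by (simp add: bij_betw_def)
  ultimately show ?thesis using z by simp
qed

text \<open>Each ring has to satisfy only half of the axioms of a grading. In \<open>R\<close> homogeneous components
  exist, since homogeneous elements generate; in \<open>S\<close> they are unique, by independence. The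
  isomorphism carries either half over to the other ring, and for \<open>F\<close> in \<open>H k\<close> uniqueness forces the
  components of its preimage outside degree \<open>k\<close> to vanish, so that \<open>\<phi>\<close> maps \<open>G k\<close> onto \<open>H k\<close>.\<close>

lemma graded_iso_criterion:
  assumes R: "ring R" and S: "ring S" and \<phi>: "\<phi> \<in> ring_iso R S"
    and Gsub: "\<And>k. subgroup (G k) (add_monoid R)" and G1: "\<one>\<^bsub>R\<^esub> \<in> G 0"
    and Gm: "\<And>k l a b. a \<in> G k \<Longrightarrow> b \<in> G l \<Longrightarrow> a \<otimes>\<^bsub>R\<^esub> b \<in> G (k + l)"
    and span: "carrier R \<subseteq> generate (add_monoid R) (\<Union>k. G k)"
    and GH: "\<And>k. \<phi> ` G k \<subseteq> H k"
    and Hsub: "\<And>k. subgroup (H k) (add_monoid S)"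
    and ind: "\<And>c A. finite A \<Longrightarrow> (\<And>k. k \<in> A \<Longrightarrow> c k \<in> H k) \<Longrightarrow> finsum S c A = \<zero>\<^bsub>S\<^esub> \<Longrightarrow> (\<And>k. k \<in> A \<Longrightarrow> c k = \<zero>\<^bsub>S\<^esub>)"
  shows "graded_ring_iso R G S H \<phi>"
proof -
  interpret R: ring R by fact
  interpret S: ring S by fact
  interpret \<phi>: ring_hom_ring R S \<phi> using R S ring_iso_hom[OF \<phi>] by (simp add: ring_hom_ringI2)
  have inj: "inj_on \<phi> (carrier R)" and surj: "\<phi> ` carrier R = carrier S" using ring_iso_bij[OF \<phi>] by (auto simp: bij_betw_def)
  have Gc: "a \<in> carrier R" if "a \<in> G k" for a k using subgroup.subset[OF Gsub] that by fastforce
  have Hc: "a \<in> carrier S" if "a \<in> H k" for a k using subgroup.subset[OF Hsub] that by fastforce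
  have G0: "\<zero>\<^bsub>R\<^esub> \<in> G k" for k using subgroup.one_closed[OF Gsub[of k]] by simp
  have H0: "\<zero>\<^bsub>S\<^esub> \<in> H k" for k using subgroup.one_closed[OF Hsub[of k]] by simp
  have Gadd: "a \<oplus>\<^bsub>R\<^esub> b \<in> G k" if "a \<in> G k" "b \<in> G k" for a b k using subgroup.m_closed[OF Gsub that] by simp
  have Hminus: "a \<ominus>\<^bsub>S\<^esub> b \<in> H k" if "a \<in> H k" "b \<in> H k" for a b k
    using subgroup.m_closed[OF Hsub that(1) subgroup.m_inv_closed[OF Hsub that(2)]] by (simp add: a_minus_def a_inv_def)
  have dec: "\<exists>c A. finite A \<and> (\<forall>k. c k \<in> G k) \<and> {k. c k \<noteq> \<zero>\<^bsub>R\<^esub>} \<subseteq> A \<and> a = finsum R c A" if "a \<in> carrier R" for a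
  proof -
    have "a \<in> generate (add_monoid R) (\<Union>k. G k)" using that span by blast
    then show ?thesis
    proof induction
      case one
      show ?case by (intro exI[of _ "\<lambda>_. \<zero>\<^bsub>R\<^esub>"] exI[of _ "{}"]) (auto simp: G0)
    next
      case (incl a)
      then obtain k where k: "a \<in> G k" by auto
      show ?case using k G0 Gc[OF k]
        by (intro exI[of _ "\<lambda>j. if j = k then a else \<zero>\<^bsub>R\<^esub>"] exI[of _ "{k}"]) auto
    next
      case (inv a)
      then obtain k where k: "a \<in> G k" by auto
      then have k: "inv\<^bsub>add_monoid R\<^esub> a \<in> G k" using subgroup.m_inv_closed[OF Gsub] by blast
      show ?case using k G0 Gc[OF k]
        by (intro exI[of _ "\<lambda>j. if j = k then inv\<^bsub>add_monoid R\<^esub> a else \<zero>\<^bsub>R\<^esub>"] exI[of _ "{k}"]) auto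
    next
      case (eng a b)
      then obtain c A d B where c: "finite A" "\<forall>k. c k \<in> G k" "{k. c k \<noteq> \<zero>\<^bsub>R\<^esub>} \<subseteq> A" "a = finsum R c A"
        and d: "finite B" "\<forall>k. d k \<in> G k" "{k. d k \<noteq> \<zero>\<^bsub>R\<^esub>} \<subseteq> B" "b = finsum R d B" by blast
      have cc: "c k \<in> carrier R" "d k \<in> carrier R" for k using c(2) d(2) Gc by blast+
      have "a = finsum R c (A \<union> B)" unfolding c(4)
        by (rule R.add.finprod_mono_neutral_cong_left) (use c d cc in auto)
      moreover have "b = finsum R d (A \<union> B)" unfolding d(4)
        by (rule R.add.finprod_mono_neutral_cong_left) (use c d cc in auto)
      ultimately have "a \<oplus>\<^bsub>R\<^esub> b = finsum R (\<lambda>k. c k \<oplus>\<^bsub>R\<^esub> d k) (A \<union> B)" using cc by (simp add: R.finsum_addf)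
      moreover have "{k. c k \<oplus>\<^bsub>R\<^esub> d k \<noteq> \<zero>\<^bsub>R\<^esub>} \<subseteq> A \<union> B"
      proof (rule subsetI, rule ccontr)
        fix k assume k: "k \<in> {k. c k \<oplus>\<^bsub>R\<^esub> d k \<noteq> \<zero>\<^bsub>R\<^esub>}" "k \<notin> A \<union> B"
        then have "c k = \<zero>\<^bsub>R\<^esub>" "d k = \<zero>\<^bsub>R\<^esub>" using c(3) d(3) by auto
        then show False using k(1) by simp
      qed
      moreover have "\<forall>k. c k \<oplus>\<^bsub>R\<^esub> d k \<in> G k" using c(2) d(2) Gadd by simp
      ultimately show ?case using c(1) d(1)
        by (intro exI[of _ "\<lambda>k. c k \<oplus>\<^bsub>R\<^esub> d k"] exI[of _ "A \<union> B"]) simp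
    qed
  qed
  have uniq: "c k = d k" if A: "finite A" and c: "\<And>k. c k \<in> H k" "{k. c k \<noteq> \<zero>\<^bsub>S\<^esub>} \<subseteq> A"
    and d: "\<And>k. d k \<in> H k" "{k. d k \<noteq> \<zero>\<^bsub>S\<^esub>} \<subseteq> A" and e: "finsum S c A = finsum S d A" for c d A k
  proof (cases "k \<in> A")
    case True
    have cc: "c k \<in> carrier S" "d k \<in> carrier S" for k using c(1) d(1) Hc by blast+
    have "finsum S (\<lambda>k. c k \<ominus>\<^bsub>S\<^esub> d k) A \<oplus>\<^bsub>S\<^esub> finsum S d A = finsum S (\<lambda>k. (c k \<ominus>\<^bsub>S\<^esub> d k) \<oplus>\<^bsub>S\<^esub> d k) A"
      using cc by (subst S.finsum_addf) auto
    also have "\<dots> = finsum S c A" using cc by (intro S.finsum_cong') (auto simp: a_minus_def S.add.m_assoc S.l_neg)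
    finally have "finsum S (\<lambda>k. c k \<ominus>\<^bsub>S\<^esub> d k) A \<oplus>\<^bsub>S\<^esub> finsum S d A = \<zero>\<^bsub>S\<^esub> \<oplus>\<^bsub>S\<^esub> finsum S d A" using e cc by (simp add: S.finsum_closed)
    then have "finsum S (\<lambda>k. c k \<ominus>\<^bsub>S\<^esub> d k) A = \<zero>\<^bsub>S\<^esub>"
      using cc by (subst (asm) S.add.r_cancel) (auto intro!: S.finsum_closed)
    then have "c k \<ominus>\<^bsub>S\<^esub> d k = \<zero>\<^bsub>S\<^esub>" using ind[OF A, of "\<lambda>k. c k \<ominus>\<^bsub>S\<^esub> d k"] Hminus c(1) d(1) True by blast
    then show ?thesis using cc S.r_right_minus_eq by simp
  next
    case False
    then have "c k = \<zero>\<^bsub>S\<^esub>" "d k = \<zero>\<^bsub>S\<^esub>" using c(2) d(2) by auto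
    then show ?thesis by simp
  qed
  have \<phi>0: "\<phi> a = \<zero>\<^bsub>S\<^esub> \<longleftrightarrow> a = \<zero>\<^bsub>R\<^esub>" if "a \<in> carrier R" for a using inj that by (metis R.zero_closed \<phi>.hom_zero inj_onD)
  have sumS: "\<phi> (finsum R c A) = finsum S (\<lambda>k. \<phi> (c k)) A" if "\<And>k. c k \<in> carrier R" for c and A :: "int set"
    using \<phi>.hom_finsum[of c A] that by (simp add: comp_def)
  have img: "\<phi> ` G k = H k" for k
  proof (intro equalityI GH subsetI)
    fix F assume F: "F \<in> H k"
    then obtain a where a: "a \<in> carrier R" "F = \<phi> a" using Hc surj by blast
    obtain c A where c: "finite A" "\<forall>k. c k \<in> G k" "{k. c k \<noteq> \<zero>\<^bsub>R\<^esub>} \<subseteq> A" "a = finsum R c A" using dec[OF a(1)] by blast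
    have cc: "c k \<in> carrier R" for k using c(2) Gc by blast
    have e: "finsum S (\<lambda>k. \<phi> (c k)) (insert k A) = F"
      unfolding a(2) c(4) sumS[OF cc, symmetric] using c cc
      by (intro arg_cong[of _ _ \<phi>] R.add.finprod_mono_neutral_cong_left[symmetric]) auto
    have e2: "finsum S (\<lambda>j. if j = k then F else \<zero>\<^bsub>S\<^esub>) (insert k A) = F"
    proof -
      have "finsum S (\<lambda>j. if j = k then F else \<zero>\<^bsub>S\<^esub>) {k} = finsum S (\<lambda>j. if j = k then F else \<zero>\<^bsub>S\<^esub>) (insert k A)"
        using c(1) Hc[OF F] by (intro S.add.finprod_mono_neutral_cong_left) auto
      then show ?thesis using Hc[OF F] by simp
    qed
    have "\<phi> (c k) = (if k = k then F else \<zero>\<^bsub>S\<^esub>)"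
    proof (rule uniq[of "insert k A" "\<lambda>k. \<phi> (c k)" "\<lambda>j. if j = k then F else \<zero>\<^bsub>S\<^esub>"])
      show "{j. \<phi> (c j) \<noteq> \<zero>\<^bsub>S\<^esub>} \<subseteq> insert k A" using c(3) \<phi>0[OF cc] by auto
      show "\<phi> (c j) \<in> H j" for j using c(2) GH by blast
    qed (use c F H0 e e2 in auto)
    then show "F \<in> \<phi> ` G k" using c(2) by auto
  qed
  have gR: "is_grading R G" unfolding is_grading_def
  proof (intro conjI allI ballI Gsub G1 Gm)
    fix a assume a: "a \<in> carrier R"
    obtain c A where c: "finite A" "\<forall>k. c k \<in> G k" "{k. c k \<noteq> \<zero>\<^bsub>R\<^esub>} \<subseteq> A" "a = finsum R c A" using dec[OF a(1)] by blast
    have cc: "c k \<in> carrier R" for k using c(2) Gc by blast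
    show "\<exists>!c. (\<forall>k. c k \<in> G k) \<and> finite {k. c k \<noteq> \<zero>\<^bsub>R\<^esub>} \<and> a = (\<Oplus>\<^bsub>R\<^esub>k\<in>{k. c k \<noteq> \<zero>\<^bsub>R\<^esub>}. c k)"
    proof (rule ex1I[of _ c])
      show "(\<forall>k. c k \<in> G k) \<and> finite {k. c k \<noteq> \<zero>\<^bsub>R\<^esub>} \<and> a = (\<Oplus>\<^bsub>R\<^esub>k\<in>{k. c k \<noteq> \<zero>\<^bsub>R\<^esub>}. c k)"
        using c finite_subset[OF c(3,1)] R.finsum_support[OF c(1,3) cc] by simp
    next
      fix d assume d: "(\<forall>k. d k \<in> G k) \<and> finite {k. d k \<noteq> \<zero>\<^bsub>R\<^esub>} \<and> a = (\<Oplus>\<^bsub>R\<^esub>k\<in>{k. d k \<noteq> \<zero>\<^bsub>R\<^esub>}. d k)"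
      then have dc: "d k \<in> carrier R" for k using Gc by blast
      define B where "B = A \<union> {k. d k \<noteq> \<zero>\<^bsub>R\<^esub>}"
      have B: "finite B" "{k. c k \<noteq> \<zero>\<^bsub>R\<^esub>} \<subseteq> B" "{k. d k \<noteq> \<zero>\<^bsub>R\<^esub>} \<subseteq> B" using c d by (auto simp: B_def)
      have "finsum R c A = finsum R c {k. c k \<noteq> \<zero>\<^bsub>R\<^esub>}" using R.finsum_support[OF c(1,3) cc] by simp
      then have "finsum R c B = finsum R d B" using R.finsum_support[OF B(1,2) cc] R.finsum_support[OF B(1,3) dc] d c(4) by simp
      then have "finsum S (\<lambda>k. \<phi> (c k)) B = finsum S (\<lambda>k. \<phi> (d k)) B" using sumS[of c B] sumS[of d B] cc dc by simp
      moreover have "\<phi> (c k) \<in> H k" "\<phi> (d k) \<in> H k" for k using c(2) d GH by blast+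
      ultimately have "\<phi> (d k) = \<phi> (c k)" for k
        by (intro uniq[of B "\<lambda>k. \<phi> (d k)" "\<lambda>k. \<phi> (c k)"]) (use B \<phi>0[OF cc] \<phi>0[OF dc] in auto)
      then show "d = c" using inj cc dc by (auto simp: inj_on_def)
    qed
  qed
  have gS: "is_grading S H" unfolding is_grading_def
  proof (intro conjI allI ballI Hsub)
    show "\<one>\<^bsub>S\<^esub> \<in> H 0" using GH[of 0] G1 \<phi>.hom_one by (metis image_subset_iff)
  next
    fix k l a b assume "a \<in> H k" "b \<in> H l"
    then obtain a' b' where ab: "a = \<phi> a'" "a' \<in> G k" "b = \<phi> b'" "b' \<in> G l" using img by blast
    then have "a \<otimes>\<^bsub>S\<^esub> b = \<phi> (a' \<otimes>\<^bsub>R\<^esub> b')" using Gc by simp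
    then show "a \<otimes>\<^bsub>S\<^esub> b \<in> H (k + l)" using GH[of "k + l"] Gm[OF ab(2,4)] by auto
  next
    fix b assume "b \<in> carrier S"
    then obtain a where a: "a \<in> carrier R" "b = \<phi> a" using surj by blast
    obtain c A where c: "finite A" "\<forall>k. c k \<in> G k" "{k. c k \<noteq> \<zero>\<^bsub>R\<^esub>} \<subseteq> A" "a = finsum R c A" using dec[OF a(1)] by blast
    have cc: "c k \<in> carrier R" for k using c(2) Gc by blast
    define e where "e = (\<lambda>k. \<phi> (c k))"
    have ckH: "\<phi> (c k) \<in> H k" for k using c(2) GH by blast
    have e: "\<And>k. e k \<in> H k" "{k. e k \<noteq> \<zero>\<^bsub>S\<^esub>} \<subseteq> A" "b = finsum S e A"
      using c ckH \<phi>0[OF cc] a(2) sumS[of c A, OF cc] by (auto simp: e_def)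
    have ec: "e k \<in> carrier S" for k using e(1) Hc by blast
    show "\<exists>!c. (\<forall>k. c k \<in> H k) \<and> finite {k. c k \<noteq> \<zero>\<^bsub>S\<^esub>} \<and> b = (\<Oplus>\<^bsub>S\<^esub>k\<in>{k. c k \<noteq> \<zero>\<^bsub>S\<^esub>}. c k)"
    proof (rule ex1I[of _ e])
      show "(\<forall>k. e k \<in> H k) \<and> finite {k. e k \<noteq> \<zero>\<^bsub>S\<^esub>} \<and> b = (\<Oplus>\<^bsub>S\<^esub>k\<in>{k. e k \<noteq> \<zero>\<^bsub>S\<^esub>}. e k)"
        using e finite_subset[OF e(2) c(1)] S.finsum_support[OF c(1) e(2) ec] by simp
    next
      fix d assume d: "(\<forall>k. d k \<in> H k) \<and> finite {k. d k \<noteq> \<zero>\<^bsub>S\<^esub>} \<and> b = (\<Oplus>\<^bsub>S\<^esub>k\<in>{k. d k \<noteq> \<zero>\<^bsub>S\<^esub>}. d k)"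
      then have dc: "d k \<in> carrier S" for k using Hc by blast
      define B where "B = A \<union> {k. d k \<noteq> \<zero>\<^bsub>S\<^esub>}"
      have B: "finite B" "{k. e k \<noteq> \<zero>\<^bsub>S\<^esub>} \<subseteq> B" "{k. d k \<noteq> \<zero>\<^bsub>S\<^esub>} \<subseteq> B" using c e d by (auto simp: B_def)
      have "finsum S e A = finsum S e {k. e k \<noteq> \<zero>\<^bsub>S\<^esub>}" using S.finsum_support[OF c(1) e(2) ec] by simp
      then have "finsum S e B = finsum S d B" using S.finsum_support[OF B(1,2) ec] S.finsum_support[OF B(1,3) dc] d e(3) by simp
      then show "d = e" using uniq[OF B(1), of d e] B e(1) d by auto
    qed
  qed
  show ?thesis unfolding graded_ring_iso_def using R S gR gS \<phi> img by blast
qed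

lemma is_grading_span:
  assumes R: "ring R" and "is_grading R G" shows "carrier R \<subseteq> generate (add_monoid R) (\<Union>k. G k)"
proof
  interpret R: ring R by fact
  fix a assume "a \<in> carrier R"
  then obtain c where c: "\<forall>k. c k \<in> G k" "finite {k. c k \<noteq> \<zero>\<^bsub>R\<^esub>}" "a = (\<Oplus>\<^bsub>R\<^esub>k\<in>{k. c k \<noteq> \<zero>\<^bsub>R\<^esub>}. c k)"
    using assms(2) unfolding is_grading_def by metis
  have cc: "c k \<in> carrier R" for k using assms(2) c(1) subgroup.subset unfolding is_grading_def by fastforce
  have "finsum R c A \<in> generate (add_monoid R) (\<Union>k. G k)" if "finite A" for A
    using that
  proof (induction A)
    case empty
    then show ?case using generate.one[of "add_monoid R"] by simp
  next
    case (insert k A)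
    have "c k \<otimes>\<^bsub>add_monoid R\<^esub> finsum R c A \<in> generate (add_monoid R) (\<Union>k. G k)"
      using insert c(1) by (intro generate.eng[OF generate.incl insert.IH]) auto
    then show ?case using insert cc by simp
  qed
  then show "a \<in> generate (add_monoid R) (\<Union>k. G k)" using c by blast
qed

section \<open>Rings of linear endomorphisms\<close>

lemma lin_end_ring: assumes P: "ring P" and L: "L \<subseteq> carrier P" shows "ring (lin_end P L)"
proof -
  interpret P: ring P by fact
  let ?E = "lin_end P L"
  have c: "F \<in> carrier ?E \<longleftrightarrow> F \<in> carrier P \<rightarrow>\<^sub>E carrier P \<and>
       (\<forall>f\<in>carrier P. \<forall>g\<in>carrier P. F (f \<oplus>\<^bsub>P\<^esub> g) = F f \<oplus>\<^bsub>P\<^esub> F g) \<and>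
       (\<forall>l\<in>L. \<forall>f\<in>carrier P. F (l \<otimes>\<^bsub>P\<^esub> f) = l \<otimes>\<^bsub>P\<^esub> F f)" for F
    by (simp add: lin_end_def)
  have s: "F \<otimes>\<^bsub>?E\<^esub> G = compose (carrier P) F G" "F \<oplus>\<^bsub>?E\<^esub> G = (\<lambda>f\<in>carrier P. F f \<oplus>\<^bsub>P\<^esub> G f)"
    "\<one>\<^bsub>?E\<^esub> = (\<lambda>f\<in>carrier P. f)" "\<zero>\<^bsub>?E\<^esub> = (\<lambda>f\<in>carrier P. \<zero>\<^bsub>P\<^esub>)" for F G
    by (auto simp: lin_end_def)
  have cl: "F f \<in> carrier P" if "F \<in> carrier ?E" "f \<in> carrier P" for F f using that by (auto simp: c)
  have ext: "F = G" if "F \<in> carrier ?E" "G \<in> carrier ?E" "\<And>f. f \<in> carrier P \<Longrightarrow> F f = G f" for F G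
    using that by (intro extensionalityI[of F "carrier P" G]) (auto simp: c PiE_def)
  have lc: "l \<in> carrier P" if "l \<in> L" for l using that L by blast
  have add: "F \<oplus>\<^bsub>?E\<^esub> G \<in> carrier ?E" if "F \<in> carrier ?E" "G \<in> carrier ?E" for F G
    using that cl[OF that(1)] cl[OF that(2)] lc by (auto simp: c s P.r_distr P.a_ac)
  have mult: "F \<otimes>\<^bsub>?E\<^esub> G \<in> carrier ?E" if "F \<in> carrier ?E" "G \<in> carrier ?E" for F G
    using that cl[OF that(1)] cl[OF that(2)] lc by (auto simp: c s compose_def)
  have one: "\<one>\<^bsub>?E\<^esub> \<in> carrier ?E" using lc by (auto simp: c s)
  have zero: "\<zero>\<^bsub>?E\<^esub> \<in> carrier ?E" using lc by (auto simp: c s)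
  have neg: "(\<lambda>f\<in>carrier P. \<ominus>\<^bsub>P\<^esub> F f) \<in> carrier ?E" if "F \<in> carrier ?E" for F
    using that cl[OF that] lc by (auto simp: c P.minus_add P.r_minus)
  show ?thesis
  proof (rule ringI)
    show "abelian_group ?E"
    proof (rule abelian_groupI)
      fix F assume F: "F \<in> carrier ?E"
      show "\<exists>y\<in>carrier ?E. y \<oplus>\<^bsub>?E\<^esub> F = \<zero>\<^bsub>?E\<^esub>"
        by (rule bexI[OF _ neg[OF F]], rule ext[OF add[OF neg[OF F] F] zero]) (use cl[OF F] in \<open>simp add: s P.l_neg\<close>)
      show "\<zero>\<^bsub>?E\<^esub> \<oplus>\<^bsub>?E\<^esub> F = F" by (rule ext[OF add[OF zero F] F]) (use cl[OF F] in \<open>simp add: s\<close>)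
      fix G assume G: "G \<in> carrier ?E"
      show "F \<oplus>\<^bsub>?E\<^esub> G = G \<oplus>\<^bsub>?E\<^esub> F" by (rule ext[OF add[OF F G] add[OF G F]]) (use cl[OF F] cl[OF G] in \<open>simp add: s P.a_comm\<close>)
      fix K assume K: "K \<in> carrier ?E"
      show "F \<oplus>\<^bsub>?E\<^esub> G \<oplus>\<^bsub>?E\<^esub> K = F \<oplus>\<^bsub>?E\<^esub> (G \<oplus>\<^bsub>?E\<^esub> K)"
        by (rule ext[OF add[OF add[OF F G] K] add[OF F add[OF G K]]]) (use cl[OF F] cl[OF G] cl[OF K] in \<open>simp add: s P.a_assoc\<close>)
    qed (use add zero in auto)
    show "monoid ?E"
    proof (rule monoidI)
      fix F assume F: "F \<in> carrier ?E"
      show "\<one>\<^bsub>?E\<^esub> \<otimes>\<^bsub>?E\<^esub> F = F" by (rule ext[OF mult[OF one F] F]) (use cl[OF F] in \<open>simp add: s compose_def\<close>)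
      show "F \<otimes>\<^bsub>?E\<^esub> \<one>\<^bsub>?E\<^esub> = F" by (rule ext[OF mult[OF F one] F]) (use cl[OF F] in \<open>simp add: s compose_def\<close>)
      fix G K assume G: "G \<in> carrier ?E" and K: "K \<in> carrier ?E"
      show "F \<otimes>\<^bsub>?E\<^esub> G \<otimes>\<^bsub>?E\<^esub> K = F \<otimes>\<^bsub>?E\<^esub> (G \<otimes>\<^bsub>?E\<^esub> K)"
        by (rule ext[OF mult[OF mult[OF F G] K] mult[OF F mult[OF G K]]]) (use cl[OF K] in \<open>simp add: s compose_def\<close>)
    qed (use mult one in auto)
    fix F G K assume F: "F \<in> carrier ?E" and G: "G \<in> carrier ?E" and K: "K \<in> carrier ?E"
    show "(F \<oplus>\<^bsub>?E\<^esub> G) \<otimes>\<^bsub>?E\<^esub> K = F \<otimes>\<^bsub>?E\<^esub> K \<oplus>\<^bsub>?E\<^esub> G \<otimes>\<^bsub>?E\<^esub> K"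
      by (rule ext[OF mult[OF add[OF F G] K] add[OF mult[OF F K] mult[OF G K]]]) (use cl[OF K] in \<open>simp add: s compose_def\<close>)
    show "K \<otimes>\<^bsub>?E\<^esub> (F \<oplus>\<^bsub>?E\<^esub> G) = K \<otimes>\<^bsub>?E\<^esub> F \<oplus>\<^bsub>?E\<^esub> K \<otimes>\<^bsub>?E\<^esub> G"
      by (rule ext[OF mult[OF K add[OF F G]] add[OF mult[OF K F] mult[OF K G]]])
        (use K cl[OF F] cl[OF G] in \<open>simp add: s compose_def\<close>, use K cl[OF F] cl[OF G] in \<open>simp add: c\<close>)
  qed
qed

section \<open>Integer multiples\<close>

lemma Const_int: "Const (c :: int) = of_int c"
  by (rule poly_mapping_eqI) (simp add: lookup_of_int lookup_single)

lemma add_pow_hom: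
  assumes R: "ring R" and H: "group H" and h: "h \<in> hom (add_monoid R) H" and x: "x \<in> carrier R"
  shows "h ([(m::int)] \<cdot>\<^bsub>R\<^esub> x) = h x [^]\<^bsub>H\<^esub> m"
proof -
  interpret gh: group_hom "add_monoid R" H h
    using assms ring_add_group by (auto simp: group_hom_def group_hom_axioms_def)
  show ?thesis using gh.hom_int_pow[of x m] x by (simp add: add_pow_def)
qed

lemma add_pow_ring_hom:
  assumes R: "ring R" and S: "ring S" and h: "h \<in> ring_hom R S" and x: "x \<in> carrier R"
  shows "h ([(m::int)] \<cdot>\<^bsub>R\<^esub> x) = [m] \<cdot>\<^bsub>S\<^esub> h x"
  using add_pow_hom[OF R ring_add_group[OF S] ring_homD_add[OF R S h] x] by (simp add: add_pow_def)

lemma a_inv_eq_uminus: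
  fixes R :: "('k::comm_ring_1, 'm) ring_scheme"
  assumes R: "ring R" "ring.add R = (+)" "ring.zero R = 0" and x: "x \<in> carrier R" "- x \<in> carrier R"
  shows "\<ominus>\<^bsub>R\<^esub> x = - x"
  by (rule abelian_group.minus_equality[OF ring.is_abelian_group[OF R(1)]]) (use R x in auto)

lemma int_pow_of_int:
  fixes R :: "('k::comm_ring_1, 'm) ring_scheme"
  assumes R: "ring R" and add: "ring.add R = (+)" and zero: "ring.zero R = 0"
    and u: "\<And>y. y \<in> carrier R \<Longrightarrow> - y \<in> carrier R" and x: "x \<in> carrier R"
  shows "x [^]\<^bsub>add_monoid R\<^esub> (m::int) = of_int m * x"
proof -
  interpret A: group "add_monoid R" by (rule ring_add_group[OF R])
  have nat: "x [^]\<^bsub>add_monoid R\<^esub> (k::nat) = of_nat k * x" for k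
    by (induction k) (simp_all add: add zero algebra_simps)
  have nc: "of_nat k * x \<in> carrier R" for k using A.nat_pow_closed[of x k] x by (simp add: nat)
  show ?thesis
  proof (cases m rule: int_cases2)
    case (nonneg k)
    have "x [^]\<^bsub>add_monoid R\<^esub> m = x [^]\<^bsub>add_monoid R\<^esub> k" unfolding nonneg by (rule int_pow_int)
    then show ?thesis unfolding nat nonneg by simp
  next
    case (nonpos k)
    have "x [^]\<^bsub>add_monoid R\<^esub> m = inv\<^bsub>add_monoid R\<^esub> (x [^]\<^bsub>add_monoid R\<^esub> k)"
      unfolding nonpos using A.int_pow_neg_int[of x k] x by simp
    also have "\<dots> = \<ominus>\<^bsub>R\<^esub> (of_nat k * x)" unfolding nat by (simp add: a_inv_def)
    also have "\<dots> = - (of_nat k * x)" by (rule a_inv_eq_uminus[OF R add zero nc u[OF nc]])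
    finally show ?thesis unfolding nonpos by simp
  qed
qed

context weyl_datum
begin

section \<open>The polynomial ring and its endomorphisms\<close>

lemma Pol_ring: "ring (Pol D :: 'k::comm_ring_1 pol ring)"
proof (rule ringI)
  show "abelian_group (Pol D :: 'k pol ring)"
  proof (rule abelian_groupI)
    fix x :: "'k pol" assume "x \<in> carrier (Pol D)"
    then show "\<exists>y\<in>carrier (Pol D). y \<oplus>\<^bsub>Pol D\<^esub> x = \<zero>\<^bsub>Pol D\<^esub>" by (intro bexI[of _ "- x"]) auto
  qed (auto simp: add_ac)
  show "monoid (Pol D :: 'k pol ring)" by (rule monoidI) (auto simp: mult_ac)
qed (auto simp: algebra_simps)

lemma Pol_inv: "x \<in> PC \<Longrightarrow> \<ominus>\<^bsub>Pol D\<^esub> x = - x"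
  by (rule a_inv_eq_uminus[OF Pol_ring]) auto

lemma Pol_int_pow: "x \<in> PC \<Longrightarrow> x [^]\<^bsub>add_monoid (Pol D)\<^esub> (m::int) = of_int m * (x :: 'k::comm_ring_1 pol)"
  by (rule int_pow_of_int[OF Pol_ring]) auto

text \<open>For all coefficient rings at once: the polynomial representation acts by elements of the integral
  version, while the theorem is about the rational one (\<open>EndQ_EE\<close>).\<close>

definition EE :: "('k::comm_ring_1 pol \<Rightarrow> 'k pol) ring" where
  "EE = lin_end (Pol D) Inv"

lemma EE_ring: "ring (EE :: ('k::comm_ring_1 pol \<Rightarrow> 'k pol) ring)"
  unfolding EE_def by (rule lin_end_ring[OF Pol_ring]) (auto dest: Inv_PC)

lemma EE_carrier: "F \<in> carrier EE \<longleftrightarrow> F \<in> PC \<rightarrow>\<^sub>E PC \<and> (\<forall>f\<in>PC. \<forall>g\<in>PC. F (f + g) = F f + F g) \<and> (\<forall>l\<in>Inv. \<forall>f\<in>PC. F (l * f) = l * F f)"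
  by (simp add: EE_def lin_end_def)

lemma EE_simps:
  "f \<in> PC \<Longrightarrow> (F \<otimes>\<^bsub>EE\<^esub> K) f = F (K f)"
  "f \<in> PC \<Longrightarrow> (F \<oplus>\<^bsub>EE\<^esub> K) f = F f + K f"
  "f \<in> PC \<Longrightarrow> \<one>\<^bsub>EE\<^esub> f = f"
  "f \<in> PC \<Longrightarrow> \<zero>\<^bsub>EE\<^esub> f = 0"
  by (auto simp: EE_def lin_end_def compose_def)

lemma EE_PC: "F \<in> carrier EE \<Longrightarrow> f \<in> PC \<Longrightarrow> F f \<in> PC"
  by (auto simp: EE_carrier)

lemma EE_add: "F \<in> carrier EE \<Longrightarrow> f \<in> PC \<Longrightarrow> g \<in> PC \<Longrightarrow> F (f + g) = F f + F g"
  and EE_lin: "F \<in> carrier EE \<Longrightarrow> f \<in> PC \<Longrightarrow> l \<in> Inv \<Longrightarrow> F (l * f) = l * F f"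
  by (auto simp: EE_carrier)

lemma EE_eqI: "F \<in> carrier EE \<Longrightarrow> K \<in> carrier EE \<Longrightarrow> (\<And>f. f \<in> PC \<Longrightarrow> F f = K f) \<Longrightarrow> F = K"
  by (rule extensionalityI[of F PC K]) (auto simp: EE_carrier PiE_def)

lemma EE_0: "F \<in> carrier EE \<Longrightarrow> F 0 = (0 :: 'k::comm_ring_1 pol)"
  using EE_add[of F 0 0] by simp

lemma EE_sum: "F \<in> carrier EE \<Longrightarrow> (\<And>a. a \<in> A \<Longrightarrow> f a \<in> PC) \<Longrightarrow> F (sum f A) = (\<Sum>a\<in>A. F (f a) :: 'k::comm_ring_1 pol)"
  by (induction A rule: infinite_finite_induct) (auto simp: EE_0 EE_add)

lemma EE_eval_hom: "f \<in> PC \<Longrightarrow> (\<lambda>F. F f) \<in> hom (add_monoid EE) (add_monoid (Pol D :: 'k::comm_ring_1 pol ring))"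
  by (rule homI) (auto simp: EE_PC EE_simps)

lemma EE_add_pow: "f \<in> PC \<Longrightarrow> F \<in> carrier EE \<Longrightarrow> ([(m::int)] \<cdot>\<^bsub>EE\<^esub> F) f = of_int m * (F f :: 'k::comm_ring_1 pol)"
  using add_pow_hom[OF EE_ring ring_add_group[OF Pol_ring] EE_eval_hom, of f F m] Pol_int_pow[of "F f" m] EE_PC[of F f] by simp

lemma EE_uminus: "f \<in> PC \<Longrightarrow> F \<in> carrier EE \<Longrightarrow> (\<ominus>\<^bsub>EE\<^esub> F) f = - (F f :: 'k::comm_ring_1 pol)"
  using add_hom_inv[OF EE_ring ring_add_group[OF Pol_ring] EE_eval_hom, of f F] Pol_inv[of "F f"] EE_PC[of F f]
  by (simp add: a_inv_def)

text \<open>Elements of \<open>lin_end\<close> are extensional functions, hence the restriction to the carrier.\<close>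

definition mulop :: "'k::comm_ring_1 pol \<Rightarrow> 'k pol \<Rightarrow> 'k pol" where
  "mulop g = (\<lambda>f\<in>PC. g * f)"

definition wordop :: "'i list \<Rightarrow> 'k::comm_ring_1 pol \<Rightarrow> 'k pol" where
  "wordop u = (\<lambda>f\<in>PC. dword u f)"

lemma mulop_EE [simp]: "g \<in> PC \<Longrightarrow> mulop g \<in> carrier EE"
  by (auto simp: EE_carrier mulop_def Inv_PC algebra_simps)

lemma wordop_EE [simp]: "u \<in> lists I \<Longrightarrow> wordop u \<in> carrier (EE :: ('k::{idom, ring_char_0} pol \<Rightarrow> 'k pol) ring)"
  by (auto simp: EE_carrier wordop_def Inv_PC dword_add dword_Inv)

lemma mulop_apply [simp]: "f \<in> PC \<Longrightarrow> mulop g f = g * f"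
  and wordop_apply [simp]: "f \<in> PC \<Longrightarrow> wordop u f = dword u f"
  by (auto simp: mulop_def wordop_def)

section \<open>The nilCoxeter algebra\<close>

abbreviation "wmon \<equiv> \<lparr>carrier = lists I, monoid.mult = (@), one = []\<rparr>"

lemma wmon_monoid: "monoid wmon"
  by (rule monoidI) auto

lemma FA_ring: "ring (free_algebra I)"
  unfolding free_algebra_def by (rule monoid_ring_ring[OF wmon_monoid])

definition nc_rel :: "('i list \<Rightarrow>\<^sub>0 int) set" where
  "nc_rel = {frag_of [i, i] | i. i \<in> I} \<union>
      {frag_of (alt_word (cox D i j) i j) - frag_of (alt_word (cox D i j) j i) | i j. i \<in> I \<and> j \<in> I \<and> i \<noteq> j}"

lemma FA_frag: "u \<in> lists I \<Longrightarrow> frag_of u \<in> carrier (free_algebra I)"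
  by (simp add: free_algebra_def monoid_ring_simps keys_single)

lemma FA_carrier: "carrier (free_algebra I) = {c. Poly_Mapping.keys c \<subseteq> lists I}"
  by (simp add: free_algebra_def monoid_ring_simps)

lemma FA_diff: "a \<in> carrier (free_algebra I) \<Longrightarrow> b \<in> carrier (free_algebra I) \<Longrightarrow> a - b \<in> carrier (free_algebra I)"
  unfolding FA_carrier using keys_frag_diff[of a "lists I" b] by simp

lemma FA_minus: "a \<in> carrier (free_algebra I) \<Longrightarrow> b \<in> carrier (free_algebra I) \<Longrightarrow> a - b = a \<ominus>\<^bsub>free_algebra I\<^esub> b"
  using add_monoid_inv_monoid_ring[of b wmon] by (simp add: free_algebra_def monoid_ring_simps a_inv_def a_minus_def)

lemma nc_rel_carrier: "nc_rel \<subseteq> carrier (free_algebra I)"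
  unfolding nc_rel_def by (safe; (intro FA_diff FA_frag alt_word_lists)?; simp)

lemma NC_ideal: "ideal (nilCoxeter_ideal D) (free_algebra I)"
  unfolding nilCoxeter_ideal_def nc_rel_def[symmetric] by (rule ring.genideal_ideal[OF FA_ring nc_rel_carrier])

lemma NC_rel: "r \<in> nc_rel \<Longrightarrow> r \<in> nilCoxeter_ideal D"
  unfolding nilCoxeter_ideal_def nc_rel_def[symmetric] using ring.genideal_self[OF FA_ring nc_rel_carrier] by blast

lemma NC_ring: "ring (nilCoxeter D)"
  unfolding nilCoxeter_def using ideal.quotient_is_ring[OF NC_ideal] .

definition ncw :: "'i list \<Rightarrow> ('i list \<Rightarrow>\<^sub>0 int) set" where
  "ncw u = a_r_coset (free_algebra I) (nilCoxeter_ideal D) (frag_of u)"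

lemma nc_del_ncw: "nc_del D i = ncw [i]"
  by (simp add: nc_del_def ncw_def)

lemma NC_proj: "a_r_coset (free_algebra I) (nilCoxeter_ideal D) \<in> ring_hom (free_algebra I) (nilCoxeter D)"
  unfolding nilCoxeter_def by (rule ideal.rcos_ring_hom[OF NC_ideal])

lemma ncw_closed [simp]: "u \<in> lists I \<Longrightarrow> ncw u \<in> carrier (nilCoxeter D)"
  unfolding ncw_def using ring_hom_closed[OF NC_proj] FA_frag by blast

lemma FA_mult_frag: "frag_of u \<otimes>\<^bsub>free_algebra I\<^esub> frag_of v = frag_of (u @ v)"
  by (simp add: free_algebra_def monoid_ring_frag_mult)

lemma ncw_append: "u \<in> lists I \<Longrightarrow> v \<in> lists I \<Longrightarrow> ncw (u @ v) = ncw u \<otimes>\<^bsub>nilCoxeter D\<^esub> ncw v"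
  unfolding ncw_def using ring_hom_mult[OF NC_proj FA_frag FA_frag, of u v] by (simp add: FA_mult_frag)

lemma ncw_Nil: "ncw [] = \<one>\<^bsub>nilCoxeter D\<^esub>"
  unfolding ncw_def using ring_hom_one[OF NC_proj] by (simp add: free_algebra_def monoid_ring_simps)

lemma NC_proj_ideal: "r \<in> nilCoxeter_ideal D \<Longrightarrow> a_r_coset (free_algebra I) (nilCoxeter_ideal D) r = \<zero>\<^bsub>nilCoxeter D\<^esub>"
proof -
  interpret J: ideal "nilCoxeter_ideal D" "free_algebra I" by (rule NC_ideal)
  assume "r \<in> nilCoxeter_ideal D"
  then have "a_r_coset (free_algebra I) (nilCoxeter_ideal D) r = nilCoxeter_ideal D" by (rule J.a_rcos_const)
  then show ?thesis by (simp add: nilCoxeter_def FactRing_def)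
qed

lemma ncw_sq: assumes "i \<in> I" shows "ncw [i, i] = \<zero>\<^bsub>nilCoxeter D\<^esub>"
  unfolding ncw_def by (rule NC_proj_ideal[OF NC_rel]) (use assms in \<open>auto simp: nc_rel_def\<close>)

lemma ncw_braid: assumes ij: "i \<in> I" "j \<in> I" "i \<noteq> j"
  shows "ncw (alt_word (cox D i j) i j) = ncw (alt_word (cox D i j) j i)"
proof -
  interpret NC: ring "nilCoxeter D" by (rule NC_ring)
  interpret p: ring_hom_ring "free_algebra I" "nilCoxeter D" "a_r_coset (free_algebra I) (nilCoxeter_ideal D)"
    by (rule ring_hom_ringI2[OF FA_ring NC_ring NC_proj])
  let ?a = "frag_of (alt_word (cox D i j) i j)" and ?b = "frag_of (alt_word (cox D i j) j i)"
  have ab: "?a \<in> carrier (free_algebra I)" "?b \<in> carrier (free_algebra I)" using ij by (simp_all add: FA_frag)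
  have "?a - ?b \<in> nc_rel" using ij unfolding nc_rel_def by blast
  then have "a_r_coset (free_algebra I) (nilCoxeter_ideal D) (?a \<ominus>\<^bsub>free_algebra I\<^esub> ?b) = \<zero>\<^bsub>nilCoxeter D\<^esub>"
    unfolding FA_minus[OF ab, symmetric] by (rule NC_proj_ideal[OF NC_rel])
  then have "ncw (alt_word (cox D i j) i j) \<ominus>\<^bsub>nilCoxeter D\<^esub> ncw (alt_word (cox D i j) j i) = \<zero>\<^bsub>nilCoxeter D\<^esub>"
    unfolding ncw_def using ab by (simp add: a_minus_def)
  then show ?thesis using ij by (subst (asm) NC.r_right_minus_eq) auto
qed

lemma ncw_braid_context:
  assumes "a \<in> lists I" "b \<in> lists I" "i \<in> I" "j \<in> I" "i \<noteq> j"
  shows "ncw (a @ alt_word (cox D i j) i j @ b) = ncw (a @ alt_word (cox D i j) j i @ b)"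
proof -
  have l: "alt_word (cox D i j) i j @ b \<in> lists I" "alt_word (cox D i j) j i @ b \<in> lists I"
    "alt_word (cox D i j) i j \<in> lists I" "alt_word (cox D i j) j i \<in> lists I" using assms by auto
  show ?thesis
    unfolding ncw_append[OF assms(1) l(1)] ncw_append[OF assms(1) l(2)] ncw_append[OF l(3) assms(2)] ncw_append[OF l(4) assms(2)]
    using ncw_braid[OF assms(3-5)] by simp
qed

lemma ncw_reduced: "reduced u \<Longrightarrow> reduced v \<Longrightarrow> wmat u = wmat v \<Longrightarrow> ncw u = ncw v"
  using matsumoto[of ncw u v "[]", OF ncw_braid_context] by simp

lemma ncw_nonreduced: assumes "u \<in> lists I" "\<not> reduced u" shows "ncw u = \<zero>\<^bsub>nilCoxeter D\<^esub>"
proof -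
  interpret NC: ring "nilCoxeter D" by (rule NC_ring)
  have "ncw (u @ []) = \<zero>\<^bsub>nilCoxeter D\<^esub>"
  proof (rule nonreduced_zero[of ncw, OF ncw_braid_context])
    fix a b i assume a: "a \<in> lists I" "b \<in> lists I" "i \<in> I"
    have "ncw (a @ [i, i] @ b) = ncw a \<otimes>\<^bsub>nilCoxeter D\<^esub> (ncw [i, i] \<otimes>\<^bsub>nilCoxeter D\<^esub> ncw b)"
      using a ncw_append[of a "[i, i] @ b"] ncw_append[of "[i, i]" b] by simp
    then show "ncw (a @ [i, i] @ b) = \<zero>\<^bsub>nilCoxeter D\<^esub>" using a ncw_sq by simp
  qed (use assms in auto)
  then show ?thesis by simp
qed

definition red :: "int mat \<Rightarrow> 'i list" where
  "red w = (SOME u. reduced u \<and> wmat u = w)"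

lemma red: assumes "w \<in> W" shows "reduced (red w)" "wmat (red w) = w" "red w \<in> lists I" "length (red w) = len w"
proof -
  obtain u where "u \<in> lists I" "wmat u = w" "length u = len w" using reduced_word_exists[OF assms] by metis
  then have "reduced u \<and> wmat u = w" by (auto simp: reduced_def)
  then have "reduced (red w) \<and> wmat (red w) = w" unfolding red_def by (rule someI)
  then show "reduced (red w)" "wmat (red w) = w" "red w \<in> lists I" "length (red w) = len w" by (auto simp: reduced_def)
qed

lemma ncw_cases: "u \<in> lists I \<Longrightarrow> ncw u = \<zero>\<^bsub>nilCoxeter D\<^esub> \<or> ncw u = ncw (red (wmat u))"
  using ncw_nonreduced ncw_reduced[of u "red (wmat u)"] red[of "wmat u"] wmat_in_W by metis

lemma NC_induct [consumes 1, case_names word diff]: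
  assumes x: "x \<in> carrier (nilCoxeter D)" and w: "\<And>u. u \<in> lists I \<Longrightarrow> P (ncw u)"
    and d: "\<And>x y. x \<in> carrier (nilCoxeter D) \<Longrightarrow> y \<in> carrier (nilCoxeter D) \<Longrightarrow> P x \<Longrightarrow> P y \<Longrightarrow> P (x \<ominus>\<^bsub>nilCoxeter D\<^esub> y)"
  shows "P x"
proof -
  interpret p: ring_hom_ring "free_algebra I" "nilCoxeter D" "a_r_coset (free_algebra I) (nilCoxeter_ideal D)"
    by (rule ring_hom_ringI2[OF FA_ring NC_ring NC_proj])
  obtain c where c: "c \<in> carrier (free_algebra I)" "x = a_r_coset (free_algebra I) (nilCoxeter_ideal D) c"
    using x by (auto simp: nilCoxeter_def quot_carrier)
  have "P (a_r_coset (free_algebra I) (nilCoxeter_ideal D) c)"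
    using c(1)[unfolded free_algebra_def] wmon_monoid
  proof (induction c rule: monoid_ring_induct)
    case (one g)
    then show ?case using w by (simp add: ncw_def)
  next
    case (diff a b)
    then have ab: "a \<in> carrier (free_algebra I)" "b \<in> carrier (free_algebra I)" by (auto simp: free_algebra_def)
    have "a_r_coset (free_algebra I) (nilCoxeter_ideal D) (a - b) =
      a_r_coset (free_algebra I) (nilCoxeter_ideal D) a \<ominus>\<^bsub>nilCoxeter D\<^esub> a_r_coset (free_algebra I) (nilCoxeter_ideal D) b"
      unfolding FA_minus[OF ab] using ab by (simp add: a_minus_def)
    then show ?case using d ab diff by simp
  qed
  then show ?thesis using c by simp
qed

lemma NC_rep_exists: "\<exists>\<sigma>\<in>ring_hom (nilCoxeter D) (EE :: ('k::{idom, ring_char_0} pol \<Rightarrow> 'k pol) ring). \<forall>u\<in>lists I. \<sigma> (ncw u) = wordop u"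
proof -
  interpret E: ring "EE :: ('k pol \<Rightarrow> 'k pol) ring" by (rule EE_ring)
  interpret F: ring "free_algebra I" by (rule FA_ring)
  have "(wordop :: _ \<Rightarrow> 'k pol \<Rightarrow> 'k pol) \<in> hom wmon EE"
    by (rule homI, simp, rule EE_eqI) (auto simp: EE_simps dword_append)
  moreover have "(wordop [] :: 'k pol \<Rightarrow> 'k pol) = \<one>\<^bsub>EE\<^esub>"
    by (rule EE_eqI) (auto simp: EE_simps)
  ultimately obtain h where h: "h \<in> ring_hom (free_algebra I) EE" "\<And>u. u \<in> lists I \<Longrightarrow> h (frag_of u) = (wordop u :: 'k pol \<Rightarrow> 'k pol)"
    using monoid_ring_hom[OF wmon_monoid EE_ring, of wordop] unfolding free_algebra_def by auto
  interpret h: ring_hom_ring "free_algebra I" "EE :: ('k pol \<Rightarrow> 'k pol) ring" h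
    by (rule ring_hom_ringI2[OF FA_ring EE_ring h(1)])
  have z: "h r = \<zero>\<^bsub>EE\<^esub>" if r: "r \<in> nc_rel" for r
  proof -
    from r consider i where "i \<in> I" "r = frag_of [i, i]"
      | i j where "i \<in> I" "j \<in> I" "i \<noteq> j" "r = frag_of (alt_word (cox D i j) i j) - frag_of (alt_word (cox D i j) j i)"
      by (auto simp: nc_rel_def)
    then show ?thesis
    proof cases
      case 1
      then show ?thesis by (intro EE_eqI) (auto simp: h(2) EE_simps dword_Cons dem_dem)
    next
      case 2
      have l: "alt_word (cox D i j) i j \<in> lists I" "alt_word (cox D i j) j i \<in> lists I" using 2 by auto
      have "(wordop (alt_word (cox D i j) i j) :: 'k pol \<Rightarrow> 'k pol) = wordop (alt_word (cox D i j) j i)"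
      proof (rule EE_eqI)
        fix f :: "'k pol" assume f: "f \<in> PC"
        show "wordop (alt_word (cox D i j) i j) f = wordop (alt_word (cox D i j) j i) f"
          using dword_braid[OF 2(1-3) f] f by simp
      qed (use l in auto)
      then show ?thesis using 2(4) FA_minus[OF FA_frag[OF l(1)] FA_frag[OF l(2)]] FA_frag[OF l(1)] FA_frag[OF l(2)] l
        by (simp add: a_minus_def h(2) E.r_neg)
    qed
  qed
  have "nilCoxeter_ideal D \<subseteq> a_kernel (free_algebra I) EE h"
    unfolding nilCoxeter_ideal_def nc_rel_def[symmetric]
  proof (rule F.genideal_minimal[OF h.kernel_is_ideal], rule subsetI)
    fix r assume r: "r \<in> nc_rel"
    show "r \<in> a_kernel (free_algebra I) EE h"
      unfolding a_kernel_def' using z[OF r] subsetD[OF nc_rel_carrier r] by blast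
  qed
  then have "h x = \<zero>\<^bsub>EE\<^esub>" if "x \<in> nilCoxeter_ideal D" for x using that unfolding a_kernel_def' by blast
  from quot_ring_hom[OF NC_ideal EE_ring h(1) this] obtain \<sigma> where
    "\<sigma> \<in> ring_hom (nilCoxeter D) EE" "\<And>x. x \<in> carrier (free_algebra I) \<Longrightarrow> \<sigma> (a_r_coset (free_algebra I) (nilCoxeter_ideal D) x) = h x"
    unfolding nilCoxeter_def by blast
  then show ?thesis unfolding ncw_def using h(2) FA_frag by (intro bexI[of _ \<sigma>]) auto
qed

end

section \<open>The nilHecke algebra\<close>

locale nil_hecke = weyl_datum D for D :: "('i, 'z) refl_datum_scheme" +
  fixes NH :: "('a, 'm) ring_scheme" and \<iota> :: "('i list \<Rightarrow>\<^sub>0 int) set \<Rightarrow> 'a" and \<kappa> :: "int pol \<Rightarrow> 'a"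
  assumes nilHecke: "nilHecke D NH \<iota> \<kappa>"
begin

abbreviation "PZ \<equiv> (PC :: int pol set)"
abbreviation "NCT \<equiv> tensor_ring (nilCoxeter D) (Pol D :: int pol ring)"

lemma NH_ring: "ring NH" and \<iota>_hom: "\<iota> \<in> ring_hom (nilCoxeter D) NH" and \<kappa>_hom: "\<kappa> \<in> ring_hom (Pol D) NH"
  and NH_iso: "\<exists>\<theta> \<in> iso (add_monoid NCT) (add_monoid NH).
        \<forall>a\<in>carrier (nilCoxeter D). \<forall>f\<in>PZ. \<theta> (pure_tensor (nilCoxeter D) (Pol D) a f) = \<iota> a \<otimes>\<^bsub>NH\<^esub> \<kappa> f"
  using nilHecke unfolding nilHecke_def by auto

sublocale NH: ring NH by (rule NH_ring)
sublocale NC: ring "nilCoxeter D" by (rule NC_ring)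
sublocale \<iota>: ring_hom_ring "nilCoxeter D" NH \<iota> by (rule ring_hom_ringI2[OF NC_ring NH_ring \<iota>_hom])
sublocale \<kappa>: ring_hom_ring "Pol D :: int pol ring" NH \<kappa> by (rule ring_hom_ringI2[OF Pol_ring NH_ring \<kappa>_hom])

lemma \<kappa>_add: "f \<in> PC \<Longrightarrow> g \<in> PC \<Longrightarrow> \<kappa> (f + g) = \<kappa> f \<oplus>\<^bsub>NH\<^esub> \<kappa> g" using \<kappa>.hom_add by simp
lemma \<kappa>_mult: "f \<in> PC \<Longrightarrow> g \<in> PC \<Longrightarrow> \<kappa> (f * g) = \<kappa> f \<otimes>\<^bsub>NH\<^esub> \<kappa> g" using \<kappa>.hom_mult by simp
lemma \<kappa>_one: "\<kappa> 1 = \<one>\<^bsub>NH\<^esub>" using \<kappa>.hom_one by simp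
lemma \<kappa>_zero: "\<kappa> 0 = \<zero>\<^bsub>NH\<^esub>" using \<kappa>.hom_zero by simp
lemma \<kappa>_uminus: "f \<in> PC \<Longrightarrow> \<kappa> (- f) = \<ominus>\<^bsub>NH\<^esub> \<kappa> f" using \<kappa>.hom_a_inv[of f] Pol_inv[of f] by simp

lemma \<kappa>_of_int_mult: "f \<in> PC \<Longrightarrow> \<kappa> (of_int m * f) = [m] \<cdot>\<^bsub>NH\<^esub> \<kappa> f"
  using add_pow_ring_hom[OF Pol_ring NH_ring \<kappa>_hom, of f m] Pol_int_pow[of f m] by (simp add: add_pow_def)

definition del :: "'i list \<Rightarrow> 'a" where "del u = \<iota> (ncw u)"

lemma del_closed [simp]: "u \<in> lists I \<Longrightarrow> del u \<in> carrier NH"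
  by (simp add: del_def)

lemma del_append: "u \<in> lists I \<Longrightarrow> v \<in> lists I \<Longrightarrow> del (u @ v) = del u \<otimes>\<^bsub>NH\<^esub> del v"
  by (simp add: del_def ncw_append)

lemma del_Cons: "i \<in> I \<Longrightarrow> u \<in> lists I \<Longrightarrow> del (i # u) = del [i] \<otimes>\<^bsub>NH\<^esub> del u"
  using del_append[of "[i]" u] by simp

lemma del_Nil: "del [] = \<one>\<^bsub>NH\<^esub>"
  by (simp add: del_def ncw_Nil)

lemma del_cases: "u \<in> lists I \<Longrightarrow> del u = \<zero>\<^bsub>NH\<^esub> \<or> del u = del (red (wmat u))"
  using ncw_cases[of u] by (auto simp: del_def)

lemma cross: "x \<in> carrier_vec n \<Longrightarrow> i \<in> I \<Longrightarrow>
    \<kappa> (lin x) \<otimes>\<^bsub>NH\<^esub> del [i] = del [i] \<otimes>\<^bsub>NH\<^esub> \<kappa> (lin (s i *\<^sub>v x)) \<oplus>\<^bsub>NH\<^esub> [(x \<bullet> rt i)] \<cdot>\<^bsub>NH\<^esub> \<one>\<^bsub>NH\<^esub>"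
proof -
  assume x: "x \<in> carrier_vec n" and i: "i \<in> I"
  let ?A = "\<kappa> (lin x) \<otimes>\<^bsub>NH\<^esub> del [i]" and ?B = "del [i] \<otimes>\<^bsub>NH\<^esub> \<kappa> (lin (s i *\<^sub>v x))" and ?C = "[(x \<bullet> rt i)] \<cdot>\<^bsub>NH\<^esub> \<one>\<^bsub>NH\<^esub>"
  have "?A \<ominus>\<^bsub>NH\<^esub> ?B = ?C" using nilHecke x i unfolding nilHecke_def nc_del_ncw del_def by blast
  moreover have "?A \<in> carrier NH" "?B \<in> carrier NH" using x i by auto
  ultimately show ?thesis by (metis NH.minus_closed NH.a_comm NH.minus_eq NH.add.inv_closed NH.a_assoc NH.l_neg NH.r_zero)
qed

text \<open>This is surjectivity of the map from the tensor product of the nilCoxeter algebra and the polynomial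
  ring.\<close>

lemma NH_induct [consumes 1, case_names prod diff]:
  assumes y: "y \<in> carrier NH" and p: "\<And>u f. u \<in> lists I \<Longrightarrow> f \<in> PC \<Longrightarrow> P (del u \<otimes>\<^bsub>NH\<^esub> \<kappa> f)"
    and d: "\<And>x y. x \<in> carrier NH \<Longrightarrow> y \<in> carrier NH \<Longrightarrow> P x \<Longrightarrow> P y \<Longrightarrow> P (x \<ominus>\<^bsub>NH\<^esub> y)"
  shows "P y"
proof -
  obtain \<theta> where \<theta>: "\<theta> \<in> iso (add_monoid NCT) (add_monoid NH)"
      "\<And>a f. a \<in> carrier (nilCoxeter D) \<Longrightarrow> f \<in> PZ \<Longrightarrow> \<theta> (pure_tensor (nilCoxeter D) (Pol D) a f) = \<iota> a \<otimes>\<^bsub>NH\<^esub> \<kappa> f"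
    using NH_iso by blast
  interpret T: ring NCT by (rule tensor_ring_ring[OF NC_ring Pol_ring])
  have \<theta>h: "\<theta> \<in> hom (add_monoid NCT) (add_monoid NH)" and \<theta>s: "\<theta> ` carrier NCT = carrier NH"
    using \<theta>(1) by (auto simp: iso_def bij_betw_def)
  have pa: "P (\<iota> a \<otimes>\<^bsub>NH\<^esub> \<kappa> f)" if "a \<in> carrier (nilCoxeter D)" "f \<in> PC" for a f
    using that(1)
  proof (induction a rule: NC_induct)
    case (word u)
    then show ?case using p that(2) by (simp add: del_def)
  next
    case (diff a b)
    then show ?case using d[of "\<iota> a \<otimes>\<^bsub>NH\<^esub> \<kappa> f" "\<iota> b \<otimes>\<^bsub>NH\<^esub> \<kappa> f"] that(2)
      by (simp add: a_minus_def NH.l_distr NH.l_minus)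
  qed
  obtain t where t: "t \<in> carrier NCT" "y = \<theta> t" using y \<theta>s by blast
  have "P (\<theta> t)"
  proof (rule tensor_induct[OF NC_ring Pol_ring t(1), where P = "\<lambda>t. P (\<theta> t)"])
    fix a and f :: "int pol" assume "a \<in> carrier (nilCoxeter D)" "f \<in> carrier (Pol D)"
    then show "P (\<theta> (pure_tensor (nilCoxeter D) (Pol D) a f))" using pa \<theta>(2) by simp
  next
    fix x y assume 2: "x \<in> carrier NCT" "y \<in> carrier NCT" "P (\<theta> x)" "P (\<theta> y)"
    have "\<theta> (\<ominus>\<^bsub>NCT\<^esub> y) = \<ominus>\<^bsub>NH\<^esub> \<theta> y"
      using add_hom_inv[OF T.ring_axioms ring_add_group[OF NH_ring] \<theta>h 2(2)] by (simp add: a_inv_def)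
    then have "\<theta> (x \<ominus>\<^bsub>NCT\<^esub> y) = \<theta> x \<ominus>\<^bsub>NH\<^esub> \<theta> y"
      using hom_mult[OF \<theta>h, of x "\<ominus>\<^bsub>NCT\<^esub> y"] T.a_inv_closed[OF 2(2)] 2(1) by (simp add: a_minus_def)
    then show "P (\<theta> (x \<ominus>\<^bsub>NCT\<^esub> y))" using d hom_in_carrier[OF \<theta>h] 2 by simp
  qed
  then show ?thesis using t by simp
qed

text \<open>As an additive group the nilHecke algebra is a tensor product, which prescribes \<open>\<rho>\<close> as an additive
  map. Multiplicativity is proved for larger and larger classes of left factors: words in the
  \<open>\<partial>\<^sub>i\<close>, linear forms (moved to the right through a word by the commutation relation \<open>cross\<close>),
  polynomials, and then all elements.\<close>

lemma rep_exists:
  "\<exists>\<rho>\<in>ring_hom NH (EE :: ('k::{idom, ring_char_0} pol \<Rightarrow> 'k pol) ring).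
     (\<forall>u\<in>lists I. \<rho> (del u) = wordop u) \<and> (\<forall>f\<in>PC. \<rho> (\<kappa> f) = mulop (base f))"
proof -
  interpret E: ring "EE :: ('k pol \<Rightarrow> 'k pol) ring" by (rule EE_ring)
  obtain \<sigma> where \<sigma>: "\<sigma> \<in> ring_hom (nilCoxeter D) (EE :: ('k pol \<Rightarrow> 'k pol) ring)" "\<And>u. u \<in> lists I \<Longrightarrow> \<sigma> (ncw u) = wordop u"
    using NC_rep_exists by blast
  interpret \<sigma>: ring_hom_ring "nilCoxeter D" "EE :: ('k pol \<Rightarrow> 'k pol) ring" \<sigma> by (rule ring_hom_ringI2[OF NC_ring EE_ring \<sigma>(1)])
  \<comment> \<open>\<open>a \<otimes> f\<close> stands for \<open>a f\<close>: multiply by \<open>f\<close> first, then apply \<open>a\<close>.\<close>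
  define \<beta> where "\<beta> = (\<lambda>a f. \<sigma> a \<otimes>\<^bsub>EE\<^esub> (mulop (base f) :: 'k pol \<Rightarrow> 'k pol))"
  have madd: "mulop (base (f + g)) = (mulop (base f) :: 'k pol \<Rightarrow> 'k pol) \<oplus>\<^bsub>EE\<^esub> mulop (base g)" if "f \<in> PC" "g \<in> PC" for f g
    using that by (intro EE_eqI) (auto simp: EE_simps base_add algebra_simps)
  obtain h where h: "h \<in> hom (add_monoid NCT) (add_monoid EE)"
     "\<And>a f. a \<in> carrier (nilCoxeter D) \<Longrightarrow> f \<in> PZ \<Longrightarrow> h (pure_tensor (nilCoxeter D) (Pol D) a f) = \<beta> a f"
    using tensor_universal[OF NC_ring Pol_ring ring_add_comm_group[OF E.ring_axioms], of \<beta>]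
    by (auto simp: \<beta>_def madd E.l_distr E.r_distr)
  obtain \<theta> where \<theta>: "\<theta> \<in> iso (add_monoid NCT) (add_monoid NH)"
      "\<And>a f. a \<in> carrier (nilCoxeter D) \<Longrightarrow> f \<in> PZ \<Longrightarrow> \<theta> (pure_tensor (nilCoxeter D) (Pol D) a f) = \<iota> a \<otimes>\<^bsub>NH\<^esub> \<kappa> f"
    using NH_iso by blast
  interpret T: ring NCT by (rule tensor_ring_ring[OF NC_ring Pol_ring])
  define \<rho> where "\<rho> = h \<circ> inv_into (carrier NCT) \<theta>"
  have "inv_into (carrier NCT) \<theta> \<in> iso (add_monoid NH) (add_monoid NCT)"
    using group.iso_set_sym[OF ring_add_group[OF T.ring_axioms] \<theta>(1)] by simp
  then have \<rho>: "\<rho> \<in> hom (add_monoid NH) (add_monoid EE)"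
    unfolding \<rho>_def using hom_compose[OF _ h(1)] by (auto simp: iso_def)
  have \<rho>c: "\<rho> y \<in> carrier EE" if "y \<in> carrier NH" for y using hom_in_carrier[OF \<rho>] that by simp
  have \<rho>add: "\<rho> (x \<oplus>\<^bsub>NH\<^esub> y) = \<rho> x \<oplus>\<^bsub>EE\<^esub> \<rho> y" if "x \<in> carrier NH" "y \<in> carrier NH" for x y
    using hom_mult[OF \<rho>] that by simp
  have \<rho>neg: "\<rho> (\<ominus>\<^bsub>NH\<^esub> x) = \<ominus>\<^bsub>EE\<^esub> \<rho> x" if "x \<in> carrier NH" for x
    using add_hom_inv[OF NH_ring ring_add_group[OF EE_ring] \<rho> that] by (simp add: a_inv_def)
  have \<rho>minus: "\<rho> (x \<ominus>\<^bsub>NH\<^esub> y) = \<rho> x \<ominus>\<^bsub>EE\<^esub> \<rho> y" if "x \<in> carrier NH" "y \<in> carrier NH" for x y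
    using \<rho>add \<rho>neg that by (simp add: a_minus_def)
  have \<rho>int: "\<rho> ([(m::int)] \<cdot>\<^bsub>NH\<^esub> x) = [m] \<cdot>\<^bsub>EE\<^esub> \<rho> x" if "x \<in> carrier NH" for m x
    using add_pow_hom[OF NH_ring ring_add_group[OF EE_ring] \<rho> that] by (simp add: add_pow_def)
  have \<rho>p: "\<rho> (\<iota> a \<otimes>\<^bsub>NH\<^esub> \<kappa> f) = \<beta> a f" if "a \<in> carrier (nilCoxeter D)" "f \<in> PC" for a f
  proof -
    have "inj_on \<theta> (carrier NCT)" using \<theta>(1) by (auto simp: iso_def bij_betw_def)
    then have "inv_into (carrier NCT) \<theta> (\<theta> (pure_tensor (nilCoxeter D) (Pol D) a f)) = pure_tensor (nilCoxeter D) (Pol D) a f"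
      using pure_tensor_closed[OF NC_ring Pol_ring, of a f] that by simp
    then show ?thesis using \<theta>(2)[OF that] h(2)[OF that] by (simp add: \<rho>_def)
  qed
  have \<rho>pd: "\<rho> (del u \<otimes>\<^bsub>NH\<^esub> \<kappa> f) = wordop u \<otimes>\<^bsub>EE\<^esub> mulop (base f)" if "u \<in> lists I" "f \<in> PC" for u f
    using \<rho>p[of "ncw u" f] that by (simp add: \<beta>_def \<sigma>(2) del_def)
  have m1: "mulop 1 = (\<one>\<^bsub>EE\<^esub> :: 'k pol \<Rightarrow> 'k pol)" by (rule EE_eqI) (auto simp: EE_simps)
  have w1: "wordop [] = (\<one>\<^bsub>EE\<^esub> :: 'k pol \<Rightarrow> 'k pol)" by (rule EE_eqI) (auto simp: EE_simps)
  have \<rho>del: "\<rho> (del u) = wordop u" if "u \<in> lists I" for u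
    using \<rho>pd[OF that, of 1] that m1 by (simp add: \<kappa>_one)
  have \<rho>\<kappa>: "\<rho> (\<kappa> f) = mulop (base f)" if "f \<in> PC" for f
    using \<rho>pd[of "[]" f] that w1 by (simp add: del_Nil)
  have step: "\<rho> (z \<otimes>\<^bsub>NH\<^esub> y) = \<rho> z \<otimes>\<^bsub>EE\<^esub> \<rho> y"
    if z: "z \<in> carrier NH" and y: "y \<in> carrier NH" and *: "\<And>u f. u \<in> lists I \<Longrightarrow> f \<in> PC \<Longrightarrow> \<rho> (z \<otimes>\<^bsub>NH\<^esub> (del u \<otimes>\<^bsub>NH\<^esub> \<kappa> f)) = \<rho> z \<otimes>\<^bsub>EE\<^esub> \<rho> (del u \<otimes>\<^bsub>NH\<^esub> \<kappa> f)" for z y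
    using y
  proof (induction y rule: NH_induct)
    case (diff x y)
    then show ?case using z \<rho>c by (simp add: \<rho>minus \<rho>add \<rho>neg a_minus_def NH.r_distr E.r_distr NH.r_minus E.r_minus)
  qed (rule *)
  have 1: "\<rho> (del v \<otimes>\<^bsub>NH\<^esub> y) = wordop v \<otimes>\<^bsub>EE\<^esub> \<rho> y" if v: "v \<in> lists I" and y: "y \<in> carrier NH" for v y
    unfolding \<rho>del[OF v, symmetric]
  proof (rule step[OF del_closed[OF v] y])
    fix u and f :: "int pol" assume u: "u \<in> lists I" and f: "f \<in> PC"
    have "wordop (v @ u) = wordop v \<otimes>\<^bsub>EE\<^esub> (wordop u :: 'k pol \<Rightarrow> 'k pol)"
      using u v by (intro EE_eqI) (auto simp: EE_simps dword_append)
    moreover have "del v \<otimes>\<^bsub>NH\<^esub> (del u \<otimes>\<^bsub>NH\<^esub> \<kappa> f) = del (v @ u) \<otimes>\<^bsub>NH\<^esub> \<kappa> f" using u v f by (simp add: del_append NH.m_assoc)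
    moreover have "v @ u \<in> lists I" using u v by simp
    ultimately show "\<rho> (del v \<otimes>\<^bsub>NH\<^esub> (del u \<otimes>\<^bsub>NH\<^esub> \<kappa> f)) = \<rho> (del v) \<otimes>\<^bsub>EE\<^esub> \<rho> (del u \<otimes>\<^bsub>NH\<^esub> \<kappa> f)"
      using u v f by (simp add: \<rho>pd \<rho>del E.m_assoc)
  qed
  have Ecross: "mulop (lin x) \<otimes>\<^bsub>EE\<^esub> wordop [i] = (wordop [i] :: 'k pol \<Rightarrow> 'k pol) \<otimes>\<^bsub>EE\<^esub> mulop (lin (s i *\<^sub>v x)) \<oplus>\<^bsub>EE\<^esub> [(x \<bullet> rt i)] \<cdot>\<^bsub>EE\<^esub> \<one>\<^bsub>EE\<^esub>"
    if x: "x \<in> carrier_vec n" and i: "i \<in> I" for x i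
  proof (rule EE_eqI)
    fix f :: "'k pol" assume f: "f \<in> PC"
    have ss: "s i *\<^sub>v (s i *\<^sub>v x) = x" using x i by (simp add: s_s flip: sq_act)
    show "(mulop (lin x) \<otimes>\<^bsub>EE\<^esub> wordop [i]) f = (wordop [i] \<otimes>\<^bsub>EE\<^esub> mulop (lin (s i *\<^sub>v x)) \<oplus>\<^bsub>EE\<^esub> [(x \<bullet> rt i)] \<cdot>\<^bsub>EE\<^esub> \<one>\<^bsub>EE\<^esub>) f"
      using f x i by (simp add: EE_simps EE_add_pow dword_Cons dem_lin_mult ss s_act_rt)
  qed (use x i in auto)
  have 2: "\<rho> (\<kappa> (lin x) \<otimes>\<^bsub>NH\<^esub> (del u \<otimes>\<^bsub>NH\<^esub> \<kappa> f)) = mulop (lin x) \<otimes>\<^bsub>EE\<^esub> \<rho> (del u \<otimes>\<^bsub>NH\<^esub> \<kappa> f)"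
    if x: "x \<in> carrier_vec n" and u: "u \<in> lists I" and f: "f \<in> PC" for x u f
    using u x
  proof (induction u arbitrary: x)
    case Nil
    have "mulop (base (lin x * f)) = mulop (lin x) \<otimes>\<^bsub>EE\<^esub> (mulop (base f) :: 'k pol \<Rightarrow> 'k pol)"
      using Nil f by (intro EE_eqI) (auto simp: EE_simps base_mult mult.assoc)
    then show ?case using f \<rho>\<kappa>[of "lin x * f"] \<rho>\<kappa>[of f] Nil by (simp add: del_Nil \<kappa>_mult)
  next
    case (Cons i u)
    let ?R = "del u \<otimes>\<^bsub>NH\<^esub> \<kappa> f"
    have c: "i \<in> I" "u \<in> lists I" "?R \<in> carrier NH" "\<kappa> (lin x) \<in> carrier NH" "\<kappa> (lin (s i *\<^sub>v x)) \<in> carrier NH" "del [i] \<in> carrier NH"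
      "(mulop (lin x) :: 'k pol \<Rightarrow> 'k pol) \<in> carrier EE" "(mulop (lin (s i *\<^sub>v x)) :: 'k pol \<Rightarrow> 'k pol) \<in> carrier EE"
      "(wordop [i] :: 'k pol \<Rightarrow> 'k pol) \<in> carrier EE"
      using Cons f by auto
    have IH: "\<rho> (\<kappa> (lin (s i *\<^sub>v x)) \<otimes>\<^bsub>NH\<^esub> ?R) = mulop (lin (s i *\<^sub>v x)) \<otimes>\<^bsub>EE\<^esub> \<rho> ?R" using Cons by simp
    have "\<kappa> (lin x) \<otimes>\<^bsub>NH\<^esub> (del (i # u) \<otimes>\<^bsub>NH\<^esub> \<kappa> f) = (\<kappa> (lin x) \<otimes>\<^bsub>NH\<^esub> del [i]) \<otimes>\<^bsub>NH\<^esub> ?R"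
      using c f by (simp add: del_Cons[OF c(1,2)] NH.m_assoc)
    also have "\<dots> = del [i] \<otimes>\<^bsub>NH\<^esub> (\<kappa> (lin (s i *\<^sub>v x)) \<otimes>\<^bsub>NH\<^esub> ?R) \<oplus>\<^bsub>NH\<^esub> [(x \<bullet> rt i)] \<cdot>\<^bsub>NH\<^esub> ?R"
      using c Cons.prems by (simp add: cross NH.l_distr NH.m_assoc NH.add_pow_ldistr_int)
    finally have "\<rho> (\<kappa> (lin x) \<otimes>\<^bsub>NH\<^esub> (del (i # u) \<otimes>\<^bsub>NH\<^esub> \<kappa> f)) =
       wordop [i] \<otimes>\<^bsub>EE\<^esub> (mulop (lin (s i *\<^sub>v x)) \<otimes>\<^bsub>EE\<^esub> \<rho> ?R) \<oplus>\<^bsub>EE\<^esub> [(x \<bullet> rt i)] \<cdot>\<^bsub>EE\<^esub> \<rho> ?R"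
      using c by (simp add: \<rho>add 1 IH \<rho>int)
    also have "\<dots> = (mulop (lin x) \<otimes>\<^bsub>EE\<^esub> wordop [i]) \<otimes>\<^bsub>EE\<^esub> \<rho> ?R"
      using c Cons.prems \<rho>c[OF c(3)] by (simp add: Ecross E.l_distr E.m_assoc E.add_pow_ldistr_int)
    also have "\<dots> = mulop (lin x) \<otimes>\<^bsub>EE\<^esub> \<rho> (del (i # u) \<otimes>\<^bsub>NH\<^esub> \<kappa> f)"
      using c \<rho>c[OF c(3)] f 1[of "[i]" ?R] by (simp add: del_Cons[OF c(1,2)] NH.m_assoc E.m_assoc)
    finally show ?case .
  qed
  have 3: "\<rho> (\<kappa> (lin x) \<otimes>\<^bsub>NH\<^esub> y) = mulop (lin x) \<otimes>\<^bsub>EE\<^esub> \<rho> y" if x: "x \<in> carrier_vec n" and y: "y \<in> carrier NH" for x y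
    using step[of "\<kappa> (lin x)" y] 2 x y \<rho>\<kappa>[of "lin x"] by simp
  have 4: "\<rho> (\<kappa> f \<otimes>\<^bsub>NH\<^esub> y) = mulop (base f) \<otimes>\<^bsub>EE\<^esub> \<rho> y" if f: "f \<in> PC" and y: "y \<in> carrier NH" for f y
    using f
  proof (induction f rule: PC_induct)
    case (Const c)
    have c: "Const c = (of_int c * 1 :: int pol)" by (simp add: Const_int)
    have "\<kappa> (Const c) = [c] \<cdot>\<^bsub>NH\<^esub> \<one>\<^bsub>NH\<^esub>" unfolding c by (subst \<kappa>_of_int_mult) (simp_all only: PC_1 \<kappa>_one)
    then have "\<rho> (\<kappa> (Const c) \<otimes>\<^bsub>NH\<^esub> y) = [c] \<cdot>\<^bsub>EE\<^esub> \<rho> y" using y by (simp add: NH.add_pow_ldistr_int \<rho>int)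
    also have "\<dots> = mulop (base (Const c)) \<otimes>\<^bsub>EE\<^esub> \<rho> y"
      using \<rho>c[OF y] by (intro EE_eqI) (auto simp: EE_simps EE_add_pow EE_PC)
    finally show ?case .
  next
    case (add f g)
    then show ?case using y \<rho>c[OF y] by (simp add: \<kappa>_add NH.l_distr \<rho>add madd E.l_distr)
  next
    case (var k f)
    have "mulop (base (lin (unit_vec n k) * f)) = mulop (lin (unit_vec n k)) \<otimes>\<^bsub>EE\<^esub> (mulop (base f) :: 'k pol \<Rightarrow> 'k pol)"
      using var by (intro EE_eqI) (auto simp: EE_simps base_mult mult.assoc)
    then show ?case using var y \<rho>c[OF y] 3[of "unit_vec n k" "\<kappa> f \<otimes>\<^bsub>NH\<^esub> y"] by (simp add: \<kappa>_mult NH.m_assoc E.m_assoc)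
  qed
  have mult: "\<rho> (x \<otimes>\<^bsub>NH\<^esub> y) = \<rho> x \<otimes>\<^bsub>EE\<^esub> \<rho> y" if x: "x \<in> carrier NH" and y: "y \<in> carrier NH" for x y
    using x
  proof (induction x rule: NH_induct)
    case (prod u f)
    then show ?case using y \<rho>c[OF y] 1[of u "\<kappa> f \<otimes>\<^bsub>NH\<^esub> y"] by (simp add: NH.m_assoc E.m_assoc 4 \<rho>pd)
  next
    case (diff a b)
    then show ?case using y \<rho>c by (simp add: \<rho>minus \<rho>add \<rho>neg a_minus_def NH.l_distr E.l_distr NH.l_minus E.l_minus)
  qed
  have "\<rho> \<in> ring_hom NH EE"
    using \<rho>c \<rho>add mult \<rho>del[of "[]"] w1 by (intro ring_hom_memI) (auto simp: del_Nil)
  then show ?thesis using \<rho>del \<rho>\<kappa> by blast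
qed

section \<open>A spanning set of the nilHecke algebra\<close>

lemma del_\<kappa>: assumes i: "i \<in> I" and f: "f \<in> PC"
  shows "\<exists>g1\<in>PC. \<exists>g2\<in>PC. del [i] \<otimes>\<^bsub>NH\<^esub> \<kappa> f = \<kappa> g1 \<otimes>\<^bsub>NH\<^esub> del [i] \<oplus>\<^bsub>NH\<^esub> \<kappa> g2"
  using f
proof (induction f rule: PC_induct)
  case (Const c)
  have "Const c = (of_int c * 1 :: int pol)" by (simp add: Const_int)
  then have "\<kappa> (Const c) = [c] \<cdot>\<^bsub>NH\<^esub> \<one>\<^bsub>NH\<^esub>" using \<kappa>_of_int_mult[of 1 c] by (simp only: PC_1 \<kappa>_one)
  then have "del [i] \<otimes>\<^bsub>NH\<^esub> \<kappa> (Const c) = \<kappa> (Const c) \<otimes>\<^bsub>NH\<^esub> del [i] \<oplus>\<^bsub>NH\<^esub> \<kappa> 0"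
    using i by (simp add: NH.add_pow_ldistr_int NH.add_pow_rdistr_int \<kappa>_zero)
  then show ?case by (meson PC_0 PC_Const)
next
  case (add f g)
  then obtain f1 f2 g1 g2 where *: "f1 \<in> PC" "f2 \<in> PC" "del [i] \<otimes>\<^bsub>NH\<^esub> \<kappa> f = \<kappa> f1 \<otimes>\<^bsub>NH\<^esub> del [i] \<oplus>\<^bsub>NH\<^esub> \<kappa> f2"
    "g1 \<in> PC" "g2 \<in> PC" "del [i] \<otimes>\<^bsub>NH\<^esub> \<kappa> g = \<kappa> g1 \<otimes>\<^bsub>NH\<^esub> del [i] \<oplus>\<^bsub>NH\<^esub> \<kappa> g2" by blast
  have "del [i] \<otimes>\<^bsub>NH\<^esub> \<kappa> (f + g) = \<kappa> (f1 + g1) \<otimes>\<^bsub>NH\<^esub> del [i] \<oplus>\<^bsub>NH\<^esub> \<kappa> (f2 + g2)"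
    using * add i by (simp add: \<kappa>_add NH.r_distr NH.l_distr NH.a_ac)
  then show ?case using * by (meson PC_add)
next
  case (var k f)
  define x :: "int vec" where "x = unit_vec n k"
  have x: "x \<in> carrier_vec n" "s i *\<^sub>v x \<in> carrier_vec n" by (simp_all add: x_def)
  have ss: "s i *\<^sub>v (s i *\<^sub>v x) = x" using x i by (simp add: s_s flip: sq_act)
  obtain g1 g2 where g: "g1 \<in> PC" "g2 \<in> PC" "del [i] \<otimes>\<^bsub>NH\<^esub> \<kappa> f = \<kappa> g1 \<otimes>\<^bsub>NH\<^esub> del [i] \<oplus>\<^bsub>NH\<^esub> \<kappa> g2" using var by blast
  let ?m = "(s i *\<^sub>v x) \<bullet> rt i"
  have "\<kappa> (lin (s i *\<^sub>v x)) \<otimes>\<^bsub>NH\<^esub> del [i] = del [i] \<otimes>\<^bsub>NH\<^esub> \<kappa> (lin x) \<oplus>\<^bsub>NH\<^esub> [?m] \<cdot>\<^bsub>NH\<^esub> \<one>\<^bsub>NH\<^esub>"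
    using cross[OF x(2) i] by (simp add: ss)
  then have "del [i] \<otimes>\<^bsub>NH\<^esub> \<kappa> (lin x) = \<kappa> (lin (s i *\<^sub>v x)) \<otimes>\<^bsub>NH\<^esub> del [i] \<ominus>\<^bsub>NH\<^esub> [?m] \<cdot>\<^bsub>NH\<^esub> \<one>\<^bsub>NH\<^esub>"
    using x i by (simp add: a_minus_def NH.a_assoc NH.r_neg)
  then have "del [i] \<otimes>\<^bsub>NH\<^esub> \<kappa> (lin x * f) = \<kappa> (lin (s i *\<^sub>v x)) \<otimes>\<^bsub>NH\<^esub> (del [i] \<otimes>\<^bsub>NH\<^esub> \<kappa> f) \<ominus>\<^bsub>NH\<^esub> [?m] \<cdot>\<^bsub>NH\<^esub> \<kappa> f"
    using x i var by (simp add: \<kappa>_mult NH.m_assoc[symmetric] a_minus_def NH.l_distr NH.l_minus NH.add_pow_ldistr_int)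
  also have "\<dots> = \<kappa> (lin (s i *\<^sub>v x) * g1) \<otimes>\<^bsub>NH\<^esub> del [i] \<oplus>\<^bsub>NH\<^esub> \<kappa> (lin (s i *\<^sub>v x) * g2 + - (of_int ?m * f))"
    unfolding g(3) using x i g var
    by (simp add: \<kappa>_mult[of "lin (s i *\<^sub>v x)"] \<kappa>_add \<kappa>_uminus \<kappa>_of_int_mult NH.r_distr NH.m_assoc a_minus_def NH.a_assoc del: add_uminus_conv_diff)
  finally have "del [i] \<otimes>\<^bsub>NH\<^esub> \<kappa> (lin x * f) = \<kappa> (lin (s i *\<^sub>v x) * g1) \<otimes>\<^bsub>NH\<^esub> del [i] \<oplus>\<^bsub>NH\<^esub> \<kappa> (lin (s i *\<^sub>v x) * g2 + - (of_int ?m * f))" .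
  moreover have "lin (s i *\<^sub>v x) * g1 \<in> PC" "lin (s i *\<^sub>v x) * g2 + - (of_int ?m * f) \<in> PC" using x g var by auto
  ultimately show ?case unfolding x_def[symmetric] by blast
qed

text \<open>Coefficients stand on the left, opposite to the order in the definition of the nilHecke algebra,
  so that \<open>comb g\<close> acts on polynomials as the combination \<open>\<Sum>\<^sub>w g\<^sub>w \<partial>\<^sub>w\<close> of operators.\<close>

definition comb :: "(int mat \<Rightarrow> int pol) \<Rightarrow> 'a" where
  "comb g = finsum NH (\<lambda>w. \<kappa> (g w) \<otimes>\<^bsub>NH\<^esub> del (red w)) W"

lemma comb_term: "g \<in> PC \<Longrightarrow> w \<in> W \<Longrightarrow> \<kappa> g \<otimes>\<^bsub>NH\<^esub> del (red w) \<in> carrier NH"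
  using red(3) by simp

lemma comb_closed: "(\<And>w. w \<in> W \<Longrightarrow> g w \<in> PC) \<Longrightarrow> comb g \<in> carrier NH"
  unfolding comb_def by (rule NH.finsum_closed) (auto intro: comb_term)

lemma comb_add: "(\<And>w. w \<in> W \<Longrightarrow> g w \<in> PC) \<Longrightarrow> (\<And>w. w \<in> W \<Longrightarrow> h w \<in> PC) \<Longrightarrow> comb (\<lambda>w. g w + h w) = comb g \<oplus>\<^bsub>NH\<^esub> comb h"
proof -
  assume g: "\<And>w. w \<in> W \<Longrightarrow> g w \<in> PC" and h: "\<And>w. w \<in> W \<Longrightarrow> h w \<in> PC"
  have "comb (\<lambda>w. g w + h w) = finsum NH (\<lambda>w. \<kappa> (g w) \<otimes>\<^bsub>NH\<^esub> del (red w) \<oplus>\<^bsub>NH\<^esub> \<kappa> (h w) \<otimes>\<^bsub>NH\<^esub> del (red w)) W"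
    unfolding comb_def using g h red(3) by (intro NH.finsum_cong') (auto simp: \<kappa>_add NH.l_distr)
  also have "\<dots> = comb g \<oplus>\<^bsub>NH\<^esub> comb h"
    unfolding comb_def using comb_term g h by (intro NH.finsum_addf) auto
  finally show ?thesis .
qed

lemma comb_single: "g \<in> PC \<Longrightarrow> w \<in> W \<Longrightarrow> comb (\<lambda>v. if v = w then g else 0) = \<kappa> g \<otimes>\<^bsub>NH\<^esub> del (red w)"
proof -
  assume g: "g \<in> PC" and w: "w \<in> W"
  have "comb (\<lambda>v. if v = w then g else 0) = finsum NH (\<lambda>v. if w = v then \<kappa> g \<otimes>\<^bsub>NH\<^esub> del (red v) else \<zero>\<^bsub>NH\<^esub>) W"
    unfolding comb_def using red(3) g by (intro NH.finsum_cong') (auto simp: \<kappa>_zero)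
  also have "\<dots> = \<kappa> g \<otimes>\<^bsub>NH\<^esub> del (red w)"
    using NH.finsum_singleton[OF w finite_W, of "\<lambda>v. \<kappa> g \<otimes>\<^bsub>NH\<^esub> del (red v)"] g red(3) by auto
  finally show ?thesis .
qed

definition span :: "'a set" where
  "span = {comb g | g. \<forall>w\<in>W. g w \<in> PC}"

lemma span_carrier: "y \<in> span \<Longrightarrow> y \<in> carrier NH"
  by (auto simp: span_def comb_closed)

lemma span_add: "x \<in> span \<Longrightarrow> y \<in> span \<Longrightarrow> x \<oplus>\<^bsub>NH\<^esub> y \<in> span"
proof -
  assume "x \<in> span" "y \<in> span"
  then obtain g h where "\<forall>w\<in>W. g w \<in> PC" "\<forall>w\<in>W. h w \<in> PC" "x = comb g" "y = comb h" by (auto simp: span_def)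
  then show ?thesis unfolding span_def using comb_add[of g h] by (intro CollectI exI[of _ "\<lambda>w. g w + h w"]) auto
qed

lemma span_single: "g \<in> PC \<Longrightarrow> w \<in> W \<Longrightarrow> \<kappa> g \<otimes>\<^bsub>NH\<^esub> del (red w) \<in> span"
  unfolding span_def using comb_single[of g w] by (intro CollectI exI[of _ "\<lambda>v. if v = w then g else 0"]) auto

lemma span_zero: "\<zero>\<^bsub>NH\<^esub> \<in> span"
  using span_single[of 0 "1\<^sub>m n"] one_W red(3) by (simp add: \<kappa>_zero)

lemma span_word: "g \<in> PC \<Longrightarrow> u \<in> lists I \<Longrightarrow> \<kappa> g \<otimes>\<^bsub>NH\<^esub> del u \<in> span"
  using del_cases[of u] span_single[of g "wmat u"] wmat_in_W[of u] span_zero by auto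

lemma span_hom:
  assumes y: "y \<in> span" and h: "h \<in> hom (add_monoid NH) (add_monoid NH)"
   and s: "\<And>g w. g \<in> PC \<Longrightarrow> w \<in> W \<Longrightarrow> h (\<kappa> g \<otimes>\<^bsub>NH\<^esub> del (red w)) \<in> span"
  shows "h y \<in> span"
proof -
  obtain g where g: "\<forall>w\<in>W. g w \<in> PC" "y = comb g" using y by (auto simp: span_def)
  interpret h: group_hom "add_monoid NH" "add_monoid NH" h
    using h ring_add_group[OF NH_ring] by (simp add: group_hom_def group_hom_axioms_def)
  have "h (finsum NH (\<lambda>w. \<kappa> (g w) \<otimes>\<^bsub>NH\<^esub> del (red w)) A) \<in> span" if "finite A" "A \<subseteq> W" for A
    using that
  proof (induction A)
    case empty
    then show ?case using h.hom_one span_zero by simp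
  next
    case (insert w A)
    have c: "\<kappa> (g v) \<otimes>\<^bsub>NH\<^esub> del (red v) \<in> carrier NH" if "v \<in> insert w A" for v using comb_term g insert that by blast
    have "h (finsum NH (\<lambda>w. \<kappa> (g w) \<otimes>\<^bsub>NH\<^esub> del (red w)) (insert w A)) =
      h (\<kappa> (g w) \<otimes>\<^bsub>NH\<^esub> del (red w)) \<oplus>\<^bsub>NH\<^esub> h (finsum NH (\<lambda>w. \<kappa> (g w) \<otimes>\<^bsub>NH\<^esub> del (red w)) A)"
      using insert.hyps c h.hom_mult[of "\<kappa> (g w) \<otimes>\<^bsub>NH\<^esub> del (red w)" "finsum NH (\<lambda>w. \<kappa> (g w) \<otimes>\<^bsub>NH\<^esub> del (red w)) A"]
      by (subst NH.finsum_insert) (auto intro!: NH.finsum_closed)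
    then show ?case using span_add s g insert by auto
  qed
  then show ?thesis using g finite_W by (simp add: comb_def)
qed

lemma span_uminus: assumes y: "y \<in> span" shows "\<ominus>\<^bsub>NH\<^esub> y \<in> span"
proof (rule span_hom[OF y])
  show "(\<lambda>y. \<ominus>\<^bsub>NH\<^esub> y) \<in> hom (add_monoid NH) (add_monoid NH)" by (intro homI) (auto simp: NH.minus_add)
  fix g w assume "g \<in> PZ" "w \<in> W"
  then show "\<ominus>\<^bsub>NH\<^esub> (\<kappa> g \<otimes>\<^bsub>NH\<^esub> del (red w)) \<in> span"
    using span_single[of "- g" w] red(3) by (simp add: \<kappa>_uminus NH.l_minus)
qed

lemma span_del1: assumes i: "i \<in> I" and y: "y \<in> span" shows "del [i] \<otimes>\<^bsub>NH\<^esub> y \<in> span"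
proof (rule span_hom[OF y])
  show "(\<lambda>y. del [i] \<otimes>\<^bsub>NH\<^esub> y) \<in> hom (add_monoid NH) (add_monoid NH)" using i by (intro homI) (auto simp: NH.r_distr)
  fix g w assume g: "g \<in> PZ" and w: "w \<in> W"
  obtain g1 g2 where *: "g1 \<in> PC" "g2 \<in> PC" "del [i] \<otimes>\<^bsub>NH\<^esub> \<kappa> g = \<kappa> g1 \<otimes>\<^bsub>NH\<^esub> del [i] \<oplus>\<^bsub>NH\<^esub> \<kappa> g2"
    using del_\<kappa>[OF i g] by blast
  have "del [i] \<otimes>\<^bsub>NH\<^esub> (\<kappa> g \<otimes>\<^bsub>NH\<^esub> del (red w)) = \<kappa> g1 \<otimes>\<^bsub>NH\<^esub> del (i # red w) \<oplus>\<^bsub>NH\<^esub> \<kappa> g2 \<otimes>\<^bsub>NH\<^esub> del (red w)"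
    using * g i red(3)[OF w] by (simp add: NH.m_assoc[symmetric] NH.l_distr del_Cons[of i "red w"])
  then show "del [i] \<otimes>\<^bsub>NH\<^esub> (\<kappa> g \<otimes>\<^bsub>NH\<^esub> del (red w)) \<in> span"
    using span_add span_word[of g1 "i # red w"] span_word[of g2 "red w"] * i red(3)[OF w] by simp
qed

lemma span_del: "u \<in> lists I \<Longrightarrow> y \<in> span \<Longrightarrow> del u \<otimes>\<^bsub>NH\<^esub> y \<in> span"
proof (induction u)
  case Nil
  then show ?case using span_carrier by (simp add: del_Nil)
next
  case (Cons i u)
  then have "i \<in> I" "u \<in> lists I" by auto
  then show ?case using Cons span_carrier[of y] span_del1[of i "del u \<otimes>\<^bsub>NH\<^esub> y"] by (simp add: del_Cons[of i u] NH.m_assoc)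
qed

lemma NH_span: "y \<in> carrier NH \<Longrightarrow> y \<in> span"
proof (induction y rule: NH_induct)
  case (prod u f)
  then show ?case using span_del[of u "\<kappa> f"] span_word[of f "[]"] by (simp add: del_Nil)
next
  case (diff x y)
  then show ?case using span_add span_uminus by (simp add: a_minus_def)
qed

section \<open>A basis of the polynomial ring over the invariants\<close>

lemma dword_reduced:
  assumes "reduced u" "reduced v" "wmat u = wmat v" and f: "f \<in> PC"
  shows "dword u f = dword v (f :: 'k::{idom, ring_char_0} pol)"
proof -
  have "dword (a @ alt_word (cox D i j) i j @ b) f = dword (a @ alt_word (cox D i j) j i @ b) f"
    if "b \<in> lists I" "i \<in> I" "j \<in> I" "i \<noteq> j" for a b i j
    using dword_braid[OF that(2-4), of "dword b f"] that f by (simp add: dword_append)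
  from matsumoto[of "\<lambda>u. dword u f", OF this assms(1-3), of "[]"] show ?thesis by simp
qed

lemma dred_mult:
  assumes v: "v \<in> W" and w: "w \<in> W" and f: "f \<in> PC"
  shows "dword (red v) (dword (red w) f) = (if len (v * w) = len v + len w then dword (red (v * w)) f else (0 :: 'k::{idom, ring_char_0} pol))"
proof -
  have u: "red v @ red w \<in> lists I" "wmat (red v @ red w) = v * w" "length (red v @ red w) = len v + len w"
    using red[OF v] red[OF w] by (auto simp: wmat_append)
  have "dword (red v @ red w) f = (if len (v * w) = len v + len w then dword (red (v * w)) f else 0)"
  proof (cases "len (v * w) = len v + len w")
    case True
    then have "reduced (red v @ red w)" using u by (simp add: reduced_def)
    then show ?thesis using dword_reduced[of "red v @ red w" "red (v * w)" f] red[OF W_mult[OF v w]] u True f by simp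
  next
    case False
    then have "\<not> reduced (red v @ red w)" using u by (simp add: reduced_def)
    then show ?thesis using dword_nonreduced[OF u(1)] f False by simp
  qed
  then show ?thesis by (simp add: dword_append)
qed

lemma red_one [simp]: "red (1\<^sub>m n) = []"
  using red(4)[OF one_W] by simp

text \<open>This is where rational coefficients enter: the integer provided by \<open>dword_power_pos\<close> need not
  be \<open>1\<close> and has to be divided out.\<close>

lemma top_exists: "\<exists>p::rat pol. p \<in> G (2 * int (len w0)) \<and> dword (red w0) p = 1"
proof -
  obtain x where x: "x \<in> carrier_vec n" "\<And>i. i \<in> I \<Longrightarrow> x \<bullet> rt i > 0" using regular_exists by blast
  obtain c where c: "c > 0" "dword (red w0) (lin x ^ len w0 :: rat pol) = of_int c"
    using dword_power_pos[OF x red(1)[OF w0], where 'k = rat] red(4)[OF w0] by auto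
  define p where "p = Const (1 / of_int c) * (lin x ^ len w0 :: rat pol)"
  have "p \<in> G (2 * int (len w0))" unfolding p_def by (intro G_Const_mult lin_power_G x)
  moreover have "dword (red w0) p = 1"
  proof -
    have "dword (red w0) p = Const (1 / of_int c) * Const (of_int c)"
      unfolding p_def using red(3)[OF w0] x c(2) by (subst dword_Inv) auto
    also have "\<dots> = 1" using c(1) by (simp add: mult_single del: single_of_int)
    finally show ?thesis .
  qed
  ultimately show ?thesis by blast
qed

definition topp :: "rat pol" where
  "topp = (SOME p. p \<in> G (2 * int (len w0)) \<and> dword (red w0) p = 1)"

lemma topp: "topp \<in> G (2 * int (len w0))" "dword (red w0) topp = 1"
  using someI_ex[OF top_exists] by (auto simp: topp_def)

definition cpl :: "int mat \<Rightarrow> int mat" where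
  "cpl w = (SOME u. u \<in> W \<and> w * u = w0 \<and> len w + len u = len w0)"

lemma cpl: assumes "w \<in> W" shows "cpl w \<in> W" "w * cpl w = w0" "len w + len (cpl w) = len w0"
proof -
  have "\<exists>u. u \<in> W \<and> w * u = w0 \<and> len w + len u = len w0" using complement_exists[OF assms] by metis
  then have "cpl w \<in> W \<and> w * cpl w = w0 \<and> len w + len (cpl w) = len w0" unfolding cpl_def by (rule someI_ex)
  then show "cpl w \<in> W" "w * cpl w = w0" "len w + len (cpl w) = len w0" by auto
qed

text \<open>The index of the operator is \<open>w\<^sup>-\<^sup>1 w\<^sub>0\<close>; in type A, for a suitable \<open>topp\<close>, these are
  the Schubert polynomials.\<close>

definition bas :: "int mat \<Rightarrow> rat pol" where
  "bas w = dword (red (cpl w)) topp"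

lemma bas_G: assumes "w \<in> W" shows "bas w \<in> G (2 * int (len w))"
proof -
  have "bas w \<in> G (2 * int (len w0) - 2 * int (length (red (cpl w))))"
    unfolding bas_def by (rule dword_G[OF red(3)[OF cpl(1)[OF assms]] topp(1)])
  moreover have "int (len w0) = int (len w) + int (len (cpl w))" using cpl(3)[OF assms] by simp
  ultimately show ?thesis using red(4)[OF cpl(1)[OF assms]] by simp
qed

lemma bas_PC [simp]: "w \<in> W \<Longrightarrow> bas w \<in> PC"
  using bas_G G_PC by blast

lemma W_cancel_right: assumes "v \<in> W" "w \<in> W" "u \<in> W" "v * u = w * u" shows "v = w"
proof -
  obtain a where a: "a \<in> lists I" "wmat a = u" using assms(3) by (auto simp: W_eq)
  have "v * u * wmat (rev a) = w * u * wmat (rev a)" using assms by simp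
  then show ?thesis using a W_carrier[OF assms(1)] W_carrier[OF assms(2)] wmat_rev_inv'[OF a(1)] W_carrier[OF assms(3)]
    by (simp add: sq_assoc)
qed

text \<open>A nonzero product of \<open>\<partial>\<^sub>v\<close> and \<open>\<partial>\<^sub>u\<close>, \<open>u = cpl w\<close>, requires lengths to add. Then \<open>v * u\<close> has at least
  the length of the longest element, hence equals it, and \<open>v = w\<close>.\<close>

lemma bas_triangular:
  assumes v: "v \<in> W" and w: "w \<in> W" and l: "len w \<le> len v"
  shows "dword (red v) (bas w) = (if v = w then 1 else 0)"
proof -
  have m: "dword (red v) (bas w) = (if len (v * cpl w) = len v + len (cpl w) then dword (red (v * cpl w)) topp else 0)"
    unfolding bas_def by (rule dred_mult[OF v cpl(1)[OF w] G_PC[OF topp(1)]])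
  show ?thesis
  proof (cases "v = w")
    case True
    then show ?thesis using m cpl[OF w] topp(2) by simp
  next
    case False
    have "len (v * cpl w) \<noteq> len v + len (cpl w)"
    proof
      assume e: "len (v * cpl w) = len v + len (cpl w)"
      have "len (v * cpl w) \<le> len w0" using len_le_w0 W_mult[OF v cpl(1)[OF w]] by blast
      then have "len (v * cpl w) = len w0" using e l cpl(3)[OF w] by simp
      then have "v * cpl w = w * cpl w" using w0_unique W_mult[OF v cpl(1)[OF w]] cpl(2)[OF w] by simp
      then show False using W_cancel_right[OF v w cpl(1)[OF w]] False by simp
    qed
    then show ?thesis using m False by simp
  qed
qed

lemma dword_sum: "u \<in> lists I \<Longrightarrow> (\<And>a. a \<in> A \<Longrightarrow> f a \<in> PC) \<Longrightarrow> dword u (sum f A) = (\<Sum>a\<in>A. dword u (f a :: 'k::{idom, ring_char_0} pol))"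
  by (induction A rule: infinite_finite_induct) (auto simp: dword_add)

text \<open>Apply \<open>\<partial>\<^sub>u\<close> for an element \<open>u\<close> of maximal length among those with nonzero coefficient.\<close>

lemma bas_independent:
  assumes c: "\<And>w. w \<in> W \<Longrightarrow> c w \<in> Inv" and z: "(\<Sum>w\<in>W. bas w * c w) = 0" and w: "w \<in> W"
  shows "c w = 0"
proof (rule ccontr)
  assume nz: "c w \<noteq> 0"
  define S where "S = {w \<in> W. c w \<noteq> 0}"
  have "finite (len ` S)" "len ` S \<noteq> {}" using finite_W w nz by (auto simp: S_def)
  then have "Max (len ` S) \<in> len ` S" by (rule Max_in)
  then obtain u where u: "u \<in> S" "len u = Max (len ` S)" by auto
  have mx: "len v \<le> len u" if "v \<in> S" for v using u(2) that finite_W by (simp add: S_def)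
  have uW: "u \<in> W" using u by (simp add: S_def)
  have "0 = dword (red u) (\<Sum>w\<in>W. c w * bas w)" using z red(3)[OF uW] by (simp add: mult.commute)
  also have "\<dots> = (\<Sum>w\<in>W. c w * dword (red u) (bas w))"
  proof (subst dword_sum[OF red(3)[OF uW]])
    show "c w * bas w \<in> PC" if "w \<in> W" for w using c[OF that] Inv_PC that by (intro PC_mult) auto
  qed (use red(3)[OF uW] c in \<open>auto simp: dword_Inv intro!: sum.cong\<close>)
  also have "\<dots> = (\<Sum>w\<in>W. if w = u then c w else 0)"
  proof (rule sum.cong[OF refl])
    fix v assume v: "v \<in> W"
    show "c v * dword (red u) (bas v) = (if v = u then c v else 0)"
    proof (cases "c v = 0")
      case False
      then have "len v \<le> len u" using mx v by (simp add: S_def)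
      then show ?thesis using bas_triangular[OF uW v] by simp
    qed auto
  qed
  also have "\<dots> = c u" using uW finite_W by simp
  finally show False using u by (simp add: S_def)
qed

text \<open>Evaluate at \<open>bas u\<close> for an element \<open>u\<close> of minimal length among those with nonzero coefficient.\<close>

lemma dred_independent:
  assumes g: "\<And>w. w \<in> W \<Longrightarrow> g w \<in> PC" and z: "\<And>f. f \<in> PC \<Longrightarrow> (\<Sum>w\<in>W. g w * dword (red w) (f :: rat pol)) = 0" and w: "w \<in> W"
  shows "g w = 0"
proof (rule ccontr)
  assume nz: "g w \<noteq> 0"
  define S where "S = {w \<in> W. g w \<noteq> 0}"
  have "finite (len ` S)" "len ` S \<noteq> {}" using finite_W w nz by (auto simp: S_def)
  then have "Min (len ` S) \<in> len ` S" by (rule Min_in)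
  then obtain u where u: "u \<in> S" "len u = Min (len ` S)" by auto
  have mn: "len u \<le> len v" if "v \<in> S" for v using u(2) that finite_W by (simp add: S_def)
  have uW: "u \<in> W" using u by (simp add: S_def)
  have "0 = (\<Sum>w\<in>W. g w * dword (red w) (bas u))" using z uW by simp
  also have "\<dots> = (\<Sum>w\<in>W. if w = u then g w else 0)"
  proof (rule sum.cong[OF refl])
    fix v assume v: "v \<in> W"
    show "g v * dword (red v) (bas u) = (if v = u then g v else 0)"
    proof (cases "g v = 0")
      case False
      then have "len u \<le> len v" using mn v by (simp add: S_def)
      then show ?thesis using bas_triangular[OF v uW] by simp
    qed auto
  qed
  also have "\<dots> = g u" using uW finite_W by simp
  finally show False using u by (simp add: S_def)
qed

abbreviation "EQ \<equiv> (EE :: (rat pol \<Rightarrow> rat pol) ring)"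

lemma EE_finsum: assumes "finite A" "\<And>a. a \<in> A \<Longrightarrow> F a \<in> carrier EE" "f \<in> PC"
  shows "finsum EE F A f = (\<Sum>a\<in>A. F a f :: 'k::comm_ring_1 pol)"
proof -
  interpret E: ring "EE :: ('k pol \<Rightarrow> 'k pol) ring" by (rule EE_ring)
  show ?thesis using assms
  proof (induction A)
    case (insert a A)
    have "finsum EE F (insert a A) = F a \<oplus>\<^bsub>EE\<^esub> finsum EE F A" using insert by (intro E.finsum_insert) auto
    then show ?case using insert by (simp add: EE_simps)
  qed (simp add: EE_simps)
qed

text \<open>Solving the unitriangular system for coordinates, from the longest element down to length \<open>l\<close>.
  Subtracting the components found so far gives an operator \<open>T\<close> whose values are killed by \<open>\<partial>\<^sub>v\<close> for
  all \<open>v\<close> longer than \<open>l\<close>. For \<open>w\<close> of length \<open>l\<close> this makes \<open>\<partial>\<^sub>w T\<close> take invariant values, because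
  \<open>\<partial>\<^sub>i \<partial>\<^sub>w\<close> is either zero or \<open>\<partial>\<^sub>v\<close> with \<open>v\<close> longer; it is the coordinate map of \<open>w\<close>.

  The class \<open>A\<close> of admissible operators is kept general because two choices matter: all
  endomorphisms, to define coordinates, and the image of the nilHecke algebra, to see that the
  coordinate maps lie in it.\<close>

lemma elimination:
  assumes A: "A \<subseteq> carrier EQ" "\<And>F K. F \<in> A \<Longrightarrow> K \<in> A \<Longrightarrow> F \<otimes>\<^bsub>EE\<^esub> K \<in> A" "\<And>F K. F \<in> A \<Longrightarrow> K \<in> A \<Longrightarrow> F \<oplus>\<^bsub>EE\<^esub> K \<in> A"
    "\<And>g. g \<in> PC \<Longrightarrow> mulop g \<in> A" "\<And>w. w \<in> W \<Longrightarrow> wordop (red w) \<in> A"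
  shows "\<exists>E. (\<forall>w\<in>W. l \<le> len w \<longrightarrow> E w \<in> A \<and> (\<forall>f\<in>PC. E w f \<in> Inv) \<and> (\<forall>j. \<forall>f\<in>G j. E w f \<in> G (j - 2 * int (len w)))) \<and>
    (\<forall>v\<in>W. l \<le> len v \<longrightarrow> (\<forall>f\<in>PC. dword (red v) (f - (\<Sum>w\<in>{w\<in>W. l \<le> len w}. bas w * E w f)) = 0))"
proof (induction "Suc (len w0) - l" arbitrary: l)
  case 0
  then have "{w \<in> W. l \<le> len w} = {}" using len_le_w0 by fastforce
  then show ?case by (intro exI[of _ "\<lambda>_ _. 0"]) auto
next
  case (Suc d)
  then have "d = Suc (len w0) - Suc l" by simp
  from Suc.hyps(1)[OF this] obtain E where
    E0: "\<forall>w\<in>W. Suc l \<le> len w \<longrightarrow> E w \<in> A \<and> (\<forall>f\<in>PC. E w f \<in> Inv) \<and> (\<forall>j. \<forall>f\<in>G j. E w f \<in> G (j - 2 * int (len w)))"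
    and T00: "\<forall>v\<in>W. Suc l \<le> len v \<longrightarrow> (\<forall>f\<in>PC. dword (red v) (f - (\<Sum>w\<in>{w\<in>W. Suc l \<le> len w}. bas w * E w f)) = 0)"
    by blast
  have E: "\<And>w. w \<in> W \<Longrightarrow> Suc l \<le> len w \<Longrightarrow> E w \<in> A" "\<And>w f. w \<in> W \<Longrightarrow> Suc l \<le> len w \<Longrightarrow> f \<in> PC \<Longrightarrow> E w f \<in> Inv"
     "\<And>w f j. w \<in> W \<Longrightarrow> Suc l \<le> len w \<Longrightarrow> f \<in> G j \<Longrightarrow> E w f \<in> G (j - 2 * int (len w))"
    using E0 by simp_all
  have T0: "\<And>v f. v \<in> W \<Longrightarrow> Suc l \<le> len v \<Longrightarrow> f \<in> PC \<Longrightarrow> dword (red v) (f - (\<Sum>w\<in>{w\<in>W. Suc l \<le> len w}. bas w * E w f)) = 0"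
    using T00 by simp
  define B where "B = {w \<in> W. Suc l \<le> len w}"
  have finB: "finite B" using finite_W by (simp add: B_def)
  interpret Er: ring EQ by (rule EE_ring)
  \<comment> \<open>\<open>T f\<close> is \<open>f\<close> minus its components along the longer elements.\<close>
  define T where "T = mulop 1 \<oplus>\<^bsub>EE\<^esub> finsum EE (\<lambda>w. mulop (- bas w) \<otimes>\<^bsub>EE\<^esub> E w) B"
  have sumA: "finsum EE F C \<in> A" if "finite C" "\<And>w. w \<in> C \<Longrightarrow> F w \<in> A" for F and C :: "int mat set"
    using that
  proof (induction C)
    case empty
    have "mulop 0 = \<zero>\<^bsub>EQ\<^esub>" by (rule EE_eqI) (auto simp: EE_simps)
    then show ?case using A(4)[of 0] by simp
  next
    case (insert w C)
    have "finsum EE F (insert w C) = F w \<oplus>\<^bsub>EE\<^esub> finsum EE F C"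
      using insert A(1) by (intro Er.finsum_insert) auto
    then show ?case using insert A(3) by simp
  qed
  have tA: "mulop (- bas w) \<otimes>\<^bsub>EE\<^esub> E w \<in> A" if "w \<in> B" for w using A(2) A(4) E(1) that by (simp add: B_def)
  have TA: "T \<in> A" unfolding T_def using A(3,4) sumA[OF finB tA] by simp
  have Tf: "T f = f - (\<Sum>w\<in>B. bas w * E w f)" if f: "f \<in> PC" for f
  proof -
    have EwPC: "E w f \<in> PC" if "w \<in> B" for w using Inv_PC[OF E(2)[OF _ _ f]] that by (simp add: B_def)
    have "finsum EE (\<lambda>w. mulop (- bas w) \<otimes>\<^bsub>EE\<^esub> E w) B f = (\<Sum>w\<in>B. (mulop (- bas w) \<otimes>\<^bsub>EE\<^esub> E w) f)"
      using tA A(1) by (intro EE_finsum finB f) auto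
    also have "\<dots> = (\<Sum>w\<in>B. - (bas w * E w f))" using f EwPC by (intro sum.cong) (auto simp: EE_simps)
    finally show ?thesis using f by (simp add: T_def EE_simps sum_negf)
  qed
  have TPC: "T f \<in> PC" if "f \<in> PC" for f using TA A(1) EE_PC that by blast
  have TG: "T f \<in> G j" if f: "f \<in> G j" for f j
  proof -
    have "bas w * E w f \<in> G j" if "w \<in> B" for w
      using G_mult[OF bas_G E(3)[OF _ _ f], of w w] that by (simp add: B_def)
    then have "f + - (\<Sum>w\<in>B. bas w * E w f) \<in> G j" using f by (intro G_add G_uminus G_sum)
    then show ?thesis using Tf[OF G_PC[OF f]] by simp
  qed
  have T0': "dword (red v) (T f) = 0" if "v \<in> W" "Suc l \<le> len v" "f \<in> PC" for v f
    using T0[OF that] Tf[OF that(3)] by (simp add: B_def)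
  define E' where "E' = (\<lambda>w. if len w = l then wordop (red w) \<otimes>\<^bsub>EE\<^esub> T else E w)"
  define C where "C = {w \<in> W. len w = l}"
  have E'C: "E' w f = dword (red w) (T f)" if "w \<in> C" "f \<in> PC" for w f
    using that TPC by (simp add: E'_def C_def EE_simps)
  have inv: "dword (red w) (T f) \<in> Inv" if w: "w \<in> C" and f: "f \<in> PC" for w f
    unfolding Inv_iff
  proof (intro conjI ballI)
    have wW: "w \<in> W" "len w = l" using w by (auto simp: C_def)
    show "dword (red w) (T f) \<in> PC" using red(3)[OF wW(1)] TPC f by simp
    fix i assume i: "i \<in> I"
    have u: "i # red w \<in> lists I" using red(3)[OF wW(1)] i by simp
    have "dword (i # red w) (T f) = 0"
    proof (cases "reduced (i # red w)")
      case True
      define v where "v = wmat (i # red w)"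
      have v: "v \<in> W" "len v = Suc l" using True wmat_in_W[OF u] red(4)[OF wW(1)] wW(2) by (auto simp: v_def reduced_def)
      then show ?thesis using dword_reduced[OF True red(1)[OF v(1)] _ TPC[OF f]] red(2)[OF v(1)] T0'[OF v(1) _ f] by (simp add: v_def)
    next
      case False
      then show ?thesis by (rule dword_nonreduced[OF u _ TPC[OF f]])
    qed
    then show "dem i (dword (red w) (T f)) = 0" by (simp add: dword_Cons)
  qed
  show ?case
  proof (intro exI[of _ E'] conjI ballI impI allI)
    fix w assume w: "w \<in> W" "l \<le> len w"
    show "E' w \<in> A" using E(1) w A(2,5) TA by (auto simp: E'_def)
    show "E' w f \<in> Inv" if f: "f \<in> PC" for f
    proof (cases "len w = l")
      case True
      then show ?thesis using inv[of w f] E'C[of w f] w f by (simp add: C_def)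
    qed (use E(2) w f in \<open>auto simp: E'_def\<close>)
    show "E' w f \<in> G (j - 2 * int (len w))" if f: "f \<in> G j" for f j
    proof (cases "len w = l")
      case True
      then show ?thesis using dword_G[OF red(3)[OF w(1)] TG[OF f]] E'C[of w f] w G_PC[OF f] red(4)[OF w(1)] by (simp add: C_def)
    qed (use E(3) w f in \<open>auto simp: E'_def\<close>)
  next
    fix v f assume v: "v \<in> W" "l \<le> len v" and f: "f \<in> (PC :: rat pol set)"
    have "l \<le> m \<longleftrightarrow> Suc l \<le> m \<or> m = l" for m by arith
    then have BC1: "{w \<in> W. l \<le> len w} = B \<union> C" unfolding B_def C_def by blast
    have BC2: "B \<inter> C = {}" unfolding B_def C_def by fastforce
    have BC3: "finite C" using finite_W by (simp add: C_def)
    note BC = BC1 BC2 BC3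
    have "f - (\<Sum>w\<in>{w \<in> W. l \<le> len w}. bas w * E' w f) = f - (\<Sum>w\<in>B. bas w * E' w f) - (\<Sum>w\<in>C. bas w * E' w f)"
      unfolding BC(1) using finB BC by (subst sum.union_disjoint) auto
    also have "(\<Sum>w\<in>B. bas w * E' w f) = (\<Sum>w\<in>B. bas w * E w f)" by (rule sum.cong) (auto simp: E'_def B_def)
    also have "(\<Sum>w\<in>C. bas w * E' w f) = (\<Sum>w\<in>C. dword (red w) (T f) * bas w)" using f by (intro sum.cong) (auto simp: E'C mult.commute)
    finally have e: "f - (\<Sum>w\<in>{w \<in> W. l \<le> len w}. bas w * E' w f) = T f - (\<Sum>w\<in>C. dword (red w) (T f) * bas w)"
      using Tf[OF f] by simp
    have CPC: "dword (red w) (T f) * bas w \<in> PC" if "w \<in> C" for w using Inv_PC[OF inv[OF that f]] that by (simp add: C_def)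
    have "dword (red v) (\<Sum>w\<in>C. dword (red w) (T f) * bas w) = (\<Sum>w\<in>C. dword (red v) (dword (red w) (T f) * bas w))"
      by (rule dword_sum[OF red(3)[OF v(1)] CPC])
    also have "\<dots> = (\<Sum>w\<in>C. if w = v then dword (red w) (T f) else 0)"
    proof (rule sum.cong[OF refl])
      fix w assume w: "w \<in> C"
      then have "w \<in> W" "len w \<le> len v" using v by (auto simp: C_def)
      then show "dword (red v) (dword (red w) (T f) * bas w) = (if w = v then dword (red w) (T f) else 0)"
        using dword_Inv[OF red(3)[OF v(1)] inv[OF w f], of "bas w"] bas_triangular[OF v(1), of w] by auto
    qed
    also have "\<dots> = dword (red v) (T f)"
    proof (cases "len v = l")
      case True
      then show ?thesis using v BC(3) by (simp add: C_def)
    next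
      case False
      then show ?thesis using T0'[OF v(1) _ f] v BC(3) by (simp add: C_def)
    qed
    finally have e2: "dword (red v) (\<Sum>w\<in>C. dword (red w) (T f) * bas w) = dword (red v) (T f)" .
    define S where "S = (\<Sum>w\<in>C. dword (red w) (T f) * bas w)"
    have S: "S \<in> PC" using CPC by (simp add: S_def)
    have "dword (red v) (T f - S) + dword (red v) S = dword (red v) (T f)"
      using dword_add[OF red(3)[OF v(1)], of "T f - S" S] S TPC[OF f] by simp
    then show "dword (red v) (f - (\<Sum>w\<in>{w \<in> W. l \<le> len w}. bas w * E' w f)) = 0"
      unfolding e using e2 by (simp add: S_def)
  qed
qed

text \<open>At \<open>l = 0\<close> the difference between \<open>f\<close> and its expansion is killed by all \<open>\<partial>\<^sub>v\<close>, including the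
  identity \<open>v = 1\<close>.\<close>

lemma expansion:
  assumes A: "A \<subseteq> carrier EQ" "\<And>F K. F \<in> A \<Longrightarrow> K \<in> A \<Longrightarrow> F \<otimes>\<^bsub>EE\<^esub> K \<in> A" "\<And>F K. F \<in> A \<Longrightarrow> K \<in> A \<Longrightarrow> F \<oplus>\<^bsub>EE\<^esub> K \<in> A"
    "\<And>g. g \<in> PC \<Longrightarrow> mulop g \<in> A" "\<And>w. w \<in> W \<Longrightarrow> wordop (red w) \<in> A"
  shows "\<exists>E. (\<forall>w\<in>W. E w \<in> A \<and> (\<forall>f\<in>PC. E w f \<in> Inv) \<and> (\<forall>j. \<forall>f\<in>G j. E w f \<in> G (j - 2 * int (len w)))) \<and>
    (\<forall>f\<in>PC. f = (\<Sum>w\<in>W. bas w * E w f))"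
proof -
  obtain E where E: "\<forall>w\<in>W. E w \<in> A \<and> (\<forall>f\<in>PC. E w f \<in> Inv) \<and> (\<forall>j. \<forall>f\<in>G j. E w f \<in> G (j - 2 * int (len w)))"
    and z: "\<forall>v\<in>W. \<forall>f\<in>PC. dword (red v) (f - (\<Sum>w\<in>W. bas w * E w f)) = 0"
    using elimination[OF A, of 0] by auto
  have "f = (\<Sum>w\<in>W. bas w * E w f)" if "f \<in> PC" for f using bspec[OF bspec[OF z one_W] that] by simp
  then show ?thesis using E by blast
qed

text \<open>By linearity \<open>F\<close> is the sum of the operators \<open>f \<mapsto> F(b\<^sub>w) E\<^sub>w(f)\<close>, where the coordinate maps \<open>E\<^sub>w\<close>
  can be chosen in \<open>A\<close>.\<close>

lemma EQ_generated:
  assumes A: "A \<subseteq> carrier EQ" "\<And>F K. F \<in> A \<Longrightarrow> K \<in> A \<Longrightarrow> F \<otimes>\<^bsub>EE\<^esub> K \<in> A" "\<And>F K. F \<in> A \<Longrightarrow> K \<in> A \<Longrightarrow> F \<oplus>\<^bsub>EE\<^esub> K \<in> A"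
    "\<And>g. g \<in> PC \<Longrightarrow> mulop g \<in> A" "\<And>w. w \<in> W \<Longrightarrow> wordop (red w) \<in> A"
  shows "carrier EQ \<subseteq> A"
proof
  interpret Er: ring EQ by (rule EE_ring)
  obtain E where E0: "\<forall>w\<in>W. E w \<in> A \<and> (\<forall>f\<in>PC. E w f \<in> Inv) \<and> (\<forall>j. \<forall>f\<in>G j. E w f \<in> G (j - 2 * int (len w)))"
    "\<forall>f\<in>PC. f = (\<Sum>w\<in>W. bas w * E w f)" using expansion[OF A] by blast
  have E: "\<And>w. w \<in> W \<Longrightarrow> E w \<in> A" "\<And>w f. w \<in> W \<Longrightarrow> f \<in> PC \<Longrightarrow> E w f \<in> Inv"
    "\<And>f. f \<in> PC \<Longrightarrow> (\<Sum>w\<in>W. bas w * E w f) = f" using E0 by auto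
  fix F assume F: "F \<in> carrier EQ"
  have tA: "mulop (F (bas w)) \<otimes>\<^bsub>EE\<^esub> E w \<in> A" if "w \<in> W" for w using A(2,4) E(1) EE_PC[OF F] that by simp
  have "finsum EE (\<lambda>w. mulop (F (bas w)) \<otimes>\<^bsub>EE\<^esub> E w) C \<in> A" if "finite C" "C \<subseteq> W" for C
    using that
  proof (induction C)
    case empty
    have "mulop 0 = \<zero>\<^bsub>EQ\<^esub>" by (rule EE_eqI) (auto simp: EE_simps)
    then show ?case using A(4)[of 0] by simp
  next
    case (insert w C)
    have "finsum EE (\<lambda>w. mulop (F (bas w)) \<otimes>\<^bsub>EE\<^esub> E w) (insert w C) = (mulop (F (bas w)) \<otimes>\<^bsub>EE\<^esub> E w) \<oplus>\<^bsub>EE\<^esub> finsum EE (\<lambda>w. mulop (F (bas w)) \<otimes>\<^bsub>EE\<^esub> E w) C"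
      using insert tA A(1) by (intro Er.finsum_insert) auto
    then show ?case using insert A(3) tA by simp
  qed
  then have sA: "finsum EE (\<lambda>w. mulop (F (bas w)) \<otimes>\<^bsub>EE\<^esub> E w) W \<in> A" using finite_W by blast
  have "finsum EE (\<lambda>w. mulop (F (bas w)) \<otimes>\<^bsub>EE\<^esub> E w) W = F"
  proof (rule EE_eqI)
    fix f :: "rat pol" assume f: "f \<in> PC"
    have "finsum EE (\<lambda>w. mulop (F (bas w)) \<otimes>\<^bsub>EE\<^esub> E w) W f = (\<Sum>w\<in>W. (mulop (F (bas w)) \<otimes>\<^bsub>EE\<^esub> E w) f)"
      using tA A(1) by (intro EE_finsum finite_W f) auto
    also have "\<dots> = (\<Sum>w\<in>W. F (E w f * bas w))"
      using f E(2) Inv_PC[OF E(2)] by (intro sum.cong) (auto simp: EE_simps EE_lin[OF F] mult.commute)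
    also have "\<dots> = F (\<Sum>w\<in>W. E w f * bas w)"
      using f Inv_PC[OF E(2)] by (intro EE_sum[OF F, symmetric]) auto
    also have "(\<Sum>w\<in>W. E w f * bas w) = f" using E(3)[OF f] by (simp add: mult.commute)
    finally show "finsum EE (\<lambda>w. mulop (F (bas w)) \<otimes>\<^bsub>EE\<^esub> E w) W f = F f" .
  qed (use sA A(1) F in auto)
  then show "F \<in> A" using sA by simp
qed

lemma coord_exists: "\<exists>E. (\<forall>w\<in>W. E w \<in> carrier EQ \<and> (\<forall>f\<in>PC. E w f \<in> Inv) \<and> (\<forall>j. \<forall>f\<in>G j. E w f \<in> G (j - 2 * int (len w)))) \<and>
    (\<forall>f\<in>PC. f = (\<Sum>w\<in>W. bas w * E w f))"
proof -
  interpret Er: ring EQ by (rule EE_ring)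
  show ?thesis
    by (rule expansion[of "carrier EQ"]) (use red(3) in \<open>auto simp del: in_lists_conv_set\<close>)
qed

definition coord :: "int mat \<Rightarrow> rat pol \<Rightarrow> rat pol" where
  "coord = (SOME E. (\<forall>w\<in>W. E w \<in> carrier EQ \<and> (\<forall>f\<in>PC. E w f \<in> Inv) \<and> (\<forall>j. \<forall>f\<in>G j. E w f \<in> G (j - 2 * int (len w)))) \<and>
    (\<forall>f\<in>PC. f = (\<Sum>w\<in>W. bas w * E w f)))"

lemma coord: "w \<in> W \<Longrightarrow> coord w \<in> carrier EQ" "w \<in> W \<Longrightarrow> f \<in> PC \<Longrightarrow> coord w f \<in> Inv"
  "w \<in> W \<Longrightarrow> f \<in> G j \<Longrightarrow> coord w f \<in> G (j - 2 * int (len w))"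
  "f \<in> PC \<Longrightarrow> (\<Sum>w\<in>W. bas w * coord w f) = f"
proof -
  have *: "(\<forall>w\<in>W. coord w \<in> carrier EQ \<and> (\<forall>f\<in>PC. coord w f \<in> Inv) \<and> (\<forall>j. \<forall>f\<in>G j. coord w f \<in> G (j - 2 * int (len w)))) \<and>
    (\<forall>f\<in>PC. f = (\<Sum>w\<in>W. bas w * coord w f))"
    using someI_ex[OF coord_exists] unfolding coord_def .
  show "w \<in> W \<Longrightarrow> coord w \<in> carrier EQ" "w \<in> W \<Longrightarrow> f \<in> PC \<Longrightarrow> coord w f \<in> Inv"
  "w \<in> W \<Longrightarrow> f \<in> G j \<Longrightarrow> coord w f \<in> G (j - 2 * int (len w))"
    using * by blast+
  show "f \<in> PC \<Longrightarrow> (\<Sum>w\<in>W. bas w * coord w f) = f" using conjunct2[OF *] by auto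
qed

lemma coord_unique:
  assumes c: "\<And>w. w \<in> W \<Longrightarrow> c w \<in> Inv" and f: "f = (\<Sum>w\<in>W. bas w * c w)" and w: "w \<in> W"
  shows "coord w f = c w"
proof -
  have fP: "f \<in> PC" unfolding f using Inv_PC[OF c] by (intro PC_sum PC_mult) auto
  have "(\<Sum>w\<in>W. bas w * (coord w f + - c w)) = f - f"
    using coord(4)[OF fP] f by (simp add: algebra_simps sum_subtractf)
  then have z: "(\<Sum>w\<in>W. bas w * (coord w f + - c w)) = 0" by simp
  have "coord w f + - c w = 0"
    by (rule bas_independent[of "\<lambda>w. coord w f + - c w", OF _ z w]) (use c coord(2) fP in \<open>auto intro: Inv_add Inv_uminus simp del: add_uminus_conv_diff\<close>)
  then show ?thesis by simp
qed

section \<open>The grading of the endomorphism ring\<close>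

lemma G_independent:
  assumes A: "finite A" and inj: "inj_on e A" and g: "\<And>k. k \<in> A \<Longrightarrow> g k \<in> G (e k)" and z: "(\<Sum>k\<in>A. g k) = (0 :: 'k::comm_ring_1 pol)" and k: "k \<in> A"
  shows "g k = 0"
proof (rule poly_mapping_eqI)
  fix m
  show "Poly_Mapping.lookup (g k) m = Poly_Mapping.lookup 0 m"
  proof (cases "edeg m = e k")
    case True
    have "0 = (\<Sum>l\<in>A. Poly_Mapping.lookup (g l) m)" using arg_cong[OF z, of "\<lambda>f. Poly_Mapping.lookup f m"] by (simp add: lookup_sum)
    also have "\<dots> = (\<Sum>l\<in>A. if l = k then Poly_Mapping.lookup (g k) m else 0)"
      using True inj k by (intro sum.cong refl) (auto intro!: G_lookup[OF g] simp: inj_on_def)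
    finally show ?thesis using A k by simp
  next
    case False
    then show ?thesis using G_lookup[OF g[OF k]] by simp
  qed
qed

lemma EE_eq0I: assumes F: "F \<in> carrier EE" and z: "\<And>j f. f \<in> G j \<Longrightarrow> F f = 0" shows "F = (\<zero>\<^bsub>EE\<^esub> :: 'k::comm_ring_1 pol \<Rightarrow> 'k pol)"
proof (rule EE_eqI[OF F])
  interpret E: ring "EE :: ('k pol \<Rightarrow> 'k pol) ring" by (rule EE_ring)
  show "\<zero>\<^bsub>EE\<^esub> \<in> carrier (EE :: ('k pol \<Rightarrow> 'k pol) ring)" by simp
  fix f :: "'k pol" assume f: "f \<in> PC"
  have "F f = F (\<Sum>m\<in>Poly_Mapping.keys f. Poly_Mapping.single m (Poly_Mapping.lookup f m))" using pm_sum[of f] by simp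
  also have "\<dots> = (\<Sum>m\<in>Poly_Mapping.keys f. F (Poly_Mapping.single m (Poly_Mapping.lookup f m)))"
    using f by (intro EE_sum[OF F] PC_single) (auto simp: PC_def)
  also have "\<dots> = 0" using f by (intro sum.neutral ballI z[OF G_single[OF _ refl]]) (auto simp: PC_def)
  finally show "F f = \<zero>\<^bsub>EE\<^esub> f" using f by (simp add: EE_simps)
qed

lemma EndQ_EE: "EndQ D = EQ"
  by (simp add: EE_def InvarQ_eq)

abbreviation "EG \<equiv> EndQ_grade D"

lemma EG_iff: "F \<in> EG k \<longleftrightarrow> F \<in> carrier EQ \<and> (\<forall>j. \<forall>f\<in>G j. F f \<in> G (j + k))"
  unfolding EndQ_grade_def EndQ_EE by auto

lemma EG_subgroup: "subgroup (EG k) (add_monoid EQ)"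
proof -
  interpret E: ring EQ by (rule EE_ring)
  show ?thesis
  proof (rule group.subgroupI[OF ring_add_group[OF EE_ring]])
    have "\<zero>\<^bsub>EQ\<^esub> \<in> EG k" by (auto simp: EG_iff EE_simps(4)[OF G_PC])
    then show "EG k \<noteq> {}" by blast
    show "inv\<^bsub>add_monoid EQ\<^esub> F \<in> EG k" if F: "F \<in> EG k" for F
    proof -
      have "\<ominus>\<^bsub>EE\<^esub> F \<in> EG k" using F by (auto simp: EG_iff EE_uminus G_PC G_uminus)
      then show ?thesis by (simp add: a_inv_def)
    qed
  qed (auto simp: EG_iff EE_simps G_PC G_add)
qed

text \<open>Components of different degrees send a homogeneous polynomial into different degrees.\<close>

lemma EG_independent:
  assumes A: "finite A" and c: "\<And>k. k \<in> A \<Longrightarrow> c k \<in> EG k" and z: "finsum EQ c A = \<zero>\<^bsub>EQ\<^esub>" and k: "k \<in> A"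
  shows "c k = \<zero>\<^bsub>EQ\<^esub>"
proof (rule EE_eq0I)
  show "c k \<in> carrier EQ" using c[OF k] by (simp add: EG_iff)
  fix j and f :: "rat pol" assume f: "f \<in> G j"
  have "(\<Sum>l\<in>A. c l f) = finsum EQ c A f" using c f G_PC by (intro EE_finsum[symmetric] A) (auto simp: EG_iff)
  also have "\<dots> = 0" using z EE_simps(4)[OF G_PC[OF f]] by simp
  finally show "c k f = 0"
    by (intro G_independent[OF A, of "\<lambda>l. j + l" "\<lambda>l. c l f"] k) (use c f in \<open>auto simp: EG_iff inj_on_def\<close>)
qed

end

section \<open>Rational coefficients\<close>

lemma Q_ring_simps [simp]: "carrier Q_ring = UNIV" "monoid.mult Q_ring = (*)" "monoid.one Q_ring = 1" "ring.zero Q_ring = 0" "ring.add Q_ring = (+)"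
  by (auto simp: ring_of_type_algebra_def)

lemma Q_ring_ring: "ring Q_ring"
  by (rule ring_from_type_algebra)

lemma Q_int_pow: "(x :: rat) [^]\<^bsub>add_monoid Q_ring\<^esub> (m::int) = of_int m * x"
  by (rule int_pow_of_int[OF Q_ring_ring]) auto

context nil_hecke
begin

abbreviation "TQ \<equiv> tensor_ring Q_ring NH"
abbreviation "pt \<equiv> pure_tensor Q_ring NH"

lemma TQ_ring: "ring TQ"
  by (rule tensor_ring_ring[OF Q_ring_ring NH_ring])

sublocale TQ: ring TQ by (rule TQ_ring)

lemma pt_closed [simp]: "y \<in> carrier NH \<Longrightarrow> pt q y \<in> carrier TQ"
  using pure_tensor_closed[OF Q_ring_ring NH_ring, of q y] by simp

lemma pt_hom_right: "pt q \<in> hom (add_monoid NH) (add_monoid TQ)"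
  by (rule homI) (auto simp: pure_tensor_add_right[OF Q_ring_ring NH_ring])

lemma pt_hom_left: "y \<in> carrier NH \<Longrightarrow> (\<lambda>q. pt q y) \<in> hom (add_monoid Q_ring) (add_monoid TQ)"
  using pure_tensor_add_left[OF Q_ring_ring NH_ring, of _ _ y] by (intro homI) auto

lemma pt_int: assumes y: "y \<in> carrier NH" shows "pt (of_int m * q) y = pt q ([m] \<cdot>\<^bsub>NH\<^esub> y)"
  using add_pow_hom[OF Q_ring_ring ring_add_group[OF TQ_ring] pt_hom_left[OF y], of q m]
    add_pow_hom[OF NH_ring ring_add_group[OF TQ_ring] pt_hom_right y, of q m] Q_int_pow[of q m]
  by (simp add: add_pow_def)

lemma pt_uminus: "y \<in> carrier NH \<Longrightarrow> pt q (\<ominus>\<^bsub>NH\<^esub> y) = \<ominus>\<^bsub>TQ\<^esub> pt q y"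
  using add_hom_inv[OF NH_ring ring_add_group[OF TQ_ring] pt_hom_right] by (simp add: a_inv_def)

lemma pt_minus: "x \<in> carrier NH \<Longrightarrow> y \<in> carrier NH \<Longrightarrow> pt q (x \<ominus>\<^bsub>NH\<^esub> y) = pt q x \<ominus>\<^bsub>TQ\<^esub> pt q y"
  using hom_mult[OF pt_hom_right, of x "\<ominus>\<^bsub>NH\<^esub> y" q] by (simp add: a_minus_def pt_uminus)

text \<open>A common denominator can be taken for all summands, so every element is a single pure tensor. This
  reduces injectivity over \<open>\<rat>\<close> to faithfulness of the integral algebra on rational polynomials.\<close>

lemma TQ_pure: assumes "t \<in> carrier TQ" shows "\<exists>d y. d > (0::int) \<and> y \<in> carrier NH \<and> t = pt (1 / of_int d) y"
proof (rule tensor_induct[OF Q_ring_ring NH_ring assms])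
  fix q and y assume y: "y \<in> carrier NH"
  obtain a b where ab: "quotient_of q = (a, b)" by fastforce
  then have b: "b > 0" "q = of_int a * (1 / of_int b)" using quotient_of_denom_pos quotient_of_div by auto
  have "pt q y = pt (1 / of_int b) ([a] \<cdot>\<^bsub>NH\<^esub> y)" unfolding b(2) by (rule pt_int[OF y])
  then show "\<exists>d y'. d > (0::int) \<and> y' \<in> carrier NH \<and> pt q y = pt (1 / of_int d) y'"
    using b(1) y by (intro exI[of _ b] exI[of _ "[a] \<cdot>\<^bsub>NH\<^esub> y"]) auto
next
  fix s t assume "\<exists>d y. d > (0::int) \<and> y \<in> carrier NH \<and> s = pt (1 / of_int d) y" "\<exists>d y. d > (0::int) \<and> y \<in> carrier NH \<and> t = pt (1 / of_int d) y"
  then obtain d y e z where *: "d > (0::int)" "y \<in> carrier NH" "s = pt (1 / of_int d) y" "e > (0::int)" "z \<in> carrier NH" "t = pt (1 / of_int e) z" by blast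
  have "s = pt (of_int e * (1 / of_int (d * e))) y" "t = pt (of_int d * (1 / of_int (d * e))) z" using * by auto
  then have "s \<ominus>\<^bsub>TQ\<^esub> t = pt (1 / of_int (d * e)) ([e] \<cdot>\<^bsub>NH\<^esub> y \<ominus>\<^bsub>NH\<^esub> [d] \<cdot>\<^bsub>NH\<^esub> z)"
    using * by (simp only: pt_int) (simp add: pt_minus)
  then show "\<exists>d y. d > (0::int) \<and> y \<in> carrier NH \<and> s \<ominus>\<^bsub>TQ\<^esub> t = pt (1 / of_int d) y"
    using * by (intro exI[of _ "d * e"] exI[of _ "[e] \<cdot>\<^bsub>NH\<^esub> y \<ominus>\<^bsub>NH\<^esub> [d] \<cdot>\<^bsub>NH\<^esub> z"]) auto
qed

definition is_rep :: "('a \<Rightarrow> 'k::{idom, ring_char_0} pol \<Rightarrow> 'k pol) \<Rightarrow> bool" where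
  "is_rep \<rho> \<longleftrightarrow> \<rho> \<in> ring_hom NH EE \<and> (\<forall>u\<in>lists I. \<rho> (del u) = wordop u) \<and> (\<forall>f\<in>PC. \<rho> (\<kappa> f) = mulop (base f))"

lemma is_rep_hom: "is_rep \<rho> \<Longrightarrow> ring_hom_ring NH EE \<rho>"
  by (rule ring_hom_ringI2[OF NH_ring EE_ring]) (simp add: is_rep_def)

lemma is_rep_comb:
  assumes \<rho>: "is_rep \<rho>" and g: "\<And>w. w \<in> W \<Longrightarrow> g w \<in> PC" and f: "f \<in> PC"
  shows "\<rho> (comb g) f = (\<Sum>w\<in>W. base (g w) * dword (red w) (f :: 'k::{idom, ring_char_0} pol))"
proof -
  interpret \<rho>: ring_hom_ring NH "EE :: ('k pol \<Rightarrow> 'k pol) ring" \<rho> by (rule is_rep_hom[OF \<rho>])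
  have "\<rho> (comb g) = finsum EE (\<lambda>w. \<rho> (\<kappa> (g w) \<otimes>\<^bsub>NH\<^esub> del (red w))) W"
    unfolding comb_def using comb_term g by (subst \<rho>.hom_finsum) (auto simp: comp_def)
  then have "\<rho> (comb g) f = (\<Sum>w\<in>W. \<rho> (\<kappa> (g w) \<otimes>\<^bsub>NH\<^esub> del (red w)) f)"
    using EE_finsum[OF finite_W _ f, of "\<lambda>w. \<rho> (\<kappa> (g w) \<otimes>\<^bsub>NH\<^esub> del (red w))"] comb_term g by simp
  also have "\<dots> = (\<Sum>w\<in>W. base (g w) * dword (red w) f)"
    using g red(3) \<rho> f by (intro sum.cong refl) (simp add: is_rep_def EE_simps)
  finally show ?thesis .
qed

lemma is_rep_faithful:
  assumes \<rho>: "is_rep (\<rho> :: 'a \<Rightarrow> rat pol \<Rightarrow> rat pol)" and y: "y \<in> carrier NH" and z: "\<And>f. f \<in> PC \<Longrightarrow> \<rho> y f = 0"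
  shows "y = \<zero>\<^bsub>NH\<^esub>"
proof -
  obtain g where g: "\<forall>w\<in>W. g w \<in> PC" "y = comb g" using NH_span[OF y] by (auto simp: span_def)
  have b: "base (g w) = (0 :: rat pol)" if "w \<in> W" for w
    by (rule dred_independent[of "\<lambda>w. base (g w)", OF _ _ that]) (use g z is_rep_comb[OF \<rho>, of g] in auto)
  have "g w = 0" if "w \<in> W" for w
  proof -
    have "base (g w) = (base 0 :: rat pol)" using b[OF that] by simp
    then show ?thesis by (simp only: base_inject)
  qed
  then have "comb g = finsum NH (\<lambda>w. \<zero>\<^bsub>NH\<^esub>) W"
    unfolding comb_def using red(3) by (intro NH.finsum_cong') (auto simp: \<kappa>_zero)
  then show ?thesis using g by simp
qed

lemma is_rep_base:
  assumes \<rho>: "is_rep (\<rho> :: 'a \<Rightarrow> 'k::{idom, ring_char_0} pol \<Rightarrow> 'k pol)" and \<rho>Z: "is_rep (\<rho>Z :: 'a \<Rightarrow> int pol \<Rightarrow> int pol)"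
    and y: "y \<in> carrier NH" and f: "f \<in> PC"
  shows "\<rho> y (base f) = base (\<rho>Z y f)"
  using y
proof (induction y rule: NH_induct)
  case (prod u g)
  interpret \<rho>: ring_hom_ring NH "EE :: ('k pol \<Rightarrow> 'k pol) ring" \<rho> by (rule is_rep_hom[OF \<rho>])
  interpret \<rho>Z: ring_hom_ring NH "EE :: (int pol \<Rightarrow> int pol) ring" \<rho>Z by (rule is_rep_hom[OF \<rho>Z])
  show ?case using prod \<rho> \<rho>Z f by (simp add: is_rep_def EE_simps base_dword base_mult)
next
  case (diff x y)
  interpret \<rho>: ring_hom_ring NH "EE :: ('k pol \<Rightarrow> 'k pol) ring" \<rho> by (rule is_rep_hom[OF \<rho>])
  interpret \<rho>Z: ring_hom_ring NH "EE :: (int pol \<Rightarrow> int pol) ring" \<rho>Z by (rule is_rep_hom[OF \<rho>Z])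
  show ?case using diff f EE_PC[OF \<rho>.hom_closed] EE_PC[OF \<rho>Z.hom_closed]
    by (simp add: a_minus_def EE_simps EE_uminus base_add base_uminus del: add_uminus_conv_diff)
qed

section \<open>The rational nilHecke algebra as an endomorphism ring\<close>

text \<open>Injectivity is faithfulness of the action (\<open>is_rep_faithful\<close>); surjectivity is \<open>EQ_generated\<close> applied
  to the image, which contains multiplication by every rational polynomial after a denominator has
  been cleared.\<close>

lemma phi_exists:
  assumes \<rho>: "is_rep (\<rho> :: 'a \<Rightarrow> rat pol \<Rightarrow> rat pol)"
  shows "\<exists>\<phi>\<in>ring_iso TQ EQ. \<forall>q. \<forall>y\<in>carrier NH. \<phi> (pt q y) = mulop (Const q) \<otimes>\<^bsub>EE\<^esub> \<rho> y"
proof -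
  interpret E: ring EQ by (rule EE_ring)
  interpret \<rho>: ring_hom_ring NH EQ \<rho> by (rule is_rep_hom[OF \<rho>])
  have \<rho>c: "\<rho> y f \<in> PC" if "y \<in> carrier NH" "f \<in> PC" for y f using EE_PC[OF \<rho>.hom_closed] that by blast
  have madd: "mulop (Const (a + b)) = mulop (Const a) \<oplus>\<^bsub>EQ\<^esub> mulop (Const b)" for a b :: rat
    by (rule EE_eqI) (auto simp: EE_simps single_add distrib_right)
  obtain \<phi> where \<phi>: "\<phi> \<in> hom (add_monoid TQ) (add_monoid EQ)" "\<And>q y. y \<in> carrier NH \<Longrightarrow> \<phi> (pt q y) = mulop (Const q) \<otimes>\<^bsub>EE\<^esub> \<rho> y"
    using tensor_universal[OF Q_ring_ring NH_ring ring_add_comm_group[OF E.ring_axioms], of "\<lambda>q y. mulop (Const q) \<otimes>\<^bsub>EE\<^esub> \<rho> y"]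
    by (auto simp: madd E.l_distr E.r_distr)
  have \<phi>c: "\<phi> t \<in> carrier EE" if "t \<in> carrier TQ" for t using hom_in_carrier[OF \<phi>(1)] that by simp
  have \<phi>add: "\<phi> (s \<oplus>\<^bsub>TQ\<^esub> t) = \<phi> s \<oplus>\<^bsub>EE\<^esub> \<phi> t" if "s \<in> carrier TQ" "t \<in> carrier TQ" for s t using hom_mult[OF \<phi>(1)] that by simp
  have \<phi>mult: "\<phi> (s \<otimes>\<^bsub>TQ\<^esub> t) = \<phi> s \<otimes>\<^bsub>EE\<^esub> \<phi> t" if s: "s \<in> carrier TQ" and t: "t \<in> carrier TQ" for s t
  proof -
    obtain d y where y: "y \<in> carrier NH" "s = pt d y" using TQ_pure[OF s] by blast
    obtain e z where z: "z \<in> carrier NH" "t = pt e z" using TQ_pure[OF t] by blast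
    have st: "s \<otimes>\<^bsub>TQ\<^esub> t = pt (d * e) (y \<otimes>\<^bsub>NH\<^esub> z)"
      using pure_tensor_mult[OF Q_ring_ring NH_ring, of d y e z] y z by simp
    show ?thesis unfolding st unfolding y(2) z(2) \<phi>(2)[OF y(1)] \<phi>(2)[OF z(1)] \<phi>(2)[OF NH.m_closed[OF y(1) z(1)]]
    proof (rule EE_eqI)
      fix f :: "rat pol" assume f: "f \<in> PC"
      have "\<rho> y (Const e * \<rho> z f) = Const e * \<rho> y (\<rho> z f)" using EE_lin[OF \<rho>.hom_closed[OF y(1)], of "\<rho> z f" "Const e"] \<rho>c[OF z(1) f] by simp
      moreover have "Const (d * e) = Const d * Const e" by (simp add: mult_single)
      ultimately show "(mulop (Const (d * e)) \<otimes>\<^bsub>EE\<^esub> \<rho> (y \<otimes>\<^bsub>NH\<^esub> z)) f = (mulop (Const d) \<otimes>\<^bsub>EE\<^esub> \<rho> y \<otimes>\<^bsub>EE\<^esub> (mulop (Const e) \<otimes>\<^bsub>EE\<^esub> \<rho> z)) f"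
        using f y z \<rho>c by (simp add: EE_simps mult.assoc)
    qed (use y z in auto)
  qed
  have \<phi>1: "\<phi> \<one>\<^bsub>TQ\<^esub> = \<one>\<^bsub>EE\<^esub>"
  proof -
    have "mulop (Const 1) = \<one>\<^bsub>EQ\<^esub>" by (rule EE_eqI) (auto simp: EE_simps)
    then show ?thesis using pure_tensor_one[OF Q_ring_ring NH_ring] \<phi>(2)[OF NH.one_closed, of 1] by simp
  qed
  have hom: "\<phi> \<in> ring_hom TQ EQ" using \<phi>c \<phi>mult \<phi>add \<phi>1 by (intro ring_hom_memI) auto
  interpret \<phi>: ring_hom_ring TQ EQ \<phi> by (rule ring_hom_ringI2[OF TQ_ring EE_ring hom])
  have ker: "t = \<zero>\<^bsub>TQ\<^esub>" if t: "t \<in> carrier TQ" and z: "\<phi> t = \<zero>\<^bsub>EE\<^esub>" for t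
  proof -
    obtain d y where y: "d > (0::int)" "y \<in> carrier NH" "t = pt (1 / of_int d) y" using TQ_pure[OF t] by blast
    have "\<rho> y f = 0" if f: "f \<in> PC" for f
    proof -
      have "Const (1 / of_int d) * \<rho> y f = \<phi> t f" unfolding y(3) \<phi>(2)[OF y(2)] using f y \<rho>c by (simp add: EE_simps)
      also have "\<dots> = 0" using z f by (simp add: EE_simps)
      finally have "Const (1 / of_int d) * \<rho> y f = 0" .
      moreover have "Const (1 / rat_of_int d) \<noteq> 0" using y(1) by (metis lookup_single_eq lookup_zero divide_eq_0_iff of_int_eq_0_iff less_irrefl zero_neq_one)
      ultimately show ?thesis by (metis mult_eq_0_iff)
    qed
    then have "y = \<zero>\<^bsub>NH\<^esub>" using is_rep_faithful[OF \<rho> y(2)] by blast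
    moreover have "pt q \<zero>\<^bsub>NH\<^esub> = \<zero>\<^bsub>TQ\<^esub>" for q
      using pt_minus[OF NH.zero_closed NH.zero_closed, of q] by (simp add: NH.r_neg TQ.r_neg a_minus_def)
    ultimately show ?thesis using y(3) by simp
  qed
  have inj: "inj_on \<phi> (carrier TQ)"
  proof (rule inj_onI)
    fix s t assume s: "s \<in> carrier TQ" and t: "t \<in> carrier TQ" and e: "\<phi> s = \<phi> t"
    have "\<phi> (s \<ominus>\<^bsub>TQ\<^esub> t) = \<zero>\<^bsub>EE\<^esub>" using s t e by (simp add: a_minus_def E.r_neg)
    then have "s \<ominus>\<^bsub>TQ\<^esub> t = \<zero>\<^bsub>TQ\<^esub>" using ker s t by simp
    then show "s = t" using s t by simp
  qed
  have surj: "carrier EQ \<subseteq> \<phi> ` carrier TQ"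
  proof (rule EQ_generated)
    show "\<phi> ` carrier TQ \<subseteq> carrier EQ" using \<phi>c by auto
    show "F \<otimes>\<^bsub>EE\<^esub> K \<in> \<phi> ` carrier TQ" if "F \<in> \<phi> ` carrier TQ" "K \<in> \<phi> ` carrier TQ" for F K
    proof -
      from that obtain s t where "s \<in> carrier TQ" "F = \<phi> s" "t \<in> carrier TQ" "K = \<phi> t" by blast
      then show ?thesis using imageI[OF TQ.m_closed[of s t], of \<phi>] \<phi>mult[of s t] by simp
    qed
    show "F \<oplus>\<^bsub>EE\<^esub> K \<in> \<phi> ` carrier TQ" if "F \<in> \<phi> ` carrier TQ" "K \<in> \<phi> ` carrier TQ" for F K
    proof -
      from that obtain s t where "s \<in> carrier TQ" "F = \<phi> s" "t \<in> carrier TQ" "K = \<phi> t" by blast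
      then show ?thesis using imageI[OF TQ.a_closed[of s t], of \<phi>] \<phi>add[of s t] by simp
    qed
    show "mulop g \<in> \<phi> ` carrier TQ" if g: "g \<in> PC" for g
    proof -
      obtain d f where d: "d > 0" "of_int d * g = base f" "Poly_Mapping.keys f = Poly_Mapping.keys g"
        using rat_pol_denominator[of g] by auto
      have f: "f \<in> PC" using g d(3) by (simp add: PC_def)
      have "mulop (Const (1 / of_int d)) \<otimes>\<^bsub>EE\<^esub> mulop (base f) = mulop g"
      proof (rule EE_eqI)
        fix h :: "rat pol" assume h: "h \<in> PC"
        have "Const (1 / of_int d) * (of_int d * g) = (Const (1 / of_int d) * Const (of_int d)) * g"
          unfolding of_int_Const by (simp only: mult.assoc)
        also have "\<dots> = g" using d(1) by (simp add: mult_single del: single_of_int)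
        finally have "Const (1 / of_int d) * base f = g" unfolding d(2) .
        then show "(mulop (Const (1 / of_int d)) \<otimes>\<^bsub>EE\<^esub> mulop (base f)) h = mulop g h"
          using h f by (simp add: EE_simps mult.assoc[symmetric])
      qed (use f g in auto)
      then have "mulop g = \<phi> (pt (1 / of_int d) (\<kappa> f))" using \<phi>(2)[of "\<kappa> f"] f \<rho> by (simp add: is_rep_def)
      then show ?thesis using f by auto
    qed
    show "wordop (red w) \<in> \<phi> ` carrier TQ" if w: "w \<in> W" for w
    proof -
      have "mulop (Const 1) = \<one>\<^bsub>EQ\<^esub>" by (rule EE_eqI) (auto simp: EE_simps)
      then have "wordop (red w) = \<phi> (pt 1 (del (red w)))" using \<phi>(2)[of "del (red w)" 1] red(3)[OF w] \<rho> by (simp add: is_rep_def)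
      then show ?thesis using red(3)[OF w] by auto
    qed
  qed
  have "\<phi> \<in> ring_iso TQ EQ" unfolding ring_iso_def using hom inj surj \<phi>c by (auto simp: bij_betw_def)
  then show ?thesis using \<phi>(2) by blast
qed

section \<open>The grading of the nilHecke algebra\<close>

abbreviation "nhm \<equiv> nh_monomials D NH \<iota> \<kappa>"
abbreviation "NG \<equiv> NH_grade D NH \<iota> \<kappa>"

lemma mono_closed: "(a, k) \<in> nhm \<Longrightarrow> a \<in> carrier NH"
  by (induction rule: nh_monomials.induct) (auto simp: nc_del_ncw simp flip: del_def)

lemma mono_mult: "(a, k) \<in> nhm \<Longrightarrow> (b, l) \<in> nhm \<Longrightarrow> (a \<otimes>\<^bsub>NH\<^esub> b, k + l) \<in> nhm"
proof (induction rule: nh_monomials.induct)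
  case one
  then show ?case using mono_closed by simp
next
  case (del i a k)
  then have "(\<iota> (nc_del D i) \<otimes>\<^bsub>NH\<^esub> (a \<otimes>\<^bsub>NH\<^esub> b), k + l - 2) \<in> nhm" by (intro nh_monomials.del) auto
  then show ?case using del mono_closed by (simp add: NH.m_assoc nc_del_ncw algebra_simps)
next
  case (lin x a k)
  then have "(\<kappa> (lin x) \<otimes>\<^bsub>NH\<^esub> (a \<otimes>\<^bsub>NH\<^esub> b), k + l + 2) \<in> nhm" by (intro nh_monomials.lin) auto
  then show ?case using lin mono_closed by (simp add: NH.m_assoc algebra_simps)
qed

lemma NG_subgroup: "subgroup (NG k) (add_monoid NH)"
  unfolding NH_grade_def by (rule group.generate_is_subgroup[OF ring_add_group[OF NH_ring]]) (auto dest: mono_closed)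

lemma NG_closed: "y \<in> NG k \<Longrightarrow> y \<in> carrier NH"
  using subgroup.subset[OF NG_subgroup] by auto

lemma NG_mono: "(a, k) \<in> nhm \<Longrightarrow> a \<in> NG k"
  unfolding NH_grade_def by (rule generate.incl) simp

lemma NG_mult: "a \<in> NG k \<Longrightarrow> b \<in> NG l \<Longrightarrow> a \<otimes>\<^bsub>NH\<^esub> b \<in> NG (k + l)"
proof -
  assume a: "a \<in> NG k" and b: "b \<in> NG l"
  show ?thesis
    by (rule mult_generate[OF NH_ring _ _ NG_subgroup _ a[unfolded NH_grade_def] b[unfolded NH_grade_def]])
      (use mono_closed mono_mult NG_mono in auto)
qed

text \<open>The subgroup generated by the homogeneous elements is stable under left multiplication by the
  algebra generators.\<close>

lemma NG_spans: "y \<in> carrier NH \<Longrightarrow> y \<in> generate (add_monoid NH) (\<Union>k. NG k)"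
proof -
  define S where "S = generate (add_monoid NH) (\<Union>k. NG k)"
  note g = ring_add_group[OF NH_ring]
  have Nc: "(\<Union>k. NG k) \<subseteq> carrier NH" using NG_closed by auto
  have S: "subgroup S (add_monoid NH)" unfolding S_def by (rule group.generate_is_subgroup[OF g]) (use Nc in simp)
  have Sc: "x \<in> carrier NH" if "x \<in> S" for x using subgroup.subset[OF S] that by auto
  have Sadd: "x \<oplus>\<^bsub>NH\<^esub> y \<in> S" if "x \<in> S" "y \<in> S" for x y using subgroup.m_closed[OF S that] by simp
  have Sneg: "\<ominus>\<^bsub>NH\<^esub> y \<in> S" if "y \<in> S" for y using subgroup.m_inv_closed[OF S that] by (simp add: a_inv_def)
  have mult: "a \<otimes>\<^bsub>NH\<^esub> x \<in> S" if a: "a \<in> NG k" and x: "x \<in> S" for a k x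
  proof (rule generate_hom_into[OF g g _ _ S _ x[unfolded S_def], of "\<lambda>x. a \<otimes>\<^bsub>NH\<^esub> x"])
    show "(\<lambda>x. a \<otimes>\<^bsub>NH\<^esub> x) \<in> hom (add_monoid NH) (add_monoid NH)" using NG_closed[OF a] by (intro homI) (auto simp: NH.r_distr)
    show "a \<otimes>\<^bsub>NH\<^esub> b \<in> S" if "b \<in> (\<Union>k. NG k)" for b
      unfolding S_def using that NG_mult[OF a] by (auto intro!: generate.incl)
  qed (use Nc in simp)
  have one: "\<one>\<^bsub>NH\<^esub> \<in> S" unfolding S_def using NG_mono[OF nh_monomials.one] by (auto intro!: generate.incl)
  have lin: "\<kappa> (lin x) \<in> NG 2" if "x \<in> colattice D" for x
    using NG_mono[OF nh_monomials.lin[OF that nh_monomials.one]] that by simp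
  have del: "del [i] \<in> NG (-2)" if "i \<in> I" for i
    using NG_mono[OF nh_monomials.del[OF that nh_monomials.one]] that by (simp add: nc_del_ncw flip: del_def)
  have \<kappa>S: "\<kappa> f \<in> S" if "f \<in> PC" for f
    using that
  proof (induction f rule: PC_induct)
    case (Const c)
    have "Const c = (of_int c * 1 :: int pol)" by (simp add: Const_int)
    then have "\<kappa> (Const c) = [c] \<cdot>\<^bsub>NH\<^esub> \<one>\<^bsub>NH\<^esub>" using \<kappa>_of_int_mult[of 1 c] by (simp only: PC_1 \<kappa>_one)
    also have "\<dots> \<in> S" using group.subgroup_int_pow_closed[OF g S one, of c] by (simp add: add_pow_def)
    finally show ?case .
  next
    case (add f g)
    then show ?case using Sadd by (simp add: \<kappa>_add)
  next
    case (var k f)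
    then show ?case using mult[OF lin, of "unit_vec n k" "\<kappa> f"] by (simp add: \<kappa>_mult)
  qed
  have delS: "del u \<otimes>\<^bsub>NH\<^esub> x \<in> S" if "u \<in> lists I" "x \<in> S" for u x
    using that(1)
  proof induction
    case Nil
    then show ?case using that(2) Sc by (simp add: del_Nil)
  next
    case (Cons i u)
    then show ?case using mult[OF del[of i], of "del u \<otimes>\<^bsub>NH\<^esub> x"] Sc[OF that(2)] by (simp add: del_Cons[of i u] NH.m_assoc)
  qed
  assume "y \<in> carrier NH"
  then have "y \<in> S"
  proof (induction y rule: NH_induct)
    case (prod u f)
    then show ?case using delS \<kappa>S by simp
  next
    case (diff x y)
    then show ?case using Sadd Sneg by (simp add: a_minus_def)
  qed
  then show ?thesis by (simp add: S_def)
qed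

lemma rep_grade:
  assumes \<rho>: "is_rep (\<rho> :: 'a \<Rightarrow> rat pol \<Rightarrow> rat pol)" and y: "y \<in> NG k"
  shows "\<rho> y \<in> EG k"
proof -
  interpret \<rho>: ring_hom_ring NH EQ \<rho> by (rule is_rep_hom[OF \<rho>])
  have m: "\<rho> a \<in> EG k" if "(a, k) \<in> nhm" for a k
    using that
  proof (induction rule: nh_monomials.induct)
    case one
    show ?case by (auto simp: EG_iff EE_simps G_PC)
  next
    case (del i a k)
    have "\<rho> (\<iota> (nc_del D i) \<otimes>\<^bsub>NH\<^esub> a) = wordop [i] \<otimes>\<^bsub>EE\<^esub> \<rho> a"
      using del(1) mono_closed[OF del(2)] \<rho> by (simp add: nc_del_ncw is_rep_def flip: del_def)
    moreover have "dem i (\<rho> a f) \<in> G (j + (k - 2))" if "f \<in> G j" for f j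
      using dem_G[OF del(1), of "\<rho> a f" "j + k"] del(3) that by (simp add: EG_iff algebra_simps)
    ultimately show ?case using del(1,3) mono_closed[OF del(2)] EE_PC[of "\<rho> a"]
      by (auto simp: EG_iff EE_simps G_PC dword_Cons nc_del_ncw intro!: \<rho>.S.m_closed)
  next
    case (lin x a k)
    have "\<rho> (\<kappa> (lin x) \<otimes>\<^bsub>NH\<^esub> a) = mulop (lin x) \<otimes>\<^bsub>EE\<^esub> \<rho> a"
      using lin(1) mono_closed[OF lin(2)] \<rho> by (simp add: is_rep_def)
    moreover have "lin x * \<rho> a f \<in> G (j + (k + 2))" if "f \<in> G j" for f j
      using G_mult[OF G_lin[OF lin(1)], of "\<rho> a f" "j + k"] lin(3) that by (simp add: EG_iff algebra_simps)
    ultimately show ?case using lin(1,3) mono_closed[OF lin(2)] EE_PC[of "\<rho> a"]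
      by (auto simp: EG_iff EE_simps G_PC intro!: \<rho>.S.m_closed)
  qed
  show ?thesis
  proof (rule generate_hom_into[OF ring_add_group[OF NH_ring] ring_add_group[OF EE_ring] ring_homD_add[OF NH_ring EE_ring] _ EG_subgroup _ y[unfolded NH_grade_def]])
    show "\<rho> \<in> ring_hom NH EQ" using \<rho> by (simp add: is_rep_def)
  qed (use m mono_closed in auto)
qed

lemma graded_iso_End:
  assumes \<rho>: "is_rep (\<rho> :: 'a \<Rightarrow> rat pol \<Rightarrow> rat pol)"
    and \<phi>: "\<phi> \<in> ring_iso TQ EQ" "\<And>q y. y \<in> carrier NH \<Longrightarrow> \<phi> (pt q y) = mulop (Const q) \<otimes>\<^bsub>EE\<^esub> \<rho> y"
  shows "graded_ring_iso TQ (base_change_grade NH NG) EQ EG \<phi>"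
proof (rule graded_iso_criterion[OF TQ_ring EE_ring \<phi>(1)])
  let ?gen = "\<lambda>k. {pt q a | q a. a \<in> NG k}"
  note g = ring_add_group[OF TQ_ring]
  have gc: "?gen k \<subseteq> carrier TQ" for k using NG_closed by auto
  show sub: "subgroup (base_change_grade NH NG k) (add_monoid TQ)" for k
    unfolding base_change_grade_def by (rule group.generate_is_subgroup[OF g]) (use gc in simp)
  have inc: "pt q a \<in> base_change_grade NH NG k" if "a \<in> NG k" for q a k
    unfolding base_change_grade_def by (rule generate.incl) (use that in blast)
  show "\<one>\<^bsub>TQ\<^esub> \<in> base_change_grade NH NG 0"
    using inc[OF NG_mono[OF nh_monomials.one], of 1] pure_tensor_one[OF Q_ring_ring NH_ring] by simp
  show "a \<otimes>\<^bsub>TQ\<^esub> b \<in> base_change_grade NH NG (k + l)" if a: "a \<in> base_change_grade NH NG k" and b: "b \<in> base_change_grade NH NG l" for k l a b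
  proof (rule mult_generate[OF TQ_ring gc gc sub _ a[unfolded base_change_grade_def] b[unfolded base_change_grade_def]])
    fix x y assume "x \<in> ?gen k" "y \<in> ?gen l"
    then obtain q a r b where *: "x = pt q a" "a \<in> NG k" "y = pt r b" "b \<in> NG l" by blast
    then have "x \<otimes>\<^bsub>TQ\<^esub> y = pt (q * r) (a \<otimes>\<^bsub>NH\<^esub> b)"
      using pure_tensor_mult[OF Q_ring_ring NH_ring, of q a r b] NG_closed by simp
    then show "x \<otimes>\<^bsub>TQ\<^esub> y \<in> base_change_grade NH NG (k + l)" using inc[OF NG_mult[OF *(2,4)]] by simp
  qed
  show "carrier TQ \<subseteq> generate (add_monoid TQ) (\<Union>k. base_change_grade NH NG k)"
  proof
    fix t assume "t \<in> carrier TQ"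
    then obtain q y where y: "y \<in> carrier NH" "t = pt q y" using TQ_pure by blast
    have bc: "(\<Union>k. base_change_grade NH NG k) \<subseteq> carrier TQ" using subgroup.subset[OF sub] by auto
    show "t \<in> generate (add_monoid TQ) (\<Union>k. base_change_grade NH NG k)"
      unfolding y(2)
    proof (rule generate_hom_into[OF ring_add_group[OF NH_ring] g pt_hom_right _ group.generate_is_subgroup[OF g] _ NG_spans[OF y(1)]])
      show "pt q a \<in> generate (add_monoid TQ) (\<Union>k. base_change_grade NH NG k)" if "a \<in> (\<Union>k. NG k)" for a
        using that inc by (auto intro!: generate.incl)
    qed (use NG_closed bc in auto)
  qed
  show "\<phi> ` base_change_grade NH NG k \<subseteq> EG k" for k
  proof (rule image_subsetI)
    fix t assume t: "t \<in> base_change_grade NH NG k"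
    show "\<phi> t \<in> EG k"
    proof (rule generate_hom_into[OF g ring_add_group[OF EE_ring] ring_homD_add[OF TQ_ring EE_ring ring_iso_hom[OF \<phi>(1)]] _ EG_subgroup _ t[unfolded base_change_grade_def]])
      fix x assume "x \<in> ?gen k"
      then obtain q a where a: "x = pt q a" "a \<in> NG k" by blast
      have "\<phi> x = mulop (Const q) \<otimes>\<^bsub>EE\<^esub> \<rho> a" using \<phi>(2) a NG_closed by simp
      moreover have r: "\<rho> a \<in> EG k" by (rule rep_grade[OF \<rho> a(2)])
      interpret E: ring EQ by (rule EE_ring)
      have "mulop (Const q) \<otimes>\<^bsub>EE\<^esub> \<rho> a \<in> EG k"
        using r EE_PC[of "\<rho> a"] by (auto simp: EG_iff EE_simps G_PC G_Const_mult)
      ultimately show "\<phi> x \<in> EG k" by simp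
    qed (use gc in simp)
  qed
  show "subgroup (EG k) (add_monoid EQ)" for k by (rule EG_subgroup)
  show "c k = \<zero>\<^bsub>EQ\<^esub>" if "finite A" "\<And>k. k \<in> A \<Longrightarrow> c k \<in> EG k" "finsum EQ c A = \<zero>\<^bsub>EQ\<^esub>" "k \<in> A" for c A k
    by (rule EG_independent[OF that])
qed

section \<open>Matrices over the invariants\<close>

text \<open>Both sides are generating functions of multisets of degrees, so \<open>ds\<close> is a rearrangement of the
  numbers \<open>2 * len w\<close> and \<open>W\<close> can be listed accordingly.\<close>

lemma poincare_enumeration:
  assumes ds: "(\<Sum>d\<leftarrow>ds. Polynomial.monom (1::int) d) = poincare_poly D"
  obtains ws where "distinct ws" "set ws = W" "map (\<lambda>w. 2 * len w) ws = ds"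
proof -
  have c1: "poly.coeff (\<Sum>d\<leftarrow>ds. Polynomial.monom (1::int) d) k = int (count (mset ds) k)" for k
    by (induction ds) (auto simp: coeff_monom)
  have c2: "poly.coeff (poincare_poly D) k = int (count (image_mset (\<lambda>w. 2 * len w) (mset_set W)) k)" for k
  proof -
    have "poly.coeff (poincare_poly D) k = (\<Sum>w\<in>W. if 2 * len w = k then 1 else 0)"
      unfolding poincare_poly_def by (simp add: coeff_sum coeff_monom)
    also have "\<dots> = int (count (image_mset (\<lambda>w. 2 * len w) (mset_set W)) k)"
    proof -
      have "(\<Sum>w\<in>A. if 2 * len w = k then 1 else 0) = int (count (image_mset (\<lambda>w. 2 * len w) (mset_set A)) k)" if "finite A" for A
        using that by (induction A rule: finite_induct) auto
      then show ?thesis using finite_W by blast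
    qed
    finally show ?thesis .
  qed
  have "mset ds = image_mset (\<lambda>w. 2 * len w) (mset_set W)"
    by (rule multiset_eqI) (use c1 c2 ds in simp)
  moreover have "\<exists>ws. mset ws = M \<and> map f ws = es" if "mset es = image_mset f M" for f :: "int mat \<Rightarrow> nat" and M es
    using that
  proof (induction es arbitrary: M)
    case Nil
    then show ?case by simp
  next
    case (Cons e es)
    then have "image_mset f M = add_mset e (mset es)" by simp
    then obtain M1 a where "M = add_mset a M1" "f a = e" "image_mset f M1 = mset es" by (metis msed_map_invR)
    moreover then obtain ws where "mset ws = M1" "map f ws = es" using Cons.IH[of M1] by metis
    ultimately show ?case by (intro exI[of _ "a # ws"]) auto
  qed
  ultimately obtain ws where ws: "mset ws = mset_set W" "map (\<lambda>w. 2 * len w) ws = ds" by blast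
  have "set ws = W" using ws(1) finite_W by (metis finite_set_mset_mset_set set_mset_mset)
  moreover have "length ws = card W" using ws(1) by (metis size_mset size_mset_set)
  ultimately have *: "distinct ws" "set ws = W" by (auto intro: card_distinct)
  show ?thesis using that[OF * ws(2)] .
qed

context
  fixes ws :: "int mat list" and ds :: "nat list"
  assumes ws: "distinct ws" "set ws = W" "map (\<lambda>w. 2 * len w) ws = ds"
begin

private abbreviation "N \<equiv> length ds"

lemma len_ws: "length ws = N" using ws(3) by auto
lemma ws_W: "a < N \<Longrightarrow> ws ! a \<in> W" using ws(2) len_ws nth_mem by metis
lemma ds_nth: "a < N \<Longrightarrow> ds ! a = 2 * len (ws ! a)" using ws(3) len_ws by (metis nth_map)

lemma sum_ws: "(\<Sum>a\<in>{0..<N}. f (ws ! a)) = (\<Sum>w\<in>W. f w)"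
proof -
  have "bij_betw ((!) ws) {0..<N} W" using bij_betw_nth[OF ws(1) _ ws(2)[symmetric]] len_ws by (simp add: lessThan_atLeast0)
  then show ?thesis by (rule sum.reindex_bij_betw)
qed

lemma ws_inj: "a < N \<Longrightarrow> b < N \<Longrightarrow> ws ! a = ws ! b \<longleftrightarrow> a = b"
  using ws(1) len_ws nth_eq_iff_index_eq by metis

definition to_mat :: "(rat pol \<Rightarrow> rat pol) \<Rightarrow> rat pol mat" where
  "to_mat F = mat N N (\<lambda>(a, b). coord (ws ! a) (F (bas (ws ! b))))"

lemma MatQ_simps:
  "carrier (MatQ D ds) = {A \<in> carrier_mat N N. \<forall>a<N. \<forall>b<N. A $$ (a, b) \<in> Inv}"
  "monoid.mult (MatQ D ds) = (*)" "monoid.one (MatQ D ds) = 1\<^sub>m N" "ring.zero (MatQ D ds) = 0\<^sub>m N N" "ring.add (MatQ D ds) = (+)"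
  by (auto simp: MatQ_def ring_mat_def InvarQ_eq)

lemma coord_bas: "w \<in> W \<Longrightarrow> v \<in> W \<Longrightarrow> coord w (bas v) = (if w = v then 1 else 0)"
  using finite_W by (intro coord_unique[where c = "\<lambda>w. if w = v then 1 else 0"]) (auto simp: if_distrib[of "\<lambda>x. _ * x"] cong: if_cong)

lemma coord_PC: "w \<in> W \<Longrightarrow> f \<in> PC \<Longrightarrow> coord w f \<in> PC"
  using coord(2) Inv_PC by blast

lemma to_mat_closed: "F \<in> carrier EQ \<Longrightarrow> to_mat F \<in> carrier (MatQ D ds)"
  using coord(2)[OF ws_W EE_PC[OF _ bas_PC[OF ws_W]]] by (auto simp: MatQ_simps to_mat_def)

lemma to_mat_hom: "to_mat \<in> ring_hom EQ (MatQ D ds)"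
proof (rule ring_hom_memI)
  fix F K assume F: "F \<in> carrier EQ" and K: "K \<in> carrier EQ"
  show "to_mat (F \<oplus>\<^bsub>EQ\<^esub> K) = to_mat F \<oplus>\<^bsub>MatQ D ds\<^esub> to_mat K"
    unfolding MatQ_simps to_mat_def
    by (rule eq_matI) (use ws_W EE_PC[OF F] EE_PC[OF K] EE_add[OF coord(1)] in \<open>auto simp: EE_simps\<close>)
  show "to_mat (F \<otimes>\<^bsub>EQ\<^esub> K) = to_mat F \<otimes>\<^bsub>MatQ D ds\<^esub> to_mat K"
    unfolding MatQ_simps
  proof (rule eq_matI)
    fix a b assume "a < dim_row (to_mat F * to_mat K)" "b < dim_col (to_mat F * to_mat K)"
    then have ab: "a < N" "b < N" by (auto simp: to_mat_def)
    have Kb: "K (bas (ws ! b)) \<in> PC" using EE_PC[OF K] ws_W[OF ab(2)] by simp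
    have FPC: "F (bas v) \<in> PC" if "v \<in> W" for v using EE_PC[OF F] that by simp
    have "coord (ws ! a) (F (K (bas (ws ! b)))) = coord (ws ! a) (F (\<Sum>v\<in>W. coord v (K (bas (ws ! b))) * bas v))"
      using coord(4)[OF Kb] by (simp add: mult.commute)
    also have "\<dots> = coord (ws ! a) (\<Sum>v\<in>W. coord v (K (bas (ws ! b))) * F (bas v))"
      using coord_PC[OF _ Kb] coord(2)[OF _ Kb] by (subst EE_sum[OF F]) (auto intro!: sum.cong arg_cong[of _ _ "coord (ws ! a)"] simp: EE_lin[OF F])
    also have "\<dots> = (\<Sum>v\<in>W. coord v (K (bas (ws ! b))) * coord (ws ! a) (F (bas v)))"
      using coord_PC[OF _ Kb] coord(2)[OF _ Kb] FPC
      by (subst EE_sum[OF coord(1)[OF ws_W[OF ab(1)]]]) (auto intro!: sum.cong simp: EE_lin[OF coord(1)[OF ws_W[OF ab(1)]]])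
    also have "\<dots> = (\<Sum>c\<in>{0..<N}. coord (ws ! a) (F (bas (ws ! c))) * coord (ws ! c) (K (bas (ws ! b))))"
      by (subst sum_ws[symmetric]) (simp add: mult.commute)
    finally show "to_mat (F \<otimes>\<^bsub>EQ\<^esub> K) $$ (a, b) = (to_mat F * to_mat K) $$ (a, b)"
      using ab ws_W by (simp add: to_mat_def scalar_prod_def EE_simps)
  qed (auto simp: to_mat_def)
next
  show "to_mat \<one>\<^bsub>EQ\<^esub> = \<one>\<^bsub>MatQ D ds\<^esub>" unfolding MatQ_simps to_mat_def
    by (rule eq_matI) (auto simp: EE_simps ws_W coord_bas ws_inj)
qed (rule to_mat_closed)

lemma to_mat_determines:
  assumes F: "F \<in> carrier EQ" and K: "K \<in> carrier EQ" and e: "to_mat F = to_mat K" shows "F = K"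
proof (rule EE_eqI[OF F K])
  have eb: "F (bas w) = K (bas w)" if "w \<in> W" for w
  proof -
    obtain b where b: "b < N" "w = ws ! b" using \<open>w \<in> W\<close> ws(2) len_ws by (metis in_set_conv_nth)
    have c: "coord v (F (bas w)) = coord v (K (bas w))" if v: "v \<in> W" for v
    proof -
      obtain a where a: "a < N" "v = ws ! a" using v ws(2) len_ws by (metis in_set_conv_nth)
      show ?thesis using arg_cong[OF e, of "\<lambda>A. A $$ (a, b)"] a b by (simp add: to_mat_def)
    qed
    have "F (bas w) = (\<Sum>v\<in>W. bas v * coord v (F (bas w)))" using coord(4)[OF EE_PC[OF F]] that by simp
    also have "\<dots> = K (bas w)" using coord(4)[OF EE_PC[OF K]] that c by simp
    finally show ?thesis .
  qed
  fix f :: "rat pol" assume f: "f \<in> PC"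
  have x: "H f = (\<Sum>w\<in>W. coord w f * H (bas w))" if H: "H \<in> carrier EQ" for H
  proof -
    have "H f = H (\<Sum>w\<in>W. coord w f * bas w)" using coord(4)[OF f] by (simp add: mult.commute)
    also have "\<dots> = (\<Sum>w\<in>W. coord w f * H (bas w))"
      using coord_PC[OF _ f] coord(2)[OF _ f] by (subst EE_sum[OF H]) (auto simp: EE_lin[OF H])
    finally show ?thesis .
  qed
  show "F f = K f" using x[OF F] x[OF K] eb by simp
qed

lemma to_mat_surj: assumes A: "A \<in> carrier (MatQ D ds)" shows "A \<in> to_mat ` carrier EQ"
proof -
  have AI: "A $$ (a, b) \<in> Inv" if "a < N" "b < N" for a b using A that by (simp add: MatQ_simps)
  define F where "F = (\<lambda>f\<in>PC. \<Sum>a\<in>{0..<N}. \<Sum>b\<in>{0..<N}. bas (ws ! a) * A $$ (a, b) * coord (ws ! b) f)"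
  have cPC: "coord (ws ! b) f \<in> PC" if "b < N" "f \<in> PC" for b f using coord_PC ws_W that by blast
  have F: "F \<in> carrier EQ"
    unfolding EE_carrier
  proof (intro conjI ballI)
    have "(\<Sum>a\<in>{0..<N}. \<Sum>b\<in>{0..<N}. bas (ws ! a) * A $$ (a, b) * coord (ws ! b) f) \<in> PC" if "f \<in> PC" for f
      using cPC[OF _ that] ws_W Inv_PC[OF AI] by (intro PC_sum PC_mult) auto
    then show "F \<in> PC \<rightarrow>\<^sub>E PC" by (auto simp: F_def)
    fix f g :: "rat pol" assume f: "f \<in> PC" and g: "g \<in> PC"
    show "F (f + g) = F f + F g"
      using f g ws_W by (simp add: F_def EE_add[OF coord(1)] algebra_simps sum.distrib)
  next
    fix l f :: "rat pol" assume l: "l \<in> Inv" and f: "f \<in> PC"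
    show "F (l * f) = l * F f"
    proof -
      have "coord (ws ! b) (l * f) = l * coord (ws ! b) f" if "b < N" for b using EE_lin[OF coord(1)[OF ws_W[OF that]] f l] .
      then have "F (l * f) = (\<Sum>a\<in>{0..<N}. \<Sum>b\<in>{0..<N}. bas (ws ! a) * A $$ (a, b) * (l * coord (ws ! b) f))"
        using f Inv_PC[OF l] by (simp add: F_def)
      also have "\<dots> = l * F f" using f by (simp add: F_def sum_distrib_left mult_ac)
      finally show ?thesis .
    qed
  qed
  have "to_mat F = A"
  proof (rule eq_matI)
    fix a b assume "a < dim_row A" "b < dim_col A"
    then have ab: "a < N" "b < N" using A by (auto simp: MatQ_simps)
    have "F (bas (ws ! b)) = (\<Sum>c\<in>{0..<N}. \<Sum>d\<in>{0..<N}. if d = b then bas (ws ! c) * A $$ (c, d) else 0)"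
    proof -
      have "coord (ws ! d) (bas (ws ! b)) = (if d = b then 1 else 0)" if "d < N" for d
        using coord_bas[OF ws_W[OF that] ws_W[OF ab(2)]] ws_inj[OF that ab(2)] by simp
      then have "bas (ws ! c) * A $$ (c, d) * coord (ws ! d) (bas (ws ! b)) = (if d = b then bas (ws ! c) * A $$ (c, d) else 0)"
        if "d < N" for c d using that by simp
      then show ?thesis using ws_W[OF ab(2)] by (auto simp: F_def intro!: sum.cong)
    qed
    also have "\<dots> = (\<Sum>c\<in>{0..<N}. bas (ws ! c) * A $$ (c, b))" using ab by simp
    also have "\<dots> = (\<Sum>w\<in>W. bas w * A $$ (inv_into {0..<N} ((!) ws) w, b))"
    proof (subst sum_ws[symmetric], rule sum.cong[OF refl])
      fix c assume c: "c \<in> {0..<N}"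
      have "inj_on ((!) ws) {0..<N}" using ws_inj by (auto simp: inj_on_def)
      then show "bas (ws ! c) * A $$ (c, b) = bas (ws ! c) * A $$ (inv_into {0..<N} ((!) ws) (ws ! c), b)"
        using c by (simp add: inv_into_f_f)
    qed
    finally have e: "F (bas (ws ! b)) = (\<Sum>w\<in>W. bas w * A $$ (inv_into {0..<N} ((!) ws) w, b))" .
    have iW: "inv_into {0..<N} ((!) ws) w < N" if "w \<in> W" for w
    proof -
      have "w \<in> (!) ws ` {0..<N}" using that ws(2) len_ws by (metis atLeast0LessThan in_set_conv_nth image_eqI lessThan_iff)
      then show ?thesis using inv_into_into[of w "(!) ws" "{0..<N}"] by simp
    qed
    have "coord (ws ! a) (F (bas (ws ! b))) = A $$ (inv_into {0..<N} ((!) ws) (ws ! a), b)"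
      by (rule coord_unique[OF _ e ws_W[OF ab(1)]]) (use AI iW ab in auto)
    moreover have "inj_on ((!) ws) {0..<N}" using ws_inj by (auto simp: inj_on_def)
    ultimately have "coord (ws ! a) (F (bas (ws ! b))) = A $$ (a, b)" using ab by (simp add: inv_into_f_f)
    then show "to_mat F $$ (a, b) = A $$ (a, b)" using ab by (simp add: to_mat_def)
  qed (use A in \<open>auto simp: MatQ_simps to_mat_def\<close>)
  then show ?thesis using F by blast
qed

lemma to_mat_iso: "to_mat \<in> ring_iso EQ (MatQ D ds)"
proof -
  have "to_mat ` carrier EQ = carrier (MatQ D ds)" using to_mat_closed to_mat_surj by blast
  moreover have "inj_on to_mat (carrier EQ)" using to_mat_determines by (auto intro: inj_onI)
  ultimately show ?thesis using to_mat_hom by (auto simp: ring_iso_def bij_betw_def)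
qed

lemma to_mat_zero: "to_mat \<zero>\<^bsub>EQ\<^esub> = \<zero>\<^bsub>MatQ D ds\<^esub>"
  unfolding MatQ_simps to_mat_def
  by (rule eq_matI) (auto simp: EE_simps ws_W EE_0[OF coord(1)])

lemma MatQ_ring: "ring (MatQ D ds)"
proof (rule ring_iso_ring)
  show "ring EQ" by (rule EE_ring)
  show "to_mat \<in> ring_iso EQ (MatQ D ds)" by (rule to_mat_iso)
  show "to_mat \<zero>\<^bsub>EQ\<^esub> = \<zero>\<^bsub>MatQ D ds\<^esub>" by (rule to_mat_zero)
qed

lemma MatQ_grade_iff: "A \<in> MatQ_grade D ds k \<longleftrightarrow> A \<in> carrier (MatQ D ds) \<and> (\<forall>a<N. \<forall>b<N. A $$ (a, b) \<in> G (k + int (ds ! b) - int (ds ! a)))"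
  by (simp add: MatQ_grade_def)

lemma MatQ_uminus: assumes "A \<in> carrier (MatQ D ds)" shows "\<ominus>\<^bsub>MatQ D ds\<^esub> A = - A"
proof -
  interpret M: ring "MatQ D ds" by (rule MatQ_ring)
  have c: "A \<in> carrier_mat N N" using assms by (simp add: MatQ_simps)
  have "- A \<in> carrier (MatQ D ds)" using assms by (auto simp: MatQ_simps intro!: Inv_uminus)
  then show ?thesis using assms c by (intro M.minus_equality) (auto simp: MatQ_simps)
qed

lemma MatQ_grade_subgroup: "subgroup (MatQ_grade D ds k) (add_monoid (MatQ D ds))"
proof -
  interpret M: ring "MatQ D ds" by (rule MatQ_ring)
  show ?thesis
  proof (rule group.subgroupI[OF ring_add_group[OF MatQ_ring]])
    have "0\<^sub>m N N \<in> MatQ_grade D ds k" by (auto simp: MatQ_grade_iff MatQ_simps)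
    then show "MatQ_grade D ds k \<noteq> {}" by blast
    fix A assume A: "A \<in> MatQ_grade D ds k"
    then have "\<ominus>\<^bsub>MatQ D ds\<^esub> A \<in> carrier (MatQ D ds)" "\<ominus>\<^bsub>MatQ D ds\<^esub> A = - A" "A \<in> carrier_mat N N"
      using MatQ_uminus[of A] M.a_inv_closed[of A] by (auto simp: MatQ_grade_iff MatQ_simps)
    then have "\<ominus>\<^bsub>MatQ D ds\<^esub> A \<in> MatQ_grade D ds k" using A by (auto simp: MatQ_grade_iff G_uminus)
    then show "inv\<^bsub>add_monoid (MatQ D ds)\<^esub> A \<in> MatQ_grade D ds k" by (simp add: a_inv_def)
    fix B assume B: "B \<in> MatQ_grade D ds k"
    have "A \<oplus>\<^bsub>MatQ D ds\<^esub> B \<in> carrier (MatQ D ds)" using A B by (intro M.a_closed) (auto simp: MatQ_grade_iff)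
    then show "A \<otimes>\<^bsub>add_monoid (MatQ D ds)\<^esub> B \<in> MatQ_grade D ds k"
      using A B by (auto simp: MatQ_grade_iff MatQ_simps intro!: G_add)
  qed (auto simp: MatQ_grade_iff)
qed

lemma MatQ_finsum_nth:
  assumes "finite C" "\<And>k. k \<in> C \<Longrightarrow> c k \<in> carrier (MatQ D ds)" "a < N" "b < N"
  shows "finsum (MatQ D ds) c C $$ (a, b) = (\<Sum>k\<in>C. c k $$ (a, b))"
proof -
  interpret M: ring "MatQ D ds" by (rule MatQ_ring)
  show ?thesis using assms
  proof (induction C)
    case empty
    then show ?case by (simp add: MatQ_simps)
  next
    case (insert k C)
    have s: "finsum (MatQ D ds) c (insert k C) = c k + finsum (MatQ D ds) c C"
      using insert by (subst M.finsum_insert) (auto simp: MatQ_simps(5))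
    have "finsum (MatQ D ds) c C \<in> carrier (MatQ D ds)" using insert by (intro M.finsum_closed) auto
    moreover have "c k \<in> carrier (MatQ D ds)" using insert by simp
    ultimately have "(c k + finsum (MatQ D ds) c C) $$ (a, b) = c k $$ (a, b) + finsum (MatQ D ds) c C $$ (a, b)"
      using insert by (intro index_add_mat(1)) (auto simp: MatQ_simps)
    then show ?case using insert unfolding s by simp
  qed
qed

lemma graded_iso_Mat:
  assumes gr: "is_grading EQ (EndQ_grade D)"
  shows "graded_ring_iso EQ (EndQ_grade D) (MatQ D ds) (MatQ_grade D ds) to_mat"
proof (rule graded_iso_criterion[OF EE_ring MatQ_ring to_mat_iso])
  show "subgroup (EndQ_grade D k) (add_monoid EQ)" for k using gr by (simp add: is_grading_def)
  show "\<one>\<^bsub>EQ\<^esub> \<in> EndQ_grade D 0" using gr by (simp add: is_grading_def)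
  show "a \<otimes>\<^bsub>EQ\<^esub> b \<in> EndQ_grade D (k + l)" if "a \<in> EndQ_grade D k" "b \<in> EndQ_grade D l" for k l a b
    using gr that by (simp add: is_grading_def)
  show "carrier EQ \<subseteq> generate (add_monoid EQ) (\<Union>k. EndQ_grade D k)" by (rule is_grading_span[OF EE_ring gr])
  show "subgroup (MatQ_grade D ds k) (add_monoid (MatQ D ds))" for k by (rule MatQ_grade_subgroup)
  show "to_mat ` EndQ_grade D k \<subseteq> MatQ_grade D ds k" for k
  proof (rule image_subsetI)
    fix F assume "F \<in> EndQ_grade D k"
    then have F: "F \<in> carrier EQ" "\<And>j f. f \<in> G j \<Longrightarrow> F f \<in> G (j + k)" by (auto simp: EndQ_grade_def EE_def InvarQ_eq)
    have "to_mat F $$ (a, b) \<in> G (k + int (ds ! b) - int (ds ! a))" if ab: "a < N" "b < N" for a b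
      using coord(3)[OF ws_W[OF ab(1)] F(2)[OF bas_G[OF ws_W[OF ab(2)]]]] ab by (simp add: to_mat_def ds_nth algebra_simps)
    then show "to_mat F \<in> MatQ_grade D ds k" using to_mat_closed[OF F(1)] by (simp add: MatQ_grade_iff)
  qed
  fix A :: "int set" and c k assume A: "finite A" and c: "\<And>k. k \<in> A \<Longrightarrow> c k \<in> MatQ_grade D ds k"
    and z: "finsum (MatQ D ds) c A = \<zero>\<^bsub>MatQ D ds\<^esub>" and k: "k \<in> A"
  have cc: "c k \<in> carrier (MatQ D ds)" if "k \<in> A" for k using c[OF that] by (simp add: MatQ_grade_iff)
  show "c k = \<zero>\<^bsub>MatQ D ds\<^esub>"
    unfolding MatQ_simps
  proof (rule eq_matI)
    fix a b assume "a < dim_row (0\<^sub>m N N :: rat pol mat)" "b < dim_col (0\<^sub>m N N :: rat pol mat)"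
    then have ab: "a < N" "b < N" by auto
    have "(\<Sum>l\<in>A. c l $$ (a, b)) = 0" using MatQ_finsum_nth[of A c a b] A cc z ab by (simp add: MatQ_simps)
    then have "c k $$ (a, b) = 0"
      by (intro G_independent[OF A, of "\<lambda>l. l + int (ds ! b) - int (ds ! a)" "\<lambda>l. c l $$ (a, b)"] k)
        (use c ab in \<open>auto simp: MatQ_grade_iff inj_on_def\<close>)
    then show "c k $$ (a, b) = 0\<^sub>m N N $$ (a, b)" using ab by simp
  qed (use cc[OF k] in \<open>auto simp: MatQ_simps\<close>)
qed

end

end

section \<open>The graded isomorphisms\<close>

theorem theoremA4:
  fixes D :: "'i refl_datum"
    and NH :: "'a ring"
    and \<iota> :: "('i list \<Rightarrow>\<^sub>0 int) set \<Rightarrow> 'a"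
    and \<kappa> :: "int pol \<Rightarrow> 'a"
  assumes W: "finite_weyl_datum D"
    and NH: "nilHecke D NH \<iota> \<kappa>"
  shows "\<exists>\<rho>. polynomial_rep D NH \<iota> \<kappa> \<rho> \<and>
    (\<exists>\<phi>. graded_ring_iso
        (tensor_ring Q_ring NH) (base_change_grade NH (NH_grade D NH \<iota> \<kappa>))
        (EndQ D) (EndQ_grade D) \<phi> \<and>
      (\<forall>q. \<forall>a\<in>carrier NH. \<forall>f\<in>carrier (Pol D).
        \<phi> (pure_tensor Q_ring NH q a) (to_rat f) = Poly_Mapping.single 0 q * to_rat (\<rho> a f))) \<and>
    (\<forall>ds. (\<Sum>d\<leftarrow>ds. Polynomial.monom 1 d) = poincare_poly D \<longrightarrow>
      (\<exists>\<psi>. graded_ring_iso (EndQ D) (EndQ_grade D) (MatQ D ds) (MatQ_grade D ds) \<psi>))"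
proof -
  interpret nil_hecke D NH \<iota> \<kappa>
    by (intro nil_hecke.intro weyl_datum.intro nil_hecke_axioms.intro W NH)
  obtain \<rho>Z where \<rho>Z: "is_rep (\<rho>Z :: 'a \<Rightarrow> int pol \<Rightarrow> int pol)"
    using rep_exists unfolding is_rep_def by blast
  obtain \<rho>Q where \<rho>Q: "is_rep (\<rho>Q :: 'a \<Rightarrow> rat pol \<Rightarrow> rat pol)"
    using rep_exists unfolding is_rep_def by blast
  obtain \<phi> where \<phi>: "\<phi> \<in> ring_iso TQ EQ" "\<And>q y. y \<in> carrier NH \<Longrightarrow> \<phi> (pt q y) = mulop (Const q) \<otimes>\<^bsub>EE\<^esub> \<rho>Q y"
    using phi_exists[OF \<rho>Q] by blast
  interpret \<rho>Q: ring_hom_ring NH EQ \<rho>Q by (rule is_rep_hom[OF \<rho>Q])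
  have g: "graded_ring_iso TQ (base_change_grade NH (NH_grade D NH \<iota> \<kappa>)) (EndQ D) (EndQ_grade D) \<phi>"
    unfolding EndQ_EE by (rule graded_iso_End[OF \<rho>Q \<phi>])
  have rep: "polynomial_rep D NH \<iota> \<kappa> \<rho>Z"
    unfolding polynomial_rep_def
  proof (intro conjI ballI)
    show "\<rho>Z \<in> ring_hom NH (lin_end (Pol D) (Invar D))" using \<rho>Z by (simp add: is_rep_def EE_def Inv_Invar)
    show "\<rho>Z (\<iota> (nc_del D i)) f = demazure D i f" if "i \<in> nodes D" "f \<in> carrier (Pol D)" for i f
      using \<rho>Z that by (simp add: is_rep_def nc_del_ncw dword_Cons flip: del_def)
    show "\<rho>Z (\<kappa> (lin x)) f = lin x * f" if "x \<in> colattice D" "f \<in> carrier (Pol D)" for x f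
      using \<rho>Z that by (simp add: is_rep_def)
  qed
  have comp: "\<phi> (pt q a) (to_rat f) = Poly_Mapping.single 0 q * to_rat (\<rho>Z a f)" if a: "a \<in> carrier NH" and f: "f \<in> carrier (Pol D)" for q a f
    using \<phi>(2)[OF a, of q] is_rep_base[OF \<rho>Q \<rho>Z a, of f] f EE_PC[OF \<rho>Q.hom_closed[OF a], of "base f"]
    by (simp add: EE_simps flip: base_def)
  have mat: "\<exists>\<psi>. graded_ring_iso (EndQ D) (EndQ_grade D) (MatQ D ds) (MatQ_grade D ds) \<psi>"
    if ds: "(\<Sum>d\<leftarrow>ds. Polynomial.monom 1 d) = poincare_poly D" for ds
  proof -
    obtain ws where ws: "distinct ws" "set ws = weyl_group D" "map (\<lambda>w. 2 * weyl_length D w) ws = ds"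
      using poincare_enumeration[OF ds] by metis
    have "is_grading EQ (EndQ_grade D)" using g unfolding EndQ_EE by (simp add: graded_ring_iso_def)
    from graded_iso_Mat[OF ws this] show ?thesis unfolding EndQ_EE by blast
  qed
  show ?thesis using rep g comp mat by blast
qed

end
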